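(* Let $(X_n)$ be the linear process $X_t=G(B)\xi_t$ described in the context, with marginal density $f$. Assume that $\mathbb{E}\xi_0^4<\infty$ and that there exist $\delta>0$ and $C<\infty$ such that $|\mathbb{E}e^{iu\xi_0}|\le C(1+|u|)^{-\delta}$ for all $u\in\mathbb{R}$. Assume that $\alpha<\frac13\wedge\frac{\alpha_0}{2}$ and that the kernel $K$ is a bounded symmetric probability density function, continuous with compact support. Let the bandwidth $m_n$ satisfy $m_n\to0$ and $nm_n\to\infty$, and let $\tilde f_n(x)=\frac{1}{nm_n}\sum_{j=1}^nK\bigl(\frac{x-X_j}{m_n}\bigr)$. Then, as $n\to\infty$, $$\int_{\mathbb{R}}\mathbb{E}\bigl(\tilde f_n(x)-f(x)\bigr)^2dx\ \sim\ \int_{\mathbb{R}}\mathbb{E}_0\bigl(\tilde f_n(x)-f(x)\bigr)^2dx+\frac14\operatorname{Var}\Bigl(\frac1n\sum_{j=1}^n\bigl(X_j^2-\mathbb{E}(X_1^2)\bigr)\Bigr)\int_{\mathbb{R}}f''(x)^2\,dx,$$ where $\mathbb{E}_0$ denotes the expectation with respect to the distribution of $n$ independent random variables distributed from the density $f$ (in place of $X_1,\dots,X_n$).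
   Context: $(\xi_n)_{n\in\mathbb{Z}}$ are i.i.d. real random variables with mean zero and finite variance $\mathbb{E}\xi_0^2=\sigma^2$. Let $m\ge1$ and $$G(z)=g(z)\prod_{j=-m}^m\bigl(1-e^{i\lambda_j}z\bigr)^{(\alpha_j-1)/2},$$ where $g$ is analytic on $\{|z|<1\}$, continuous on $\{|z|\le1\}$, $g(z)\ne0$ for $|z|=1$ (with real Taylor coefficients, so that the process is real), and $0<\alpha_j\le1$, $\alpha_j=\alpha_{-j}$, $\lambda_{-j}=-\lambda_j$ for $j=0,\dots,m$, $0=\lambda_0<\lambda_1<\dots<\lambda_m<\pi$. With $G(z)=\sum_{k\ge0}b_kz^k$ and $B$ the backshift operator, $X_t=G(B)\xi_t=\sum_{j=-\infty}^t b_{t-j}\xi_j$. Put $\alpha=\min\{\alpha_j: j=0,\dots,m\}$. The left-hand side of the equivalence is the mean integrated squared error $\mathrm{MISE}(\tilde f_n)$; $u_n\sim v_n$ means $u_n/v_n\to1$; $a\wedge b=\min(a,b)$. *)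

theory Defs
  imports "HOL-Probability.Probability" "HOL-Complex_Analysis.Complex_Analysis"
begin

definition iid :: "'a measure \<Rightarrow> (int \<Rightarrow> 'a \<Rightarrow> real) \<Rightarrow> bool" where
  "iid M \<xi> \<longleftrightarrow> prob_space.indep_vars M (\<lambda>_. borel) \<xi> UNIV \<and>
     (\<forall>n. distr M borel (\<xi> n) = distr M borel (\<xi> 0))"

text \<open>For \<open>|z| < 1\<close> every factor lies in the right half-plane, so \<open>powr\<close>,
  which uses the principal branch of the logarithm, is the analytic branch equal to 1 at \<open>z = 0\<close>.\<close>

definition transfer_fun ::
    "(complex \<Rightarrow> complex) \<Rightarrow> nat \<Rightarrow> (int \<Rightarrow> real) \<Rightarrow> (int \<Rightarrow> real) \<Rightarrow> complex \<Rightarrow> complex" where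
  "transfer_fun g m \<alpha> lam z =
     g z * (\<Prod>j\<in>{- int m..int m}. (1 - cis (lam j) * z) powr complex_of_real ((\<alpha> j - 1) / 2))"

text \<open>\<open>X\<^sub>t = \<Sum>\<^sub>j\<^sub>\<le>\<^sub>t b\<^sub>t\<^sub>-\<^sub>j \<xi>\<^sub>j\<close>, reindexed by \<open>k = t - j\<close>.  For centred, independent, square-integrable
  innovations and square-summable \<open>b\<close>, almost sure and mean-square convergence of the series
  are equivalent and give the same limit.\<close>

definition linear_process ::
    "'a measure \<Rightarrow> (int \<Rightarrow> 'a \<Rightarrow> real) \<Rightarrow> (nat \<Rightarrow> real) \<Rightarrow> (int \<Rightarrow> 'a \<Rightarrow> real) \<Rightarrow> bool" where
  "linear_process M \<xi> b X \<longleftrightarrow>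
     (\<forall>t. X t \<in> borel_measurable M \<and> (AE \<omega> in M. (\<lambda>k. b k * \<xi> (t - int k) \<omega>) sums X t \<omega>))"

definition kde :: "(real \<Rightarrow> real) \<Rightarrow> real \<Rightarrow> nat \<Rightarrow> (nat \<Rightarrow> real) \<Rightarrow> real \<Rightarrow> real" where
  "kde K h n y x = 1 / (real n * h) * (\<Sum>j=1..n. K ((x - y j) / h))"

definition MISE ::
    "'a measure \<Rightarrow> (int \<Rightarrow> 'a \<Rightarrow> real) \<Rightarrow> (real \<Rightarrow> real) \<Rightarrow> (real \<Rightarrow> real) \<Rightarrow> real \<Rightarrow> nat \<Rightarrow> real" where
  "MISE M X f K h n =
     (LINT x|lborel. LINT \<omega>|M. (kde K h n (\<lambda>j. X (int j) \<omega>) x - f x)\<^sup>2)"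

definition MISE_iid :: "(real \<Rightarrow> real) \<Rightarrow> (real \<Rightarrow> real) \<Rightarrow> real \<Rightarrow> nat \<Rightarrow> real" where
  "MISE_iid f K h n =
     (LINT x|lborel. LINT y|(\<Pi>\<^sub>M j\<in>{1..n}. density lborel (\<lambda>u. ennreal (f u))).
        (kde K h n y x - f x)\<^sup>2)"

end

theory Submission
  imports Defs
begin

text \<open>
  The two mean integrated squared errors are compared on the Fourier side. Let \<open>ch\<close> be the
  characteristic function of \<open>X 0\<close>, let \<open>\<Psi> s t\<close> be that of \<open>X s - X t\<close>, and let \<open>kh\<close> be the Fourier
  transform of the kernel. Expanding the square and integrating over the line, everything cancels in
  the difference of the two errors except the pairs of distinct times:
  \<open>n\<^sup>2 * (MISE - MISE_iid)\<close> is \<open>1 / (2 * pi)\<close> times the integral of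
  \<open>(norm (kh (u * h)))\<^sup>2 * (\<Sum>s \<noteq> t. \<Psi> s t u - (norm (ch u))\<^sup>2)\<close> (lemma \<open>MISE_difference\<close>).

  Let \<open>\<rho>\<close> be the autocovariance of the filter, \<open>Tn\<close> the sum of \<open>\<rho>(s - t)\<close> over all pairs of times up to
  \<open>n\<close>, and \<open>Wn\<close> the sum of \<open>\<rho>(s - t)\<^sup>2\<close>. The function \<open>\<Psi> s t\<close> is a product over the innovations, and
  \<open>(norm (ch u))\<^sup>2\<close> is the product obtained by replacing each factor by its value for independent
  observations. Taylor expansion between the two products gives a first order term, a second order
  term with main part \<open>\<sigma>\<^sup>4 / 2 * u\<^sup>4 * \<rho>(s - t)\<^sup>2 * (norm (ch u))\<^sup>2\<close>, and an error. The first order term is of the size of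
  \<open>\<rho>(s - t)\<close> and must not be bounded pair by pair: its sum over all pairs is controlled by \<open>Tn + n\<close>
  because it is a sum of inner products of column sums (lemma \<open>first_order_sum\<close>). The sum \<open>Tn\<close> is
  governed by the singularity of the transfer function at frequency zero and grows at most like
  \<open>n powr (2 - \<gamma>)\<close> for each \<open>\<gamma> < \<alpha> 0\<close>, whereas \<open>Wn\<close> feels the strongest seasonal singularity and grows at least
  like \<open>n powr (2 - 2 * \<alpha>_min)\<close>. Since \<open>2 * \<alpha>_min < \<alpha> 0\<close>, both \<open>Tn\<close> and \<open>n\<close> are negligible against \<open>Wn\<close>
  (lemma \<open>Wn_dominates\<close>). Together with \<open>\<rho> \<longlonglongrightarrow> 0\<close>, which makes the cubic errors negligible, this
  leaves only the quadratic term (lemma \<open>covariance_expansion\<close>).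

  The same quantity governs the empirical second moment: \<open>n\<^sup>2\<close> times its variance is
  \<open>2 * \<sigma>\<^sup>4 * Wn + O(n)\<close> (lemma \<open>variance_expansion\<close>). By Plancherel, the integral of the squared second derivative of
  \<open>f\<close> is \<open>1 / (2 * pi)\<close> times the integral of \<open>u\<^sup>4 * (norm (ch u))\<^sup>2\<close>. Hence \<open>n\<^sup>2 / Wn\<close> times
  \<open>MISE - MISE_iid\<close>, and \<open>n\<^sup>2 / Wn\<close> times the variance term, have the same positive limit; since
  \<open>MISE_iid\<close> is nonnegative, the quotient in the theorem tends to 1 (lemma \<open>ratio_tendsto_1\<close>).

  All estimates need decay in \<open>u\<close>. Polynomial decay of the characteristic function of the noise, however slow, suffices: the growth of
  \<open>Wn\<close> forces infinitely many filter coefficients to be nonzero, so that the products contain as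
  many decaying factors as desired (lemma \<open>char_prod_decay\<close>).
\<close>

section \<open>Parseval identities for power series in the unit disc\<close>

lemma has_integral_cis:
  fixes m :: int
  shows "((\<lambda>\<theta>. cis (of_int m * \<theta>)) has_integral (if m = 0 then 2 * pi else 0)) {-pi..pi}"
proof (cases "m = 0")
  case True
  have "((\<lambda>\<theta>. 1::complex) has_integral of_real (2*pi)) {-pi..pi}"
    using has_integral_const_real[of "1::complex" "-pi" pi] by (simp add: scaleR_conv_of_real)
  then show ?thesis using True by simp
next
  case False
  have "((\<lambda>\<theta>. cis (of_int m * \<theta>)) has_integral
      (cis (of_int m * pi) / (\<i> * of_int m) - cis (of_int m * (-pi)) / (\<i> * of_int m))) {-pi..pi}"
  proof (rule fundamental_theorem_of_calculus)
    fix x :: real assume "x \<in> {-pi..pi}"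
    have "((\<lambda>z. exp (\<i> * of_int m * z) / (\<i> * of_int m)) has_field_derivative exp (\<i> * of_int m * of_real x))
            (at (of_real x))"
      using False by (auto intro!: derivative_eq_intros)
    from has_vector_derivative_real_field[OF this]
    show "((\<lambda>\<theta>. cis (of_int m * \<theta>) / (\<i> * of_int m)) has_vector_derivative cis (of_int m * x))
            (at x within {-pi..pi})"
      by (simp add: cis_conv_exp mult.assoc)
  qed auto
  moreover have "cis (of_int m * pi) = cis (of_int m * (-pi))"
    using sin_zero_iff_int2[of "of_int m * pi"] by (auto simp: complex_eq_iff sin_zero_iff_int2 intro: exI[of _ m])
  ultimately show ?thesis using False by simp
qed

lemma has_integral_trig_poly:
  fixes c :: "nat \<Rightarrow> complex"
  shows "((\<lambda>\<theta>. (norm (\<Sum>k<N. c k * cis (real k * \<theta>)))\<^sup>2) has_integral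
            2 * pi * (\<Sum>k<N. (norm (c k))\<^sup>2)) {-pi..pi}"
proof -
  have "((\<lambda>\<theta>. \<Sum>k<N. \<Sum>l<N. c k * cnj (c l) * cis (of_int (int k - int l) * \<theta>)) has_integral
     (\<Sum>k<N. \<Sum>l<N. c k * cnj (c l) * (if int k - int l = 0 then 2 * pi else 0))) {-pi..pi}"
    by (intro has_integral_sum has_integral_mult_right has_integral_cis) auto
  also have "(\<Sum>k<N. \<Sum>l<N. c k * cnj (c l) * (if int k - int l = 0 then 2 * pi else 0))
      = of_real (2 * pi * (\<Sum>k<N. (norm (c k))\<^sup>2))"
    by (simp add: if_distrib [of complex_of_real] if_distrib [of "\<lambda>x. _ * x"] complex_norm_square[symmetric]
      sum_distrib_left mult_ac cong: if_cong)
  also have "(\<lambda>\<theta>. \<Sum>k<N. \<Sum>l<N. c k * cnj (c l) * cis (of_int (int k - int l) * \<theta>))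
     = (\<lambda>\<theta>. of_real ((norm (\<Sum>k<N. c k * cis (real k * \<theta>)))\<^sup>2))"
  proof
    fix \<theta>
    have "(\<Sum>k<N. \<Sum>l<N. c k * cnj (c l) * cis (of_int (int k - int l) * \<theta>))
       = (\<Sum>k<N. c k * cis (real k * \<theta>)) * cnj (\<Sum>k<N. c k * cis (real k * \<theta>))"
      by (simp add: sum_product cis_cnj cis_mult algebra_simps)
    then show "(\<Sum>k<N. \<Sum>l<N. c k * cnj (c l) * cis (of_int (int k - int l) * \<theta>))
       = of_real ((norm (\<Sum>k<N. c k * cis (real k * \<theta>)))\<^sup>2)"
      by (simp only: complex_norm_square)
  qed
  finally have "(Re \<circ> (\<lambda>\<theta>. of_real ((norm (\<Sum>k<N. c k * cis (real k * \<theta>)))\<^sup>2)) has_integral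
      Re (of_real (2 * pi * (\<Sum>k<N. (norm (c k))\<^sup>2)))) {-pi..pi}"
    by (rule has_integral_linear[OF _ bounded_linear_Re])
  then show ?thesis by (simp add: o_def)
qed

lemma parseval_circle:
  fixes c :: "nat \<Rightarrow> complex"
  assumes "summable (\<lambda>k. norm (c k))"
  shows "summable (\<lambda>k. (norm (c k))\<^sup>2)"
    and "((\<lambda>\<theta>. (norm (\<Sum>k. c k * cis (real k * \<theta>)))\<^sup>2) has_integral
            2 * pi * (\<Sum>k. (norm (c k))\<^sup>2)) {-pi..pi}"
proof -
  define B where "B = (\<Sum>k. norm (c k))"
  have sm: "summable (\<lambda>k. c k * cis (real k * \<theta>))" for \<theta>
    by (rule summable_norm_cancel) (use assms in \<open>simp add: norm_mult\<close>)
  have bd: "norm (\<Sum>k<N. c k * cis (real k * \<theta>)) \<le> B" for N \<theta>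
  proof -
    have "norm (\<Sum>k<N. c k * cis (real k * \<theta>)) \<le> (\<Sum>k<N. norm (c k))"
      by (rule order_trans[OF norm_sum]) (simp add: norm_mult)
    also have "\<dots> \<le> B" unfolding B_def by (rule sum_le_suminf[OF assms]) auto
    finally show ?thesis .
  qed
  have B0: "0 \<le> B" unfolding B_def by (rule suminf_nonneg[OF assms]) auto
  show s2: "summable (\<lambda>k. (norm (c k))\<^sup>2)"
  proof (rule summable_comparison_test'[of "\<lambda>k. B * norm (c k)" 0])
    show "summable (\<lambda>k. B * norm (c k))" using assms by (rule summable_mult)
    fix k :: nat
    have "norm (c k) \<le> B" unfolding B_def
      using sum_le_suminf[OF assms, of "{k}"] by simp
    then show "norm ((norm (c k))\<^sup>2) \<le> B * norm (c k)"
      by (simp add: power2_eq_square mult_right_mono)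
  qed
  let ?f = "\<lambda>N \<theta>. (norm (\<Sum>k<N. c k * cis (real k * \<theta>)))\<^sup>2"
  let ?g = "\<lambda>\<theta>. (norm (\<Sum>k. c k * cis (real k * \<theta>)))\<^sup>2"
  have D: "?g integrable_on {-pi..pi}" "(\<lambda>N. integral {-pi..pi} (?f N)) \<longlonglongrightarrow> integral {-pi..pi} ?g"
  proof -
    have 1: "?f N integrable_on {-pi..pi}" for N using has_integral_trig_poly by blast
    have 2: "(\<lambda>_. B\<^sup>2) integrable_on {-pi..pi}" by auto
    have 3: "norm (?f N \<theta>) \<le> B\<^sup>2" if "\<theta> \<in> {-pi..pi}" for N \<theta>
      by (simp add: power_mono bd)
    have 4: "(\<lambda>N. ?f N \<theta>) \<longlonglongrightarrow> ?g \<theta>" if "\<theta> \<in> {-pi..pi}" for \<theta>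
      by (intro tendsto_intros summable_LIMSEQ sm)
    show "?g integrable_on {-pi..pi}" "(\<lambda>N. integral {-pi..pi} (?f N)) \<longlonglongrightarrow> integral {-pi..pi} ?g"
      using dominated_convergence[OF 1 2 3 4] by auto
  qed
  have "integral {-pi..pi} (?f N) = 2 * pi * (\<Sum>k<N. (norm (c k))\<^sup>2)" for N
    using has_integral_trig_poly by (rule integral_unique)
  moreover have "(\<lambda>N. 2 * pi * (\<Sum>k<N. (norm (c k))\<^sup>2)) \<longlonglongrightarrow> 2 * pi * (\<Sum>k. (norm (c k))\<^sup>2)"
    by (intro tendsto_intros summable_LIMSEQ s2)
  ultimately have "integral {-pi..pi} ?g = 2 * pi * (\<Sum>k. (norm (c k))\<^sup>2)"
    using D(2) by (simp only: LIMSEQ_unique)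
  then show "(?g has_integral 2 * pi * (\<Sum>k. (norm (c k))\<^sup>2)) {-pi..pi}"
    using D(1) by (simp add: has_integral_iff)
qed

lemma disc_series_circle:
  fixes c :: "nat \<Rightarrow> complex"
  assumes F: "\<And>z. norm z < 1 \<Longrightarrow> (\<lambda>k. c k * z ^ k) sums F z" and r: "0 < r" "r < 1"
  shows "summable (\<lambda>k. (norm (c k))\<^sup>2 * r ^ (2*k))"
    and "((\<lambda>\<theta>. (norm (F (of_real r * cis \<theta>)))\<^sup>2) has_integral
            2 * pi * (\<Sum>k. (norm (c k))\<^sup>2 * r ^ (2*k))) {-pi..pi}"
proof -
  have "summable (\<lambda>k. norm (c k * of_real r ^ k))"
  proof (rule powser_insidea[of c "of_real ((1+r)/2)" "of_real r"])
    show "summable (\<lambda>n. c n * (complex_of_real ((1 + r) / 2)) ^ n)"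
      using F[of "of_real ((1+r)/2)"] r by (auto simp: sums_iff simp del: of_real_divide of_real_add)
    show "norm (complex_of_real r) < norm (complex_of_real ((1 + r) / 2))" using r by (simp del: of_real_divide of_real_add)
  qed
  note P = parseval_circle[OF this]
  have e: "(norm (c k * of_real r ^ k))\<^sup>2 = (norm (c k))\<^sup>2 * r ^ (2*k)" for k
    using r by (simp add: norm_mult norm_power power_mult_distrib power_mult[symmetric] mult.commute[of k])
  have e2: "(\<Sum>k. c k * of_real r ^ k * cis (real k * \<theta>)) = F (of_real r * cis \<theta>)" for \<theta>
    using F[of "of_real r * cis \<theta>"] r
    by (simp add: norm_mult sums_iff power_mult_distrib Complex.DeMoivre mult_ac)
  show "summable (\<lambda>k. (norm (c k))\<^sup>2 * r ^ (2*k))" using P(1) by (simp only: e)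
  show "((\<lambda>\<theta>. (norm (F (of_real r * cis \<theta>)))\<^sup>2) has_integral
            2 * pi * (\<Sum>k. (norm (c k))\<^sup>2 * r ^ (2*k))) {-pi..pi}"
    using P(2) by (simp only: e e2)
qed

text \<open>
  Integrating over circles of radius \<open>r < 1\<close> and letting \<open>r\<close> increase to 1 avoids the unit circle
  itself, where \<open>F\<close> may be unbounded. The finite set \<open>S\<close> consists of the directions of such singularities.
\<close>

lemma disc_series_l2_upper:
  fixes c :: "nat \<Rightarrow> complex"
  assumes F: "\<And>z. norm z < 1 \<Longrightarrow> (\<lambda>k. c k * z ^ k) sums F z"
    and h: "h integrable_on {-pi..pi}" and S: "finite S"
    and le: "\<And>r \<theta>. 0 < r \<Longrightarrow> r < 1 \<Longrightarrow> \<theta> \<in> {-pi..pi} - S \<Longrightarrow> (norm (F (of_real r * cis \<theta>)))\<^sup>2 \<le> h \<theta>"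
  shows "2 * pi * (\<Sum>k<N. (norm (c k))\<^sup>2) \<le> integral {-pi..pi} h"
proof -
  have main: "2 * pi * (\<Sum>k<N. (norm (c k))\<^sup>2 * r ^ (2*k)) \<le> integral {-pi..pi} h" if r: "0 < r" "r < 1" for r
  proof -
    note P = disc_series_circle[OF F r]
    have "(\<Sum>k<N. (norm (c k))\<^sup>2 * r ^ (2*k)) \<le> (\<Sum>k. (norm (c k))\<^sup>2 * r ^ (2*k))"
      using r by (intro sum_le_suminf P(1)) auto
    then have "2 * pi * (\<Sum>k<N. (norm (c k))\<^sup>2 * r ^ (2*k)) \<le> 2 * pi * (\<Sum>k. (norm (c k))\<^sup>2 * r ^ (2*k))"
      by (rule mult_left_mono) simp
    also have "2 * pi * (\<Sum>k. (norm (c k))\<^sup>2 * r ^ (2*k)) \<le> integral {-pi..pi} h"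
    proof (rule has_integral_le[OF P(2)])
      let ?h = "\<lambda>\<theta>. if \<theta> \<in> S then (norm (F (of_real r * cis \<theta>)))\<^sup>2 else h \<theta>"
      show "(?h has_integral integral {-pi..pi} h) {-pi..pi}"
        by (rule has_integral_spike_finite[OF S _ integrable_integral[OF h]]) auto
      show "\<And>x. x \<in> {-pi..pi} \<Longrightarrow> (norm (F (of_real r * cis x)))\<^sup>2 \<le> ?h x"
        using le[OF r] by auto
    qed
    finally show ?thesis .
  qed
  define L where "L = (\<lambda>r::real. 2 * pi * (\<Sum>k<N. (norm (c k))\<^sup>2 * r ^ (2*k)))"
  have "(L \<longlongrightarrow> L 1) (at 1 within {..<1})"
    unfolding L_def by (intro tendsto_mult tendsto_const tendsto_sum tendsto_power tendsto_ident_at)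
  moreover have "\<forall>\<^sub>F r in at_left (1::real). L r \<le> integral {-pi..pi} h"
    by (rule eventually_mono[OF eventually_at_left_real[of 0 1]]) (use main in \<open>auto simp: L_def\<close>)
  ultimately have "L 1 \<le> integral {-pi..pi} h"
    by (rule tendsto_upperbound[OF _ _ trivial_limit_at_left_real])
  then show ?thesis by (simp add: L_def)
qed

text \<open>
  A single circle suffices for a lower bound since \<open>r ^ (2 * k) \<le> 1\<close>. Hence \<open>F\<close> need only be large on a
  short arc near one boundary singularity.
\<close>

lemma disc_series_l2_lower:
  fixes c :: "nat \<Rightarrow> complex"
  assumes F: "\<And>z. norm z < 1 \<Longrightarrow> (\<lambda>k. c k * z ^ k) sums F z"
    and s: "summable (\<lambda>k. (norm (c k))\<^sup>2)"
    and r: "0 < r" "r < 1" and ab: "-pi \<le> a" "a \<le> b" "b \<le> pi"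
    and le: "\<And>\<theta>. a \<le> \<theta> \<Longrightarrow> \<theta> \<le> b \<Longrightarrow> A \<le> (norm (F (of_real r * cis \<theta>)))\<^sup>2"
  shows "A * (b - a) \<le> 2 * pi * (\<Sum>k. (norm (c k))\<^sup>2)"
proof -
  note P = disc_series_circle[OF F r]
  let ?f = "\<lambda>\<theta>. (norm (F (of_real r * cis \<theta>)))\<^sup>2"
  have i: "?f integrable_on {a..b}"
    by (rule integrable_subinterval_real[OF has_integral_integrable[OF P(2)]]) (use ab in auto)
  have "A * (b - a) \<le> integral {a..b} ?f"
    by (rule has_integral_le[OF _ integrable_integral[OF i]])
       (use has_integral_const_real[of A a b] ab le in \<open>auto simp: mult_ac\<close>)
  also have "\<dots> \<le> integral {-pi..pi} ?f"
    by (rule integral_subset_le) (use ab i P(2) in auto)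
  also have "\<dots> = 2 * pi * (\<Sum>k. (norm (c k))\<^sup>2 * r ^ (2*k))"
    using P(2) by (rule integral_unique)
  also have "\<dots> \<le> 2 * pi * (\<Sum>k. (norm (c k))\<^sup>2)"
  proof (intro mult_left_mono suminf_le P(1) s)
    fix k show "(norm (c k))\<^sup>2 * r ^ (2*k) \<le> (norm (c k))\<^sup>2"
      using r by (intro mult_left_le power_le_one) auto
  qed auto
  finally show ?thesis .
qed

section \<open>Distance from the singularities on the circle\<close>

lemma powr_abs_shift_integrable:
  fixes e p :: real
  assumes "e < 1" "-pi \<le> p" "p \<le> pi"
  shows "(\<lambda>\<theta>. \<bar>\<theta> - p\<bar> powr (- e)) integrable_on {-pi..pi}"
proof -
  have "(\<lambda>x. x powr (-e)) integrable_on {0..pi-p}" "(\<lambda>x. x powr (-e)) integrable_on {0..pi+p}"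
    using assms by (auto intro!: integrable_on_powr_from_0)
  then obtain I J where I: "((\<lambda>x. x powr (-e)) has_integral I) (cbox 0 (pi-p))"
     and J: "((\<lambda>x. x powr (-e)) has_integral J) {0..pi+p}"
    by (auto simp: integrable_on_def)
  have "((\<lambda>x. (x - p) powr (-e)) has_integral I) {p..pi}"
    using has_integral_affinity'[OF I, where m = 1 and c = "-p"] by simp
  then have 1: "((\<lambda>x. \<bar>x - p\<bar> powr (-e)) has_integral I) {p..pi}"
    by (rule has_integral_eq[rotated]) auto
  have "((\<lambda>x. (- x) powr (-e)) has_integral J) (cbox (-(pi+p)) 0)"
    using J has_integral_reflect_real[where f = "\<lambda>x. x powr (-e)" and a = 0 and b = "pi+p" and i = J] assms by simp
  from has_integral_affinity'[OF this, where m = 1 and c = "-p"]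
  have "((\<lambda>x. (- (x - p)) powr (-e)) has_integral J) {-pi..p}"
    by simp
  then have 2: "((\<lambda>x. \<bar>x - p\<bar> powr (-e)) has_integral J) {-pi..p}"
    by (rule has_integral_eq[rotated]) auto
  show ?thesis
    using has_integral_combine[OF assms(2,3) 2 1] by blast
qed

text \<open>
  A point can be close to only one of finitely many separated points, so that all factors but one
  are bounded. This reduces integrability of a product of singularities to that of each of them.
\<close>

lemma prod_powr_le_sum:
  fixes p e :: "'i \<Rightarrow> real"
  assumes "finite J" "J \<noteq> {}" "inj_on p J" and e: "\<And>j. j \<in> J \<Longrightarrow> 0 \<le> e j"
  shows "\<exists>C>0. \<forall>x. x \<notin> p ` J \<longrightarrow> (\<Prod>j\<in>J. \<bar>x - p j\<bar> powr (- e j)) \<le> C * (\<Sum>j\<in>J. \<bar>x - p j\<bar> powr (- e j))"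
proof -
  obtain d :: real where d: "d > 0" "\<And>i j. i \<in> J \<Longrightarrow> j \<in> J \<Longrightarrow> i \<noteq> j \<Longrightarrow> 2 * d \<le> \<bar>p i - p j\<bar>"
  proof -
    let ?D = "(\<lambda>(i,j). \<bar>p i - p j\<bar> / 2) ` ((J \<times> J) - Id)"
    have fin: "finite ?D" by (intro finite_imageI finite_Diff finite_cartesian_product assms)
    have pos: "\<forall>y\<in>?D. 0 < y"
    proof
      fix y assume "y \<in> ?D"
      then obtain i j where ij: "i \<in> J" "j \<in> J" "i \<noteq> j" "y = \<bar>p i - p j\<bar> / 2" by (clarsimp, blast)
      then have "p i \<noteq> p j" using assms(3) by (meson inj_onD)
      then show "0 < y" using ij by simp
    qed
    show ?thesis
    proof (rule that[of "Min (insert 1 ?D)"])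
      show "0 < Min (insert 1 ?D)" using fin pos by (subst Min_gr_iff) auto
      fix i j assume ij: "i \<in> J" "j \<in> J" "i \<noteq> j"
      then have "\<bar>p i - p j\<bar> / 2 \<in> ?D" by (auto intro!: image_eqI[of _ _ "(i, j)"])
      then have "Min (insert 1 ?D) \<le> \<bar>p i - p j\<bar> / 2" using fin by (intro Min_le) auto
      then show "2 * Min (insert 1 ?D) \<le> \<bar>p i - p j\<bar>" by simp
    qed
  qed
  define C where "C = (\<Prod>j\<in>J. max 1 (d powr (- e j)))"
  have C1: "C > 0" unfolding C_def by (intro prod_pos) auto
  have "(\<Prod>j\<in>J. \<bar>x - p j\<bar> powr (- e j)) \<le> C * (\<Sum>j\<in>J. \<bar>x - p j\<bar> powr (- e j))"
    if x: "x \<notin> p ` J" for x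
  proof -
    obtain k where k: "k \<in> J" "\<And>j. j \<in> J \<Longrightarrow> \<bar>x - p k\<bar> \<le> \<bar>x - p j\<bar>"
      using arg_min_if_finite(1)[OF assms(1,2), of "\<lambda>j. \<bar>x - p j\<bar>"]
        arg_min_least[OF assms(1,2), of _ "\<lambda>j. \<bar>x - p j\<bar>"] that by blast
    have far: "d \<le> \<bar>x - p j\<bar>" if "j \<in> J" "j \<noteq> k" for j
      using k(2)[OF that(1)] d(2)[OF that(1) k(1) that(2)] by linarith
    have "(\<Prod>j\<in>J. \<bar>x - p j\<bar> powr (- e j)) = \<bar>x - p k\<bar> powr (- e k) * (\<Prod>j\<in>J-{k}. \<bar>x - p j\<bar> powr (- e j))"
      using k assms by (subst prod.remove[of J k]) auto
    also have "\<dots> \<le> \<bar>x - p k\<bar> powr (- e k) * (\<Prod>j\<in>J-{k}. max 1 (d powr (- e j)))"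
    proof (intro mult_left_mono prod_mono conjI)
      fix j assume j: "j \<in> J - {k}"
      have "\<bar>x - p j\<bar> powr (- e j) \<le> d powr (- e j)"
        using d(1) far[of j] e[of j] j by (intro powr_mono2') auto
      then show "\<bar>x - p j\<bar> powr (- e j) \<le> max 1 (d powr (- e j))" by simp
    qed auto
    also have "\<dots> \<le> \<bar>x - p k\<bar> powr (- e k) * C"
    proof (intro mult_left_mono)
      have "C = max 1 (d powr (- e k)) * (\<Prod>j\<in>J-{k}. max 1 (d powr (- e j)))"
        unfolding C_def using k assms by (subst prod.remove[of J k]) auto
      moreover have "1 * (\<Prod>j\<in>J-{k}. max 1 (d powr (- e j))) \<le> max 1 (d powr (- e k)) * (\<Prod>j\<in>J-{k}. max 1 (d powr (- e j)))"
        by (intro mult_right_mono prod_nonneg) auto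
      ultimately show "(\<Prod>j\<in>J-{k}. max 1 (d powr (- e j))) \<le> C" by simp
    qed auto
    also have "\<bar>x - p k\<bar> powr (- e k) \<le> (\<Sum>j\<in>J. \<bar>x - p j\<bar> powr (- e j))"
      using k assms by (intro member_le_sum) auto
    finally show ?thesis using C1 by (simp add: mult_ac)
  qed
  then show ?thesis using C1 by blast
qed

lemma norm_one_minus_cis: "norm (1 - cis \<phi>) = 2 * \<bar>sin (\<phi> / 2)\<bar>"
proof -
  have "(norm (1 - cis \<phi>))\<^sup>2 = (1 - cos \<phi>)\<^sup>2 + (sin \<phi>)\<^sup>2"
    by (simp add: cmod_power2)
  also have "\<dots> = 2 - 2 * cos (2 * (\<phi>/2))"
    using sin_cos_squared_add[of \<phi>] by (simp add: power2_eq_square algebra_simps)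
  also have "\<dots> = (2 * \<bar>sin (\<phi> / 2)\<bar>)\<^sup>2"
    unfolding cos_double using sin_cos_squared_add[of "\<phi>/2"]
    by (simp add: power_mult_distrib algebra_simps) (simp flip: distrib_left)
  finally show ?thesis by (metis abs_ge_zero mult_nonneg_nonneg norm_ge_zero power2_eq_imp_eq zero_le_numeral)
qed

text \<open>
  Retracting a point of the circle along its radius at most halves its distance from 1; this makes the
  bounds near the circle uniform in \<open>r\<close>.
\<close>

lemma norm_one_minus_radial:
  assumes "0 \<le> r" "r \<le> 1"
  shows "norm (1 - cis \<phi>) / 2 \<le> norm (1 - of_real r * cis \<phi>)"
proof -
  have "norm (1 - cis \<phi>) \<le> norm (1 - of_real r * cis \<phi>) + norm (of_real r * cis \<phi> - cis \<phi>)"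
    using norm_triangle_ineq[of "1 - of_real r * cis \<phi>" "of_real r * cis \<phi> - cis \<phi>"] by simp
  also have "norm (of_real r * cis \<phi> - cis \<phi>) = 1 - r"
  proof -
    have "of_real r * cis \<phi> - cis \<phi> = of_real (r - 1) * cis \<phi>" by (simp add: algebra_simps)
    then show ?thesis using assms by (simp add: norm_mult del: of_real_diff)
  qed
  also have "1 - r \<le> norm (1 - of_real r * cis \<phi>)"
    using norm_triangle_ineq2[of 1 "of_real r * cis \<phi>"] assms by (simp add: norm_mult)
  finally show ?thesis by simp
qed

lemma sin_lower_compact:
  assumes "0 \<le> y0" "y0 < pi"
  shows "\<exists>c>0. \<forall>y. \<bar>y\<bar> \<le> y0 \<longrightarrow> c * \<bar>y\<bar> \<le> \<bar>sin y\<bar>"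
proof -
  have "continuous_on {0..y0} sinc"
    by (intro continuous_at_imp_continuous_on ballI isCont_sinc)
  then obtain x where x: "x \<in> {0..y0}" "\<And>y. y \<in> {0..y0} \<Longrightarrow> sinc x \<le> sinc y"
    using continuous_attains_inf[of "{0..y0}" sinc] assms by force
  have pos: "sinc x > 0"
    using x(1) assms by (cases "x = 0") (auto simp: sin_gt_zero)
  have "sinc x * \<bar>y\<bar> \<le> \<bar>sin y\<bar>" if "\<bar>y\<bar> \<le> y0" for y
  proof (cases "y = 0")
    case False
    have "sinc x \<le> sin \<bar>y\<bar> / \<bar>y\<bar>" using x(2)[of "\<bar>y\<bar>"] False that by auto
    then have "sinc x * \<bar>y\<bar> \<le> sin \<bar>y\<bar>" using False by (simp add: field_simps)
    also have "\<dots> \<le> \<bar>sin y\<bar>" by (cases "y \<ge> 0") auto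
    finally show ?thesis .
  qed simp
  then show ?thesis using pos by blast
qed

text \<open>
  As \<open>\<bar>l\<bar> \<le> L < pi\<close>, half of the angle \<open>\<theta> + l\<close> stays in a compact subset of the interval from \<open>- pi\<close> to \<open>pi\<close>,
  where sine and argument are comparable.
\<close>

lemma norm_one_minus_lower:
  assumes "0 \<le> L" "L < pi"
  shows "\<exists>c>0. \<forall>r \<theta> l. 0 \<le> r \<and> r \<le> 1 \<and> \<theta> \<in> {-pi..pi} \<and> \<bar>l\<bar> \<le> L \<longrightarrow>
      c * \<bar>\<theta> + l\<bar> \<le> norm (1 - cis l * (of_real r * cis \<theta>))"
proof -
  obtain c where c: "c > 0" "\<And>y. \<bar>y\<bar> \<le> (pi + L)/2 \<Longrightarrow> c * \<bar>y\<bar> \<le> \<bar>sin y\<bar>"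
    using sin_lower_compact[of "(pi+L)/2"] assms by auto
  have "(c/2) * \<bar>\<theta> + l\<bar> \<le> norm (1 - cis l * (of_real r * cis \<theta>))"
    if "0 \<le> r" "r \<le> 1" "\<theta> \<in> {-pi..pi}" "\<bar>l\<bar> \<le> L" for r \<theta> l
  proof -
    have "\<bar>(\<theta> + l)/2\<bar> \<le> (pi + L)/2" using that abs_triangle_ineq[of \<theta> l] by (simp add: abs_le_iff)
    from c(2)[OF this] have "(c/2) * \<bar>\<theta> + l\<bar> \<le> norm (1 - cis (\<theta> + l)) / 2"
      by (simp add: norm_one_minus_cis)
    also have "\<dots> \<le> norm (1 - of_real r * cis (\<theta> + l))"
      using that by (intro norm_one_minus_radial)
    also have "of_real r * cis (\<theta> + l) = cis l * (of_real r * cis \<theta>)"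
      by (simp add: cis_mult[symmetric] mult_ac)
    finally show ?thesis .
  qed
  then show ?thesis using c(1) by (intro exI[of _ "c/2"]) auto
qed

section \<open>Growth of the partial sums of a seasonal fractional filter\<close>

text \<open>
  Row \<open>i\<close> of the Toeplitz matrix of \<open>b\<close>. Time runs backwards from a fixed last time \<open>s\<close>: the entry
  \<open>sh b i q\<close> is the coefficient of the innovation at time \<open>s - q\<close> in the observation at time \<open>s - i\<close>.
\<close>

definition sh :: "(nat \<Rightarrow> real) \<Rightarrow> nat \<Rightarrow> nat \<Rightarrow> real" where
  "sh b i q = (if i \<le> q then b (q - i) else 0)"

lemma sums_sh:
  fixes z :: complex
  assumes "(\<lambda>k. complex_of_real (b k) * z ^ k) sums G"
  shows "(\<lambda>k. complex_of_real (sh b i k) * z ^ k) sums (z ^ i * G)"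
proof -
  have "(\<lambda>k. complex_of_real (sh b i (k + i)) * z ^ (k + i)) sums (z ^ i * G)"
    using sums_mult[OF assms, of "z ^ i"] by (simp add: sh_def power_add mult_ac)
  then show ?thesis by (subst (asm) sums_iff_shift) (simp add: sh_def)
qed

lemma norm_geometric_sum_le:
  fixes z :: complex
  assumes "norm z \<le> 1"
  shows "norm (\<Sum>i<n. z ^ i) \<le> real n" "norm (\<Sum>i<n. z ^ i) * norm (1 - z) \<le> 2"
proof -
  have "(\<Sum>i<n. norm (z ^ i)) \<le> (\<Sum>i<n. 1)"
    by (intro sum_mono) (auto intro!: power_le_one simp: norm_power assms)
  then have "norm (\<Sum>i<n. z ^ i) \<le> (\<Sum>i<n. 1)"
    using norm_sum order_trans by blast
  then show "norm (\<Sum>i<n. z ^ i) \<le> real n" by simp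
  have "norm (\<Sum>i<n. z ^ i) * norm (1 - z) = norm (1 - z ^ n)"
    unfolding one_diff_power_eq norm_mult by (simp add: mult.commute)
  also have "\<dots> \<le> 1 + norm (z ^ n)" using norm_triangle_ineq4[of 1 "z ^ n"] by simp
  also have "norm (z ^ n) \<le> 1" using assms by (auto simp: norm_power intro: power_le_one)
  finally show "norm (\<Sum>i<n. z ^ i) * norm (1 - z) \<le> 2" by simp
qed

lemma norm_geometric_sum_ge:
  fixes z :: complex
  assumes "norm z \<le> 1" "n \<ge> 1" "norm (1 - z) \<le> 1 / real n"
  shows "real n / 2 \<le> norm (\<Sum>i<n. z ^ i)"
proof -
  have "norm (of_nat n - (\<Sum>i<n. z ^ i)) = norm (\<Sum>i<n. (1 - z ^ i))"
    by (simp add: sum_subtractf)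
  also have "\<dots> \<le> (\<Sum>i<n. norm (1 - z ^ i))" by (rule norm_sum)
  also have "\<dots> \<le> (\<Sum>i<n. real i * norm (1 - z))"
  proof (rule sum_mono)
    fix i
    show "norm (1 - z ^ i) \<le> real i * norm (1 - z)"
      unfolding one_diff_power_eq norm_mult
      using mult_right_mono[OF norm_geometric_sum_le(1)[OF assms(1), of i] norm_ge_zero[of "1 - z"]]
      by (simp only: mult.commute)
  qed
  also have "\<dots> = (\<Sum>i<n. real i) * norm (1 - z)" by (simp add: sum_distrib_right)
  also have "(\<Sum>i<n. real i) = real n * (real n - 1) / 2"
    by (induction n) (auto simp: field_simps)
  also have "real n * (real n - 1) / 2 * norm (1 - z) \<le> real n * (real n - 1) / 2 * (1 / real n)"
    using assms by (intro mult_left_mono) auto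
  also have "\<dots> \<le> real n / 2" using assms by (simp add: field_simps)
  finally have "norm (of_nat n - (\<Sum>i<n. z ^ i)) \<le> real n / 2" .
  moreover have "norm (of_nat n :: complex) \<le> norm (of_nat n - (\<Sum>i<n. z ^ i)) + norm (\<Sum>i<n. z ^ i)"
    using norm_triangle_ineq[of "of_nat n - (\<Sum>i<n. z ^ i)" "\<Sum>i<n. z ^ i"] by simp
  ultimately show ?thesis by simp
qed

locale fractional_filter =
  fixes g :: "complex \<Rightarrow> complex" and m :: nat and \<alpha> lam :: "int \<Rightarrow> real" and b :: "nat \<Rightarrow> real"
  assumes g_cont: "continuous_on (cball 0 1) g"
    and g_nz: "norm z = 1 \<Longrightarrow> g z \<noteq> 0"
    and par: "j \<in> {0..int m} \<Longrightarrow> 0 < \<alpha> j \<and> \<alpha> j \<le> 1 \<and> \<alpha> (- j) = \<alpha> j \<and> lam (- j) = - lam j"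
    and lam0: "lam 0 = 0" and lam_mono: "strict_mono_on {0..int m} lam" and lam_pi: "lam (int m) < pi"
    and series: "norm z < 1 \<Longrightarrow> (\<lambda>k. complex_of_real (b k) * z ^ k) sums transfer_fun g m \<alpha> lam z"
begin

abbreviation "G \<equiv> transfer_fun g m \<alpha> lam"
abbreviation "J \<equiv> {- int m..int m}"

lemma lam_pos: "j \<in> {0..int m} \<Longrightarrow> 0 < j \<Longrightarrow> 0 < lam j"
  using lam_mono lam0 unfolding strict_mono_on_def by (metis atLeastAtMost_iff order.refl order.trans)

lemma lam_le: "j \<in> {0..int m} \<Longrightarrow> lam j \<le> lam (int m)"
  using lam_mono by (cases "j = int m") (auto simp: strict_mono_on_def less_imp_le)

lemma lam_neg: "j \<in> {- int m..0} \<Longrightarrow> lam j = - lam (- j)"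
  using par[of "-j"] by auto

lemma lam_m_nonneg: "0 \<le> lam (int m)"
  using lam_le[of 0] lam0 by auto

lemma lam_bound: "j \<in> J \<Longrightarrow> \<bar>lam j\<bar> \<le> lam (int m)"
proof (cases "0 \<le> j")
  case True
  assume "j \<in> J"
  with True have "j \<in> {0..int m}" by auto
  then show ?thesis using lam_le[of j] lam_pos[of j] lam0 by (cases "j = 0") (auto simp: lam_m_nonneg)
next
  case False
  assume "j \<in> J"
  with False have "- j \<in> {0..int m}" "0 < - j" "j \<in> {- int m..0}" by auto
  then show ?thesis using lam_le[of "-j"] lam_pos[of "-j"] lam_neg[of j] by auto
qed

lemma lam_inj: "inj_on lam J"
proof (rule linorder_inj_onI)
  fix i j assume ij: "i < j" "i \<in> J" "j \<in> J"
  have P: "lam i < lam j" if "i < j" "0 \<le> i" "j \<le> int m" for i j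
    using lam_mono that by (auto simp: strict_mono_on_def)
  consider "0 \<le> i" | "i < 0" "0 \<le> j" | "j < 0" using ij by linarith
  then show "lam i \<noteq> lam j"
  proof cases
    case 1 then show ?thesis using P[of i j] ij by auto
  next
    case 2
    have "lam i < 0" using lam_neg[of i] lam_pos[of "-i"] 2 ij by auto
    moreover have "0 \<le> lam j" using lam_pos[of j] lam0 2 ij by (cases "j = 0") auto
    ultimately show ?thesis by simp
  next
    case 3
    then show ?thesis using P[of "-j" "-i"] lam_neg[of i] lam_neg[of j] ij by auto
  qed
qed auto

lemma \<alpha>_J: "j \<in> J \<Longrightarrow> 0 < \<alpha> j \<and> \<alpha> j \<le> 1"
  using par[of j] par[of "-j"] by (cases "0 \<le> j") auto

lemma norm_G_sq:
  assumes "norm z < 1"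
  shows "(norm (G z))\<^sup>2 = (norm (g z))\<^sup>2 * (\<Prod>j\<in>J. norm (1 - cis (lam j) * z) powr (\<alpha> j - 1))"
proof -
  have nz: "1 - cis (lam j) * z \<noteq> 0" for j
  proof
    assume "1 - cis (lam j) * z = 0"
    then have "norm (cis (lam j) * z) = 1" by (metis eq_iff_diff_eq_0 norm_one)
    then show False using assms by (simp add: norm_mult)
  qed
  have "(norm ((1 - cis (lam j) * z) powr complex_of_real ((\<alpha> j - 1) / 2)))\<^sup>2
      = norm (1 - cis (lam j) * z) powr (\<alpha> j - 1)" for j
    using nz[of j]
    by (subst norm_powr_real_powr') (auto simp: power2_eq_square powr_add[symmetric])
  then show ?thesis unfolding transfer_fun_def norm_mult power_mult_distrib prod_norm[symmetric]
    by (simp add: prod_power_distrib)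
qed

text \<open>
  The factor \<open>g\<close> is bounded on the closed disc, and each remaining factor is compared with the distance of
  the angle from its singularity, uniformly in the radius.
\<close>

lemma G_upper:
  "\<exists>C>0. \<forall>r \<theta>. 0 < r \<and> r < 1 \<and> \<theta> \<in> {-pi..pi} \<and> \<theta> \<notin> (\<lambda>j. - lam j) ` J \<longrightarrow>
     (norm (G (of_real r * cis \<theta>)))\<^sup>2 \<le> C * (\<Prod>j\<in>J. \<bar>\<theta> - (- lam j)\<bar> powr (\<alpha> j - 1))"
proof -
  have "compact (g ` cball 0 1)" using g_cont by (intro compact_continuous_image) auto
  then obtain K where K: "\<And>z. norm z \<le> 1 \<Longrightarrow> norm (g z) \<le> K"
    by (force dest!: compact_imp_bounded simp: bounded_iff mem_cball_0)
  have K0: "K \<ge> 0" by (rule order_trans[OF norm_ge_zero K[of 0]]) simp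
  obtain c where c: "c > 0" "\<And>r \<theta> l. 0 \<le> r \<and> r \<le> 1 \<and> \<theta> \<in> {-pi..pi} \<and> \<bar>l\<bar> \<le> lam (int m) \<Longrightarrow>
      c * \<bar>\<theta> + l\<bar> \<le> norm (1 - cis l * (of_real r * cis \<theta>))"
    using norm_one_minus_lower[OF lam_m_nonneg lam_pi] by blast
  define C where "C = (K\<^sup>2 + 1) * (\<Prod>j\<in>J. c powr (\<alpha> j - 1))"
  have C0: "C > 0" unfolding C_def using c(1) by (intro mult_pos_pos prod_pos) (auto intro: add_nonneg_pos)
  have "(norm (G (of_real r * cis \<theta>)))\<^sup>2 \<le> C * (\<Prod>j\<in>J. \<bar>\<theta> - (- lam j)\<bar> powr (\<alpha> j - 1))"
    if H: "0 < r" "r < 1" "\<theta> \<in> {-pi..pi}" "\<theta> \<notin> (\<lambda>j. - lam j) ` J" for r \<theta>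
  proof -
    let ?z = "of_real r * cis \<theta>"
    have z: "norm ?z < 1" using H by (simp add: norm_mult)
    have "(norm (g ?z))\<^sup>2 \<le> K\<^sup>2 + 1"
      using K[of ?z] z by (smt (verit) norm_ge_zero power_mono)
    moreover have "(\<Prod>j\<in>J. norm (1 - cis (lam j) * ?z) powr (\<alpha> j - 1))
        \<le> (\<Prod>j\<in>J. c powr (\<alpha> j - 1) * \<bar>\<theta> - (- lam j)\<bar> powr (\<alpha> j - 1))"
    proof (intro prod_mono conjI)
      fix j assume j: "j \<in> J"
      have ne: "\<theta> + lam j \<noteq> 0" using H(4) j by force
      have "norm (1 - cis (lam j) * ?z) powr (\<alpha> j - 1) \<le> (c * \<bar>\<theta> + lam j\<bar>) powr (\<alpha> j - 1)"
        using \<alpha>_J[OF j] ne c(1) c(2)[of r \<theta> "lam j"] H lam_bound[OF j]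
        by (intro powr_mono2') auto
      also have "\<dots> = c powr (\<alpha> j - 1) * \<bar>\<theta> - (- lam j)\<bar> powr (\<alpha> j - 1)"
        using c(1) by (simp add: powr_mult)
      finally show "norm (1 - cis (lam j) * ?z) powr (\<alpha> j - 1)
         \<le> c powr (\<alpha> j - 1) * \<bar>\<theta> - (- lam j)\<bar> powr (\<alpha> j - 1)" .
    qed auto
    ultimately have "(norm (G ?z))\<^sup>2 \<le> (K\<^sup>2 + 1) * (\<Prod>j\<in>J. c powr (\<alpha> j - 1) * \<bar>\<theta> - (- lam j)\<bar> powr (\<alpha> j - 1))"
      unfolding norm_G_sq[OF z] by (intro mult_mono prod_nonneg) auto
    also have "\<dots> = C * (\<Prod>j\<in>J. \<bar>\<theta> - (- lam j)\<bar> powr (\<alpha> j - 1))"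
      by (simp add: C_def prod.distrib)
    finally show ?thesis .
  qed
  then show ?thesis using C0 by blast
qed

text \<open>
  Compactness bounds \<open>g\<close> away from 0 on the circle; uniform continuity extends this to an annulus.
\<close>

lemma g_lower: "\<exists>c>0. \<exists>r0<1. \<forall>z. r0 \<le> norm z \<and> norm z \<le> 1 \<longrightarrow> c \<le> norm (g z)"
proof -
  have "continuous_on (sphere 0 1) (\<lambda>z. norm (g z))"
    by (intro continuous_on_norm continuous_on_subset[OF g_cont]) auto
  then obtain w where w: "norm w = 1" "\<And>z. norm z = 1 \<Longrightarrow> norm (g w) \<le> norm (g z)"
    using continuous_attains_inf[of "sphere (0::complex) 1" "\<lambda>z. norm (g z)"] by force
  define c where "c = norm (g w) / 2"
  have c: "c > 0" using g_nz[OF w(1)] by (simp add: c_def)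
  have "uniformly_continuous_on (cball 0 1) g"
    using g_cont by (intro compact_uniformly_continuous) auto
  then obtain d where d: "d > 0" "\<And>x y. x \<in> cball 0 1 \<Longrightarrow> y \<in> cball 0 1 \<Longrightarrow> dist y x < d \<Longrightarrow> dist (g y) (g x) < c"
    using c unfolding uniformly_continuous_on_def by metis
  have "c \<le> norm (g z)" if "max (1/2) (1 - d/2) \<le> norm z" "norm z \<le> 1" for z
  proof -
    let ?y = "z / of_real (norm z)"
    have z0: "norm z > 0" using that(1) by linarith
    have y: "norm ?y = 1" using z0 by (simp add: norm_divide)
    have "z - ?y = of_real (1 - 1 / norm z) * z" by (simp add: algebra_simps)
    then have "norm (z - ?y) = \<bar>1 - 1 / norm z\<bar> * norm z" by (simp add: norm_mult del: of_real_diff of_real_divide)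
    also have "\<dots> = 1 - norm z" using z0 that by (simp add: abs_if field_simps)
    also have "\<dots> < d" using that(1) d(1) by simp
    finally have "dist (g z) (g ?y) < c" using d(2)[of ?y z] y that by (simp add: dist_norm)
    moreover have "2 * c \<le> norm (g ?y)" using w(2)[OF y] by (simp add: c_def)
    ultimately show ?thesis
      using norm_triangle_ineq2[of "g ?y" "g z"] by (simp add: dist_norm norm_minus_commute)
  qed
  moreover have "max (1/2) (1 - d/2) < 1" using d by auto
  ultimately show ?thesis using c by blast
qed

text \<open>
  The factors belonging to \<open>j \<noteq> k\<close> have a base of at most 2 and a nonpositive exponent, hence are bounded
  below; only the singularity at index \<open>k\<close> is kept.
\<close>

lemma G_lower:
  assumes k: "k \<in> J"
  shows "\<exists>c>0. \<exists>r0<1. \<forall>z. r0 \<le> norm z \<and> norm z < 1 \<longrightarrow>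
     c * norm (1 - cis (lam k) * z) powr (\<alpha> k - 1) \<le> (norm (G z))\<^sup>2"
proof -
  obtain c r0 where c: "c > 0" "r0 < 1" "\<And>z. r0 \<le> norm z \<and> norm z \<le> 1 \<Longrightarrow> c \<le> norm (g z)"
    using g_lower by blast
  define c' where "c' = c\<^sup>2 * (\<Prod>j\<in>J-{k}. 2 powr (\<alpha> j - 1))"
  have c'0: "c' > 0" unfolding c'_def using c by (intro mult_pos_pos prod_pos) auto
  have "c' * norm (1 - cis (lam k) * z) powr (\<alpha> k - 1) \<le> (norm (G z))\<^sup>2"
    if z: "r0 \<le> norm z" "norm z < 1" for z
  proof -
    have "(\<Prod>j\<in>J-{k}. 2 powr (\<alpha> j - 1)) \<le> (\<Prod>j\<in>J-{k}. norm (1 - cis (lam j) * z) powr (\<alpha> j - 1))"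
    proof (intro prod_mono conjI)
      fix j assume j: "j \<in> J - {k}"
      have "norm (1 - cis (lam j) * z) \<le> 2"
        using norm_triangle_ineq4[of 1 "cis (lam j) * z"] z by (simp add: norm_mult)
      moreover have "norm (1 - cis (lam j) * z) > 0"
      proof -
        have "1 - norm z \<le> norm (1 - cis (lam j) * z)"
          using norm_triangle_ineq2[of 1 "cis (lam j) * z"] by (simp add: norm_mult)
        then show ?thesis using z by linarith
      qed
      ultimately show "2 powr (\<alpha> j - 1) \<le> norm (1 - cis (lam j) * z) powr (\<alpha> j - 1)"
        using \<alpha>_J[of j] j by (intro powr_mono2') auto
    qed auto
    moreover have "c\<^sup>2 \<le> (norm (g z))\<^sup>2" using c z by (intro power_mono) auto
    ultimately have "c' \<le> (norm (g z))\<^sup>2 * (\<Prod>j\<in>J-{k}. norm (1 - cis (lam j) * z) powr (\<alpha> j - 1))"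
      unfolding c'_def by (intro mult_mono prod_nonneg) auto
    then have "c' * norm (1 - cis (lam k) * z) powr (\<alpha> k - 1) \<le>
      (norm (g z))\<^sup>2 * (\<Prod>j\<in>J-{k}. norm (1 - cis (lam j) * z) powr (\<alpha> j - 1)) * norm (1 - cis (lam k) * z) powr (\<alpha> k - 1)"
      by (intro mult_right_mono) auto
    also have "\<dots> = (norm (G z))\<^sup>2"
      unfolding norm_G_sq[OF z(2)] using k by (subst prod.remove[of J k]) (auto simp: mult_ac)
    finally show ?thesis .
  qed
  then show ?thesis using c'0 c(2) by blast
qed

text \<open>
  The left side is a partial sum of squared coefficients of \<open>(\<Sum>i<n. z ^ i) * G z\<close>. The geometric sum is at most
  \<open>n\<close> and at most a multiple of \<open>1 / \<bar>\<theta>\<bar>\<close>; interpolating between the two bounds yields the power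
  \<open>n powr (2 - \<gamma>)\<close> at the cost of raising the singularity at angle 0 to the exponent
  \<open>1 - \<alpha> 0 + \<gamma> < 1\<close>, which is still integrable.
\<close>

lemma sum_sh_l2_upper:
  assumes \<gamma>: "0 \<le> \<gamma>" "\<gamma> < \<alpha> 0"
  shows "\<exists>C>0. \<forall>n N. n \<ge> 1 \<longrightarrow> (\<Sum>k<N. (\<Sum>i<n. sh b i k)\<^sup>2) \<le> C * real n powr (2 - \<gamma>)"
proof -
  obtain C1 where C1: "C1 > 0" "\<And>r \<theta>. 0 < r \<and> r < 1 \<and> \<theta> \<in> {-pi..pi} \<and> \<theta> \<notin> (\<lambda>j. - lam j) ` J \<Longrightarrow>
     (norm (G (of_real r * cis \<theta>)))\<^sup>2 \<le> C1 * (\<Prod>j\<in>J. \<bar>\<theta> - (- lam j)\<bar> powr (\<alpha> j - 1))"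
    using G_upper by blast
  obtain c where c: "c > 0" "\<And>r \<theta> l. 0 \<le> r \<and> r \<le> 1 \<and> \<theta> \<in> {-pi..pi} \<and> \<bar>l\<bar> \<le> lam (int m) \<Longrightarrow>
      c * \<bar>\<theta> + l\<bar> \<le> norm (1 - cis l * (of_real r * cis \<theta>))"
    using norm_one_minus_lower[OF lam_m_nonneg lam_pi] by blast
  define e where "e j = (if j = 0 then 1 - \<alpha> 0 + \<gamma> else 1 - \<alpha> j)" for j
  have J0: "0 \<in> J" "finite J" "J \<noteq> {}" by auto
  have e: "0 \<le> e j" "e j < 1" if "j \<in> J" for j
    using \<alpha>_J[OF that] \<alpha>_J[OF J0(1)] \<gamma> by (auto simp: e_def)
  have inj: "inj_on (\<lambda>j. - lam j) J" using lam_inj by (auto simp: inj_on_def)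
  obtain C2 where C2: "C2 > 0" "\<And>x. x \<notin> (\<lambda>j. - lam j) ` J \<Longrightarrow>
      (\<Prod>j\<in>J. \<bar>x - (- lam j)\<bar> powr (- e j)) \<le> C2 * (\<Sum>j\<in>J. \<bar>x - (- lam j)\<bar> powr (- e j))"
    using prod_powr_le_sum[OF J0(2,3) inj, of e] e by blast
  define H where "H \<theta> = (\<Sum>j\<in>J. \<bar>\<theta> - (- lam j)\<bar> powr (- e j))" for \<theta>
  have Hint: "H integrable_on {-pi..pi}"
    unfolding H_def
  proof (intro integrable_sum J0(2) powr_abs_shift_integrable)
    fix j assume "j \<in> J"
    then show "e j < 1" "- pi \<le> - lam j" "- lam j \<le> pi"
      using e[of j] lam_bound[of j] lam_pi by auto
  qed
  define C where "C = C1 * (2 / c) powr \<gamma> * C2 * integral {-pi..pi} H / (2 * pi) + 1"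
  have I0: "0 \<le> integral {-pi..pi} H"
    by (rule integral_nonneg[OF Hint]) (auto simp: H_def intro!: sum_nonneg)
  have "(\<Sum>k<N. (\<Sum>i<n. sh b i k)\<^sup>2) \<le> C * real n powr (2 - \<gamma>)" if n: "n \<ge> 1" for n N
  proof -
    define h where "h \<theta> = C1 * (2 / c) powr \<gamma> * C2 * real n powr (2 - \<gamma>) * H \<theta>" for \<theta>
    let ?F = "\<lambda>z. (\<Sum>i<n. z ^ i) * G z"
    have "2 * pi * (\<Sum>k<N. (norm (complex_of_real (\<Sum>i<n. sh b i k)))\<^sup>2) \<le> integral {-pi..pi} h"
    proof (rule disc_series_l2_upper[of _ ?F h "(\<lambda>j. - lam j) ` J"])
      fix z :: complex assume z: "norm z < 1"
      have "(\<lambda>k. \<Sum>i<n. complex_of_real (sh b i k) * z ^ k) sums (\<Sum>i<n. z ^ i * G z)"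
        by (intro sums_sum sums_sh series z)
      then show "(\<lambda>k. complex_of_real (\<Sum>i<n. sh b i k) * z ^ k) sums ?F z"
        by (simp add: sum_distrib_right)
    next
      show "h integrable_on {-pi..pi}" unfolding h_def by (intro integrable_on_mult_right Hint)
    next
      fix r \<theta> :: real assume r: "0 < r" "r < 1" and \<theta>: "\<theta> \<in> {-pi..pi} - (\<lambda>j. - lam j) ` J"
      let ?z = "of_real r * cis \<theta>"
      let ?D = "norm (\<Sum>i<n. ?z ^ i)"
      have z: "norm ?z \<le> 1" using r by (simp add: norm_mult)
      have \<theta>0: "\<theta> \<noteq> 0" using \<theta> J0 lam0 by force
      have "c * \<bar>\<theta>\<bar> \<le> norm (1 - ?z)" using c(2)[of r \<theta> 0] r \<theta> lam_m_nonneg by simp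
      then have "?D * (c * \<bar>\<theta>\<bar>) \<le> 2"
        using norm_geometric_sum_le(2)[OF z, of n] by (meson mult_left_mono norm_ge_zero order_trans)
      then have D2: "?D \<le> (2 / c) / \<bar>\<theta>\<bar>" using c \<theta>0 by (simp add: field_simps)
      have g2: "\<gamma> \<le> 2" using \<gamma> \<alpha>_J[OF J0(1)] by auto
      have "?D\<^sup>2 \<le> real n powr (2 - \<gamma>) * ((2 / c) powr \<gamma> * \<bar>\<theta>\<bar> powr (- \<gamma>))"
      proof (cases "?D = 0")
        case False
        then have "?D\<^sup>2 = ?D powr (2 - \<gamma>) * ?D powr \<gamma>"
          by (simp add: powr_add[symmetric])
        also have "\<dots> \<le> real n powr (2 - \<gamma>) * ((2 / c) / \<bar>\<theta>\<bar>) powr \<gamma>"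
          using norm_geometric_sum_le(1)[OF z, of n] D2 g2 \<gamma>
          by (intro mult_mono powr_mono2) auto
        also have "((2 / c) / \<bar>\<theta>\<bar>) powr \<gamma> = (2 / c) powr \<gamma> * \<bar>\<theta>\<bar> powr (- \<gamma>)"
          by (subst powr_divide) (use c in \<open>auto simp: powr_minus field_simps\<close>)
        finally show ?thesis .
      qed simp
      then have "(norm (?F ?z))\<^sup>2 \<le> (real n powr (2 - \<gamma>) * ((2 / c) powr \<gamma> * \<bar>\<theta>\<bar> powr (- \<gamma>)))
           * (C1 * (\<Prod>j\<in>J. \<bar>\<theta> - (- lam j)\<bar> powr (\<alpha> j - 1)))"
        unfolding norm_mult power_mult_distrib
        using C1(2)[of r \<theta>] r \<theta> by (intro mult_mono) auto
      also have "\<dots> = C1 * (2 / c) powr \<gamma> * real n powr (2 - \<gamma>) *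
           (\<bar>\<theta>\<bar> powr (- \<gamma>) * (\<Prod>j\<in>J. \<bar>\<theta> - (- lam j)\<bar> powr (\<alpha> j - 1)))" by (simp add: mult_ac)
      also have "(\<bar>\<theta>\<bar> powr (- \<gamma>) * (\<Prod>j\<in>J. \<bar>\<theta> - (- lam j)\<bar> powr (\<alpha> j - 1)))
          = (\<Prod>j\<in>J. \<bar>\<theta> - (- lam j)\<bar> powr (- e j))"
      proof -
        have "(\<Prod>j\<in>J. \<bar>\<theta> - (- lam j)\<bar> powr (- e j)) = \<bar>\<theta>\<bar> powr (\<alpha> 0 - 1 - \<gamma>) * (\<Prod>j\<in>J-{0}. \<bar>\<theta> - (- lam j)\<bar> powr (- e j))"
          using J0 by (subst prod.remove[of J 0]) (auto simp: e_def lam0 algebra_simps)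
        also have "(\<Prod>j\<in>J-{0}. \<bar>\<theta> - (- lam j)\<bar> powr (- e j)) = (\<Prod>j\<in>J-{0}. \<bar>\<theta> - (- lam j)\<bar> powr (\<alpha> j - 1))"
          by (intro prod.cong) (auto simp: e_def)
        also have "\<bar>\<theta>\<bar> powr (\<alpha> 0 - 1 - \<gamma>) = \<bar>\<theta>\<bar> powr (- \<gamma>) * \<bar>\<theta> - (- lam 0)\<bar> powr (\<alpha> 0 - 1)"
          by (simp add: lam0 powr_add[symmetric])
        finally show ?thesis
          using J0 by (subst prod.remove[of J 0]) (auto simp: mult_ac)
      qed
      also have "C1 * (2 / c) powr \<gamma> * real n powr (2 - \<gamma>) * (\<Prod>j\<in>J. \<bar>\<theta> - (- lam j)\<bar> powr (- e j))
          \<le> C1 * (2 / c) powr \<gamma> * real n powr (2 - \<gamma>) * (C2 * H \<theta>)"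
        unfolding H_def using C1 C2(2)[of \<theta>] \<theta> by (intro mult_left_mono) auto
      also have "\<dots> = h \<theta>" by (simp add: h_def mult_ac)
      finally show "(norm (?F ?z))\<^sup>2 \<le> h \<theta>" .
    qed auto
    also have "integral {-pi..pi} h = 2 * pi * ((C - 1) * real n powr (2 - \<gamma>))"
      by (simp add: h_def[abs_def] C_def)
    finally have "(\<Sum>k<N. (\<Sum>i<n. sh b i k)\<^sup>2) \<le> (C - 1) * real n powr (2 - \<gamma>)"
      by (simp only: norm_of_real power2_abs mult_le_cancel_left_pos) simp
    also have "\<dots> \<le> C * real n powr (2 - \<gamma>)" by (intro mult_right_mono) auto
    finally show ?thesis .
  qed
  moreover have "C > 0" using C1 C2 I0 c by (auto simp: C_def intro!: add_nonneg_pos)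
  ultimately show ?thesis by blast
qed

lemma summable_b_sq: "summable (\<lambda>k. (b k)\<^sup>2)"
proof -
  obtain C where C: "\<And>n N. n \<ge> 1 \<Longrightarrow> (\<Sum>k<N. (\<Sum>i<n. sh b i k)\<^sup>2) \<le> C * real n powr (2 - 0)"
    using sum_sh_l2_upper[of 0] \<alpha>_J[of 0] by force
  show ?thesis
    by (rule summableI_nonneg_bounded[of _ C]) (use C[of 1] in \<open>auto simp: sh_def\<close>)
qed

end

section \<open>Linear and quadratic sums of autocovariances\<close>

definition lag :: "nat \<Rightarrow> nat \<Rightarrow> nat" where "lag i j = (i - j) + (j - i)"
definition rho :: "(nat \<Rightarrow> real) \<Rightarrow> nat \<Rightarrow> real" where "rho b k = (\<Sum>q. b q * b (q + k))"

lemma card_small_lag: "card {j\<in>{..<n}. \<not> lag i j > k0} \<le> 2 * k0 + 1"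
proof -
  have "{j\<in>{..<n}. \<not> lag i j > k0} \<subseteq> {i - k0..i + k0}" by (auto simp: lag_def)
  then have "card {j\<in>{..<n}. \<not> lag i j > k0} \<le> card {i - k0..i + k0}" by (intro card_mono) auto
  also have "\<dots> \<le> 2 * k0 + 1" by simp
  finally show ?thesis .
qed

lemma small_lag_sum_real:
  assumes "0 \<le> (H :: real)"
  shows "(\<Sum>i<n. \<Sum>j<n. if lag i j > k0 then 0 else H) \<le> real n * (2 * real k0 + 1) * H"
proof -
  have "(\<Sum>j<n. if lag i j > k0 then 0 else H) \<le> (2 * real k0 + 1) * H" for i
  proof -
    have "(\<Sum>j<n. if lag i j > k0 then 0 else H) = (\<Sum>j<n. if \<not> lag i j > k0 then H else 0)"
      by (rule sum.cong) auto
    also have "\<dots> = (\<Sum>j\<in>{j\<in>{..<n}. \<not> lag i j > k0}. H)" by (rule sum.inter_filter[symmetric]) simp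
    also have "\<dots> = real (card {j\<in>{..<n}. \<not> lag i j > k0}) * H" by simp
    also have "\<dots> \<le> real (2 * k0 + 1) * H"
      by (rule mult_right_mono[OF of_nat_mono[OF card_small_lag] assms])
    finally show ?thesis by (simp add: add.commute)
  qed
  then have "(\<Sum>i<n. \<Sum>j<n. if lag i j > k0 then 0 else H) \<le> (\<Sum>i<n. (2 * real k0 + 1) * H)" by (intro sum_mono)
  then show ?thesis by simp
qed

lemma small_lag_sum:
  fixes h :: "nat \<Rightarrow> nat \<Rightarrow> complex"
  assumes "\<And>i j. i < n \<Longrightarrow> j < n \<Longrightarrow> norm (h i j) \<le> H" "0 \<le> H"
  shows "norm (\<Sum>i<n. \<Sum>j<n. if lag i j > k0 then 0 else h i j) \<le> real n * (2 * real k0 + 1) * H"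
proof -
  have "norm (\<Sum>i<n. \<Sum>j<n. if lag i j > k0 then 0 else h i j) \<le> (\<Sum>i<n. \<Sum>j<n. if lag i j > k0 then 0 else H)"
    using assms by (intro order_trans[OF norm_sum] sum_mono) auto
  then show ?thesis using small_lag_sum_real[OF assms(2)] by (rule order_trans)
qed

lemma summable_prod_l2:
  fixes x y :: "nat \<Rightarrow> real"
  assumes "summable (\<lambda>q. (x q)\<^sup>2)" "summable (\<lambda>q. (y q)\<^sup>2)"
  shows "summable (\<lambda>q. \<bar>x q * y q\<bar>)" "summable (\<lambda>q. x q * y q)"
proof -
  have "summable (\<lambda>q. (x q)\<^sup>2 + (y q)\<^sup>2)" using assms by (rule summable_add)
  then show "summable (\<lambda>q. \<bar>x q * y q\<bar>)"
  proof (rule summable_comparison_test'[of _ 0])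
    fix q
    have "2 * \<bar>x q * y q\<bar> \<le> (x q)\<^sup>2 + (y q)\<^sup>2"
      using sum_squares_bound[of "\<bar>x q\<bar>" "\<bar>y q\<bar>"] by (simp add: abs_mult)
    then show "norm \<bar>x q * y q\<bar> \<le> (x q)\<^sup>2 + (y q)\<^sup>2" by simp
  qed
  then show "summable (\<lambda>q. x q * y q)" by (rule summable_rabs_cancel)
qed

lemma sh_prod_sums:
  assumes "summable (\<lambda>q. (b q)\<^sup>2)"
  shows "(\<lambda>q. sh b i q * sh b j q) sums rho b (lag i j)"
proof -
  have P: "(\<lambda>q. sh b i q * sh b j q) sums rho b (lag i j)" if "i \<le> j" for i j
  proof -
    have "summable (\<lambda>q. b q * b (q + (j - i)))"
      by (rule summable_prod_l2(2)[OF assms]) (use assms in \<open>simp add: summable_iff_shift[of "\<lambda>q. (b q)\<^sup>2"]\<close>)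
    then have "(\<lambda>q. b q * b (q + (j - i))) sums rho b (lag i j)"
      using that by (simp add: rho_def lag_def summable_sums)
    also have "(\<lambda>q. b q * b (q + (j - i))) = (\<lambda>q. sh b i (q + j) * sh b j (q + j))"
      using that by (auto simp: sh_def fun_eq_iff add.commute)
    finally show ?thesis by (subst (asm) sums_iff_shift) (simp add: sh_def)
  qed
  show ?thesis using P[of i j] P[of j i] by (cases "i \<le> j") (auto simp: lag_def mult.commute add.commute)
qed

lemma sh_quadratic_sums:
  fixes w :: "nat \<Rightarrow> complex"
  assumes "summable (\<lambda>q. (b q)\<^sup>2)"
  shows "(\<lambda>q. complex_of_real ((norm (\<Sum>i<n. w i * of_real (sh b i q)))\<^sup>2)) sums
     (\<Sum>i<n. \<Sum>j<n. w i * cnj (w j) * of_real (rho b (lag i j)))"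
proof -
  have "(\<lambda>q. \<Sum>i<n. \<Sum>j<n. w i * cnj (w j) * of_real (sh b i q * sh b j q)) sums
     (\<Sum>i<n. \<Sum>j<n. w i * cnj (w j) * of_real (rho b (lag i j)))"
    by (intro sums_sum sums_mult sums_of_real sh_prod_sums assms)
  also have "(\<lambda>q. \<Sum>i<n. \<Sum>j<n. w i * cnj (w j) * of_real (sh b i q * sh b j q)) =
     (\<lambda>q. complex_of_real ((norm (\<Sum>i<n. w i * of_real (sh b i q)))\<^sup>2))"
    by (simp only: complex_norm_square) (simp add: sum_product mult_ac)
  finally show ?thesis .
qed

text \<open>
  For innovations of unit variance, \<open>Tn\<close> is the variance of the sum of \<open>n\<close> consecutive observations and
  \<open>Wn\<close> is the sum of their squared covariances.
\<close>

definition Tn :: "(nat \<Rightarrow> real) \<Rightarrow> nat \<Rightarrow> real" where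
  "Tn b n = (\<Sum>i<n. \<Sum>j<n. rho b (lag i j))"
definition Wn :: "(nat \<Rightarrow> real) \<Rightarrow> nat \<Rightarrow> real" where
  "Wn b n = (\<Sum>i<n. \<Sum>j<n. (rho b (lag i j))\<^sup>2)"

lemma Tn_sums:
  assumes "summable (\<lambda>q. (b q)\<^sup>2)"
  shows "(\<lambda>q. (\<Sum>i<n. sh b i q)\<^sup>2) sums Tn b n"
proof -
  have "(\<lambda>q. complex_of_real ((\<Sum>i<n. sh b i q)\<^sup>2)) sums complex_of_real (Tn b n)"
    using sh_quadratic_sums[OF assms, where n = n and w = "\<lambda>_. 1"] unfolding Tn_def
    by (simp del: of_real_power add: of_real_sum[symmetric] del: of_real_sum)
  then show ?thesis by (simp only: sums_of_real_iff)
qed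

context fractional_filter
begin

lemma Tn_upper:
  assumes "0 \<le> \<gamma>" "\<gamma> < \<alpha> 0"
  shows "\<exists>C>0. \<forall>n\<ge>1. Tn b n \<le> C * real n powr (2 - \<gamma>)"
proof -
  obtain C where C: "C > 0" "\<And>n N. n \<ge> 1 \<longrightarrow> (\<Sum>k<N. (\<Sum>i<n. sh b i k)\<^sup>2) \<le> C * real n powr (2 - \<gamma>)"
    using sum_sh_l2_upper[OF assms] by blast
  have "Tn b n \<le> C * real n powr (2 - \<gamma>)" if "n \<ge> 1" for n
    by (rule LIMSEQ_le_const2[OF Tn_sums[OF summable_b_sq, unfolded sums_def]]) (use C(2) that in blast)
  then show ?thesis using C(1) by blast
qed

text \<open>
  Weighting row \<open>i\<close> by \<open>cis (lam k) ^ i\<close> moves the peak of the geometric sum to the singularity with index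
  \<open>k\<close>. On an arc of length \<open>1 / (2 * n)\<close>, at radius \<open>1 - 1 / (2 * n)\<close>, the geometric sum is of order \<open>n\<close> and the
  squared modulus of the transfer function of order \<open>n powr (1 - \<alpha> k)\<close>.
\<close>

lemma twisted_lower:
  assumes k: "k \<in> J"
  shows "\<exists>c>0. \<exists>n0. \<forall>n\<ge>n0. c * real n powr (2 - \<alpha> k) \<le>
     (\<Sum>q. (norm (\<Sum>i<n. cis (lam k) ^ i * of_real (sh b i q)))\<^sup>2)"
proof -
  obtain c r0 where c: "c > 0" "r0 < 1" "\<And>z. r0 \<le> norm z \<and> norm z < 1 \<Longrightarrow>
     c * norm (1 - cis (lam k) * z) powr (\<alpha> k - 1) \<le> (norm (G z))\<^sup>2"
    using G_lower[OF k] by blast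
  define d where "d = min (1 - r0) (pi - lam (int m))"
  have d: "d > 0" using c lam_pi by (simp add: d_def)
  obtain n0 where n0: "n0 > 0" "1 / real n0 < d"
    using reals_Archimedean[OF d] by (metis inverse_eq_divide zero_less_Suc)
  have "c / (16 * pi) * real n powr (2 - \<alpha> k) \<le>
     (\<Sum>q. (norm (\<Sum>i<n. cis (lam k) ^ i * of_real (sh b i q)))\<^sup>2)" if n: "n \<ge> n0" for n
  proof -
    have n1: "n \<ge> 1" "real n > 0" using n n0 by auto
    have nd: "1 / real n < d"
      using n0 n by (smt (verit) frac_le of_nat_0_less_iff of_nat_mono)
    define r where "r = 1 - 1 / (2 * real n)"
    have r: "0 < r" "r < 1" "r0 \<le> r" using n1 nd by (auto simp: r_def d_def field_simps)
    let ?a = "- lam k" let ?b = "- lam k + 1 / (2 * real n)"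
    let ?F = "\<lambda>z. (\<Sum>i<n. (cis (lam k) * z) ^ i) * G z"
    let ?A = "(real n / 2)\<^sup>2 * (c * (1 / real n) powr (\<alpha> k - 1))"
    have lk: "\<bar>lam k\<bar> \<le> lam (int m)" using lam_bound[OF k] .
    have "1 / (2 * real n) \<le> 1 / real n" using n1 by (simp add: field_simps)
    then have bpi: "?b \<le> pi" "- pi \<le> ?a" "?a \<le> ?b"
      using nd lk lam_pi n1 by (auto simp: d_def abs_le_iff)
    have "?A * (?b - ?a) \<le> 2 * pi * (\<Sum>q. (norm (\<Sum>i<n. cis (lam k) ^ i * of_real (sh b i q)))\<^sup>2)"
    proof (rule disc_series_l2_lower[of _ ?F])
      fix z :: complex assume z: "norm z < 1"
      have "(\<lambda>q. \<Sum>i<n. cis (lam k) ^ i * (of_real (sh b i q) * z ^ q)) sums (\<Sum>i<n. cis (lam k) ^ i * (z ^ i * G z))"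
        by (intro sums_sum sums_mult sums_sh series z)
      then show "(\<lambda>q. (\<Sum>i<n. cis (lam k) ^ i * of_real (sh b i q)) * z ^ q) sums ?F z"
        by (simp add: sum_distrib_left sum_distrib_right power_mult_distrib mult_ac)
    next
      have "summable (\<lambda>q. complex_of_real ((norm (\<Sum>i<n. cis (lam k) ^ i * of_real (sh b i q)))\<^sup>2))"
        using sh_quadratic_sums[OF summable_b_sq, where n = n and w = "\<lambda>i. cis (lam k) ^ i"] by (rule sums_summable)
      then show "summable (\<lambda>q. (norm (\<Sum>i<n. cis (lam k) ^ i * of_real (sh b i q)))\<^sup>2)"
        by (simp only: summable_of_real_iff)
    next
      fix \<theta> assume \<theta>: "?a \<le> \<theta>" "\<theta> \<le> ?b"
      let ?z = "of_real r * cis \<theta>"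
      let ?w = "cis (lam k) * ?z"
      have z: "norm ?z = r" using r by (simp add: norm_mult)
      have w: "norm ?w = r" using r by (simp add: norm_mult)
      have weq: "?w = of_real r * cis (\<theta> + lam k)" by (simp add: cis_mult[symmetric] mult_ac)
      have "norm (1 - ?w) \<le> norm (1 - cis (\<theta> + lam k)) + norm (of_real (1 - r) * cis (\<theta> + lam k))"
        unfolding weq
        using norm_triangle_ineq[of "1 - cis (\<theta> + lam k)" "of_real (1 - r) * cis (\<theta> + lam k)"]
        by (simp add: algebra_simps)
      also have "norm (of_real (1 - r) * cis (\<theta> + lam k)) = 1 - r"
        using r by (simp add: norm_mult del: of_real_diff)
      also have "1 - r = 1 / (2 * real n)" by (simp add: r_def)
      also have "norm (1 - cis (\<theta> + lam k)) \<le> \<bar>\<theta> + lam k\<bar>"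
        using abs_sin_x_le_abs_x[of "(\<theta> + lam k)/2"] by (simp add: norm_one_minus_cis)
      also have "\<bar>\<theta> + lam k\<bar> \<le> 1 / (2 * real n)" using \<theta> by simp
      finally have w1: "norm (1 - ?w) \<le> 1 / real n" by (simp add: field_simps)
      have w0: "norm (1 - ?w) > 0" using w r by auto
      have "(real n / 2)\<^sup>2 \<le> (norm (\<Sum>i<n. ?w ^ i))\<^sup>2"
        using norm_geometric_sum_ge[of ?w n] w r n1 w1 by (intro power_mono) auto
      moreover have "c * (1 / real n) powr (\<alpha> k - 1) \<le> (norm (G ?z))\<^sup>2"
      proof -
        have "(1 / real n) powr (\<alpha> k - 1) \<le> norm (1 - ?w) powr (\<alpha> k - 1)"
          using \<alpha>_J[OF k] w0 w1 by (intro powr_mono2') auto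
        then have "c * (1 / real n) powr (\<alpha> k - 1) \<le> c * norm (1 - ?w) powr (\<alpha> k - 1)"
          using c(1) by simp
        also have "\<dots> \<le> (norm (G ?z))\<^sup>2" using c(3)[of ?z] r z by simp
        finally show ?thesis .
      qed
      ultimately show "?A \<le> (norm (?F ?z))\<^sup>2"
        unfolding norm_mult power_mult_distrib using c by (intro mult_mono) auto
    qed (use r bpi in auto)
    moreover have "?A * (?b - ?a) = c / 8 * real n powr (2 - \<alpha> k)"
    proof -
      have "(1 / real n) powr (\<alpha> k - 1) = real n powr (1 - \<alpha> k)"
        using n1 by (simp add: powr_divide powr_minus_divide[symmetric])
      moreover have "real n * real n powr (1 - \<alpha> k) = real n powr (2 - \<alpha> k)"
        using n1 powr_mult_base[of "real n" "1 - \<alpha> k"] by simp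
      ultimately show ?thesis using n1 by (simp add: power2_eq_square field_simps)
    qed
    ultimately show ?thesis by (simp add: field_simps)
  qed
  then show ?thesis using c(1) by (intro exI[of _ "c / (16 * pi)"]) auto
qed

text \<open>
  The twisted sum of squares is a quadratic form in the autocovariances with weights of modulus 1, so it
  is at most the sum of their absolute values. Cauchy-Schwarz over the \<open>n\<^sup>2\<close> pairs brings in \<open>Wn\<close>.
\<close>

lemma Wn_lower:
  assumes k: "k \<in> J"
  shows "\<exists>c>0. \<exists>n0. \<forall>n\<ge>n0. c * real n powr (2 - 2 * \<alpha> k) \<le> Wn b n"
proof -
  obtain c n0 where c: "c > 0" "\<And>n. n \<ge> n0 \<Longrightarrow> c * real n powr (2 - \<alpha> k) \<le>
     (\<Sum>q. (norm (\<Sum>i<n. cis (lam k) ^ i * of_real (sh b i q)))\<^sup>2)"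
    using twisted_lower[OF k] by blast
  have "c\<^sup>2 * real n powr (2 - 2 * \<alpha> k) \<le> Wn b n" if n: "n \<ge> max n0 1" for n
  proof -
    have n1: "real n > 0" using n by auto
    let ?w = "\<lambda>i. cis (lam k) ^ i"
    have "(\<lambda>q. complex_of_real ((norm (\<Sum>i<n. ?w i * of_real (sh b i q)))\<^sup>2)) sums
        (\<Sum>i<n. \<Sum>j<n. ?w i * cnj (?w j) * of_real (rho b (lag i j)))"
      by (rule sh_quadratic_sums[OF summable_b_sq])
    from sums_unique2[OF this sums_of_real[OF summable_sums[OF this[THEN sums_summable, unfolded summable_of_real_iff]]]]
    have e: "(\<Sum>i<n. \<Sum>j<n. ?w i * cnj (?w j) * of_real (rho b (lag i j)))
        = complex_of_real (\<Sum>q. (norm (\<Sum>i<n. ?w i * of_real (sh b i q)))\<^sup>2)" .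
    have "c * real n powr (2 - \<alpha> k) \<le> (\<Sum>q. (norm (\<Sum>i<n. ?w i * of_real (sh b i q)))\<^sup>2)"
      using c(2)[of n] n by simp
    also have "\<dots> \<le> norm (\<Sum>i<n. \<Sum>j<n. ?w i * cnj (?w j) * of_real (rho b (lag i j)))"
      unfolding e norm_of_real by (rule abs_ge_self)
    also have "\<dots> \<le> (\<Sum>i<n. \<Sum>j<n. \<bar>rho b (lag i j)\<bar>)"
      by (intro order_trans[OF norm_sum] sum_mono) (simp add: norm_mult norm_power)
    finally have "(c * real n powr (2 - \<alpha> k))\<^sup>2 \<le> (\<Sum>i<n. \<Sum>j<n. \<bar>rho b (lag i j)\<bar>)\<^sup>2"
      using c(1) by (intro power_mono) auto
    also have "\<dots> = (\<Sum>p\<in>{..<n}\<times>{..<n}. 1 * \<bar>rho b (lag (fst p) (snd p))\<bar>)\<^sup>2"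
      by (simp add: sum.cartesian_product case_prod_beta)
    also have "\<dots> \<le> (\<Sum>p\<in>{..<n}\<times>{..<n}. 1\<^sup>2) * (\<Sum>p\<in>{..<n}\<times>{..<n}. \<bar>rho b (lag (fst p) (snd p))\<bar>\<^sup>2)"
      by (rule Cauchy_Schwarz_ineq_sum)
    also have "\<dots> = (real n)\<^sup>2 * Wn b n"
      by (simp add: Wn_def sum.cartesian_product case_prod_beta power2_eq_square)
    finally have "c\<^sup>2 * (real n powr (2 - \<alpha> k))\<^sup>2 \<le> (real n)\<^sup>2 * Wn b n" by (simp add: power_mult_distrib)
    moreover have "(real n powr (2 - \<alpha> k))\<^sup>2 = (real n)\<^sup>2 * real n powr (2 - 2 * \<alpha> k)"
    proof -
      have "(real n powr (2 - \<alpha> k))\<^sup>2 = real n powr (2 + (2 - 2 * \<alpha> k))"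
        by (simp add: power2_eq_square powr_add[symmetric])
      also have "\<dots> = (real n)\<^sup>2 * real n powr (2 - 2 * \<alpha> k)"
        unfolding powr_add using n1 by simp
      finally show ?thesis .
    qed
    ultimately show ?thesis using n1 by (simp add: mult.left_commute)
  qed
  then show ?thesis using c(1) by (intro exI[of _ "c\<^sup>2"] conjI exI[of _ "max n0 1"]) auto
qed

text \<open>
  The gap between \<open>2 * \<alpha> k\<close> and \<open>\<alpha> 0\<close> leaves room for an exponent \<open>\<gamma>\<close> at which the upper bound for
  \<open>Tn\<close> is of smaller order than the lower bound for \<open>Wn\<close>; it also gives \<open>2 * \<alpha> k < 1\<close>.
\<close>

lemma Wn_dominates:
  assumes k: "k \<in> J" and k2: "2 * \<alpha> k < \<alpha> 0"
  shows "(\<lambda>n. real n / Wn b n) \<longlonglongrightarrow> 0" "(\<lambda>n. Tn b n / Wn b n) \<longlonglongrightarrow> 0"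
    "eventually (\<lambda>n. Wn b n > 0) sequentially"
proof -
  obtain c n0 where c: "c > 0" "\<And>n. n \<ge> n0 \<Longrightarrow> c * real n powr (2 - 2 * \<alpha> k) \<le> Wn b n"
    using Wn_lower[OF k] by blast
  \<comment> \<open>The midpoint lies strictly between \<open>2 * \<alpha> k\<close> and \<open>\<alpha> 0\<close>.\<close>
  define \<gamma> where "\<gamma> = (2 * \<alpha> k + \<alpha> 0) / 2"
  have a0: "\<alpha> 0 \<le> 1" "0 < \<alpha> k" using \<alpha>_J[of 0] \<alpha>_J[OF k] by auto
  obtain C where C: "C > 0" "\<And>n. n \<ge> 1 \<Longrightarrow> Tn b n \<le> C * real n powr (2 - \<gamma>)"
    using Tn_upper[of \<gamma>] k2 a0 unfolding \<gamma>_def by (auto simp: field_simps)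
  have T0: "0 \<le> Tn b n" for n
    by (rule sums_le[OF _ sums_zero Tn_sums[OF summable_b_sq]]) auto
  have ev: "eventually (\<lambda>n. n \<ge> max n0 1) sequentially" by (rule eventually_ge_at_top)
  show "eventually (\<lambda>n. Wn b n > 0) sequentially"
    using ev
  proof eventually_elim
    case (elim n)
    have "0 < c * real n powr (2 - 2 * \<alpha> k)" using c elim by auto
    also have "\<dots> \<le> Wn b n" using c(2) elim by auto
    finally show ?case .
  qed
  have dom: "(\<lambda>n. u n / Wn b n) \<longlonglongrightarrow> 0"
    if u0: "\<And>n. 0 \<le> u n" and u: "\<And>n. n \<ge> 1 \<Longrightarrow> u n \<le> D * real n powr (2 - s)" and s: "s > 2 * \<alpha> k" "D > 0" for u D s
  proof (rule tendsto_sandwich[of "\<lambda>_. 0" _ _ "\<lambda>n. D / c * real n powr (2 * \<alpha> k - s)"])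
    show "\<forall>\<^sub>F n in sequentially. 0 \<le> u n / Wn b n"
      using u0 by (auto simp: Wn_def intro!: always_eventually divide_nonneg_nonneg sum_nonneg)
    show "\<forall>\<^sub>F n in sequentially. u n / Wn b n \<le> D / c * real n powr (2 * \<alpha> k - s)"
      using ev
    proof eventually_elim
      case (elim n)
      then have n: "n \<ge> n0" "n \<ge> 1" by auto
      have "u n / Wn b n \<le> (D * real n powr (2 - s)) / (c * real n powr (2 - 2 * \<alpha> k))"
        using u[OF n(2)] c(2)[OF n(1)] u0 c(1) n s(2) by (intro frac_le) auto
      also have "\<dots> = D / c * (real n powr (2 - s) / real n powr (2 - 2 * \<alpha> k))" by simp
      also have "real n powr (2 - s) / real n powr (2 - 2 * \<alpha> k) = real n powr (2 * \<alpha> k - s)"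
        by (simp add: powr_diff[symmetric])
      finally show ?case .
    qed
    have "(\<lambda>n. real n powr (2 * \<alpha> k - s)) \<longlonglongrightarrow> 0"
      using s by (intro tendsto_neg_powr filterlim_real_sequentially) auto
    then show "(\<lambda>n. D / c * real n powr (2 * \<alpha> k - s)) \<longlonglongrightarrow> 0"
      by (rule tendsto_mult_right_zero)
  qed auto
  show "(\<lambda>n. real n / Wn b n) \<longlonglongrightarrow> 0"
    by (rule dom[of _ 1 1]) (use k2 a0 in auto)
  show "(\<lambda>n. Tn b n / Wn b n) \<longlonglongrightarrow> 0"
    by (rule dom[of _ C \<gamma>]) (use T0 C k2 in \<open>auto simp: \<gamma>_def\<close>)
qed

end

section \<open>Expansions of the characteristic function of the noise\<close>

lemma norm_integral_le_bound:
  fixes f :: "'a \<Rightarrow> complex"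
  assumes "f \<in> borel_measurable M" "integrable M g" "\<And>x. norm (f x) \<le> g x"
  shows "integrable M f" "norm (integral\<^sup>L M f) \<le> integral\<^sup>L M g"
proof -
  have g: "norm (f x) \<le> norm (g x)" for x using assms(3)[of x] by simp
  show i: "integrable M f" by (rule Bochner_Integration.integrable_bound[OF assms(2,1)]) (use g in auto)
  have "norm (integral\<^sup>L M f) \<le> (LINT x|M. norm (f x))" by simp
  also have "\<dots> \<le> integral\<^sup>L M g" using i assms by (intro integral_mono) auto
  finally show "norm (integral\<^sup>L M f) \<le> integral\<^sup>L M g" .
qed

locale centred_noise = real_distribution N for N +
  assumes int4: "integrable N (\<lambda>x. x ^ 4)"
    and mean0: "(LINT x|N. x) = 0"
begin

lemma int2: "integrable N (\<lambda>x. x\<^sup>2)"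
proof (rule Bochner_Integration.integrable_bound[of N "\<lambda>x. 1 + x ^ 4"])
  show "AE x in N. norm (x\<^sup>2) \<le> norm (1 + x ^ 4)"
  proof (intro AE_I2)
    fix x :: real
    have "x\<^sup>2 \<le> 1 + (x\<^sup>2)\<^sup>2" using sum_squares_bound[of 1 "x\<^sup>2"] zero_le_power2[of x] unfolding power_one by linarith
    then show "norm (x\<^sup>2) \<le> norm (1 + x ^ 4)" by (simp add: power_mult[symmetric])
  qed
qed (auto intro!: Bochner_Integration.integrable_add int4)

lemma int3: "integrable N (\<lambda>x. \<bar>x\<bar> ^ 3)"
proof (rule Bochner_Integration.integrable_bound[of N "\<lambda>x. x\<^sup>2 + x ^ 4"])
  show "AE x in N. norm (\<bar>x\<bar> ^ 3) \<le> norm (x\<^sup>2 + x ^ 4)"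
  proof (intro AE_I2)
    fix x :: real
    have "2 * \<bar>x\<bar> * x\<^sup>2 \<le> x\<^sup>2 + (x\<^sup>2)\<^sup>2" using sum_squares_bound[of "\<bar>x\<bar>" "x\<^sup>2"] by simp
    moreover have "\<bar>x\<bar> ^ 3 = \<bar>x\<bar> * x\<^sup>2" by (simp add: power3_eq_cube power2_eq_square)
    moreover have "0 \<le> \<bar>x\<bar> * x\<^sup>2" "(x\<^sup>2)\<^sup>2 = x ^ 4" by auto
    ultimately have "\<bar>x\<bar> ^ 3 \<le> x\<^sup>2 + x ^ 4" by linarith
    then show "norm (\<bar>x\<bar> ^ 3) \<le> norm (x\<^sup>2 + x ^ 4)" by simp
  qed
qed (auto intro!: Bochner_Integration.integrable_add int4 int2)

lemma int1: "integrable N (\<lambda>x. \<bar>x\<bar>)"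
proof (rule Bochner_Integration.integrable_bound[of N "\<lambda>x. 1 + x\<^sup>2"])
  show "AE x in N. norm \<bar>x\<bar> \<le> norm (1 + x\<^sup>2)"
  proof (intro AE_I2)
    fix x :: real
    show "norm \<bar>x\<bar> \<le> norm (1 + x\<^sup>2)" using sum_squares_bound[of 1 "\<bar>x\<bar>"] by simp
  qed
qed (auto intro!: Bochner_Integration.integrable_add int2)

text \<open>
  \<open>A\<close> majorises 1 and all moments, so that error bounds can be stated with a single constant. The function \<open>\<zeta>\<close> is the
  derivative of the characteristic function.
\<close>

definition "s2 = (LINT x|N. x\<^sup>2)"
definition "m1 = (LINT x|N. \<bar>x\<bar>)"
definition "m3 = (LINT x|N. \<bar>x\<bar> ^ 3)"
definition "m4 = (LINT x|N. x ^ 4)"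
definition "A = 1 + m1 + s2 + m3 + m4"
definition "\<zeta> t = (LINT x|N. \<i> * of_real x * iexp (t * x))"
abbreviation "\<phi> \<equiv> char N"

lemma moments_nonneg: "0 \<le> s2" "0 \<le> m1" "0 \<le> m3" "0 \<le> m4"
  unfolding s2_def m1_def m3_def m4_def by (auto intro!: integral_nonneg_AE)

lemma A_ge: "1 \<le> A" "s2 \<le> A" "m1 \<le> A" "m3 \<le> A" "m4 \<le> A"
  using moments_nonneg by (auto simp: A_def)

lemma A_le_sq: "A \<le> A\<^sup>2"
  using A_ge(1) by (simp add: power2_eq_square)

text \<open>
  Taylor remainders of the exponential: \<open>P\<close> is of first and \<open>Q\<close> of second order in \<open>a\<close>.
\<close>

definition "P a x = iexp (a * x) - 1"
definition "Q a x = P a x - \<i> * of_real (a * x)"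

lemma P_meas [measurable]: "P a \<in> borel_measurable N"
  unfolding P_def by measurable
lemma Q_meas [measurable]: "Q a \<in> borel_measurable N"
  unfolding Q_def P_def by measurable

lemma P_le: "norm (P a x) \<le> \<bar>a\<bar> * \<bar>x\<bar>"
  using iexp_approx1[of "a * x" 0] by (simp add: P_def abs_mult)

lemma Q_le: "norm (Q a x) \<le> a\<^sup>2 * x\<^sup>2"
proof -
  have "norm (Q a x) \<le> (\<bar>a * x\<bar>)\<^sup>2 / 2"
    using iexp_approx1[of "a * x" 1] by (simp add: Q_def P_def algebra_simps power2_eq_square)
  also have "\<dots> \<le> a\<^sup>2 * x\<^sup>2" by (simp add: power_mult_distrib)
  finally show ?thesis .
qed

lemma int_iexp: "integrable N (\<lambda>x. iexp (t * x))"
  by (rule integrable_iexp) auto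

lemma int_x: "integrable N (\<lambda>x. complex_of_real x)"
  by (rule norm_integral_le_bound(1)[OF _ int1]) auto

lemma int_P: "integrable N (P a)" and E_P: "(LINT x|N. P a x) = \<phi> a - 1"
  unfolding P_def char_def using int_iexp prob_space by auto

lemma mean0': "(LINT x|N. complex_of_real x) = 0"
  using mean0 integral_complex_of_real[of N "\<lambda>x. x"] by simp

lemma int_Q: "integrable N (Q a)" and E_Q: "(LINT x|N. Q a x) = \<phi> a - 1"
  unfolding Q_def using int_P E_P int_x mean0' by auto

lemma chi_minus_one: "norm (\<phi> t - 1) \<le> A * t\<^sup>2"
proof -
  have "norm (LINT x|N. Q t x) \<le> (LINT x|N. t\<^sup>2 * x\<^sup>2)"
    by (rule norm_integral_le_bound(2)) (use int2 Q_le in auto)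
  also have "\<dots> = s2 * t\<^sup>2" by (simp add: s2_def)
  also have "\<dots> \<le> A * t\<^sup>2" using A_ge by (intro mult_right_mono) auto
  finally show ?thesis by (simp add: E_Q)
qed

lemma chi_minus_one_abs: "norm (\<phi> t - 1) \<le> A * \<bar>t\<bar>"
proof -
  have "norm (LINT x|N. P t x) \<le> (LINT x|N. \<bar>t\<bar> * \<bar>x\<bar>)"
    by (rule norm_integral_le_bound(2)) (use int1 P_le in auto)
  also have "\<dots> = m1 * \<bar>t\<bar>" by (simp add: m1_def)
  also have "\<dots> \<le> A * \<bar>t\<bar>" using A_ge by (intro mult_right_mono) auto
  finally show ?thesis by (simp add: E_P)
qed

lemma int_zeta: "integrable N (\<lambda>x. \<i> * of_real x * iexp (t * x))"
  by (rule norm_integral_le_bound(1)[OF _ int1]) (auto simp: norm_mult)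

lemma zeta_approx: "norm (\<zeta> t + of_real (s2 * t)) \<le> A * t\<^sup>2"
proof -
  have i: "integrable N (\<lambda>x. \<i> * of_real x * Q t x)"
   and n: "norm (LINT x|N. \<i> * of_real x * Q t x) \<le> (LINT x|N. t\<^sup>2 * \<bar>x\<bar> ^ 3)"
  proof -
    have b: "norm (\<i> * of_real x * Q t x) \<le> t\<^sup>2 * \<bar>x\<bar> ^ 3" for x
    proof -
      have "norm (\<i> * of_real x * Q t x) \<le> \<bar>x\<bar> * (t\<^sup>2 * x\<^sup>2)"
        using mult_left_mono[OF Q_le[of t x] abs_ge_zero[of x]] by (simp add: norm_mult)
      then show ?thesis by (simp add: power3_eq_cube power2_eq_square mult_ac)
    qed
    have g: "integrable N (\<lambda>x. t\<^sup>2 * \<bar>x\<bar> ^ 3)" using int3 by simp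
    show "integrable N (\<lambda>x. \<i> * of_real x * Q t x)"
      "norm (LINT x|N. \<i> * of_real x * Q t x) \<le> (LINT x|N. t\<^sup>2 * \<bar>x\<bar> ^ 3)"
      using norm_integral_le_bound[OF _ g b] by auto
  qed
  have e: "\<i> * of_real x * Q t x = \<i> * of_real x * iexp (t * x) - \<i> * of_real x + of_real t * of_real (x\<^sup>2)" for x
    by (simp add: Q_def P_def algebra_simps power2_eq_square)
  have i2: "integrable N (\<lambda>x. complex_of_real (x\<^sup>2))" using int2 by (simp only: integrable_of_real)
  have "(LINT x|N. \<i> * of_real x * Q t x) = \<zeta> t + of_real (s2 * t)"
    unfolding e \<zeta>_def s2_def using int_zeta[of t] int_x i2 mean0'
    by (simp add: integral_complex_of_real del: of_real_power)
  then have "norm (\<zeta> t + of_real (s2 * t)) \<le> (LINT x|N. t\<^sup>2 * \<bar>x\<bar> ^ 3)" using n by simp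
  also have "\<dots> = m3 * t\<^sup>2" by (simp add: m3_def)
  also have "\<dots> \<le> A * t\<^sup>2" using A_ge by (intro mult_right_mono) auto
  finally show ?thesis .
qed

text \<open>
  With the noise variable \<open>Y\<close>, \<open>\<epsilon> a c\<close> is the characteristic function of \<open>a * Y - c * Y\<close> minus the one it
  would have if the two terms were independent.
\<close>

definition "\<epsilon> a c = \<phi> (a - c) - \<phi> a * \<phi> (- c)"

lemma int_PP: "integrable N (\<lambda>x. P a x * P c x)"
  and norm_PP: "norm (LINT x|N. P a x * P c x) \<le> s2 * (\<bar>a\<bar> * \<bar>c\<bar>)"
proof -
  have b: "norm (P a x * P c x) \<le> \<bar>a\<bar> * \<bar>c\<bar> * x\<^sup>2" for x
  proof -
    have "norm (P a x * P c x) \<le> (\<bar>a\<bar> * \<bar>x\<bar>) * (\<bar>c\<bar> * \<bar>x\<bar>)"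
      unfolding norm_mult using P_le[of a x] P_le[of c x] by (intro mult_mono) auto
    also have "\<dots> = \<bar>a\<bar> * \<bar>c\<bar> * \<bar>x\<bar>\<^sup>2" by (simp only: power2_eq_square mult_ac)
    finally show ?thesis by simp
  qed
  have g: "integrable N (\<lambda>x. \<bar>a\<bar> * \<bar>c\<bar> * x\<^sup>2)" using int2 by simp
  show "integrable N (\<lambda>x. P a x * P c x)"
    by (rule norm_integral_le_bound(1)[OF _ g b]) measurable
  have "norm (LINT x|N. P a x * P c x) \<le> (LINT x|N. \<bar>a\<bar> * \<bar>c\<bar> * x\<^sup>2)"
    by (rule norm_integral_le_bound(2)[OF _ g b]) measurable
  then show "norm (LINT x|N. P a x * P c x) \<le> s2 * (\<bar>a\<bar> * \<bar>c\<bar>)" by (simp add: s2_def mult_ac)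
qed

lemma eps_eq: "\<epsilon> a c = (LINT x|N. P a x * P (-c) x) - (\<phi> a - 1) * (\<phi> (-c) - 1)"
proof -
  have e: "P a x * P (-c) x = iexp ((a - c) * x) - iexp (a * x) - iexp ((-c) * x) + 1" for x
    by (simp add: P_def algebra_simps exp_diff[symmetric] exp_add[symmetric] exp_minus field_simps)
       (simp add: exp_diff exp_add exp_minus field_simps)?
  have "(LINT x|N. P a x * P (-c) x) = \<phi> (a - c) - \<phi> a - \<phi> (-c) + 1"
    unfolding e char_def using int_iexp[of "a-c"] int_iexp[of a] int_iexp[of "-c"] prob_space by simp
  then show ?thesis by (simp add: \<epsilon>_def algebra_simps)
qed

lemma eps_le: "norm (\<epsilon> a c) \<le> 2 * A\<^sup>2 * (\<bar>a\<bar> * \<bar>c\<bar>)"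
proof -
  have "norm (\<epsilon> a c) \<le> norm (LINT x|N. P a x * P (-c) x) + norm (\<phi> a - 1) * norm (\<phi> (-c) - 1)"
    unfolding eps_eq norm_mult[symmetric] by (rule norm_triangle_ineq4)
  also have "norm (LINT x|N. P a x * P (-c) x) \<le> A\<^sup>2 * (\<bar>a\<bar> * \<bar>c\<bar>)"
  proof -
    have "s2 \<le> A\<^sup>2" using A_ge(2) A_le_sq by linarith
    then have "s2 * (\<bar>a\<bar> * \<bar>c\<bar>) \<le> A\<^sup>2 * (\<bar>a\<bar> * \<bar>c\<bar>)" by (intro mult_right_mono) auto
    then show ?thesis using norm_PP[of a "-c"] by simp
  qed
  also have "norm (\<phi> a - 1) * norm (\<phi> (-c) - 1) \<le> (A * \<bar>a\<bar>) * (A * \<bar>c\<bar>)"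
    using chi_minus_one_abs[of a] chi_minus_one_abs[of "-c"] A_ge by (intro mult_mono) auto
  finally show ?thesis by (simp add: power2_eq_square algebra_simps)
qed

lemma chi_sq_prod: "norm ((\<phi> a - 1) * (\<phi> (-c) - 1)) \<le> A\<^sup>2 * (a\<^sup>2 * c\<^sup>2)"
proof -
  have "norm ((\<phi> a - 1) * (\<phi> (-c) - 1)) \<le> (A * a\<^sup>2) * (A * c\<^sup>2)"
    unfolding norm_mult using chi_minus_one[of a] chi_minus_one[of "-c"] A_ge by (intro mult_mono) auto
  then show ?thesis by (simp add: power2_eq_square mult_ac)
qed

lemma int_QQ: "integrable N (\<lambda>x. Q a x * Q c x)"
  and norm_QQ: "norm (LINT x|N. Q a x * Q c x) \<le> m4 * (a\<^sup>2 * c\<^sup>2)"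
proof -
  have b: "norm (Q a x * Q c x) \<le> a\<^sup>2 * c\<^sup>2 * x ^ 4" for x
  proof -
    have "norm (Q a x * Q c x) \<le> (a\<^sup>2 * x\<^sup>2) * (c\<^sup>2 * x\<^sup>2)"
      unfolding norm_mult using Q_le[of a x] Q_le[of c x] by (intro mult_mono) auto
    also have "\<dots> = a\<^sup>2 * c\<^sup>2 * x ^ 4" by (simp add: power4_eq_xxxx power2_eq_square mult_ac)
    finally show ?thesis .
  qed
  have g: "integrable N (\<lambda>x. a\<^sup>2 * c\<^sup>2 * x ^ 4)" using int4 by simp
  show "integrable N (\<lambda>x. Q a x * Q c x)"
    by (rule norm_integral_le_bound(1)[OF _ g b]) measurable
  have "norm (LINT x|N. Q a x * Q c x) \<le> (LINT x|N. a\<^sup>2 * c\<^sup>2 * x ^ 4)"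
    by (rule norm_integral_le_bound(2)[OF _ g b]) measurable
  then show "norm (LINT x|N. Q a x * Q c x) \<le> m4 * (a\<^sup>2 * c\<^sup>2)" by (simp add: m4_def mult_ac)
qed

lemma QQ_eq: "(LINT x|N. Q a x * Q (-c) x) =
   (LINT x|N. P a x * P (-c) x) + of_real c * \<zeta> a - of_real a * \<zeta> (-c) + of_real (s2 * a * c)"
proof -
  have e: "Q a x * Q (-c) x = P a x * P (-c) x + of_real c * (\<i> * of_real x * iexp (a * x)) - of_real c * (\<i> * of_real x)
     - of_real a * (\<i> * of_real x * iexp ((-c) * x)) + of_real a * (\<i> * of_real x) + of_real (a * c) * of_real (x\<^sup>2)" for x
    by (simp add: Q_def P_def algebra_simps power2_eq_square)
  define h1 h2 h3 h4 h5 where "h1 = (\<lambda>x. P a x * P (-c) x)" and "h2 = (\<lambda>x. \<i> * complex_of_real x * iexp (a * x))"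
    and "h3 = (\<lambda>x. \<i> * complex_of_real x * iexp ((-c) * x))" and "h4 = complex_of_real" and "h5 = (\<lambda>x. complex_of_real (x\<^sup>2))"
  have i: "integrable N h1" "integrable N h2" "integrable N h3" "integrable N h4" "integrable N h5"
    unfolding h1_def h2_def h3_def h4_def h5_def
    using int_PP[of a "-c"] int_zeta[of a] int_zeta[of "-c"] int_x int2 by (simp_all only: integrable_of_real)
  have "(LINT x|N. Q a x * Q (-c) x) = (LINT x|N. h1 x + of_real c * h2 x - of_real c * (\<i> * h4 x)
     - of_real a * h3 x + of_real a * (\<i> * h4 x) + of_real (a * c) * h5 x)"
    unfolding e h1_def h2_def h3_def h4_def h5_def ..
  also have "\<dots> = integral\<^sup>L N h1 + of_real c * integral\<^sup>L N h2 - of_real c * (\<i> * integral\<^sup>L N h4)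
     - of_real a * integral\<^sup>L N h3 + of_real a * (\<i> * integral\<^sup>L N h4) + of_real (a * c) * integral\<^sup>L N h5"
    using i by simp
  also have "integral\<^sup>L N h4 = 0" unfolding h4_def by (rule mean0')
  also have "integral\<^sup>L N h5 = of_real s2" unfolding h5_def s2_def by (rule integral_complex_of_real)
  finally show ?thesis by (simp add: h1_def h2_def h3_def \<zeta>_def)
qed

text \<open>
  Passing from \<open>P\<close> to \<open>Q\<close> isolates the terms that are linear in \<open>a\<close> or in \<open>c\<close>; the rest is of order
  \<open>a\<^sup>2 * c\<^sup>2\<close>. Keeping the linear terms exactly matters: an error of order \<open>a\<^sup>2 * \<bar>c\<bar>\<close> would be too large when
  summed over all pairs of observations.
\<close>

lemma eps_approx4:
  "norm (\<epsilon> a c + of_real c * \<zeta> a - of_real a * \<zeta> (-c) + of_real (s2 * a * c)) \<le> 2 * A\<^sup>2 * (a\<^sup>2 * c\<^sup>2)"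
proof -
  have "\<epsilon> a c + of_real c * \<zeta> a - of_real a * \<zeta> (-c) + of_real (s2 * a * c)
      = (LINT x|N. Q a x * Q (-c) x) - (\<phi> a - 1) * (\<phi> (-c) - 1)"
    unfolding eps_eq QQ_eq by simp
  also have "norm \<dots> \<le> norm (LINT x|N. Q a x * Q (-c) x) + norm ((\<phi> a - 1) * (\<phi> (-c) - 1))"
    by (rule norm_triangle_ineq4)
  also have "norm (LINT x|N. Q a x * Q (-c) x) \<le> A\<^sup>2 * (a\<^sup>2 * c\<^sup>2)"
  proof -
    have "m4 \<le> A\<^sup>2" using A_ge(5) A_le_sq by linarith
    then have "m4 * (a\<^sup>2 * c\<^sup>2) \<le> A\<^sup>2 * (a\<^sup>2 * c\<^sup>2)" by (intro mult_right_mono) auto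
    then show ?thesis using norm_QQ[of a "-c"] by simp
  qed
  finally show ?thesis using chi_sq_prod[of a c] by simp
qed

text \<open>
  The cruder version for the second order terms, where \<open>\<zeta>\<close> may be linearised.
\<close>

lemma eps_approx3:
  "norm (\<epsilon> a c - of_real (s2 * a * c)) \<le> 4 * A\<^sup>2 * (a\<^sup>2 * \<bar>c\<bar> + \<bar>a\<bar> * c\<^sup>2 + a\<^sup>2 * c\<^sup>2)"
proof -
  note AA = A_le_sq
  have d: "\<epsilon> a c - of_real (s2 * a * c) = (\<epsilon> a c + of_real c * \<zeta> a - of_real a * \<zeta> (-c) + of_real (s2 * a * c))
     - of_real c * (\<zeta> a + of_real (s2 * a)) + of_real a * (\<zeta> (-c) + of_real (s2 * (-c)))"
    by (simp add: algebra_simps)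
  have "norm (\<epsilon> a c - of_real (s2 * a * c)) \<le> norm (\<epsilon> a c + of_real c * \<zeta> a - of_real a * \<zeta> (-c) + of_real (s2 * a * c))
     + norm (of_real c * (\<zeta> a + of_real (s2 * a))) + norm (of_real a * (\<zeta> (-c) + of_real (s2 * (-c))))"
    unfolding d by (rule order_trans[OF norm_triangle_ineq add_right_mono[OF norm_triangle_ineq4]])
  also have "norm (of_real c * (\<zeta> a + of_real (s2 * a))) \<le> \<bar>c\<bar> * (A * a\<^sup>2)"
    unfolding norm_mult using zeta_approx[of a] by (intro mult_mono) auto
  also have "norm (of_real a * (\<zeta> (-c) + of_real (s2 * (-c)))) \<le> \<bar>a\<bar> * (A * c\<^sup>2)"
    unfolding norm_mult using zeta_approx[of "-c"] by (intro mult_mono) auto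
  also note eps_approx4[of a c]
  also have "2 * A\<^sup>2 * (a\<^sup>2 * c\<^sup>2) + \<bar>c\<bar> * (A * a\<^sup>2) + \<bar>a\<bar> * (A * c\<^sup>2)
     \<le> 2 * A\<^sup>2 * (a\<^sup>2 * c\<^sup>2) + A\<^sup>2 * (a\<^sup>2 * \<bar>c\<bar>) + A\<^sup>2 * (\<bar>a\<bar> * c\<^sup>2)"
    using mult_right_mono[OF AA, of "a\<^sup>2 * \<bar>c\<bar>"] mult_right_mono[OF AA, of "\<bar>a\<bar> * c\<^sup>2"] by (simp add: mult_ac)
  also have "\<dots> \<le> 4 * A\<^sup>2 * (a\<^sup>2 * \<bar>c\<bar> + \<bar>a\<bar> * c\<^sup>2 + a\<^sup>2 * c\<^sup>2)"
    by (simp add: algebra_simps)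
  finally show ?thesis by simp
qed

lemma chi_cnj: "\<phi> (- t) = cnj (\<phi> t)"
proof -
  have "(LINT x|N. cnj (iexp (t * x))) = cnj (\<phi> t)"
    unfolding char_def by (rule integral_bounded_linear[OF bounded_linear_cnj int_iexp])
  then show ?thesis by (simp add: char_def exp_cnj)
qed

lemma zeta_cnj: "\<zeta> (- t) = - cnj (\<zeta> t)"
proof -
  have "(LINT x|N. cnj (\<i> * of_real x * iexp (t * x))) = cnj (\<zeta> t)"
    unfolding \<zeta>_def by (rule integral_bounded_linear[OF bounded_linear_cnj int_zeta])
  moreover have "(LINT x|N. cnj (\<i> * of_real x * iexp (t * x))) = (LINT x|N. - (\<i> * of_real x * iexp ((-t) * x)))"
    by (intro Bochner_Integration.integral_cong) (auto simp: exp_cnj)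
  ultimately show ?thesis by (simp add: \<zeta>_def)
qed

end

section \<open>Second order expansion of a product\<close>

text \<open>
  Taylor expansion at \<open>x = 0\<close> of the product of the factors \<open>B p + x * e p\<close>. Its derivatives are sums of products with
  one or two factors missing. A missing factor is reinstated by the identity \<open>F' = F + (1 - B p - x * e p) * F'\<close>, where \<open>F\<close> is the
  product with and \<open>F'\<close> the product without the factor; dividing would be wrong since factors may vanish. Every estimate is
  proportional to the bound \<open>D\<close> for the products with at most two factors missing, so that decay of these
  products is inherited by the error.
\<close>

lemma prod_second_order_expansion:
  fixes B e :: "'i \<Rightarrow> complex" and \<mu> :: "'i \<Rightarrow> real"
  assumes fin: "finite I"
    and M1: "\<And>p x. p \<in> I \<Longrightarrow> x \<in> closed_segment 0 1 \<Longrightarrow> norm (1 - (B p + x * e p)) \<le> \<mu> p"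
    and \<mu>2: "\<And>p. p \<in> I \<Longrightarrow> \<mu> p \<le> 2"
    and D: "\<And>x E. x \<in> closed_segment 0 1 \<Longrightarrow> E \<subseteq> I \<Longrightarrow> card (I - E) \<le> 2 \<Longrightarrow> norm (\<Prod>p\<in>E. B p + x * e p) \<le> D"
  defines "s \<equiv> (\<Sum>p\<in>I. e p)" and "\<tau> \<equiv> (\<Sum>p\<in>I. norm (e p) * \<mu> p)" and "\<kappa> \<equiv> (\<Sum>p\<in>I. (norm (e p))\<^sup>2)"
  shows "norm ((\<Prod>p\<in>I. B p + e p) - (\<Prod>p\<in>I. B p) - (\<Sum>p\<in>I. e p * (\<Prod>q\<in>I-{p}. B q)) - s\<^sup>2 / 2 * (\<Prod>p\<in>I. B p))
     \<le> D * (5 * \<kappa> + 2 * \<tau> * norm s + \<tau>\<^sup>2 + (norm s)\<^sup>2 * (norm s + \<tau>))"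
proof -
  define M where "M p x = B p + x * e p" for p and x :: complex
  define w where "w p x = 1 - M p x" for p x
  define F where "F E x = (\<Prod>p\<in>E. M p x)" for E x
  have seg: "(0::complex) \<in> closed_segment 0 1" "(1::complex) \<in> closed_segment 0 1" by auto
  have \<mu>0: "0 \<le> \<mu> p" if "p \<in> I" for p
    by (rule order_trans[OF norm_ge_zero M1[OF that seg(1)]])
  have \<tau>0: "0 \<le> \<tau>" unfolding \<tau>_def using \<mu>0 by (intro sum_nonneg) auto
  have \<kappa>0: "0 \<le> \<kappa>" unfolding \<kappa>_def by (intro sum_nonneg) auto
  have wle: "norm (w p x) \<le> \<mu> p" if "p \<in> I" "x \<in> closed_segment 0 1" for p x
    using M1[OF that] by (simp add: w_def M_def)
  have FD0: "norm (F I x) \<le> D" if "x \<in> closed_segment 0 1" for x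
    using D[OF that, of I] by (simp add: F_def M_def)
  have FD1: "norm (F (I-{p}) x) \<le> D" if "x \<in> closed_segment 0 1" "p \<in> I" for x p
  proof -
    have "I - (I - {p}) = {p}" using that by auto
    then show ?thesis using D[OF that(1), of "I-{p}"] by (simp add: F_def M_def)
  qed
  have FD2: "norm (F (I-{p}-{q}) x) \<le> D" if "x \<in> closed_segment 0 1" "p \<in> I" "q \<in> I" for x p q
  proof -
    have "I - (I - {p} - {q}) = {p,q}" using that by auto
    moreover have "card {p,q} \<le> 2" by (simp add: card_insert_if)
    ultimately show ?thesis using D[OF that(1), of "I-{p}-{q}"] by (auto simp: F_def M_def)
  qed
  have D0: "0 \<le> D" by (rule order_trans[OF norm_ge_zero FD0[OF seg(1)]])
  have rem1: "F E x = M p x * F (E-{p}) x" if "p \<in> E" "finite E" for E p x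
    unfolding F_def using that by (rule prod.remove[rotated])
  \<comment> \<open>In the first derivative one factor is missing; \<open>split1\<close> reinstates it.\<close>
  define F1 where "F1 x = (\<Sum>p\<in>I. e p * F (I-{p}) x)" for x
  define F2 where "F2 x = (\<Sum>p\<in>I. e p * (\<Sum>q\<in>I-{p}. e q * F (I-{p}-{q}) x))" for x
  have dF: "(F E has_field_derivative (\<Sum>p\<in>E. e p * F (E-{p}) x)) (at x within S)" for E x S
    unfolding F_def M_def
    by (rule has_field_derivative_at_within, rule has_field_derivative_prod) (auto intro!: derivative_eq_intros)
  have dF1: "(F1 has_field_derivative F2 x) (at x within S)" for x S
    unfolding F1_def F2_def
    by (intro DERIV_sum DERIV_cmult dF)
  have split1: "F (I-{p}) x = F I x + w p x * F (I-{p}) x" if "p \<in> I" for p x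
    using rem1[OF that fin, of x] by (simp add: w_def algebra_simps)
  have F1_eq: "F1 x = s * F I x + (\<Sum>p\<in>I. e p * w p x * F (I-{p}) x)" for x
  proof -
    have "F1 x = (\<Sum>p\<in>I. e p * F I x + e p * w p x * F (I-{p}) x)"
      unfolding F1_def by (intro sum.cong refl) (subst split1, auto simp: algebra_simps)
    then show ?thesis by (simp add: sum.distrib s_def sum_distrib_right)
  qed
  have F1_le: "norm (F1 x) \<le> D * (norm s + \<tau>)" if x: "x \<in> closed_segment 0 1" for x
  proof -
    have "norm (F1 x) \<le> norm s * D + (\<Sum>p\<in>I. norm (e p) * \<mu> p * D)"
      unfolding F1_eq
      by (intro order_trans[OF norm_triangle_ineq] add_mono order_trans[OF norm_sum] sum_mono)
         (auto simp: norm_mult intro!: mult_mono FD0 FD1 wle x \<mu>0 mult_nonneg_nonneg)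
    also have "\<dots> = D * (norm s + \<tau>)" unfolding \<tau>_def sum_distrib_right[symmetric] by (simp add: algebra_simps)
    finally show ?thesis .
  qed
  have split2: "F (I-{p}-{q}) x = F I x + w p x * F (I-{p}) x + w q x * F (I-{q}) x + w p x * w q x * F (I-{p}-{q}) x"
    if pq: "p \<in> I" "q \<in> I-{p}" for p q x
  proof -
    have 1: "F (I-{p}) x = M q x * F (I-{p}-{q}) x" using rem1[of q "I-{p}" x] pq fin by auto
    have c: "I - {q} - {p} = I - {p} - {q}" by auto
    have 2: "F (I-{q}) x = M p x * F (I-{p}-{q}) x" using rem1[of p "I-{q}" x] pq fin unfolding c by auto
    have 3: "F I x = M p x * (M q x * F (I-{p}-{q}) x)" using rem1[OF pq(1) fin, of x] 1 by simp
    show ?thesis unfolding 3 1 2 by (simp add: w_def algebra_simps)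
  qed
  have inner: "(\<Sum>q\<in>I-{p}. e q) = s - e p" if "p \<in> I" for p
    unfolding s_def using that fin by (simp add: sum_diff1)
  \<comment> \<open>In the second derivative the pairs \<open>p = q\<close> do not occur; adding them costs \<open>\<kappa>\<close>.\<close>
  have F2_le: "norm (F2 x - s\<^sup>2 * F I x) \<le> D * (5 * \<kappa> + 2 * \<tau> * norm s + \<tau>\<^sup>2)" if x: "x \<in> closed_segment 0 1" for x
  proof -
    define T1 where "T1 = (\<Sum>p\<in>I. e p * (s - e p)) * F I x"
    define T2 where "T2 = (\<Sum>p\<in>I. e p * w p x * F (I-{p}) x * (s - e p))"
    define T4 where "T4 = (\<Sum>p\<in>I. \<Sum>q\<in>I-{p}. e p * e q * w p x * w q x * F (I-{p}-{q}) x)"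
    have "F2 x = (\<Sum>p\<in>I. \<Sum>q\<in>I-{p}. e p * e q * F I x + e p * w p x * F (I-{p}) x * e q + e p * (e q * w q x * F (I-{q}) x)
         + e p * e q * w p x * w q x * F (I-{p}-{q}) x)"
      unfolding F2_def sum_distrib_left
      by (intro sum.cong refl) (subst split2, auto simp: algebra_simps)
    also have "\<dots> = T1 + T2 + (\<Sum>p\<in>I. \<Sum>q\<in>I-{p}. e p * (e q * w q x * F (I-{q}) x)) + T4"
      unfolding T1_def T2_def T4_def sum.distrib sum_distrib_right
      by (intro arg_cong2[of _ _ _ _ "(+)"] sum.cong refl)
         (auto simp: inner[symmetric] sum_distrib_left sum_distrib_right mult_ac)
    also have "(\<Sum>p\<in>I. \<Sum>q\<in>I-{p}. e p * (e q * w q x * F (I-{q}) x))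
        = (\<Sum>q\<in>I. \<Sum>p\<in>I-{q}. e p * (e q * w q x * F (I-{q}) x))"
    proof -
      have "(\<Sum>p\<in>I. \<Sum>q\<in>I-{p}. h p q) = (\<Sum>q\<in>I. \<Sum>p\<in>I-{q}. h p q)" for h :: "'i \<Rightarrow> 'i \<Rightarrow> complex"
        using sum.swap_restrict[OF fin fin, of h "\<lambda>p q. p \<noteq> q"]
        by (simp add: set_diff_eq conj_commute eq_commute[of _ "_::'i"] cong: conj_cong)
           (simp add: eq_commute Collect_conj_eq)?
      then show ?thesis .
    qed
    also have "\<dots> = T2"
      unfolding T2_def by (intro sum.cong refl) (auto simp: inner[symmetric] sum_distrib_left mult_ac)
    finally have F2e: "F2 x = T1 + T2 + T2 + T4" .
    have "(\<Sum>p\<in>I. e p * (s - e p)) = s\<^sup>2 - (\<Sum>p\<in>I. (e p)\<^sup>2)"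
      by (simp add: algebra_simps sum_subtractf power2_eq_square s_def sum_distrib_left sum_distrib_right)
    then have d: "F2 x - s\<^sup>2 * F I x = - (\<Sum>p\<in>I. (e p)\<^sup>2) * F I x + T2 + T2 + T4"
      unfolding F2e T1_def by (simp only:) (simp add: left_diff_distrib)
    have a1: "norm (- (\<Sum>p\<in>I. (e p)\<^sup>2) * F I x) \<le> \<kappa> * D"
      unfolding norm_mult norm_minus_cancel \<kappa>_def
      by (intro mult_mono order_trans[OF norm_sum] FD0 x) (auto simp: norm_power intro: sum_nonneg)
    have a2: "norm T2 \<le> (\<tau> * norm s + 2 * \<kappa>) * D"
    proof -
      have "norm T2 \<le> (\<Sum>p\<in>I. norm (e p) * \<mu> p * D * (norm s + norm (e p)))"
        unfolding T2_def
        by (intro order_trans[OF norm_sum] sum_mono)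
           (auto simp: norm_mult intro!: mult_mono FD1 wle x \<mu>0 mult_nonneg_nonneg norm_triangle_ineq4 D0)
      also have "\<dots> = (\<tau> * norm s + (\<Sum>p\<in>I. (norm (e p))\<^sup>2 * \<mu> p)) * D"
        by (simp add: \<tau>_def sum_distrib_right sum_distrib_left algebra_simps sum.distrib power2_eq_square)
      also have "\<dots> \<le> (\<tau> * norm s + (\<Sum>p\<in>I. (norm (e p))\<^sup>2 * 2)) * D"
        by (intro mult_right_mono add_left_mono sum_mono mult_left_mono \<mu>2 D0) auto
      finally show ?thesis by (simp add: \<kappa>_def sum_distrib_left mult_ac)
    qed
    have a3: "norm T4 \<le> \<tau>\<^sup>2 * D"
    proof -
      have "norm T4 \<le> (\<Sum>p\<in>I. \<Sum>q\<in>I-{p}. norm (e p) * norm (e q) * \<mu> p * \<mu> q * D)"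
        unfolding T4_def
        by (intro order_trans[OF norm_sum] sum_mono)
           (auto simp: norm_mult intro!: mult_mono FD2 wle x \<mu>0 mult_nonneg_nonneg)
      also have "\<dots> \<le> (\<Sum>p\<in>I. \<Sum>q\<in>I. norm (e p) * norm (e q) * \<mu> p * \<mu> q * D)"
        using fin by (intro sum_mono sum_mono2) (auto intro!: mult_nonneg_nonneg \<mu>0 D0)
      also have "\<dots> = \<tau>\<^sup>2 * D"
        unfolding \<tau>_def power2_eq_square sum_product sum_distrib_right by (simp add: sum_distrib_left mult_ac)
      finally show ?thesis .
    qed
    have "norm (F2 x - s\<^sup>2 * F I x) \<le> norm (- (\<Sum>p\<in>I. (e p)\<^sup>2) * F I x) + norm T2 + norm T2 + norm T4"
      unfolding d by (intro order_trans[OF norm_triangle_ineq] add_right_mono) auto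
    also have "\<dots> \<le> \<kappa> * D + (\<tau> * norm s + 2 * \<kappa>) * D + (\<tau> * norm s + 2 * \<kappa>) * D + \<tau>\<^sup>2 * D"
      by (intro add_mono a1 a2 a3)
    also have "\<dots> = D * (5 * \<kappa> + 2 * \<tau> * norm s + \<tau>\<^sup>2)" by (simp add: algebra_simps)
    finally show ?thesis .
  qed
  have Fdiff: "norm (F I x - F I 0) \<le> D * (norm s + \<tau>)" if x: "x \<in> closed_segment 0 1" for x
  proof -
    have "norm (F I x - F I 0) \<le> D * (norm s + \<tau>) * norm (x - 0)"
      by (rule field_differentiable_bound[where S = "closed_segment 0 1"])
         (use x F1_le dF[of I] in \<open>auto simp: F1_def\<close>)
    also have "\<dots> \<le> D * (norm s + \<tau>) * 1"
    proof (intro mult_left_mono mult_nonneg_nonneg D0 add_nonneg_nonneg \<tau>0)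
      show "norm (x - 0) \<le> 1" using x segment_bound1[of x 0 1] by simp
    qed auto
    finally show ?thesis by simp
  qed
  \<comment> \<open>Subtracting the quadratic \<open>s\<^sup>2 / 2 * F I 0 * x\<^sup>2\<close> first, Taylor expansion of order one suffices for the rest.\<close>
  define H where "H i x = (if i = 0 then F I x - s\<^sup>2 / 2 * F I 0 * x\<^sup>2
     else if i = 1 then F1 x - s\<^sup>2 * F I 0 * x else F2 x - s\<^sup>2 * F I 0)" for i :: nat and x
  have "norm (H 0 1 - (\<Sum>i\<le>1. H i 0 * (1 - 0) ^ i / fact i)) \<le>
      D * (5 * \<kappa> + 2 * \<tau> * norm s + \<tau>\<^sup>2 + (norm s)\<^sup>2 * (norm s + \<tau>)) * norm (1 - 0 :: complex) ^ Suc 1 / fact 1"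
  proof (rule complex_Taylor[where S = "closed_segment 0 1"])
    fix i :: nat and x :: complex assume "x \<in> closed_segment 0 1" "i \<le> 1"
    then consider "i = 0" | "i = 1" by linarith
    then show "(H i has_field_derivative H (Suc i) x) (at x within closed_segment 0 1)"
    proof cases
      case 1
      have "((\<lambda>x. F I x - s\<^sup>2 / 2 * F I 0 * x\<^sup>2) has_field_derivative (F1 x - s\<^sup>2 * F I 0 * x)) (at x within closed_segment 0 1)"
        using dF[of I x] unfolding F1_def by (auto intro!: derivative_eq_intros)
      then show ?thesis using 1 by (simp add: H_def[abs_def])
    next
      case 2
      have "((\<lambda>x. F1 x - s\<^sup>2 * F I 0 * x) has_field_derivative (F2 x - s\<^sup>2 * F I 0)) (at x within closed_segment 0 1)"
        using dF1[of x] by (auto intro!: derivative_eq_intros)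
      then show ?thesis using 2 by (simp add: H_def[abs_def])
    qed
  next
    fix x :: complex assume x: "x \<in> closed_segment 0 1"
    have "norm (F2 x - s\<^sup>2 * F I 0) \<le> norm (F2 x - s\<^sup>2 * F I x) + norm (s\<^sup>2 * (F I x - F I 0))"
      using norm_triangle_ineq[of "F2 x - s\<^sup>2 * F I x" "s\<^sup>2 * (F I x - F I 0)"] by (simp add: algebra_simps)
    also have "norm (s\<^sup>2 * (F I x - F I 0)) \<le> (norm s)\<^sup>2 * (D * (norm s + \<tau>))"
      unfolding norm_mult norm_power by (intro mult_left_mono Fdiff x) auto
    also note F2_le[OF x]
    finally show "norm (H (Suc 1) x) \<le> D * (5 * \<kappa> + 2 * \<tau> * norm s + \<tau>\<^sup>2 + (norm s)\<^sup>2 * (norm s + \<tau>))"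
      by (simp add: H_def algebra_simps)
  qed auto
  then have "norm (F I 1 - s\<^sup>2 / 2 * F I 0 - (F I 0 + F1 0)) \<le> D * (5 * \<kappa> + 2 * \<tau> * norm s + \<tau>\<^sup>2 + (norm s)\<^sup>2 * (norm s + \<tau>))"
    by (simp add: H_def)
  moreover have "F I 1 - s\<^sup>2 / 2 * F I 0 - (F I 0 + F1 0) =
     (\<Prod>p\<in>I. B p + e p) - (\<Prod>p\<in>I. B p) - (\<Sum>p\<in>I. e p * (\<Prod>q\<in>I-{p}. B q)) - s\<^sup>2 / 2 * (\<Prod>p\<in>I. B p)"
    by (simp add: F1_def F_def M_def)
  ultimately show ?thesis by simp
qed

section \<open>Truncated filters\<close>

lemma prod_le_prod_subset:
  fixes f :: "'i \<Rightarrow> real"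
  assumes "finite E" "S \<subseteq> E" "\<And>p. p \<in> E \<Longrightarrow> 0 \<le> f p \<and> f p \<le> 1"
  shows "prod f E \<le> prod f S"
proof -
  have "prod f E = prod f S * prod f (E - S)"
    using assms(1,2) by (metis mult.commute prod.subset_diff)
  also have "\<dots> \<le> prod f S * 1"
    using assms by (intro mult_left_mono prod_le_1 prod_nonneg) auto
  finally show ?thesis by simp
qed

locale noise_filter = centred_noise N for N +
  fixes b :: "nat \<Rightarrow> real"
  assumes b_sq: "summable (\<lambda>q. (b q)\<^sup>2)"
    and b_supp: "infinite {q. b q \<noteq> 0}"
    and decay: "\<exists>\<delta> C. \<delta> > 0 \<and> (\<forall>u. norm (char N u) \<le> C * (1 + \<bar>u\<bar>) powr (- \<delta>))"
begin

text \<open>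
  Each factor with nonzero coefficient decays at a fixed polynomial rate, so sufficiently many of them give the rate \<open>R\<close>. Two
  spare factors are included since the product expansion removes up to two.
\<close>

lemma char_prod_decay:
  fixes d :: "nat \<Rightarrow> real"
  assumes inf: "infinite {l. d l \<noteq> 0}"
  shows "\<exists>L D. finite L \<and> D > 0 \<and>
    (\<forall>S u. S \<subseteq> L \<and> card (L - S) \<le> 2 \<longrightarrow> (\<Prod>l\<in>S. norm (\<phi> (u * d l))) \<le> D / (1 + \<bar>u\<bar>) ^ R)"
proof -
  obtain \<delta> C where \<delta>: "\<delta> > 0" and C: "\<And>u. norm (\<phi> u) \<le> C * (1 + \<bar>u\<bar>) powr (- \<delta>)"
    using decay by auto
  obtain P :: nat where P: "real R \<le> \<delta> * real P"
    using reals_Archimedean3[OF \<delta>] by (metis less_imp_le mult.commute)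
  obtain L where L: "L \<subseteq> {l. d l \<noteq> 0}" "finite L" "card L = P + 2"
    using infinite_arbitrarily_large[OF inf] by blast
  define \<beta> where "\<beta> = Min (insert 1 ((\<lambda>l. \<bar>d l\<bar>) ` L))"
  have \<beta>0: "0 < \<beta>" unfolding \<beta>_def using L by (subst Min_gr_iff) auto
  have \<beta>1: "\<beta> \<le> 1" unfolding \<beta>_def using L by (intro Min_le) auto
  have \<beta>d: "\<beta> \<le> \<bar>d l\<bar>" if "l \<in> L" for l unfolding \<beta>_def using L that by (intro Min_le) auto
  define C2 where "C2 = max 1 (max 0 C * \<beta> powr (- \<delta>))"
  have fac: "norm (\<phi> (u * d l)) \<le> C2 * (1 + \<bar>u\<bar>) powr (- \<delta>)" if l: "l \<in> L" for l u
  proof -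
    have "norm (\<phi> (u * d l)) \<le> C * (1 + \<bar>u * d l\<bar>) powr (- \<delta>)" by (rule C)
    also have "\<dots> \<le> max 0 C * (1 + \<bar>u * d l\<bar>) powr (- \<delta>)" by (intro mult_right_mono) auto
    also have "(1 + \<bar>u * d l\<bar>) powr (- \<delta>) \<le> (\<beta> * (1 + \<bar>u\<bar>)) powr (- \<delta>)"
    proof (rule powr_mono2')
      have "\<bar>u\<bar> * \<beta> \<le> \<bar>u\<bar> * \<bar>d l\<bar>" using \<beta>d[OF l] by (intro mult_left_mono) auto
      then show "\<beta> * (1 + \<bar>u\<bar>) \<le> 1 + \<bar>u * d l\<bar>" using \<beta>1 by (simp add: abs_mult algebra_simps)
      show "0 < \<beta> * (1 + \<bar>u\<bar>)" using \<beta>0 by (intro mult_pos_pos) auto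
    qed (use \<delta> in auto)
    also have "\<dots> = \<beta> powr (- \<delta>) * (1 + \<bar>u\<bar>) powr (- \<delta>)" using \<beta>0 by (simp add: powr_mult)
    also have "max 0 C * (\<beta> powr (- \<delta>) * (1 + \<bar>u\<bar>) powr (- \<delta>)) \<le> C2 * (1 + \<bar>u\<bar>) powr (- \<delta>)"
      unfolding mult.assoc[symmetric] C2_def by (intro mult_right_mono) auto
    finally show ?thesis by (simp add: mult_left_mono)
  qed
  have "(\<Prod>l\<in>S. norm (\<phi> (u * d l))) \<le> C2 ^ P / (1 + \<bar>u\<bar>) ^ R" if S: "S \<subseteq> L" "card (L - S) \<le> 2" for S u
  proof -
    have fS: "finite S" using S L finite_subset by auto
    have "P \<le> card S" using S L by (simp add: card_Diff_subset fS)
    then obtain S' where S': "S' \<subseteq> S" "card S' = P" using fS by (meson obtain_subset_with_card_n)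
    have "(\<Prod>l\<in>S. norm (\<phi> (u * d l))) \<le> (\<Prod>l\<in>S'. norm (\<phi> (u * d l)))"
      by (rule prod_le_prod_subset[OF fS S'(1)]) (simp add: cmod_char_le_1)
    also have "\<dots> \<le> (\<Prod>l\<in>S'. C2 * (1 + \<bar>u\<bar>) powr (- \<delta>))"
      using S' S fac by (intro prod_mono) auto
    also have "\<dots> = C2 ^ P * (1 + \<bar>u\<bar>) powr (- (\<delta> * real P))"
      using S' by (simp add: power_mult_distrib powr_powr powr_realpow[symmetric])
    also have "\<dots> \<le> C2 ^ P * (1 + \<bar>u\<bar>) powr (- real R)"
      using P by (intro mult_left_mono powr_mono) (auto simp: C2_def)
    also have "\<dots> = C2 ^ P / (1 + \<bar>u\<bar>) ^ R"
      by (simp add: powr_minus powr_realpow divide_inverse)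
    finally show ?thesis .
  qed
  moreover have "C2 ^ P > 0" by (auto simp: C2_def intro: zero_less_power less_le_trans[of 0 1])
  ultimately show ?thesis using L(2) by blast
qed

definition S where "S = 1 + (\<Sum>q. (b q)\<^sup>2)"

lemma S_ge1: "1 \<le> S" unfolding S_def using suminf_nonneg[OF b_sq] by auto

text \<open>
  Truncation makes all products finite: the \<open>n\<close> rows of the truncated filter are supported in \<open>{..<K + n}\<close>.
\<close>

definition tr :: "nat \<Rightarrow> nat \<Rightarrow> real" where "tr K q = (if q < K then b q else 0)"

lemma tr_sq_sum_le: "(\<Sum>q<m. (tr K q)\<^sup>2) \<le> S"
proof -
  have "(\<Sum>q<m. (tr K q)\<^sup>2) \<le> (\<Sum>q<m. (b q)\<^sup>2)" by (intro sum_mono) (auto simp: tr_def)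
  also have "\<dots> \<le> (\<Sum>q. (b q)\<^sup>2)" by (rule sum_le_suminf[OF b_sq]) auto
  finally show ?thesis by (simp add: S_def)
qed

lemma tr_abs_le: "\<bar>tr K q\<bar> \<le> S"
proof -
  have "(tr K q)\<^sup>2 \<le> (\<Sum>q<Suc q. (tr K q)\<^sup>2)" by (rule member_le_sum) auto
  also have "\<dots> \<le> S" by (rule tr_sq_sum_le)
  also have "S \<le> S\<^sup>2" using S_ge1 by (simp add: power2_eq_square)
  finally show ?thesis using S_ge1 by (metis abs_le_square_iff abs_of_nonneg order_trans zero_le_one)
qed

abbreviation "x K i q \<equiv> sh (tr K) i q"

lemma x_abs_le: "\<bar>x K i q\<bar> \<le> S"
  using tr_abs_le S_ge1 by (simp add: sh_def)

lemma x_row: "(\<Sum>q<m. (x K i q)\<^sup>2) \<le> S"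
proof -
  have "(\<Sum>q<m. (x K i q)\<^sup>2) \<le> (\<Sum>q<m+i. (x K i q)\<^sup>2)" by (intro sum_mono2) auto
  also have "\<dots> = (\<Sum>q\<in>{i..<m+i}. (x K i q)\<^sup>2)"
    by (intro sum.mono_neutral_right) (auto simp: sh_def)
  also have "\<dots> = (\<Sum>q<m. (tr K q)\<^sup>2)"
    using sum.shift_bounds_nat_ivl[of "\<lambda>q. (x K i q)\<^sup>2" 0 i m] by (simp add: sh_def atLeast0LessThan)
  also have "\<dots> \<le> S" by (rule tr_sq_sum_le)
  finally show ?thesis .
qed

lemma x_col: "(\<Sum>i<n. (x K i q)\<^sup>2) \<le> S"
proof -
  have "(\<Sum>i<n. (x K i q)\<^sup>2) \<le> (\<Sum>i<n + Suc q. (x K i q)\<^sup>2)" by (intro sum_mono2) auto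
  also have "\<dots> = (\<Sum>i<Suc q. (x K i q)\<^sup>2)"
    by (intro sum.mono_neutral_right) (auto simp: sh_def)
  also have "\<dots> = (\<Sum>i<Suc q. (tr K (q - i))\<^sup>2)" by (intro sum.cong) (auto simp: sh_def)
  also have "\<dots> = (\<Sum>i<Suc q. (tr K i)\<^sup>2)"
    using sum.nat_diff_reindex[of "\<lambda>i. (tr K i)\<^sup>2" "Suc q"] by simp
  also have "\<dots> \<le> S" by (rule tr_sq_sum_le)
  finally show ?thesis .
qed

text \<open>
  \<open>r\<close> is the autocovariance of the truncated filter. Up to a factor, \<open>k2\<close> is the fourth joint cumulant of
  a pair of observations; it also bounds the errors of the expansion of that pair.
\<close>

definition r :: "nat \<Rightarrow> nat \<Rightarrow> nat \<Rightarrow> nat \<Rightarrow> real" where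
  "r K n i j = (\<Sum>q<K+n. x K i q * x K j q)"
definition k2 :: "nat \<Rightarrow> nat \<Rightarrow> nat \<Rightarrow> nat \<Rightarrow> real" where
  "k2 K n i j = (\<Sum>q<K+n. (x K i q)\<^sup>2 * (x K j q)\<^sup>2)"

lemma k2_nonneg: "0 \<le> k2 K n i j" unfolding k2_def by (intro sum_nonneg) auto

text \<open>
  Although there are \<open>n\<^sup>2\<close> pairs, the bound is linear in \<open>n\<close> because both the rows and the columns of the Toeplitz matrix are
  bounded in \<open>\<ell>\<^sup>2\<close>.
\<close>

lemma k2_sum_le: "(\<Sum>i<n. \<Sum>j<n. k2 K n i j) \<le> real n * S\<^sup>2"
proof -
  have "(\<Sum>j<n. k2 K n i j) \<le> S\<^sup>2" for i
  proof -
    have "(\<Sum>j<n. k2 K n i j) = (\<Sum>q<K+n. (x K i q)\<^sup>2 * (\<Sum>j<n. (x K j q)\<^sup>2))"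
      unfolding k2_def by (subst sum.swap) (simp add: sum_distrib_left)
    also have "\<dots> \<le> (\<Sum>q<K+n. (x K i q)\<^sup>2 * S)" by (intro sum_mono mult_left_mono x_col) auto
    also have "\<dots> = (\<Sum>q<K+n. (x K i q)\<^sup>2) * S" by (simp add: sum_distrib_right)
    also have "\<dots> \<le> S * S" using S_ge1 by (intro mult_right_mono x_row) auto
    finally show ?thesis by (simp add: power2_eq_square)
  qed
  then have "(\<Sum>i<n. \<Sum>j<n. k2 K n i j) \<le> (\<Sum>i<n. S\<^sup>2)" by (intro sum_mono)
  then show ?thesis by simp
qed

lemma k2_le: "k2 K n i j \<le> S ^ 3"
proof -
  have "k2 K n i j \<le> (\<Sum>q<K+n. (x K i q)\<^sup>2 * S\<^sup>2)"
    unfolding k2_def using x_abs_le[of K j] S_ge1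
    by (intro sum_mono mult_left_mono) (auto simp: abs_le_square_iff[symmetric])
  also have "\<dots> = (\<Sum>q<K+n. (x K i q)\<^sup>2) * S\<^sup>2" by (simp add: sum_distrib_right)
  also have "\<dots> \<le> S * S\<^sup>2" using S_ge1 by (intro mult_right_mono x_row) auto
  finally show ?thesis by (simp add: power3_eq_cube power2_eq_square)
qed

lemma tau_le: "(\<Sum>q<K+n. (x K i q)\<^sup>2 * \<bar>x K j q\<bar>) \<le> S * sqrt (k2 K n i j)"
proof -
  have "(\<Sum>q<K+n. \<bar>x K i q\<bar> * (\<bar>x K i q\<bar> * \<bar>x K j q\<bar>))\<^sup>2 \<le>
      (\<Sum>q<K+n. \<bar>x K i q\<bar>\<^sup>2) * (\<Sum>q<K+n. (\<bar>x K i q\<bar> * \<bar>x K j q\<bar>)\<^sup>2)"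
    by (rule Cauchy_Schwarz_ineq_sum)
  also have "\<dots> = (\<Sum>q<K+n. (x K i q)\<^sup>2) * k2 K n i j"
    by (simp add: k2_def power_mult_distrib)
  also have "\<dots> \<le> S * k2 K n i j" by (intro mult_right_mono x_row k2_nonneg)
  also have "\<dots> \<le> S\<^sup>2 * k2 K n i j"
    using S_ge1 by (intro mult_right_mono k2_nonneg) (simp add: power2_eq_square)
  also have "\<dots> = (S * sqrt (k2 K n i j))\<^sup>2" using k2_nonneg by (simp add: power_mult_distrib)
  finally have "(\<Sum>q<K+n. \<bar>x K i q\<bar> * (\<bar>x K i q\<bar> * \<bar>x K j q\<bar>)) \<le> S * sqrt (k2 K n i j)"
    by (rule power2_le_imp_le) (use S_ge1 k2_nonneg in auto)
  moreover have "\<bar>x K i q\<bar> * (\<bar>x K i q\<bar> * \<bar>x K j q\<bar>) = (x K i q)\<^sup>2 * \<bar>x K j q\<bar>" for q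
    by (simp add: power2_eq_square abs_mult[symmetric])
       (simp add: abs_mult)
  ultimately show ?thesis by simp
qed

lemma k2_commute: "k2 K n i j = k2 K n j i" unfolding k2_def by (simp add: mult.commute)

lemma r_abs_le: "\<bar>r K n i j\<bar> \<le> S"
proof -
  have "\<bar>r K n i j\<bar> \<le> (\<Sum>q<K+n. ((x K i q)\<^sup>2 + (x K j q)\<^sup>2) / 2)"
    unfolding r_def
  proof (rule order_trans[OF sum_abs sum_mono])
    fix q show "\<bar>x K i q * x K j q\<bar> \<le> ((x K i q)\<^sup>2 + (x K j q)\<^sup>2) / 2"
      using sum_squares_bound[of "\<bar>x K i q\<bar>" "\<bar>x K j q\<bar>"] by (simp add: abs_mult)
  qed
  also have "\<dots> = ((\<Sum>q<K+n. (x K i q)\<^sup>2) + (\<Sum>q<K+n. (x K j q)\<^sup>2)) / 2"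
    by (simp add: sum_divide_distrib[symmetric] sum.distrib)
  also have "\<dots> \<le> S" using x_row[where m = "K+n" and i=i and K=K] x_row[where m = "K+n" and i=j and K=K] by simp
  finally show ?thesis .
qed

end

section \<open>Characteristic functions of pairs as products\<close>

context noise_filter
begin

text \<open>
  \<open>\<psi>\<close> is the characteristic function of the difference of two truncated observations and \<open>\<Phi>\<close> that of a single one.
  Each factor of \<open>\<psi>\<close> is split into the part \<open>B\<close> that it would have for independent observations and the defect \<open>e\<close>.
  In \<open>f\<close> the factor with index \<open>q\<close> is left out of \<open>\<Phi>\<close>.
\<close>

definition \<psi> :: "nat \<Rightarrow> nat \<Rightarrow> nat \<Rightarrow> nat \<Rightarrow> real \<Rightarrow> complex" where
  "\<psi> K n i j u = (\<Prod>q<K+n. \<phi> (u * x K i q - u * x K j q))"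
definition \<Phi> :: "nat \<Rightarrow> real \<Rightarrow> complex" where
  "\<Phi> K u = (\<Prod>q<K. \<phi> (u * b q))"
definition f :: "nat \<Rightarrow> nat \<Rightarrow> nat \<Rightarrow> nat \<Rightarrow> real \<Rightarrow> complex" where
  "f K n i q u = (\<Prod>p\<in>{..<K+n}-{q}. \<phi> (u * x K i p))"
definition B :: "nat \<Rightarrow> nat \<Rightarrow> nat \<Rightarrow> nat \<Rightarrow> real \<Rightarrow> complex" where
  "B K i j q u = \<phi> (u * x K i q) * \<phi> (- (u * x K j q))"
definition e :: "nat \<Rightarrow> nat \<Rightarrow> nat \<Rightarrow> nat \<Rightarrow> real \<Rightarrow> complex" where
  "e K i j q u = \<epsilon> (u * x K i q) (u * x K j q)"

lemma psi_eq: "\<psi> K n i j u = (\<Prod>q<K+n. B K i j q u + e K i j q u)"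
  by (simp add: \<psi>_def B_def e_def \<epsilon>_def)

lemma phi_0 [simp]: "\<phi> 0 = 1" by (rule char_zero)

lemma prod_phi_x: "i \<le> n \<Longrightarrow> (\<Prod>q<K+n. \<phi> (u * x K i q)) = \<Phi> K u"
proof -
  assume i: "i \<le> n"
  have "(\<Prod>q<K+n. \<phi> (u * x K i q)) = (\<Prod>q\<in>{i..<K+i}. \<phi> (u * x K i q))"
    using i by (intro prod.mono_neutral_right) (auto simp: sh_def tr_def)
  also have "\<dots> = (\<Prod>q<K. \<phi> (u * b q))"
    using prod.shift_bounds_nat_ivl[of "\<lambda>q. \<phi> (u * x K i q)" 0 i K] by (simp add: sh_def tr_def atLeast0LessThan)
  finally show ?thesis by (simp add: \<Phi>_def)
qed

lemma prod_B: "i \<le> n \<Longrightarrow> j \<le> n \<Longrightarrow> (\<Prod>q<K+n. B K i j q u) = \<Phi> K u * cnj (\<Phi> K u)"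
  by (simp add: B_def prod.distrib prod_phi_x chi_cnj cnj_prod[symmetric] del: cnj_prod)

lemma prod_B_remove: "(\<Prod>p\<in>{..<K+n}-{q}. B K i j p u) = f K n i q u * cnj (f K n j q u)"
  by (simp add: B_def prod.distrib f_def chi_cnj)

text \<open>
  The factors on the segment are convex combinations of products of characteristic functions.
\<close>

lemma mixed_factor_le_1:
  assumes "t \<in> closed_segment (0::complex) 1"
  shows "norm (B K i j q u + t * e K i j q u) \<le> 1"
proof -
  obtain s where s: "0 \<le> s" "s \<le> 1" "t = of_real s"
    using assms by (auto simp: closed_segment_def scaleR_conv_of_real)
  have "B K i j q u + t * e K i j q u = of_real (1 - s) * B K i j q u + of_real s * \<phi> (u * x K i q - u * x K j q)"
    by (simp add: s e_def B_def \<epsilon>_def algebra_simps)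
  also have "norm \<dots> \<le> norm (of_real (1 - s) * B K i j q u) + norm (of_real s * \<phi> (u * x K i q - u * x K j q))"
    by (rule norm_triangle_ineq)
  also have "\<dots> \<le> (1 - s) * 1 + s * 1"
    unfolding norm_mult B_def using s cmod_char_le_1
    by (intro add_mono mult_mono) (auto intro!: mult_le_one simp del: of_real_diff)
  finally show ?thesis by simp
qed

text \<open>
  When the lag exceeds \<open>k0\<close>, the innovations providing the decay of one row have coefficient 0 in the other, so
  that these factors do not depend on \<open>t\<close>. The power 14 is 12 + 2: the expansions below lose at most 12 powers of
  \<open>1 + \<bar>u\<bar>\<close>, and 2 must remain for integrability. The bounds are uniform in the truncation \<open>K\<close>.
\<close>

lemma uniform_decay:
  "\<exists>k0 D. D \<ge> 1 \<and> (\<forall>K>k0. \<forall>n i j u. i < n \<longrightarrow> j < n \<longrightarrow>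
     norm (\<Phi> K u) \<le> D / (1 + \<bar>u\<bar>) ^ 14 \<and> (\<forall>q. norm (f K n i q u) \<le> D / (1 + \<bar>u\<bar>) ^ 14) \<and>
     (lag i j > k0 \<longrightarrow> (\<forall>t\<in>closed_segment 0 1. \<forall>E\<subseteq>{..<K+n}. card ({..<K+n} - E) \<le> 2 \<longrightarrow>
        norm (\<Prod>q\<in>E. B K i j q u + t * e K i j q u) \<le> D / (1 + \<bar>u\<bar>) ^ 14)))"
proof -
  obtain L D where L: "finite L" "D > 0" and
    D: "\<And>S u. S \<subseteq> L \<Longrightarrow> card (L - S) \<le> 2 \<Longrightarrow> (\<Prod>l\<in>S. norm (\<phi> (u * b l))) \<le> D / (1 + \<bar>u\<bar>) ^ 14"
    using char_prod_decay[OF b_supp, of 14] by blast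
  define k0 where "k0 = Max (insert 0 L)"
  have k0: "l \<le> k0" if "l \<in> L" for l unfolding k0_def using L that by (intro Max_ge) auto
  have D1: "D \<ge> 1" using D[of "{}" 0] D[of L 0] by simp
  have gen: "norm (\<Prod>q\<in>E. g q) \<le> D / (1 + \<bar>u\<bar>) ^ 14"
    if K: "K > k0" and i: "i < n" and E: "E \<subseteq> {..<K+n}" "card ({..<K+n} - E) \<le> 2"
      and g1: "\<And>q. norm (g q) \<le> 1" and gL: "\<And>l. l \<in> L \<Longrightarrow> norm (g (i + l)) = norm (\<phi> (u * b l))"
    for K n i E u and g :: "nat \<Rightarrow> complex"
  proof -
    define S where "S = {l\<in>L. i + l \<in> E}"
    have fE: "finite E" using E finite_subset by blast
    have "(+) i ` (L - S) \<subseteq> {..<K+n} - E" using k0 K i by (fastforce simp: S_def)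
    then have "card (L - S) \<le> card ({..<K+n} - E)"
      by (intro card_inj_on_le[of "(+) i"]) (auto simp: inj_on_def)
    then have cS: "card (L - S) \<le> 2" using E by simp
    have "norm (\<Prod>q\<in>E. g q) = (\<Prod>q\<in>E. norm (g q))" by (simp add: prod_norm)
    also have "\<dots> \<le> (\<Prod>q\<in>(+) i ` S. norm (g q))"
      by (rule prod_le_prod_subset[OF fE]) (auto simp: S_def g1)
    also have "\<dots> = (\<Prod>l\<in>S. norm (\<phi> (u * b l)))"
      by (subst prod.reindex) (auto simp: S_def gL intro!: prod.cong)
    also have "\<dots> \<le> D / (1 + \<bar>u\<bar>) ^ 14" using cS by (intro D) (auto simp: S_def)
    finally show ?thesis .
  qed
  have xL: "x K i (i + l) = b l" if "l \<in> L" "K > k0" for K i l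
    using k0[OF that(1)] that(2) by (simp add: sh_def tr_def)
  have xL0: "x K j (i + l) = 0" if "l \<in> L" "i + k0 < j" for K i j l
    using k0[OF that(1)] that(2) by (simp add: sh_def)
  have 1: "norm (f K n i q u) \<le> D / (1 + \<bar>u\<bar>) ^ 14" if "K > k0" "i < n" for K n i q u
    unfolding f_def
  proof (rule gen[OF that])
    have "{..<K+n} - ({..<K+n} - {q}) \<subseteq> {q}" by auto
    then have "card ({..<K+n} - ({..<K+n} - {q})) \<le> card {q}" by (intro card_mono) auto
    then show "card ({..<K+n} - ({..<K+n} - {q})) \<le> 2" by simp
  qed (auto simp: cmod_char_le_1 xL that)
  have 2: "norm (\<Phi> K u) \<le> D / (1 + \<bar>u\<bar>) ^ 14" if "K > k0" for K u
    using gen[OF that, of 0 1 "{..<K+1}" "\<lambda>q. \<phi> (u * x K 0 q)" u] prod_phi_x[of 0 1 u K] xL[of _ K 0] that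
    by (auto simp: cmod_char_le_1)
  have 3: "norm (\<Prod>q\<in>E. B K i j q u + t * e K i j q u) \<le> D / (1 + \<bar>u\<bar>) ^ 14"
    if K: "K > k0" and ij: "i < n" "j < n" "lag i j > k0" and t: "t \<in> closed_segment 0 1"
      and E: "E \<subseteq> {..<K+n}" "card ({..<K+n} - E) \<le> 2" for K n i j u t E
  proof (cases "i < j")
    case True
    then have l: "i + k0 < j" using ij by (simp add: lag_def)
    show ?thesis
      by (rule gen[OF K ij(1) E mixed_factor_le_1[OF t]]) (simp add: B_def e_def \<epsilon>_def xL K xL0 l)
  next
    case False
    then have l: "j + k0 < i" using ij by (simp add: lag_def)
    show ?thesis
      by (rule gen[OF K ij(2) E mixed_factor_le_1[OF t]]) (simp add: B_def e_def \<epsilon>_def xL K xL0 l chi_cnj)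
  qed
  show ?thesis
    by (intro exI[of _ k0] exI[of _ D] conjI allI impI ballI D1) (assumption | rule 1 2 3)+
qed

text \<open>
  All deviations are measured by \<open>sqrt (k2 K n i j)\<close>, whose square sums to \<open>O(n)\<close>; the defects add up to the
  autocovariance.
\<close>

lemma pair_errors:
  fixes K n i j :: nat and u :: real
  defines "V \<equiv> (1 + \<bar>u\<bar>) ^ 4" and "t \<equiv> sqrt (k2 K n i j)"
  defines "c \<equiv> 24 * A ^ 4 * S ^ 2"
  shows "norm ((\<Sum>q<K+n. e K i j q u) - of_real (s2 * u\<^sup>2 * r K n i j)) \<le> c * V * t"
    and "(\<Sum>q<K+n. norm (e K i j q u) * min 2 (2 * A\<^sup>2 * ((u * x K i q)\<^sup>2 + (u * x K j q)\<^sup>2))) \<le> c * V * t"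
    and "(\<Sum>q<K+n. (norm (e K i j q u))\<^sup>2) \<le> c * V * t\<^sup>2"
proof -
  have A1: "1 \<le> A" by (rule A_ge)
  have AA: "A\<^sup>2 \<le> A ^ 4" using A1 by (intro power_increasing) auto
  have A40: "0 \<le> A ^ 4" by simp
  have S2: "1 \<le> S\<^sup>2" "S \<le> S\<^sup>2" using S_ge1 by (auto simp: power2_eq_square mult_ge1_I)
  have U: "u\<^sup>2 \<le> V" "\<bar>u\<bar> ^ 3 \<le> V" "u ^ 4 \<le> V"
  proof -
    have p: "\<bar>u\<bar> ^ k \<le> V" if "k \<le> 4" for k
    proof -
      have "\<bar>u\<bar> ^ k \<le> (1 + \<bar>u\<bar>) ^ k" by (intro power_mono) auto
      also have "\<dots> \<le> (1 + \<bar>u\<bar>) ^ 4" using that by (intro power_increasing) auto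
      finally show ?thesis by (simp add: V_def)
    qed
    show "u\<^sup>2 \<le> V" using p[of 2] by simp
    show "\<bar>u\<bar> ^ 3 \<le> V" using p[of 3] by simp
    show "u ^ 4 \<le> V" using p[of 4] by simp
  qed
  have V0: "0 \<le> V" by (simp add: V_def)
  have t0: "0 \<le> t" "t\<^sup>2 = k2 K n i j" using k2_nonneg by (auto simp: t_def)
  let ?X = "\<lambda>q. x K i q" and ?Y = "\<lambda>q. x K j q"
  have tau1: "(\<Sum>q<K+n. (?X q)\<^sup>2 * \<bar>?Y q\<bar>) \<le> S * t" unfolding t_def by (rule tau_le)
  have tau2: "(\<Sum>q<K+n. \<bar>?X q\<bar> * (?Y q)\<^sup>2) \<le> S * t"
    using tau_le[of K j i n] by (simp add: t_def k2_commute[of K n j i] mult.commute)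
  have kap: "(\<Sum>q<K+n. (?X q)\<^sup>2 * (?Y q)\<^sup>2) \<le> S\<^sup>2 * t"
  proof -
    have "(\<Sum>q<K+n. (?X q)\<^sup>2 * (?Y q)\<^sup>2) \<le> (\<Sum>q<K+n. S * ((?X q)\<^sup>2 * \<bar>?Y q\<bar>))"
    proof (rule sum_mono)
      fix q
      have "(?Y q)\<^sup>2 = \<bar>?Y q\<bar> * \<bar>?Y q\<bar>" by (simp add: power2_eq_square)
      also have "\<dots> \<le> S * \<bar>?Y q\<bar>" by (intro mult_right_mono x_abs_le) auto
      finally have "(?X q)\<^sup>2 * (?Y q)\<^sup>2 \<le> (?X q)\<^sup>2 * (S * \<bar>?Y q\<bar>)" by (intro mult_left_mono) auto
      then show "(?X q)\<^sup>2 * (?Y q)\<^sup>2 \<le> S * ((?X q)\<^sup>2 * \<bar>?Y q\<bar>)" by (simp add: mult_ac)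
    qed
    also have "\<dots> = S * (\<Sum>q<K+n. (?X q)\<^sup>2 * \<bar>?Y q\<bar>)" by (simp add: sum_distrib_left)
    also have "\<dots> \<le> S * (S * t)" using S_ge1 by (intro mult_left_mono tau1) auto
    finally show ?thesis by (simp add: power2_eq_square)
  qed
  have St: "S * t \<le> S\<^sup>2 * t" using S2 t0 by (intro mult_right_mono) auto
  have "norm ((\<Sum>q<K+n. e K i j q u) - of_real (s2 * u\<^sup>2 * r K n i j))
     = norm (\<Sum>q<K+n. e K i j q u - of_real (s2 * (u * ?X q) * (u * ?Y q)))"
    by (simp add: r_def sum_subtractf sum_distrib_left power2_eq_square mult_ac)
  also have "\<dots> \<le> (\<Sum>q<K+n. 4 * A\<^sup>2 * V * ((?X q)\<^sup>2 * \<bar>?Y q\<bar> + \<bar>?X q\<bar> * (?Y q)\<^sup>2 + (?X q)\<^sup>2 * (?Y q)\<^sup>2))"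
  proof (rule order_trans[OF norm_sum sum_mono])
    fix q
    have "norm (e K i j q u - of_real (s2 * (u * ?X q) * (u * ?Y q)))
       \<le> 4 * A\<^sup>2 * ((u * ?X q)\<^sup>2 * \<bar>u * ?Y q\<bar> + \<bar>u * ?X q\<bar> * (u * ?Y q)\<^sup>2 + (u * ?X q)\<^sup>2 * (u * ?Y q)\<^sup>2)"
      unfolding e_def by (rule eps_approx3)
    also have "\<dots> = 4 * A\<^sup>2 * (\<bar>u\<bar>^3 * ((?X q)\<^sup>2 * \<bar>?Y q\<bar>) + \<bar>u\<bar>^3 * (\<bar>?X q\<bar> * (?Y q)\<^sup>2) + u ^ 4 * ((?X q)\<^sup>2 * (?Y q)\<^sup>2))"
    proof -
      have c: "\<bar>u\<bar>\<^sup>2 * \<bar>u\<bar> = \<bar>u\<bar> ^ 3" by (simp only: power3_eq_cube power2_eq_square mult.assoc)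
      have "(u * v)\<^sup>2 * \<bar>u * w\<bar> = \<bar>u\<bar> ^ 3 * (v\<^sup>2 * \<bar>w\<bar>)" for v w
        unfolding c[symmetric] by (simp only: power_mult_distrib abs_mult power2_abs mult_ac)
      moreover have "\<bar>u * v\<bar> * (u * w)\<^sup>2 = \<bar>u\<bar> ^ 3 * (\<bar>v\<bar> * w\<^sup>2)" for v w
        unfolding c[symmetric] by (simp only: power_mult_distrib abs_mult power2_abs mult_ac)
      moreover have "(u * v)\<^sup>2 * (u * w)\<^sup>2 = u ^ 4 * (v\<^sup>2 * w\<^sup>2)" for v w
        by (simp add: power4_eq_xxxx power2_eq_square mult_ac)
      ultimately show ?thesis by (simp only:)
    qed
    also have "\<dots> \<le> 4 * A\<^sup>2 * (V * ((?X q)\<^sup>2 * \<bar>?Y q\<bar>) + V * (\<bar>?X q\<bar> * (?Y q)\<^sup>2) + V * ((?X q)\<^sup>2 * (?Y q)\<^sup>2))"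
      by (intro mult_left_mono add_mono mult_right_mono U) auto
    finally show "norm (e K i j q u - of_real (s2 * (u * ?X q) * (u * ?Y q))) \<le>
       4 * A\<^sup>2 * V * ((?X q)\<^sup>2 * \<bar>?Y q\<bar> + \<bar>?X q\<bar> * (?Y q)\<^sup>2 + (?X q)\<^sup>2 * (?Y q)\<^sup>2)"
      by (simp add: algebra_simps)
  qed
  also have "\<dots> = 4 * A\<^sup>2 * V * ((\<Sum>q<K+n. (?X q)\<^sup>2 * \<bar>?Y q\<bar>) + (\<Sum>q<K+n. \<bar>?X q\<bar> * (?Y q)\<^sup>2) + (\<Sum>q<K+n. (?X q)\<^sup>2 * (?Y q)\<^sup>2))"
    by (simp only: sum_distrib_left[symmetric] sum.distrib)
  also have "\<dots> \<le> 4 * A ^ 4 * V * (S\<^sup>2 * t + S\<^sup>2 * t + S\<^sup>2 * t)"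
    using AA V0 St t0 tau1 tau2 kap by (intro mult_mono add_mono) (auto intro!: add_nonneg_nonneg sum_nonneg)
  also have "\<dots> \<le> c * V * t"
  proof -
    have "0 \<le> A ^ 4 * V * (S\<^sup>2 * t)" using V0 t0 by auto
    then show ?thesis unfolding c_def by (simp add: algebra_simps)
  qed
  finally show "norm ((\<Sum>q<K+n. e K i j q u) - of_real (s2 * u\<^sup>2 * r K n i j)) \<le> c * V * t" .
  have ele: "norm (e K i j q u) \<le> 2 * A\<^sup>2 * u\<^sup>2 * (\<bar>?X q\<bar> * \<bar>?Y q\<bar>)" for q
    using eps_le[of "u * ?X q" "u * ?Y q"] by (simp add: e_def abs_mult power2_eq_square mult_ac)
  have "(\<Sum>q<K+n. norm (e K i j q u) * min 2 (2 * A\<^sup>2 * ((u * ?X q)\<^sup>2 + (u * ?Y q)\<^sup>2)))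
     \<le> (\<Sum>q<K+n. 4 * A ^ 4 * V * (S * ((?X q)\<^sup>2 * \<bar>?Y q\<bar> + \<bar>?X q\<bar> * (?Y q)\<^sup>2)))"
  proof (rule sum_mono)
    fix q
    have "norm (e K i j q u) * min 2 (2 * A\<^sup>2 * ((u * ?X q)\<^sup>2 + (u * ?Y q)\<^sup>2))
       \<le> (2 * A\<^sup>2 * u\<^sup>2 * (\<bar>?X q\<bar> * \<bar>?Y q\<bar>)) * (2 * A\<^sup>2 * ((u * ?X q)\<^sup>2 + (u * ?Y q)\<^sup>2))"
      using ele[of q] by (intro mult_mono) auto
    also have "\<dots> = 4 * A ^ 4 * u ^ 4 * (\<bar>?X q\<bar> * ((?X q)\<^sup>2 * \<bar>?Y q\<bar>) + \<bar>?Y q\<bar> * (\<bar>?X q\<bar> * (?Y q)\<^sup>2))"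
      by (simp add: power_mult_distrib power4_eq_xxxx power2_eq_square algebra_simps)
    also have "\<dots> \<le> 4 * A ^ 4 * V * (S * ((?X q)\<^sup>2 * \<bar>?Y q\<bar>) + S * (\<bar>?X q\<bar> * (?Y q)\<^sup>2))"
      using U V0 x_abs_le S_ge1 by (intro mult_mono add_mono) auto
    finally show "norm (e K i j q u) * min 2 (2 * A\<^sup>2 * ((u * ?X q)\<^sup>2 + (u * ?Y q)\<^sup>2)) \<le>
       4 * A ^ 4 * V * (S * ((?X q)\<^sup>2 * \<bar>?Y q\<bar> + \<bar>?X q\<bar> * (?Y q)\<^sup>2))" by (simp add: algebra_simps)
  qed
  also have "\<dots> = 4 * A ^ 4 * V * (S * ((\<Sum>q<K+n. (?X q)\<^sup>2 * \<bar>?Y q\<bar>) + (\<Sum>q<K+n. \<bar>?X q\<bar> * (?Y q)\<^sup>2)))"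
    by (simp only: sum_distrib_left[symmetric] sum.distrib)
  also have "\<dots> \<le> 4 * A ^ 4 * V * (S * (S * t + S * t))"
    using V0 S_ge1 by (intro mult_left_mono add_mono tau1 tau2) auto
  also have "\<dots> \<le> c * V * t"
  proof -
    have "0 \<le> A ^ 4 * V * (S\<^sup>2 * t)" using V0 t0 by auto
    then show ?thesis unfolding c_def by (simp add: algebra_simps power2_eq_square)
  qed
  finally show "(\<Sum>q<K+n. norm (e K i j q u) * min 2 (2 * A\<^sup>2 * ((u * x K i q)\<^sup>2 + (u * x K j q)\<^sup>2))) \<le> c * V * t" .
  have "(\<Sum>q<K+n. (norm (e K i j q u))\<^sup>2) \<le> (\<Sum>q<K+n. 4 * A ^ 4 * V * ((?X q)\<^sup>2 * (?Y q)\<^sup>2))"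
  proof (rule sum_mono)
    fix q
    have "(norm (e K i j q u))\<^sup>2 \<le> (2 * A\<^sup>2 * u\<^sup>2 * (\<bar>?X q\<bar> * \<bar>?Y q\<bar>))\<^sup>2"
      using ele by (intro power_mono) auto
    also have "\<dots> = 4 * A ^ 4 * u ^ 4 * ((?X q)\<^sup>2 * (?Y q)\<^sup>2)"
      by (simp add: power_mult_distrib)
    also have "\<dots> \<le> 4 * A ^ 4 * V * ((?X q)\<^sup>2 * (?Y q)\<^sup>2)"
      using U by (intro mult_right_mono mult_left_mono) auto
    finally show "(norm (e K i j q u))\<^sup>2 \<le> 4 * A ^ 4 * V * ((?X q)\<^sup>2 * (?Y q)\<^sup>2)" .
  qed
  also have "\<dots> = 4 * A ^ 4 * V * t\<^sup>2" by (simp add: t0 k2_def sum_distrib_left)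
  also have "\<dots> \<le> c * V * t\<^sup>2"
  proof (intro mult_right_mono)
    have "4 * A ^ 4 * 1 \<le> 4 * A ^ 4 * (6 * S\<^sup>2)" using S2 by (intro mult_left_mono) auto
    then show "4 * A ^ 4 \<le> c" by (simp add: c_def)
  qed (use V0 in auto)
  finally show "(\<Sum>q<K+n. (norm (e K i j q u))\<^sup>2) \<le> c * V * t\<^sup>2" .
qed

lemma one_minus_mixed:
  assumes "t \<in> closed_segment (0::complex) 1"
  shows "norm (1 - (B K i j q u + t * e K i j q u)) \<le> min 2 (2 * A\<^sup>2 * ((u * x K i q)\<^sup>2 + (u * x K j q)\<^sup>2))"
proof -
  have "norm (1 - (B K i j q u + t * e K i j q u)) \<le> 1 + 1"
    by (rule order_trans[OF norm_triangle_ineq4]) (use mixed_factor_le_1[OF assms] in auto)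
  moreover have "norm (1 - (B K i j q u + t * e K i j q u)) \<le> 2 * A\<^sup>2 * ((u * x K i q)\<^sup>2 + (u * x K j q)\<^sup>2)"
  proof -
    let ?a = "u * x K i q" and ?c = "u * x K j q"
    have t1: "norm t \<le> 1" using segment_bound1[OF assms] by simp
    have eq: "1 - (B K i j q u + t * e K i j q u) = (1 - \<phi> ?a) + \<phi> ?a * (1 - \<phi> (- ?c)) - t * \<epsilon> ?a ?c"
      by (simp add: B_def e_def algebra_simps)
    have "norm (1 - (B K i j q u + t * e K i j q u)) \<le> norm (1 - \<phi> ?a) + norm (\<phi> ?a * (1 - \<phi> (- ?c))) + norm (t * \<epsilon> ?a ?c)"
      unfolding eq using norm_triangle_ineq4[of "(1 - \<phi> ?a) + \<phi> ?a * (1 - \<phi> (- ?c))" "t * \<epsilon> ?a ?c"]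
        norm_triangle_ineq[of "1 - \<phi> ?a" "\<phi> ?a * (1 - \<phi> (- ?c))"] by linarith
    also have "\<dots> \<le> A * ?a\<^sup>2 + A * ?c\<^sup>2 + 2 * A\<^sup>2 * (\<bar>?a\<bar> * \<bar>?c\<bar>)"
    proof -
      have h1: "norm (1 - \<phi> ?a) \<le> A * ?a\<^sup>2"
        using chi_minus_one[of ?a] by (subst norm_minus_commute)
      have h2: "norm (1 - \<phi> (- ?c)) \<le> A * ?c\<^sup>2"
        using chi_minus_one[of "- ?c"] unfolding power2_minus by (subst norm_minus_commute)
      have h3: "norm (\<phi> ?a * (1 - \<phi> (- ?c))) \<le> 1 * (A * ?c\<^sup>2)"
        unfolding norm_mult by (rule mult_mono[OF cmod_char_le_1 h2]) auto
      have h4: "norm (t * \<epsilon> ?a ?c) \<le> 1 * (2 * A\<^sup>2 * (\<bar>?a\<bar> * \<bar>?c\<bar>))"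
        unfolding norm_mult by (rule mult_mono[OF t1 eps_le]) auto
      show ?thesis using h1 h3 h4 unfolding mult_1 by linarith
    qed
    also have "\<dots> \<le> A\<^sup>2 * ?a\<^sup>2 + A\<^sup>2 * ?c\<^sup>2 + A\<^sup>2 * (?a\<^sup>2 + ?c\<^sup>2)"
    proof -
      have "2 * (\<bar>?a\<bar> * \<bar>?c\<bar>) \<le> ?a\<^sup>2 + ?c\<^sup>2" using sum_squares_bound[of "\<bar>?a\<bar>" "\<bar>?c\<bar>"] by simp
      then have "A\<^sup>2 * (2 * (\<bar>?a\<bar> * \<bar>?c\<bar>)) \<le> A\<^sup>2 * (?a\<^sup>2 + ?c\<^sup>2)" by (intro mult_left_mono) auto
      then have "2 * A\<^sup>2 * (\<bar>?a\<bar> * \<bar>?c\<bar>) \<le> A\<^sup>2 * (?a\<^sup>2 + ?c\<^sup>2)" by (simp only: mult_ac)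
      moreover have "A * ?a\<^sup>2 \<le> A\<^sup>2 * ?a\<^sup>2" "A * ?c\<^sup>2 \<le> A\<^sup>2 * ?c\<^sup>2"
        by (rule mult_right_mono[OF A_le_sq], simp)+
      ultimately show ?thesis by linarith
    qed
    finally show ?thesis by (simp add: algebra_simps)
  qed
  ultimately show ?thesis by simp
qed

end

section \<open>The first order term\<close>

text \<open>
  Products of the negligible \<open>t\<close> with the autocovariance \<open>\<rho>\<close> are split by the weighted arithmetic-geometric mean inequality,
  charging the small weight \<open>\<eta>\<close> to \<open>\<rho>\<^sup>2\<close> and \<open>1 / \<eta>\<close> to \<open>t\<^sup>2\<close>.
\<close>

lemma third_order_arith:
  fixes W t \<rho> \<eta> T0 :: real
  assumes W: "1 \<le> W" and t: "0 \<le> t" "t \<le> T0" and \<rho>: "0 \<le> \<rho>" and \<eta>: "0 < \<eta>" "\<eta> \<le> 1"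
    and k: "0 \<le> \<kappa>" "\<kappa> \<le> W * t\<^sup>2" and tau: "0 \<le> \<tau>" "\<tau> \<le> W * t" and s: "0 \<le> \<sigma>" "\<sigma> \<le> W * (\<rho> + t)"
    and d: "0 \<le> d" "d \<le> W * t" and s0: "0 \<le> \<sigma>0" "\<sigma>0 \<le> W * \<rho>"
  shows "5 * \<kappa> + 2 * \<tau> * \<sigma> + \<tau>\<^sup>2 + \<sigma>\<^sup>2 * (\<sigma> + \<tau>) + d * (\<sigma> + \<sigma>0) / 2
     \<le> (12 + 8 * T0) * W ^ 3 * (t\<^sup>2 / \<eta> + \<eta> * \<rho>\<^sup>2 + \<rho> ^ 3)"
proof -
  have W2: "W\<^sup>2 \<le> W ^ 3" "W \<le> W ^ 3" using W by (auto intro: power_increasing self_le_power)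
  have W0: "0 \<le> W" using W by simp
  have a1: "5 * \<kappa> \<le> W ^ 3 * (5 * t\<^sup>2)"
    using k mult_right_mono[OF W2(2), of "t\<^sup>2"] by simp
  have "2 * \<tau> * \<sigma> \<le> 2 * (W * t) * (W * (\<rho> + t))" using tau s t W0 by (intro mult_mono) auto
  also have "\<dots> = W\<^sup>2 * (2 * t * (\<rho> + t))" by (simp add: power2_eq_square mult_ac)
  also have "\<dots> \<le> W ^ 3 * (2 * t * (\<rho> + t))" using W2 t \<rho> by (intro mult_right_mono) auto
  finally have a2: "2 * \<tau> * \<sigma> \<le> W ^ 3 * (2 * t * (\<rho> + t))" .
  have "\<tau>\<^sup>2 \<le> (W * t)\<^sup>2" using tau by (intro power_mono)
  also have "\<dots> = W\<^sup>2 * t\<^sup>2" by (simp add: power_mult_distrib)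
  also have "\<dots> \<le> W ^ 3 * t\<^sup>2" using W2 by (intro mult_right_mono) auto
  finally have a3: "\<tau>\<^sup>2 \<le> W ^ 3 * t\<^sup>2" .
  have "\<sigma>\<^sup>2 * (\<sigma> + \<tau>) \<le> (W * (\<rho> + t))\<^sup>2 * (W * (\<rho> + t) + W * t)"
    using s tau by (intro mult_mono power_mono add_mono) auto
  also have "\<dots> = W ^ 3 * ((\<rho> + t)\<^sup>2 * (\<rho> + 2 * t))" by (simp add: power2_eq_square power3_eq_cube algebra_simps)
  finally have a4: "\<sigma>\<^sup>2 * (\<sigma> + \<tau>) \<le> W ^ 3 * ((\<rho> + t)\<^sup>2 * (\<rho> + 2 * t))" .
  have "d * (\<sigma> + \<sigma>0) \<le> (W * t) * (W * (\<rho> + t) + W * \<rho>)"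
    using d s s0 t W0 by (intro mult_mono add_mono) auto
  also have "\<dots> = W\<^sup>2 * (t * (2 * \<rho> + t))" by (simp add: power2_eq_square algebra_simps)
  also have "\<dots> \<le> W ^ 3 * (t * (2 * \<rho> + t))" using W2 t \<rho> by (intro mult_right_mono) auto
  finally have a5: "d * (\<sigma> + \<sigma>0) / 2 \<le> W ^ 3 * (t * (2 * \<rho> + t) / 2)" by simp
  define p v where "p = t\<^sup>2 / \<eta>" and "v = \<eta> * \<rho>\<^sup>2"
  have tt: "t\<^sup>2 \<le> p" unfolding p_def using \<eta> by (simp add: field_simps mult_left_le_one_le)
  have rt: "2 * (\<rho> * t) \<le> v + p"
  proof -
    have "0 \<le> (\<eta> * \<rho> - t)\<^sup>2 / \<eta>" using \<eta> by simp
    also have "\<dots> = \<eta> * \<rho>\<^sup>2 - 2 * (\<rho> * t) + t\<^sup>2 / \<eta>" using \<eta> by (simp add: power2_eq_square field_simps)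
    finally show ?thesis by (simp add: p_def v_def)
  qed
  have t3: "t ^ 3 \<le> T0 * t\<^sup>2" using mult_right_mono[OF t(2), of "t\<^sup>2"] by (simp add: power3_eq_cube power2_eq_square mult_ac)
  have cube: "(\<rho> + t) ^ 3 \<le> 4 * \<rho> ^ 3 + 4 * t ^ 3"
  proof -
    have "0 \<le> 3 * (\<rho> + t) * (\<rho> - t)\<^sup>2" using t \<rho> by auto
    then show ?thesis by (simp add: power2_eq_square power3_eq_cube algebra_simps)
  qed
  have c2: "(\<rho> + t)\<^sup>2 * (\<rho> + 2 * t) \<le> 2 * (\<rho> + t) ^ 3"
  proof -
    have "(\<rho> + t)\<^sup>2 * (\<rho> + 2 * t) \<le> (\<rho> + t)\<^sup>2 * (2 * (\<rho> + t))" using \<rho> by (intro mult_left_mono) auto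
    then show ?thesis by (simp add: power2_eq_square power3_eq_cube mult_ac)
  qed
  have t2: "0 \<le> p" "0 \<le> v" "0 \<le> \<rho> ^ 3" "0 \<le> T0" using \<eta> t \<rho> by (auto simp: p_def v_def)
  have "5 * t\<^sup>2 + 2 * t * (\<rho> + t) + t\<^sup>2 + (\<rho> + t)\<^sup>2 * (\<rho> + 2 * t) + t * (2 * \<rho> + t) / 2
     \<le> 9 * t\<^sup>2 + 3 * (\<rho> * t) + 8 * \<rho> ^ 3 + 8 * (T0 * t\<^sup>2)"
  proof -
    have "2 * t * (\<rho> + t) = 2 * (\<rho> * t) + 2 * t\<^sup>2" "t * (2 * \<rho> + t) / 2 = \<rho> * t + t\<^sup>2 / 2"
      by (simp_all add: power2_eq_square algebra_simps)
    moreover have "5 * a + P + a + X + R \<le> 9 * a + 3 * z + 8 * q + 8 * w"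
      if "P = 2 * z + 2 * a" "R = z + a / 2" "0 \<le> a" "X \<le> 2 * Y" "Y \<le> 4 * q + 4 * y" "y \<le> w"
      for a P X R z q w Y y :: real using that by linarith
    ultimately show ?thesis using c2 cube t3 by (metis zero_le_power2)
  qed
  also have "\<dots> \<le> 9 * (p) + 3 * (v + p) + 8 * \<rho> ^ 3 + 8 * (T0 * (p))"
  proof -
    have "9 * a + 3 * z + q + 8 * y \<le> 9 * p' + 3 * (v' + p') + q + 8 * w"
      if "a \<le> p'" "2 * z \<le> v' + p'" "y \<le> w" "0 \<le> v'" "0 \<le> p'" for a z q y w p' v' :: real
      using that by auto
    from this[OF tt rt mult_left_mono[OF tt t2(4)] t2(2,1)] show ?thesis by simp
  qed
  also have "\<dots> \<le> (12 + 8 * T0) * (p + v + \<rho> ^ 3)"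
  proof -
    have "0 \<le> T0 * (v)" "0 \<le> T0 * \<rho> ^ 3" using t2 by auto
    moreover have "(12 + 8 * T0) * (p + q + s) = 12 * p + 12 * q + 12 * s + 8 * (T0 * p) + 8 * (T0 * q) + 8 * (T0 * s)"
      for p q s :: real by (simp add: algebra_simps)
    ultimately show ?thesis using t2 by simp
  qed
  finally have fin: "5 * t\<^sup>2 + 2 * t * (\<rho> + t) + t\<^sup>2 + (\<rho> + t)\<^sup>2 * (\<rho> + 2 * t) + t * (2 * \<rho> + t) / 2
     \<le> (12 + 8 * T0) * (p + v + \<rho> ^ 3)" .
  have "5 * \<kappa> + 2 * \<tau> * \<sigma> + \<tau>\<^sup>2 + \<sigma>\<^sup>2 * (\<sigma> + \<tau>) + d * (\<sigma> + \<sigma>0) / 2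
     \<le> W ^ 3 * (5 * t\<^sup>2 + 2 * t * (\<rho> + t) + t\<^sup>2 + (\<rho> + t)\<^sup>2 * (\<rho> + 2 * t) + t * (2 * \<rho> + t) / 2)"
    unfolding distrib_left[of "W ^ 3"] by (intro add_mono a1 a2 a3 a4 a5)
  also have "\<dots> \<le> W ^ 3 * ((12 + 8 * T0) * (p + v + \<rho> ^ 3))"
    using W by (intro mult_left_mono fin) auto
  finally show ?thesis by (simp add: p_def v_def mult_ac)
qed

context noise_filter
begin

text \<open>
  The derivative at the independent product of the path from it to \<open>\<psi>\<close>.
\<close>

definition G :: "nat \<Rightarrow> nat \<Rightarrow> nat \<Rightarrow> nat \<Rightarrow> real \<Rightarrow> complex" where
  "G K n i j u = (\<Sum>q<K+n. e K i j q u * (f K n i q u * cnj (f K n j q u)))"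

lemma r_T: "(\<Sum>i<n. \<Sum>j<n. r K n i j) = (\<Sum>q<K+n. (\<Sum>i<n. x K i q)\<^sup>2)"
proof -
  have "(\<Sum>i<n. \<Sum>j<n. r K n i j) = (\<Sum>i<n. \<Sum>q<K+n. \<Sum>j<n. x K i q * x K j q)"
    unfolding r_def by (intro sum.cong refl sum.swap)
  also have "\<dots> = (\<Sum>q<K+n. \<Sum>i<n. \<Sum>j<n. x K i q * x K j q)" by (rule sum.swap)
  also have "\<dots> = (\<Sum>q<K+n. (\<Sum>i<n. x K i q)\<^sup>2)" by (simp add: power2_eq_square sum_product)
  finally show ?thesis .
qed

lemma f_diff:
  assumes "i < n" "q < K + n"
  shows "norm (f K n i q u - \<Phi> K u) \<le> A * u\<^sup>2 * (x K i q)\<^sup>2 * norm (f K n i q u)"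
proof -
  have "\<Phi> K u = \<phi> (u * x K i q) * f K n i q u"
    unfolding f_def prod_phi_x[OF less_imp_le[OF assms(1)], symmetric] using assms by (intro prod.remove) auto
  then have "f K n i q u - \<Phi> K u = - (\<phi> (u * x K i q) - 1) * f K n i q u" by (simp add: algebra_simps)
  also have "norm \<dots> \<le> (A * (u * x K i q)\<^sup>2) * norm (f K n i q u)"
    unfolding norm_mult norm_minus_cancel by (intro mult_right_mono chi_minus_one) auto
  finally show ?thesis by (simp add: power_mult_distrib mult_ac)
qed

text \<open>
  Entries that are proportional to those of the Toeplitz matrix up to a quadratic error have column sums controlled by the
  column sums of the matrix, since squares are summable along each column.
\<close>

lemma row_sums_l2:
  fixes z :: "nat \<Rightarrow> nat \<Rightarrow> complex"
  assumes z: "\<And>i q. i < n \<Longrightarrow> q < K + n \<Longrightarrow> norm (z i q - w * of_real (x K i q)) \<le> E * (x K i q)\<^sup>2"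
    and w: "norm w \<le> F" and E: "0 \<le> E"
  shows "(\<Sum>q<K+n. (norm (\<Sum>i<n. z i q))\<^sup>2) \<le> 2 * F\<^sup>2 * (\<Sum>i<n. \<Sum>j<n. r K n i j) + 2 * E\<^sup>2 * S\<^sup>2 * real n"
proof -
  have "(\<Sum>q<K+n. (norm (\<Sum>i<n. z i q))\<^sup>2) \<le> (\<Sum>q<K+n. 2 * F\<^sup>2 * (\<Sum>i<n. x K i q)\<^sup>2 + 2 * E\<^sup>2 * S * (\<Sum>i<n. (x K i q)\<^sup>2))"
  proof (rule sum_mono)
    fix q assume q: "q \<in> {..<K+n}"
    let ?P = "norm (w * of_real (\<Sum>i<n. x K i q))" and ?Q = "norm (\<Sum>i<n. z i q - w * of_real (x K i q))"
    have "(\<Sum>i<n. z i q) = w * of_real (\<Sum>i<n. x K i q) + (\<Sum>i<n. z i q - w * of_real (x K i q))"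
      by (simp add: sum_subtractf sum_distrib_left)
    then have "norm (\<Sum>i<n. z i q) \<le> ?P + ?Q" by (metis norm_triangle_ineq)
    then have "(norm (\<Sum>i<n. z i q))\<^sup>2 \<le> (?P + ?Q)\<^sup>2" by (intro power_mono) auto
    also have "\<dots> \<le> 2 * ?P\<^sup>2 + 2 * ?Q\<^sup>2" using sum_squares_bound[of ?P ?Q] by (simp add: power2_sum)
    also have "?P\<^sup>2 \<le> F\<^sup>2 * (\<Sum>i<n. x K i q)\<^sup>2"
      unfolding norm_mult power_mult_distrib norm_of_real power2_abs
      using w by (intro mult_right_mono power_mono) auto
    also have "?Q\<^sup>2 \<le> (E * (\<Sum>i<n. (x K i q)\<^sup>2))\<^sup>2"
      unfolding sum_distrib_left using q by (intro power_mono order_trans[OF norm_sum] sum_mono z) auto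
    also have "\<dots> = E\<^sup>2 * ((\<Sum>i<n. (x K i q)\<^sup>2) * (\<Sum>i<n. (x K i q)\<^sup>2))"
      by (simp add: power_mult_distrib power2_eq_square)
    also have "\<dots> \<le> E\<^sup>2 * (S * (\<Sum>i<n. (x K i q)\<^sup>2))"
      by (intro mult_left_mono mult_right_mono x_col sum_nonneg) auto
    finally show "(norm (\<Sum>i<n. z i q))\<^sup>2 \<le> 2 * F\<^sup>2 * (\<Sum>i<n. x K i q)\<^sup>2 + 2 * E\<^sup>2 * S * (\<Sum>i<n. (x K i q)\<^sup>2)"
      by (simp add: mult_ac)
  qed
  also have "\<dots> = 2 * F\<^sup>2 * (\<Sum>i<n. \<Sum>j<n. r K n i j) + 2 * E\<^sup>2 * S * (\<Sum>i<n. \<Sum>q<K+n. (x K i q)\<^sup>2)"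
    unfolding r_T sum.distrib sum_distrib_left[symmetric] by (subst sum.swap) (rule refl)
  also have "\<dots> \<le> 2 * F\<^sup>2 * (\<Sum>i<n. \<Sum>j<n. r K n i j) + 2 * E\<^sup>2 * S * (\<Sum>i<n. S)"
    using S_ge1 by (intro add_left_mono mult_left_mono sum_mono x_row) auto
  finally show ?thesis by (simp add: power2_eq_square mult_ac)
qed

text \<open>
  Summing absolute values would produce the sum of \<open>\<bar>\<rho>\<bar>\<close>, which need not be small against \<open>Wn\<close>. Instead, by \<open>eps_approx4\<close>,
  each first order term is bilinear in quantities attached to the two rows. The sum over the pairs then becomes a sum of
  products of column sums, to which Cauchy-Schwarz applies, and those column sums are controlled by the sum of the
  autocovariances without absolute values.
\<close>

lemma first_order_sum:
  assumes Df: "\<And>i q. i < n \<Longrightarrow> norm (f K n i q u) \<le> D" and D\<Phi>: "norm (\<Phi> K u) \<le> D"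
  shows "norm (\<Sum>i<n. \<Sum>j<n. G K n i j u) \<le> 26 * A ^ 5 * S ^ 4 * (1 + \<bar>u\<bar>) ^ 8 * D\<^sup>2 * ((\<Sum>i<n. \<Sum>j<n. r K n i j) + real n)"
proof -
  define U where "U = 1 + \<bar>u\<bar>"
  have U1: "1 \<le> U" "\<bar>u\<bar> \<le> U" by (auto simp: U_def)
  have A1: "1 \<le> A" by (rule A_ge)
  have D0: "0 \<le> D" by (rule order_trans[OF norm_ge_zero D\<Phi>])
  have uU: "\<bar>u\<bar> ^ k \<le> U ^ k" for k using U1 by (intro power_mono) auto
  define T where "T = (\<Sum>i<n. \<Sum>j<n. r K n i j)"
  have T0: "0 \<le> T" unfolding T_def r_T by (intro sum_nonneg) auto
  define Q where "Q = 8 * A ^ 4 * S ^ 4 * U ^ 6 * D\<^sup>2 * (T + real n)"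
  define X where "X q = (\<Sum>i<n. of_real (x K i q) * f K n i q u)" for q
  define Y where "Y q = (\<Sum>i<n. \<zeta> (u * x K i q) * f K n i q u)" for q
  have dlow: "norm (f K n i q u - \<Phi> K u) \<le> A * U\<^sup>2 * D * (x K i q)\<^sup>2" if "i < n" "q < K + n" for i q
  proof -
    have "norm (f K n i q u - \<Phi> K u) \<le> A * u\<^sup>2 * (x K i q)\<^sup>2 * norm (f K n i q u)" by (rule f_diff[OF that])
    also have "\<dots> \<le> A * U\<^sup>2 * (x K i q)\<^sup>2 * D"
      using Df[OF that(1), of q] uU[of 2] A1 by (intro mult_mono) auto
    finally show ?thesis by (simp add: mult_ac)
  qed
  have Qge: "2 * (A * U * D)\<^sup>2 * T + 2 * (2 * A\<^sup>2 * S * U ^ 3 * D)\<^sup>2 * S\<^sup>2 * real n \<le> Q"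
  proof -
    have "(A * U * D)\<^sup>2 \<le> 4 * A ^ 4 * S ^ 4 * U ^ 6 * D\<^sup>2"
    proof -
      have "A\<^sup>2 \<le> A ^ 4" "U\<^sup>2 \<le> U ^ 6" "1 \<le> S ^ 4" using A1 U1 S_ge1 by (auto intro: power_increasing one_le_power)
      then have "A\<^sup>2 * 1 * U\<^sup>2 * D\<^sup>2 \<le> A ^ 4 * S ^ 4 * U ^ 6 * D\<^sup>2"
        by (intro mult_mono mult_nonneg_nonneg) auto
      moreover have "0 \<le> A ^ 4 * S ^ 4 * U ^ 6 * D\<^sup>2" using S_ge1 U1 by auto
      ultimately have "A\<^sup>2 * U\<^sup>2 * D\<^sup>2 \<le> 4 * (A ^ 4 * S ^ 4 * U ^ 6 * D\<^sup>2)"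
        unfolding mult_1_right by linarith
      then show ?thesis by (simp add: power_mult_distrib mult.assoc)
    qed
    then have f1: "2 * (A * U * D)\<^sup>2 * T \<le> 2 * (4 * A ^ 4 * S ^ 4 * U ^ 6 * D\<^sup>2) * T"
      using T0 by (intro mult_right_mono mult_left_mono) auto
    have f2: "(2 * A\<^sup>2 * S * U ^ 3 * D)\<^sup>2 * S\<^sup>2 = 4 * A ^ 4 * S ^ 4 * U ^ 6 * D\<^sup>2"
      by (simp add: power_mult_distrib power_mult[symmetric] power_add[symmetric] mult_ac) (simp add: power2_eq_square power4_eq_xxxx)?
    have f3: "2 * (2 * A\<^sup>2 * S * U ^ 3 * D)\<^sup>2 * S\<^sup>2 * real n = 2 * ((2 * A\<^sup>2 * S * U ^ 3 * D)\<^sup>2 * S\<^sup>2) * real n"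
      by (simp only: mult.assoc)
    have Qeq: "Q = 2 * (4 * A ^ 4 * S ^ 4 * U ^ 6 * D\<^sup>2) * T + 2 * (4 * A ^ 4 * S ^ 4 * U ^ 6 * D\<^sup>2) * real n"
      by (simp add: Q_def algebra_simps)
    show ?thesis unfolding f3 f2 Qeq using f1 by (rule add_right_mono)
  qed
  have XQ: "(\<Sum>q<K+n. (norm (X q))\<^sup>2) \<le> Q"
    unfolding X_def
  proof (rule order_trans[OF row_sums_l2 Qge[unfolded T_def]])
    fix i q assume iq: "i < n" "q < K + n"
    have "norm (of_real (x K i q) * f K n i q u - \<Phi> K u * of_real (x K i q)) = \<bar>x K i q\<bar> * norm (f K n i q u - \<Phi> K u)"
    proof -
      have "of_real (x K i q) * f K n i q u - \<Phi> K u * of_real (x K i q) = of_real (x K i q) * (f K n i q u - \<Phi> K u)"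
        by (simp add: algebra_simps)
      then show ?thesis by (simp add: norm_mult)
    qed
    also have "\<dots> \<le> S * (A * U\<^sup>2 * D * (x K i q)\<^sup>2)"
      using S_ge1 by (intro mult_mono x_abs_le dlow iq) auto
    also have "\<dots> \<le> 2 * A\<^sup>2 * S * U ^ 3 * D * (x K i q)\<^sup>2"
    proof -
      have "A \<le> 2 * A\<^sup>2" "U\<^sup>2 \<le> U ^ 3" using A1 A_le_sq U1 by (auto intro: power_increasing)
      then have "A * S * U\<^sup>2 * D * (x K i q)\<^sup>2 \<le> 2 * A\<^sup>2 * S * U ^ 3 * D * (x K i q)\<^sup>2"
        using S_ge1 U1 D0 A1 by (intro mult_mono mult_nonneg_nonneg) auto
      then show ?thesis by (simp add: mult_ac)
    qed
    finally show "norm (of_real (x K i q) * f K n i q u - \<Phi> K u * of_real (x K i q)) \<le> 2 * A\<^sup>2 * S * U ^ 3 * D * (x K i q)\<^sup>2" .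
  next
    have "1 * 1 * norm (\<Phi> K u) \<le> A * U * D" using A1 U1 D\<Phi> by (intro mult_mono) auto
    then show "norm (\<Phi> K u) \<le> A * U * D" by simp
  qed (use S_ge1 U1 D0 A1 in auto)
  have YQ: "(\<Sum>q<K+n. (norm (Y q))\<^sup>2) \<le> Q"
    unfolding Y_def
  proof (rule order_trans[OF row_sums_l2 Qge[unfolded T_def]])
    fix i q assume iq: "i < n" "q < K + n"
    let ?x = "x K i q" and ?f = "f K n i q u"
    have eq: "\<zeta> (u * ?x) * ?f - (- of_real (s2 * u) * \<Phi> K u) * of_real ?x
       = (\<zeta> (u * ?x) + of_real (s2 * (u * ?x))) * ?f - of_real (s2 * (u * ?x)) * (?f - \<Phi> K u)"
      by (simp add: algebra_simps)
    have "norm (\<zeta> (u * ?x) * ?f - (- of_real (s2 * u) * \<Phi> K u) * of_real ?x) \<le>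
        norm (\<zeta> (u * ?x) + of_real (s2 * (u * ?x))) * norm ?f + \<bar>s2 * (u * ?x)\<bar> * norm (?f - \<Phi> K u)"
      unfolding eq by (rule order_trans[OF norm_triangle_ineq4]) (simp add: norm_mult abs_mult)
    also have "\<dots> \<le> (A * (u * ?x)\<^sup>2) * D + (A * (U * S)) * (A * U\<^sup>2 * D * ?x\<^sup>2)"
    proof (intro add_mono mult_mono zeta_approx Df iq dlow)
      show "\<bar>s2 * (u * ?x)\<bar> \<le> A * (U * S)"
        unfolding abs_mult using A_ge moments_nonneg U1 x_abs_le S_ge1 by (intro mult_mono) auto
    qed (use A1 U1 S_ge1 in auto)
    also have "(A * (u * ?x)\<^sup>2) * D \<le> A\<^sup>2 * S * U ^ 3 * D * ?x\<^sup>2"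
    proof -
      have "u\<^sup>2 \<le> U ^ 3" using uU[of 2] U1 power_increasing[of 2 3 U] by simp
      then have "A * 1 * u\<^sup>2 * D * ?x\<^sup>2 \<le> A\<^sup>2 * S * U ^ 3 * D * ?x\<^sup>2"
        using A_le_sq S_ge1 U1 D0 A1 by (intro mult_mono mult_nonneg_nonneg) auto
      then show ?thesis by (simp add: mult_ac power_mult_distrib)
    qed
    also have "(A * (U * S)) * (A * U\<^sup>2 * D * ?x\<^sup>2) = A\<^sup>2 * S * U ^ 3 * D * ?x\<^sup>2"
      by (simp add: power2_eq_square power3_eq_cube mult_ac)
    finally show "norm (\<zeta> (u * ?x) * ?f - (- of_real (s2 * u) * \<Phi> K u) * of_real ?x) \<le> 2 * A\<^sup>2 * S * U ^ 3 * D * ?x\<^sup>2"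
      by (simp add: mult_ac)
  next
    show "norm (- of_real (s2 * u) * \<Phi> K u) \<le> A * U * D"
      unfolding norm_mult norm_minus_cancel norm_of_real abs_mult
      using A_ge moments_nonneg U1 D\<Phi> by (intro mult_mono) auto
  qed (use S_ge1 U1 D0 A1 in auto)
  define R where "R i j q = e K i j q u + of_real (u * x K j q) * \<zeta> (u * x K i q) - of_real (u * x K i q) * \<zeta> (- (u * x K j q))
      + of_real (s2 * (u * x K i q) * (u * x K j q))" for i j q
  have Rle: "norm (R i j q * (f K n i q u * cnj (f K n j q u))) \<le> 2 * A\<^sup>2 * U ^ 4 * D\<^sup>2 * ((x K i q)\<^sup>2 * (x K j q)\<^sup>2)"
    if "i < n" "j < n" for i j q
  proof -
    have "norm (R i j q) \<le> 2 * A\<^sup>2 * ((u * x K i q)\<^sup>2 * (u * x K j q)\<^sup>2)"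
      unfolding R_def e_def by (rule eps_approx4)
    also have "\<dots> = 2 * A\<^sup>2 * \<bar>u\<bar> ^ 4 * ((x K i q)\<^sup>2 * (x K j q)\<^sup>2)"
      by (simp add: power_mult_distrib power4_eq_xxxx power2_eq_square mult_ac)
    also have "\<dots> \<le> 2 * A\<^sup>2 * U ^ 4 * ((x K i q)\<^sup>2 * (x K j q)\<^sup>2)"
      by (intro mult_right_mono mult_left_mono uU) auto
    finally have "norm (R i j q) \<le> 2 * A\<^sup>2 * U ^ 4 * ((x K i q)\<^sup>2 * (x K j q)\<^sup>2)" .
    moreover have "norm (f K n i q u * cnj (f K n j q u)) \<le> D * D"
      unfolding norm_mult complex_mod_cnj using D0 by (intro mult_mono Df that) auto
    ultimately have "norm (R i j q) * norm (f K n i q u * cnj (f K n j q u)) \<le> (2 * A\<^sup>2 * U ^ 4 * ((x K i q)\<^sup>2 * (x K j q)\<^sup>2)) * (D * D)"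
      using U1 by (intro mult_mono) auto
    then show ?thesis by (simp add: norm_mult power2_eq_square mult_ac)
  qed
  have tm: "e K i j q u * (f K n i q u * cnj (f K n j q u)) =
      - of_real u * ((\<zeta> (u * x K i q) * f K n i q u) * cnj (of_real (x K j q) * f K n j q u))
      - of_real u * ((of_real (x K i q) * f K n i q u) * cnj (\<zeta> (u * x K j q) * f K n j q u))
      - of_real (s2 * u\<^sup>2) * ((of_real (x K i q) * f K n i q u) * cnj (of_real (x K j q) * f K n j q u))
      + R i j q * (f K n i q u * cnj (f K n j q u))" for i j q
    by (simp add: R_def zeta_cnj algebra_simps power2_eq_square)
  have prodsum: "(\<Sum>i<n. \<Sum>j<n. \<Sum>q<K+n. c * (p i q * cnj (p' j q))) = c * (\<Sum>q<K+n. (\<Sum>i<n. p i q) * cnj (\<Sum>j<n. p' j q))"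
    for c :: complex and p p' :: "nat \<Rightarrow> nat \<Rightarrow> complex"
  proof -
    have "(\<Sum>i<n. \<Sum>j<n. \<Sum>q<K+n. c * (p i q * cnj (p' j q))) = (\<Sum>i<n. \<Sum>q<K+n. \<Sum>j<n. c * (p i q * cnj (p' j q)))"
      by (intro sum.cong refl sum.swap)
    also have "\<dots> = (\<Sum>q<K+n. \<Sum>i<n. \<Sum>j<n. c * (p i q * cnj (p' j q)))" by (rule sum.swap)
    also have "\<dots> = c * (\<Sum>q<K+n. \<Sum>i<n. \<Sum>j<n. p i q * cnj (p' j q))"
      by (simp only: sum_distrib_left)
    also have "(\<lambda>q. \<Sum>i<n. \<Sum>j<n. p i q * cnj (p' j q)) = (\<lambda>q. (\<Sum>i<n. p i q) * cnj (\<Sum>j<n. p' j q))"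
      by (simp only: cnj_sum sum_product)
    finally show ?thesis .
  qed
  have Geq: "(\<Sum>i<n. \<Sum>j<n. G K n i j u) =
     - of_real u * (\<Sum>q<K+n. Y q * cnj (X q)) - of_real u * (\<Sum>q<K+n. X q * cnj (Y q))
     - of_real (s2 * u\<^sup>2) * (\<Sum>q<K+n. X q * cnj (X q)) + (\<Sum>i<n. \<Sum>j<n. \<Sum>q<K+n. R i j q * (f K n i q u * cnj (f K n j q u)))"
    unfolding G_def tm sum.distrib sum_subtractf prodsum X_def[symmetric] Y_def[symmetric] by simp
  have "norm (\<Sum>i<n. \<Sum>j<n. G K n i j u) \<le> norm (- of_real u * (\<Sum>q<K+n. Y q * cnj (X q))) + norm (of_real u * (\<Sum>q<K+n. X q * cnj (Y q)))
     + norm (of_real (s2 * u\<^sup>2) * (\<Sum>q<K+n. X q * cnj (X q))) + norm (\<Sum>i<n. \<Sum>j<n. \<Sum>q<K+n. R i j q * (f K n i q u * cnj (f K n j q u)))"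
    unfolding Geq
    by (intro order_trans[OF norm_triangle_ineq] add_right_mono order_trans[OF norm_triangle_ineq4] order_refl)
  also have "\<dots> \<le> U * Q + U * Q + (A * U\<^sup>2) * Q + 2 * A\<^sup>2 * U ^ 4 * D\<^sup>2 * (real n * S\<^sup>2)"
  proof (intro add_mono)
    have XY: "norm (\<Sum>q<K+n. a q * cnj (c q)) \<le> Q"
      if "(\<Sum>q<K+n. (norm (a q))\<^sup>2) \<le> Q" "(\<Sum>q<K+n. (norm (c q))\<^sup>2) \<le> Q" for a c :: "nat \<Rightarrow> complex"
    proof -
      have "norm (\<Sum>q<K+n. a q * cnj (c q)) \<le> (\<Sum>q<K+n. ((norm (a q))\<^sup>2 + (norm (c q))\<^sup>2) / 2)"
      proof (rule order_trans[OF norm_sum sum_mono])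
        fix q show "norm (a q * cnj (c q)) \<le> ((norm (a q))\<^sup>2 + (norm (c q))\<^sup>2) / 2"
          using sum_squares_bound[of "norm (a q)" "norm (c q)"] by (simp add: norm_mult)
      qed
      also have "\<dots> = ((\<Sum>q<K+n. (norm (a q))\<^sup>2) + (\<Sum>q<K+n. (norm (c q))\<^sup>2)) / 2"
        by (simp add: sum_divide_distrib[symmetric] sum.distrib)
      finally show ?thesis using that by simp
    qed
    show "norm (- of_real u * (\<Sum>q<K+n. Y q * cnj (X q))) \<le> U * Q"
      unfolding norm_mult norm_minus_cancel norm_of_real using U1 by (intro mult_mono XY XQ YQ) auto
    show "norm (of_real u * (\<Sum>q<K+n. X q * cnj (Y q))) \<le> U * Q"
      unfolding norm_mult norm_of_real using U1 by (intro mult_mono XY XQ YQ) auto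
    have "\<bar>s2 * u\<^sup>2\<bar> \<le> A * U\<^sup>2"
      unfolding abs_mult using A_ge moments_nonneg uU[of 2] by (intro mult_mono) auto
    then show "norm (of_real (s2 * u\<^sup>2) * (\<Sum>q<K+n. X q * cnj (X q))) \<le> (A * U\<^sup>2) * Q"
      unfolding norm_mult norm_of_real using A1 by (intro mult_mono XY XQ) auto
    have "norm (\<Sum>i<n. \<Sum>j<n. \<Sum>q<K+n. R i j q * (f K n i q u * cnj (f K n j q u)))
       \<le> (\<Sum>i<n. \<Sum>j<n. \<Sum>q<K+n. 2 * A\<^sup>2 * U ^ 4 * D\<^sup>2 * ((x K i q)\<^sup>2 * (x K j q)\<^sup>2))"
      by (intro order_trans[OF norm_sum] sum_mono Rle) auto
    also have "\<dots> = 2 * A\<^sup>2 * U ^ 4 * D\<^sup>2 * (\<Sum>i<n. \<Sum>j<n. k2 K n i j)"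
      unfolding k2_def by (simp only: sum_distrib_left)
    also have "\<dots> \<le> 2 * A\<^sup>2 * U ^ 4 * D\<^sup>2 * (real n * S\<^sup>2)"
      using U1 by (intro mult_left_mono k2_sum_le) auto
    finally show "norm (\<Sum>i<n. \<Sum>j<n. \<Sum>q<K+n. R i j q * (f K n i q u * cnj (f K n j q u))) \<le> 2 * A\<^sup>2 * U ^ 4 * D\<^sup>2 * (real n * S\<^sup>2)" .
  qed
  also have "\<dots> \<le> 3 * (A * U\<^sup>2 * Q) + 2 * A ^ 5 * S ^ 4 * U ^ 8 * D\<^sup>2 * (T + real n)"
  proof -
    have Q0: "0 \<le> Q" unfolding Q_def using T0 A1 S_ge1 U1 by auto
    have "1 * U \<le> A * U\<^sup>2" using A1 U1 by (intro mult_mono) (auto simp: power2_eq_square)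
    then have "U * Q \<le> A * U\<^sup>2 * Q" using Q0 by (intro mult_right_mono) auto
    moreover have "2 * A\<^sup>2 * U ^ 4 * D\<^sup>2 * (real n * S\<^sup>2) \<le> 2 * A ^ 5 * S ^ 4 * U ^ 8 * D\<^sup>2 * (T + real n)"
    proof -
      have "A\<^sup>2 \<le> A ^ 5" "U ^ 4 \<le> U ^ 8" "S\<^sup>2 \<le> S ^ 4" using A1 U1 S_ge1 by (auto intro: power_increasing)
      then have "2 * A\<^sup>2 * S\<^sup>2 * U ^ 4 * D\<^sup>2 * real n \<le> 2 * A ^ 5 * S ^ 4 * U ^ 8 * D\<^sup>2 * (T + real n)"
        using T0 A1 U1 S_ge1 by (intro mult_mono mult_nonneg_nonneg) auto
      then show ?thesis by (simp add: mult_ac)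
    qed
    ultimately show ?thesis by linarith
  qed
  also have "\<dots> = 26 * A ^ 5 * S ^ 4 * U ^ 8 * D\<^sup>2 * (T + real n)"
  proof -
    have "A * U\<^sup>2 * Q = 8 * (A * A ^ 4) * S ^ 4 * (U\<^sup>2 * U ^ 6) * D\<^sup>2 * (T + real n)" unfolding Q_def by (simp only: mult_ac)
    moreover have "A * A ^ 4 = A ^ 5" "U\<^sup>2 * U ^ 6 = U ^ 8" by (simp_all flip: power_Suc power_add)
    ultimately show ?thesis by simp
  qed
  finally show ?thesis unfolding U_def T_def .
qed

end

section \<open>Expansion of the truncated pair sums\<close>

context noise_filter
begin

lemma T_nonneg: "0 \<le> (\<Sum>i<n. \<Sum>j<n. r K n i j)"
  unfolding r_T by (intro sum_nonneg) auto

lemma abs_x_row: "(\<Sum>q<K+n. \<bar>x K i q\<bar> * \<bar>x K j q\<bar>) \<le> S"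
proof -
  have "(\<Sum>q<K+n. \<bar>x K i q\<bar> * \<bar>x K j q\<bar>) \<le> (\<Sum>q<K+n. ((x K i q)\<^sup>2 + (x K j q)\<^sup>2) / 2)"
  proof (rule sum_mono)
    fix q show "\<bar>x K i q\<bar> * \<bar>x K j q\<bar> \<le> ((x K i q)\<^sup>2 + (x K j q)\<^sup>2) / 2"
      using sum_squares_bound[of "\<bar>x K i q\<bar>" "\<bar>x K j q\<bar>"] by simp
  qed
  also have "\<dots> = ((\<Sum>q<K+n. (x K i q)\<^sup>2) + (\<Sum>q<K+n. (x K j q)\<^sup>2)) / 2"
    by (simp add: sum_divide_distrib[symmetric] sum.distrib)
  also have "\<dots> \<le> S" using x_row[where m = "K+n" and i=i and K=K] x_row[where m = "K+n" and i=j and K=K] by simp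
  finally show ?thesis .
qed

lemma G_le:
  assumes Df: "\<And>q. norm (f K n i q u) \<le> D" "\<And>q. norm (f K n j q u) \<le> D"
  shows "norm (G K n i j u) \<le> 2 * A\<^sup>2 * u\<^sup>2 * S * D\<^sup>2"
proof -
  have "norm (G K n i j u) \<le> (\<Sum>q<K+n. 2 * A\<^sup>2 * u\<^sup>2 * D\<^sup>2 * (\<bar>x K i q\<bar> * \<bar>x K j q\<bar>))"
    unfolding G_def
  proof (rule order_trans[OF norm_sum sum_mono])
    fix q
    have "norm (e K i j q u) \<le> 2 * A\<^sup>2 * (\<bar>u * x K i q\<bar> * \<bar>u * x K j q\<bar>)" unfolding e_def by (rule eps_le)
    moreover have ff: "norm (f K n i q u) * norm (f K n j q u) \<le> D * D"
      using Df[of q] order_trans[OF norm_ge_zero Df(1)[of q]] by (intro mult_mono) auto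
    ultimately have "norm (e K i j q u) * (norm (f K n i q u) * norm (f K n j q u)) \<le> (2 * A\<^sup>2 * (\<bar>u * x K i q\<bar> * \<bar>u * x K j q\<bar>)) * (D * D)"
      by (rule mult_mono) auto
    also have "\<dots> = 2 * A\<^sup>2 * (\<bar>u\<bar> * \<bar>u\<bar>) * D\<^sup>2 * (\<bar>x K i q\<bar> * \<bar>x K j q\<bar>)"
      by (simp only: abs_mult power2_eq_square mult_ac)
    also have "\<bar>u\<bar> * \<bar>u\<bar> = u\<^sup>2" by (simp add: power2_eq_square)
    finally show "norm (e K i j q u * (f K n i q u * cnj (f K n j q u))) \<le> 2 * A\<^sup>2 * u\<^sup>2 * D\<^sup>2 * (\<bar>x K i q\<bar> * \<bar>x K j q\<bar>)"
      by (simp add: norm_mult)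
  qed
  also have "\<dots> = 2 * A\<^sup>2 * u\<^sup>2 * D\<^sup>2 * (\<Sum>q<K+n. \<bar>x K i q\<bar> * \<bar>x K j q\<bar>)" by (simp add: sum_distrib_left)
  also have "\<dots> \<le> 2 * A\<^sup>2 * u\<^sup>2 * D\<^sup>2 * S" by (intro mult_left_mono abs_x_row) auto
  finally show ?thesis by (simp add: mult_ac)
qed

text \<open>
  The defects of a pair sum up to \<open>s2 * u\<^sup>2 * r K n i j\<close>, so the quadratic term of the product expansion is half of the
  square of this number. The parameter \<open>\<eta>\<close> is kept free until the sum over the pairs is compared with \<open>Wn\<close>.
\<close>

lemma pair_expansion:
  assumes D: "\<And>t E. t \<in> closed_segment 0 1 \<Longrightarrow> E \<subseteq> {..<K+n} \<Longrightarrow> card ({..<K+n} - E) \<le> 2 \<Longrightarrow>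
        norm (\<Prod>q\<in>E. B K i j q u + t * e K i j q u) \<le> D"
    and ij: "i \<le> n" "j \<le> n" and \<eta>: "0 < \<eta>" "\<eta> \<le> 1"
  shows "norm (\<psi> K n i j u - \<Phi> K u * cnj (\<Phi> K u) - G K n i j u
       - of_real (s2\<^sup>2 / 2 * u ^ 4 * (r K n i j)\<^sup>2) * (\<Phi> K u * cnj (\<Phi> K u)))
     \<le> (12 + 8 * S ^ 3) * (24 * A ^ 4 * S\<^sup>2) ^ 3 * (1 + \<bar>u\<bar>) ^ 12 * D * (k2 K n i j / \<eta> + \<eta> * (r K n i j)\<^sup>2 + \<bar>r K n i j\<bar> ^ 3)"
proof -
  define V where "V = (1 + \<bar>u\<bar>) ^ 4"
  define c where "c = 24 * A ^ 4 * S\<^sup>2"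
  define t where "t = sqrt (k2 K n i j)"
  define s where "s = (\<Sum>q<K+n. e K i j q u)"
  define s0 where "s0 = s2 * u\<^sup>2 * r K n i j"
  define \<kappa> where "\<kappa> = (\<Sum>q<K+n. (norm (e K i j q u))\<^sup>2)"
  define \<mu> where "\<mu> q = min 2 (2 * A\<^sup>2 * ((u * x K i q)\<^sup>2 + (u * x K j q)\<^sup>2))" for q
  define \<tau> where "\<tau> = (\<Sum>q<K+n. norm (e K i j q u) * \<mu> q)"
  let ?P = "\<Phi> K u * cnj (\<Phi> K u)"
  have A1: "1 \<le> A" by (rule A_ge)
  have V1: "1 \<le> V" unfolding V_def by (intro one_le_power) auto
  have t0: "0 \<le> t" "t\<^sup>2 = k2 K n i j" using k2_nonneg by (auto simp: t_def)
  have cA: "A \<le> c" "1 \<le> c"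
  proof -
    have "1 * A \<le> 24 * A ^ 4" using A1 self_le_power[of A 4] by (intro mult_mono) auto
    then have "A * 1 \<le> 24 * A ^ 4 * S\<^sup>2" using A1 S_ge1 by (intro mult_mono one_le_power) auto
    then show "A \<le> c" "1 \<le> c" using A1 by (auto simp: c_def)
  qed
  have tS: "t \<le> S ^ 3"
  proof -
    have S3: "1 \<le> S ^ 3" using S_ge1 by simp
    have "t\<^sup>2 \<le> S ^ 3" unfolding t0 by (rule k2_le)
    also have "\<dots> \<le> (S ^ 3)\<^sup>2" using S3 self_le_power[of "S ^ 3" 2] by simp
    finally show ?thesis by (rule power2_le_imp_le) (use S_ge1 in auto)
  qed
  have sd: "norm (s - of_real s0) \<le> c * V * t"
    unfolding s_def s0_def V_def c_def t_def by (rule pair_errors(1))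
  have tau: "\<tau> \<le> c * V * t"
    unfolding \<tau>_def \<mu>_def V_def c_def t_def by (rule pair_errors(2))
  have kap: "\<kappa> \<le> c * V * t\<^sup>2"
    unfolding \<kappa>_def V_def c_def t_def by (rule pair_errors(3))
  have s0le: "\<bar>s0\<bar> \<le> c * V * \<bar>r K n i j\<bar>"
  proof -
    have u2: "u\<^sup>2 \<le> V"
    proof -
      have "u\<^sup>2 \<le> (1 + \<bar>u\<bar>)\<^sup>2" using power_mono[of "\<bar>u\<bar>" "1 + \<bar>u\<bar>" 2] by simp
      also have "\<dots> \<le> V" unfolding V_def by (intro power_increasing) auto
      finally show ?thesis .
    qed
    have "s2 * u\<^sup>2 * \<bar>r K n i j\<bar> \<le> c * V * \<bar>r K n i j\<bar>"
      using u2 A_ge(2) cA(1,2) V1 by (intro mult_mono) auto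
    then show ?thesis using moments_nonneg(1) by (simp add: s0_def abs_mult)
  qed
  have sle: "norm s \<le> c * V * (\<bar>r K n i j\<bar> + t)"
  proof -
    have "norm s \<le> norm (s - of_real s0) + norm (complex_of_real s0)"
      using norm_triangle_ineq[of "s - of_real s0" "of_real s0"] by simp
    then show ?thesis using sd s0le by (simp add: algebra_simps)
  qed
  have seg: "(0::complex) \<in> closed_segment 0 1" by simp
  have D0: "0 \<le> D" using order_trans[OF norm_ge_zero D[OF seg, of "{..<K+n}"]] by simp
  have PD: "norm ?P \<le> D" using D[OF seg, of "{..<K+n}"] prod_B[OF ij, of K u] by simp
  have prod2: "norm (\<psi> K n i j u - ?P - G K n i j u - s\<^sup>2 / 2 * ?P)
     \<le> D * (5 * \<kappa> + 2 * \<tau> * norm s + \<tau>\<^sup>2 + (norm s)\<^sup>2 * (norm s + \<tau>))"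
  proof -
    have "norm ((\<Prod>p<K+n. B K i j p u + e K i j p u) - (\<Prod>p<K+n. B K i j p u)
        - (\<Sum>p<K+n. e K i j p u * (\<Prod>q\<in>{..<K+n}-{p}. B K i j q u)) - s\<^sup>2 / 2 * (\<Prod>p<K+n. B K i j p u))
      \<le> D * (5 * \<kappa> + 2 * \<tau> * norm s + \<tau>\<^sup>2 + (norm s)\<^sup>2 * (norm s + \<tau>))"
      unfolding s_def \<tau>_def \<kappa>_def
    proof (rule prod_second_order_expansion)
      fix q and y :: complex assume "y \<in> closed_segment 0 1"
      then show "norm (1 - (B K i j q u + y * e K i j q u)) \<le> \<mu> q"
        unfolding \<mu>_def by (rule one_minus_mixed)
    qed (use D in \<open>auto simp: \<mu>_def\<close>)
    then show ?thesis unfolding psi_eq prod_B[OF ij] prod_B_remove G_def .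
  qed
  have sq: "norm (s\<^sup>2 / 2 * ?P - of_real (s0\<^sup>2 / 2) * ?P) \<le> D * (norm (s - of_real s0) * (norm s + \<bar>s0\<bar>) / 2)"
  proof -
    have eq: "s\<^sup>2 / 2 * ?P - of_real (s0\<^sup>2 / 2) * ?P = (s - of_real s0) * (s + of_real s0) / 2 * ?P"
      by (simp add: power2_eq_square algebra_simps diff_divide_distrib)
    have "norm (s\<^sup>2 / 2 * ?P - of_real (s0\<^sup>2 / 2) * ?P) = norm (s - of_real s0) * norm (s + of_real s0) / 2 * norm ?P"
      unfolding eq by (simp add: norm_mult norm_divide)
    also have "\<dots> \<le> norm (s - of_real s0) * (norm s + \<bar>s0\<bar>) / 2 * D"
      using norm_triangle_ineq[of s "of_real s0"] D0
      by (intro mult_mono divide_right_mono PD mult_left_mono) auto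
    finally show ?thesis by (simp add: mult_ac)
  qed
  have "\<psi> K n i j u - ?P - G K n i j u - of_real (s0\<^sup>2 / 2) * ?P
     = (\<psi> K n i j u - ?P - G K n i j u - s\<^sup>2 / 2 * ?P) + (s\<^sup>2 / 2 * ?P - of_real (s0\<^sup>2 / 2) * ?P)" by simp
  then have "norm (\<psi> K n i j u - ?P - G K n i j u - of_real (s0\<^sup>2 / 2) * ?P)
      \<le> norm (\<psi> K n i j u - ?P - G K n i j u - s\<^sup>2 / 2 * ?P) + norm (s\<^sup>2 / 2 * ?P - of_real (s0\<^sup>2 / 2) * ?P)"
    by (metis norm_triangle_ineq)
  also have "\<dots> \<le> D * (5 * \<kappa> + 2 * \<tau> * norm s + \<tau>\<^sup>2 + (norm s)\<^sup>2 * (norm s + \<tau>))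
      + D * (norm (s - of_real s0) * (norm s + \<bar>s0\<bar>) / 2)" by (intro add_mono prod2 sq)
  also have "\<dots> = D * (5 * \<kappa> + 2 * \<tau> * norm s + \<tau>\<^sup>2 + (norm s)\<^sup>2 * (norm s + \<tau>) + norm (s - of_real s0) * (norm s + \<bar>s0\<bar>) / 2)"
    by (simp only: distrib_left)
  also have "\<dots> \<le> D * ((12 + 8 * S ^ 3) * (c * V) ^ 3 * (t\<^sup>2 / \<eta> + \<eta> * \<bar>r K n i j\<bar>\<^sup>2 + \<bar>r K n i j\<bar> ^ 3))"
  proof (intro mult_left_mono D0 third_order_arith)
    have "1 * 1 \<le> c * V" using cA V1 by (intro mult_mono) auto
    then show "1 \<le> c * V" by simp
    show "0 \<le> \<kappa>" unfolding \<kappa>_def by (intro sum_nonneg) auto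
    show "0 \<le> \<tau>" unfolding \<tau>_def \<mu>_def by (intro sum_nonneg mult_nonneg_nonneg) auto
  qed (use t0 tS \<eta> kap tau sle sd s0le in auto)
  also have "of_real (s0\<^sup>2 / 2) = (of_real (s2\<^sup>2 / 2 * u ^ 4 * (r K n i j)\<^sup>2) :: complex)"
    by (simp add: s0_def power_mult_distrib)
  also have "D * ((12 + 8 * S ^ 3) * (c * V) ^ 3 * (t\<^sup>2 / \<eta> + \<eta> * \<bar>r K n i j\<bar>\<^sup>2 + \<bar>r K n i j\<bar> ^ 3))
     = (12 + 8 * S ^ 3) * c ^ 3 * V ^ 3 * D * (k2 K n i j / \<eta> + \<eta> * (r K n i j)\<^sup>2 + \<bar>r K n i j\<bar> ^ 3)"
    by (simp only: t0 power2_abs power_mult_distrib mult_ac)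
  also have "V ^ 3 = (1 + \<bar>u\<bar>) ^ 12" by (simp add: V_def power_mult[symmetric])
  finally show ?thesis unfolding c_def .
qed

text \<open>
  The expansion of a pair is available only for large lags, but the first order terms must be summed over all pairs in order to
  factor. The small lags that are added for this purpose contribute \<open>O(n)\<close>.
\<close>

theorem truncated_expansion:
  "\<exists>k0 C. C \<ge> 0 \<and> (\<forall>K>k0. \<forall>n u \<eta>. 0 < \<eta> \<longrightarrow> \<eta> \<le> 1 \<longrightarrow>
     norm ((\<Sum>i<n. \<Sum>j<n. if lag i j > k0 then \<psi> K n i j u - \<Phi> K u * cnj (\<Phi> K u) else 0)
       - of_real (s2\<^sup>2 / 2 * u ^ 4 * (\<Sum>i<n. \<Sum>j<n. (r K n i j)\<^sup>2)) * (\<Phi> K u * cnj (\<Phi> K u)))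
     \<le> C / (1 + \<bar>u\<bar>)\<^sup>2 * (real n / \<eta> + (\<Sum>i<n. \<Sum>j<n. r K n i j) + (\<Sum>i<n. \<Sum>j<n. \<eta> * (r K n i j)\<^sup>2 + \<bar>r K n i j\<bar> ^ 3)))"
proof -
  obtain k0 D0 where D0: "D0 \<ge> 1" and dec0: "\<forall>K>k0. \<forall>n i j u. i < n \<longrightarrow> j < n \<longrightarrow>
     norm (\<Phi> K u) \<le> D0 / (1 + \<bar>u\<bar>) ^ 14 \<and> (\<forall>q. norm (f K n i q u) \<le> D0 / (1 + \<bar>u\<bar>) ^ 14) \<and>
     (lag i j > k0 \<longrightarrow> (\<forall>t\<in>closed_segment 0 1. \<forall>E\<subseteq>{..<K+n}. card ({..<K+n} - E) \<le> 2 \<longrightarrow>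
        norm (\<Prod>q\<in>E. B K i j q u + t * e K i j q u) \<le> D0 / (1 + \<bar>u\<bar>) ^ 14))"
    using uniform_decay by (elim exE conjE)
  note dec = dec0[rule_format]
  have A1: "1 \<le> A" by (rule A_ge)
  define c1 where "c1 = (12 + 8 * S ^ 3) * (24 * A ^ 4 * S\<^sup>2) ^ 3 * D0 * S\<^sup>2"
  define c2 where "c2 = 26 * A ^ 5 * S ^ 4 * D0\<^sup>2"
  define c3 where "c3 = (2 * real k0 + 1) * (2 * A\<^sup>2 * S * D0\<^sup>2 + A\<^sup>2 * S\<^sup>2 * D0)"
  define C where "C = c1 + c2 + c3"
  have c0: "0 \<le> c1" "0 \<le> c2" "0 \<le> c3" unfolding c1_def c2_def c3_def using A1 S_ge1 D0 by auto
  have main: "norm ((\<Sum>i<n. \<Sum>j<n. if lag i j > k0 then \<psi> K n i j u - \<Phi> K u * cnj (\<Phi> K u) else 0)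
       - of_real (s2\<^sup>2 / 2 * u ^ 4 * (\<Sum>i<n. \<Sum>j<n. (r K n i j)\<^sup>2)) * (\<Phi> K u * cnj (\<Phi> K u)))
     \<le> C / (1 + \<bar>u\<bar>)\<^sup>2 * (real n / \<eta> + (\<Sum>i<n. \<Sum>j<n. r K n i j) + (\<Sum>i<n. \<Sum>j<n. \<eta> * (r K n i j)\<^sup>2 + \<bar>r K n i j\<bar> ^ 3))"
    if K: "K > k0" and \<eta>: "0 < \<eta>" "\<eta> \<le> 1" for K n u \<eta>
  proof (cases "n = 0")
    case True then show ?thesis by simp
  next
    case False
    then have n: "0 < n" by simp
    define U where "U = 1 + \<bar>u\<bar>"
    define D where "D = D0 / U ^ 14"
    have U1: "1 \<le> U" by (simp add: U_def)
    have D1: "0 \<le> D" "D \<le> D0" unfolding D_def using U1 D0 one_le_power[OF U1, of 14] by (auto simp: field_simps mult_le_cancel_left1)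
    have uU: "\<bar>u\<bar> ^ k \<le> U ^ k" for k unfolding U_def by (intro power_mono) auto
    have DU: "U ^ k * D \<le> D0 / U\<^sup>2" if "k \<le> 12" for k
    proof -
      have "U ^ k * D \<le> U ^ 12 * D" using U1 D1 that by (intro mult_right_mono power_increasing) auto
      also have "\<dots> = D0 / U\<^sup>2"
      proof -
        have "U ^ 14 = U ^ 12 * U\<^sup>2" by (simp flip: power_add)
        moreover have "U ^ 12 \<noteq> 0" "U\<^sup>2 \<noteq> 0" using U1 by auto
        ultimately show ?thesis unfolding D_def by (simp only:) (simp add: field_simps)
      qed
      finally show ?thesis .
    qed
    have \<Phi>D: "norm (\<Phi> K u) \<le> D" using dec[OF K n n] by (auto simp: D_def U_def)
    have fD: "norm (f K n i q u) \<le> D" if "i < n" for i q using dec[OF K that that] by (auto simp: D_def U_def)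
    define P where "P = \<Phi> K u * cnj (\<Phi> K u)"
    have \<Phi>1: "norm (\<Phi> K u) \<le> 1" unfolding \<Phi>_def prod_norm[symmetric] by (intro prod_le_1) (auto simp: cmod_char_le_1)
    have PD: "norm P \<le> D"
      using mult_mono[OF \<Phi>D \<Phi>1 D1(1) norm_ge_zero] by (simp add: P_def norm_mult)
    define M where "M i j = of_real (s2\<^sup>2 / 2 * u ^ 4 * (r K n i j)\<^sup>2) * P" for i j
    define T where "T = (\<Sum>i<n. \<Sum>j<n. r K n i j)"
    define Z where "Z = (\<Sum>i<n. \<Sum>j<n. \<eta> * (r K n i j)\<^sup>2 + \<bar>r K n i j\<bar> ^ 3)"
    have Z0: "0 \<le> Z" unfolding Z_def using \<eta> by (intro sum_nonneg add_nonneg_nonneg) auto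
    have T0: "0 \<le> T" unfolding T_def by (rule T_nonneg)
    have n\<eta>: "real n \<le> real n / \<eta>" using \<eta> by (simp add: field_simps mult_left_le_one_le)
    have dec3: "(\<Sum>i<n. \<Sum>j<n. if lag i j > k0 then \<psi> K n i j u - P else 0) - (\<Sum>i<n. \<Sum>j<n. M i j)
       = (\<Sum>i<n. \<Sum>j<n. if lag i j > k0 then \<psi> K n i j u - P - G K n i j u - M i j else 0)
       + (\<Sum>i<n. \<Sum>j<n. G K n i j u) - (\<Sum>i<n. \<Sum>j<n. if lag i j > k0 then 0 else G K n i j u + M i j)"
      unfolding sum.distrib[symmetric] sum_subtractf[symmetric] by (intro sum.cong refl) auto
    have e1: "norm (\<Sum>i<n. \<Sum>j<n. if lag i j > k0 then \<psi> K n i j u - P - G K n i j u - M i j else 0)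
       \<le> c1 / U\<^sup>2 * (real n / \<eta> + Z)"
    proof -
      define cc where "cc = (12 + 8 * S ^ 3) * (24 * A ^ 4 * S\<^sup>2) ^ 3"
      have cc0: "0 \<le> cc" unfolding cc_def using S_ge1 by auto
      have "norm (\<Sum>i<n. \<Sum>j<n. if lag i j > k0 then \<psi> K n i j u - P - G K n i j u - M i j else 0)
         \<le> (\<Sum>i<n. \<Sum>j<n. cc * (U ^ 12 * D) * (k2 K n i j / \<eta> + (\<eta> * (r K n i j)\<^sup>2 + \<bar>r K n i j\<bar> ^ 3)))"
      proof (intro order_trans[OF norm_sum] sum_mono)
        fix i j assume "i \<in> {..<n}" "j \<in> {..<n}"
        then have ij: "i < n" "j < n" by auto
        have q0: "0 \<le> k2 K n i j / \<eta> + (\<eta> * (r K n i j)\<^sup>2 + \<bar>r K n i j\<bar> ^ 3)"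
          using \<eta> k2_nonneg by (intro add_nonneg_nonneg) auto
        show "norm (if lag i j > k0 then \<psi> K n i j u - P - G K n i j u - M i j else 0)
          \<le> cc * (U ^ 12 * D) * (k2 K n i j / \<eta> + (\<eta> * (r K n i j)\<^sup>2 + \<bar>r K n i j\<bar> ^ 3))"
        proof (cases "lag i j > k0")
          case True
          have "norm (\<psi> K n i j u - P - G K n i j u - M i j) \<le>
            cc * U ^ 12 * D * (k2 K n i j / \<eta> + \<eta> * (r K n i j)\<^sup>2 + \<bar>r K n i j\<bar> ^ 3)"
            unfolding P_def M_def cc_def U_def
            by (rule pair_expansion) (use dec[OF K ij] True ij \<eta> in \<open>auto simp: D_def U_def\<close>)
          then show ?thesis using True by (simp add: add.assoc mult.assoc)
        next
          case False
          then show ?thesis using q0 cc0 U1 D1 by auto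
        qed
      qed
      also have "\<dots> = cc * (U ^ 12 * D) * ((\<Sum>i<n. \<Sum>j<n. k2 K n i j) / \<eta> + Z)"
        unfolding Z_def by (simp add: sum_distrib_left[symmetric] sum.distrib sum_divide_distrib[symmetric])
      also have "\<dots> \<le> cc * (D0 / U\<^sup>2) * ((real n * S\<^sup>2) / \<eta> + S\<^sup>2 * Z)"
      proof -
        have "1 * Z \<le> S\<^sup>2 * Z" using S_ge1 Z0 by (intro mult_right_mono) auto
        then show ?thesis
          using \<eta> Z0 cc0 U1 D1 k2_nonneg DU[of 12] k2_sum_le
          by (intro mult_mono add_mono divide_right_mono) (auto intro!: add_nonneg_nonneg divide_nonneg_nonneg sum_nonneg)
      qed
      also have "\<dots> = c1 / U\<^sup>2 * (real n / \<eta> + Z)"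
        unfolding c1_def cc_def[symmetric] by (simp add: algebra_simps add_divide_distrib)
      finally show ?thesis .
    qed
    have e2: "norm (\<Sum>i<n. \<Sum>j<n. G K n i j u) \<le> c2 / U\<^sup>2 * (real n / \<eta> + T)"
    proof -
      have "norm (\<Sum>i<n. \<Sum>j<n. G K n i j u) \<le> 26 * A ^ 5 * S ^ 4 * U ^ 8 * D\<^sup>2 * (T + real n)"
        unfolding U_def T_def by (rule first_order_sum[OF fD \<Phi>D])
      also have "\<dots> = 26 * A ^ 5 * S ^ 4 * ((U ^ 8 * D) * D) * (T + real n)" by (simp add: power2_eq_square mult_ac)
      also have "\<dots> \<le> 26 * A ^ 5 * S ^ 4 * ((D0 / U\<^sup>2) * D0) * (T + real n / \<eta>)"
        using DU[of 8] D1 D0 U1 A1 S_ge1 T0 n\<eta> by (intro mult_mono add_mono) auto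
      also have "\<dots> = c2 / U\<^sup>2 * (real n / \<eta> + T)" by (simp add: c2_def power2_eq_square mult_ac add_ac)
      finally show ?thesis .
    qed
    have e3: "norm (\<Sum>i<n. \<Sum>j<n. if lag i j > k0 then 0 else G K n i j u + M i j) \<le> c3 / U\<^sup>2 * (real n / \<eta>)"
    proof -
      let ?H = "(2 * A\<^sup>2 * S * D0\<^sup>2 + A\<^sup>2 * S\<^sup>2 * D0) / U\<^sup>2"
      have "norm (\<Sum>i<n. \<Sum>j<n. if lag i j > k0 then 0 else G K n i j u + M i j) \<le> real n * (2 * real k0 + 1) * ?H"
      proof (rule small_lag_sum)
        fix i j assume ij: "i < n" "j < n"
        have "norm (G K n i j u) \<le> 2 * A\<^sup>2 * u\<^sup>2 * S * D\<^sup>2" by (rule G_le) (use fD ij in auto)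
        also have "\<dots> \<le> 2 * A\<^sup>2 * U\<^sup>2 * S * (D * D)"
          unfolding power2_eq_square[of D] using uU[of 2] S_ge1 by (intro mult_right_mono mult_left_mono) auto
        also have "\<dots> = 2 * A\<^sup>2 * S * ((U\<^sup>2 * D) * D)" by (simp add: mult_ac)
        also have "\<dots> \<le> 2 * A\<^sup>2 * S * ((D0 / U\<^sup>2) * D0)"
          using DU[of 2] D1 D0 U1 S_ge1 by (intro mult_left_mono mult_mono) auto
        finally have g: "norm (G K n i j u) \<le> 2 * A\<^sup>2 * S * D0\<^sup>2 / U\<^sup>2" by (simp add: power2_eq_square mult_ac)
        have "norm (M i j) = s2\<^sup>2 / 2 * \<bar>u\<bar> ^ 4 * \<bar>r K n i j\<bar>\<^sup>2 * norm P"
          by (simp add: M_def norm_mult abs_mult del: of_real_mult of_real_power of_real_divide)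
        also have "\<dots> \<le> A\<^sup>2 * U ^ 4 * S\<^sup>2 * D"
        proof -
          have "s2\<^sup>2 \<le> A\<^sup>2" using A_ge moments_nonneg by (intro power_mono) auto
          then have "s2\<^sup>2 / 2 \<le> A\<^sup>2" using zero_le_power2[of s2] by linarith
          then show ?thesis using uU[of 1] r_abs_le PD U1 by (intro mult_mono power_mono) auto
        qed
        also have "\<dots> = A\<^sup>2 * S\<^sup>2 * (U ^ 4 * D)" by (simp add: mult_ac)
        also have "\<dots> \<le> A\<^sup>2 * S\<^sup>2 * (D0 / U\<^sup>2)" by (intro mult_left_mono DU) auto
        finally have "norm (M i j) \<le> A\<^sup>2 * S\<^sup>2 * D0 / U\<^sup>2" by simp
        then show "norm (G K n i j u + M i j) \<le> ?H"
          using norm_triangle_ineq[of "G K n i j u" "M i j"] g by (simp add: add_divide_distrib)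
      qed (use S_ge1 D0 U1 in auto)
      also have "\<dots> = c3 / U\<^sup>2 * real n" by (simp add: c3_def mult_ac)
      also have "\<dots> \<le> c3 / U\<^sup>2 * (real n / \<eta>)" using c0 by (intro mult_left_mono n\<eta>) auto
      finally show ?thesis .
    qed
    have "norm ((\<Sum>i<n. \<Sum>j<n. if lag i j > k0 then \<psi> K n i j u - P else 0) - (\<Sum>i<n. \<Sum>j<n. M i j))
      \<le> c1 / U\<^sup>2 * (real n / \<eta> + Z) + c2 / U\<^sup>2 * (real n / \<eta> + T) + c3 / U\<^sup>2 * (real n / \<eta>)"
      unfolding dec3
      by (intro order_trans[OF norm_triangle_ineq4] add_mono order_trans[OF norm_triangle_ineq] e1 e2 e3)
    also have "\<dots> \<le> c1 / U\<^sup>2 * (real n / \<eta> + T + Z) + c2 / U\<^sup>2 * (real n / \<eta> + T + Z) + c3 / U\<^sup>2 * (real n / \<eta> + T + Z)"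
    proof -
      have m: "c / U\<^sup>2 * v \<le> c / U\<^sup>2 * w" if "0 \<le> c" "v \<le> w" for c v w
        using that by (intro mult_left_mono) auto
      have "real n / \<eta> + Z \<le> real n / \<eta> + T + Z" "real n / \<eta> + T \<le> real n / \<eta> + T + Z"
        "real n / \<eta> \<le> real n / \<eta> + T + Z" using T0 Z0 by auto
      from m[OF c0(1) this(1)] m[OF c0(2) this(2)] m[OF c0(3) this(3)]
      show ?thesis by (rule add_mono[OF add_mono])
    qed
    also have "\<dots> = C / U\<^sup>2 * (real n / \<eta> + T + Z)" by (simp add: C_def add_divide_distrib algebra_simps)
    finally have fin: "norm ((\<Sum>i<n. \<Sum>j<n. if lag i j > k0 then \<psi> K n i j u - P else 0) - (\<Sum>i<n. \<Sum>j<n. M i j))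
      \<le> C / U\<^sup>2 * (real n / \<eta> + T + Z)" .
    have ms: "(\<Sum>i<n. \<Sum>j<n. M i j) = of_real (s2\<^sup>2 / 2 * u ^ 4 * (\<Sum>i<n. \<Sum>j<n. (r K n i j)\<^sup>2)) * P"
      by (simp add: M_def sum_distrib_left sum_distrib_right)
    show ?thesis using fin unfolding ms unfolding P_def U_def T_def Z_def .
  qed
  show ?thesis using c0 main by (intro exI[of _ k0] exI[of _ C]) (auto simp: C_def)
qed

end

section \<open>Passage to the linear process\<close>

lemma (in prob_space) indep_vars_reindex_inj:
  assumes ind: "indep_vars (\<lambda>_. S) X (f ` I)" and inj: "inj_on f I"
  shows "indep_vars (\<lambda>_. S) (\<lambda>i. X (f i)) I"
  unfolding indep_vars_def2 indep_sets_def
proof (intro conjI ballI allI impI)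
  fix i assume "i \<in> I"
  then show "random_variable S (X (f i))" "{X (f i) -` A \<inter> space M |A. A \<in> sets S} \<subseteq> events"
    using ind unfolding indep_vars_def2 indep_sets_def by auto
next
  fix J A assume J: "J \<subseteq> I" "J \<noteq> {}" "finite J" and A: "A \<in> (\<Pi> i\<in>J. {X (f i) -` A \<inter> space M |A. A \<in> sets S})"
  have injJ: "inj_on f J" using inj J by (meson inj_on_subset)
  define A' where "A' k = A (the_inv_into J f k)" for k
  have A': "A' (f j) = A j" if "j \<in> J" for j
    unfolding A'_def using that injJ by (simp add: the_inv_into_f_f)
  have "A' \<in> (\<Pi> k\<in>f ` J. {X k -` A \<inter> space M |A. A \<in> sets S})"
    using A A' by (auto simp: Pi_iff)
  then have "prob (\<Inter>k\<in>f ` J. A' k) = (\<Prod>k\<in>f ` J. prob (A' k))"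
    using J by (intro ind[unfolded indep_vars_def2 indep_sets_def, THEN conjunct2, THEN conjunct2, rule_format] image_mono) auto
  moreover have "(\<Inter>k\<in>f ` J. A' k) = (\<Inter>j\<in>J. A j)" using A' by auto
  moreover have "(\<Prod>k\<in>f ` J. prob (A' k)) = (\<Prod>j\<in>J. prob (A j))"
    by (subst prod.reindex[OF injJ]) (auto simp: A')
  ultimately show "prob (\<Inter>j\<in>J. A j) = (\<Prod>j\<in>J. prob (A j))" by simp
qed

context noise_filter
begin

lemma r_tendsto: "(\<lambda>K. r K n i j) \<longlonglongrightarrow> rho b (lag i j)" if ij: "i < n" "j < n"
proof -
  have P: "(\<lambda>K. r K n i j) \<longlonglongrightarrow> rho b (lag i j)" if ij: "i \<le> j" "j < n" for i j
  proof -
    define l where "l = j - i"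
    have re: "r (K + l) n i j = (\<Sum>p<K. b p * b (p + l))" for K
    proof -
      have "r (K + l) n i j = (\<Sum>q\<in>{j..<K + j}. x (K+l) i q * x (K+l) j q)"
        unfolding r_def using ij
        by (intro sum.mono_neutral_right) (auto simp: sh_def tr_def l_def)
      also have "\<dots> = (\<Sum>p<K. x (K+l) i (p + j) * x (K+l) j (p + j))"
        using sum.shift_bounds_nat_ivl[of "\<lambda>q. x (K+l) i q * x (K+l) j q" 0 j K] by (simp add: atLeast0LessThan)
      also have "\<dots> = (\<Sum>p<K. b p * b (p + l))"
        using ij by (intro sum.cong refl) (auto simp: sh_def tr_def l_def add.commute mult.commute)
      finally show ?thesis .
    qed
    have "summable (\<lambda>p. b p * b (p + l))"
      by (rule summable_prod_l2(2)[OF b_sq]) (use b_sq in \<open>simp add: summable_iff_shift[of "\<lambda>q. (b q)\<^sup>2"]\<close>)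
    then have "(\<lambda>K. r (K + l) n i j) \<longlonglongrightarrow> rho b l"
      unfolding re rho_def by (rule summable_LIMSEQ)
    then have "(\<lambda>K. r K n i j) \<longlonglongrightarrow> rho b l" by (rule LIMSEQ_offset)
    then show ?thesis using ij by (simp add: lag_def l_def)
  qed
  have "r K n i j = r K n j i" for K by (simp add: r_def mult.commute)
  then show ?thesis using P[of i j] P[of j i] ij by (cases "i \<le> j") (auto simp: lag_def add.commute)
qed

text \<open>
  Otherwise \<open>b\<close> would eventually be periodic with period \<open>l\<close>; as it tends to 0, it would have finite support.
\<close>

lemma infinite_shift_diff:
  assumes l: "l \<ge> 1"
  shows "infinite {q. sh b 0 q - sh b l q \<noteq> 0}"
proof
  assume "finite {q. sh b 0 q - sh b l q \<noteq> 0}"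
  then obtain Q where Q: "\<And>q. sh b 0 q - sh b l q \<noteq> 0 \<Longrightarrow> q < Q"
    by (metis (mono_tags, lifting) finite_nat_bounded lessThan_iff mem_Collect_eq subset_eq)
  have step: "b (q + l) = b q" if "q \<ge> Q" for q
    using Q[of "q + l"] that by (auto simp: sh_def)
  have per: "b (p + l * k) = b p" if "p \<ge> Q" for p k
  proof (induction k)
    case (Suc k)
    then show ?case using step[of "p + l * k"] that by (simp add: algebra_simps)
  qed simp
  have b0: "b \<longlonglongrightarrow> 0"
  proof -
    have "(\<lambda>q. (b q)\<^sup>2) \<longlonglongrightarrow> 0" by (rule summable_LIMSEQ_zero[OF b_sq])
    then have "(\<lambda>q. sqrt ((b q)\<^sup>2)) \<longlonglongrightarrow> sqrt 0" by (rule tendsto_real_sqrt)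
    then show ?thesis by (simp add: tendsto_rabs_zero_iff)
  qed
  have "b p = 0" if p: "p \<ge> Q" for p
  proof -
    have "strict_mono (\<lambda>k. p + l * k)" using l by (auto simp: strict_mono_def)
    from LIMSEQ_subseq_LIMSEQ[OF b0 this] have "(\<lambda>k. b (p + l * k)) \<longlonglongrightarrow> 0" by (simp add: o_def)
    then show ?thesis using per[OF p] by (simp add: LIMSEQ_const_iff)
  qed
  then have "{q. b q \<noteq> 0} \<subseteq> {..<Q}" by (auto simp: not_less[symmetric])
  then show False using b_supp finite_subset by blast
qed

lemma psi_sym: "\<psi> K n j i u = cnj (\<psi> K n i j u)"
  by (simp add: \<psi>_def chi_cnj[symmetric])

text \<open>
  At small lags the rows overlap, and the decay comes from the coefficients of their difference.
\<close>

lemma psi_decay_lag: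
  assumes l: "l \<ge> 1"
  shows "\<exists>D k1. D > 0 \<and> (\<forall>K>k1. \<forall>n i j u. i < n \<longrightarrow> j < n \<longrightarrow> lag i j = l \<longrightarrow> norm (\<psi> K n i j u) \<le> D / (1 + \<bar>u\<bar>)\<^sup>2)"
proof -
  define d where "d q = sh b 0 q - sh b l q" for q
  obtain L D where L: "finite L" "D > 0" and D: "\<forall>S u. S \<subseteq> L \<and> card (L - S) \<le> 2 \<longrightarrow> (\<Prod>l\<in>S. norm (\<phi> (u * d l))) \<le> D / (1 + \<bar>u\<bar>)\<^sup>2"
    using char_prod_decay[OF infinite_shift_diff[OF l], of 2] unfolding d_def by (elim exE conjE)
  define k1 where "k1 = Max (insert 0 L)"
  have k1: "q \<le> k1" if "q \<in> L" for q unfolding k1_def using L that by (intro Max_ge) auto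
  have 1: "norm (\<psi> K n i (i + l) u) \<le> D / (1 + \<bar>u\<bar>)\<^sup>2" if K: "K > k1" and i: "i + l < n" for K n i u
  proof -
    have xd: "u * x K i (i + q) - u * x K (i + l) (i + q) = u * d q" if "q \<in> L" for q
      using k1[OF that] K by (auto simp: d_def sh_def tr_def algebra_simps)
    have "norm (\<psi> K n i (i + l) u) = (\<Prod>q<K+n. norm (\<phi> (u * x K i q - u * x K (i + l) q)))"
      by (simp add: \<psi>_def prod_norm)
    also have "\<dots> \<le> (\<Prod>q\<in>(+) i ` L. norm (\<phi> (u * x K i q - u * x K (i + l) q)))"
    proof (rule prod_le_prod_subset)
      show "(+) i ` L \<subseteq> {..<K+n}" using k1 K i by fastforce
    qed (auto simp: cmod_char_le_1)
    also have "\<dots> = (\<Prod>q\<in>L. norm (\<phi> (u * d q)))"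
      by (subst prod.reindex) (auto simp: xd intro!: prod.cong)
    also have "\<dots> \<le> D / (1 + \<bar>u\<bar>)\<^sup>2" using D[rule_format, of L u] by simp
    finally show ?thesis .
  qed
  have 2: "norm (\<psi> K n i j u) \<le> D / (1 + \<bar>u\<bar>)\<^sup>2" if K: "K > k1" and i: "i < n" "j < n" "lag i j = l" for K n i j u
  proof (cases "i < j")
    case True
    then have "j = i + l" using i by (auto simp: lag_def)
    then show ?thesis using 1[OF K, of i n u] i by simp
  next
    case False
    then have j: "i = j + l" using i by (auto simp: lag_def)
    show ?thesis unfolding psi_sym[of K n i j u] complex_mod_cnj using 1[OF K, of j n u] i unfolding j by simp
  qed
  show ?thesis using 2 L(2) by (intro exI[of _ D] exI[of _ k1] conjI allI impI)
qed

end

locale noise_process = prob_space M + nf: noise_filter "distr M borel (\<xi> 0)" b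
  for M :: "'a measure" and \<xi> :: "int \<Rightarrow> 'a \<Rightarrow> real" and b +
  fixes X :: "int \<Rightarrow> 'a \<Rightarrow> real"
  assumes iid: "iid M \<xi>" and lin: "linear_process M \<xi> b X"
begin

lemma xi_meas [measurable]: "\<xi> s \<in> borel_measurable M"
  using iid unfolding iid_def indep_vars_def2 by auto

lemma X_meas [measurable]: "X t \<in> borel_measurable M"
  using lin by (auto simp: linear_process_def)

lemma xi_distr: "distr M borel (\<xi> s) = distr M borel (\<xi> 0)"
  using iid by (auto simp: iid_def)

lemma noise_indep: "indep_vars (\<lambda>_. borel) (\<lambda>q. \<xi> (s - int q)) (UNIV :: nat set)"
proof -
  have "indep_vars (\<lambda>_. borel) \<xi> UNIV" using iid by (simp add: iid_def)
  then have "indep_vars (\<lambda>_. borel) \<xi> ((\<lambda>q. s - int q) ` UNIV)" by (rule indep_vars_subset) auto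
  then show ?thesis by (rule indep_vars_reindex_inj) (auto simp: inj_on_def)
qed

lemma char_lincomb:
  "char (distr M borel (\<lambda>\<omega>. \<Sum>q<m. d q * \<xi> (s - int q) \<omega>)) u = (\<Prod>q<m. nf.\<phi> (u * d q))"
proof -
  have "indep_vars (\<lambda>_. borel) (\<lambda>q. \<xi> (s - int q)) {..<m}"
    using noise_indep by (rule indep_vars_subset) auto
  then have "indep_vars (\<lambda>_. borel) (\<lambda>q \<omega>. d q * \<xi> (s - int q) \<omega>) {..<m}"
    by (rule indep_vars_compose2[where Y = "\<lambda>q y. d q * y"]) auto
  from char_distr_sum[OF this]
  have "char (distr M borel (\<lambda>\<omega>. \<Sum>q<m. d q * \<xi> (s - int q) \<omega>)) u
      = (\<Prod>q<m. char (distr M borel (\<lambda>\<omega>. d q * \<xi> (s - int q) \<omega>)) u)" .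
  also have "\<dots> = (\<Prod>q<m. nf.\<phi> (u * d q))"
  proof (intro prod.cong refl)
    fix q
    have "char (distr M borel (\<lambda>\<omega>. d q * \<xi> (s - int q) \<omega>)) u = (CLINT \<omega>|M. iexp (u * (d q * \<xi> (s - int q) \<omega>)))"
      by (simp add: char_def integral_distr)
    also have "\<dots> = (CLINT \<omega>|M. iexp ((u * d q) * \<xi> (s - int q) \<omega>))"
      by (simp only: mult.assoc)
    also have "\<dots> = char (distr M borel (\<xi> (s - int q))) (u * d q)"
      by (simp add: char_def integral_distr del: of_real_mult)
    finally show "char (distr M borel (\<lambda>\<omega>. d q * \<xi> (s - int q) \<omega>)) u = nf.\<phi> (u * d q)"
      unfolding xi_distr[of "s - int q"] .
  qed
  finally show ?thesis .
qed

lemma partial_sum_eq: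
  "i < n \<Longrightarrow> (\<Sum>q<K+n. nf.x K i q * \<xi> (s - int q) \<omega>) = (\<Sum>p<K. b p * \<xi> ((s - int i) - int p) \<omega>)"
proof -
  assume i: "i < n"
  have "(\<Sum>q<K+n. nf.x K i q * \<xi> (s - int q) \<omega>) = (\<Sum>q\<in>{i..<K+i}. nf.x K i q * \<xi> (s - int q) \<omega>)"
    using i by (intro sum.mono_neutral_right) (auto simp: sh_def nf.tr_def)
  also have "\<dots> = (\<Sum>p<K. nf.x K i (p + i) * \<xi> (s - int (p + i)) \<omega>)"
    using sum.shift_bounds_nat_ivl[of "\<lambda>q. nf.x K i q * \<xi> (s - int q) \<omega>" 0 i K] by (simp add: atLeast0LessThan)
  also have "\<dots> = (\<Sum>p<K. b p * \<xi> ((s - int i) - int p) \<omega>)"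
    by (intro sum.cong refl) (auto simp: sh_def nf.tr_def algebra_simps)
  finally show ?thesis .
qed

lemma partial_sum_tendsto:
  assumes "i < n"
  shows "AE \<omega> in M. (\<lambda>K. \<Sum>q<K+n. nf.x K i q * \<xi> (s - int q) \<omega>) \<longlonglongrightarrow> X (s - int i) \<omega>"
  using lin unfolding linear_process_def partial_sum_eq[OF assms] sums_def by auto

lemma char_limit:
  fixes Y :: "nat \<Rightarrow> 'a \<Rightarrow> real"
  assumes [measurable]: "\<And>K. Y K \<in> borel_measurable M" "Z \<in> borel_measurable M"
    and AE: "AE \<omega> in M. (\<lambda>K. Y K \<omega>) \<longlonglongrightarrow> Z \<omega>"
  shows "(\<lambda>K. char (distr M borel (Y K)) u) \<longlonglongrightarrow> char (distr M borel Z) u"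
proof -
  have "(\<lambda>K. CLINT \<omega>|M. iexp (u * Y K \<omega>)) \<longlonglongrightarrow> (CLINT \<omega>|M. iexp (u * Z \<omega>))"
  proof (rule integral_dominated_convergence[where w = "\<lambda>_. 1"])
    show "AE \<omega> in M. (\<lambda>K. iexp (u * Y K \<omega>)) \<longlonglongrightarrow> iexp (u * Z \<omega>)"
      using AE by eventually_elim (intro tendsto_intros)
  qed auto
  then show ?thesis by (simp add: char_def integral_distr)
qed

definition "\<Psi> s t u = char (distr M borel (\<lambda>\<omega>. X s \<omega> - X t \<omega>)) u"
definition "ch u = char (distr M borel (X 0)) u"

lemma Phi_tendsto: "(\<lambda>K. nf.\<Phi> K u) \<longlonglongrightarrow> char (distr M borel (X t)) u"
proof -
  have "(\<lambda>K. char (distr M borel (\<lambda>\<omega>. \<Sum>p<K. b p * \<xi> (t - int p) \<omega>)) u) \<longlonglongrightarrow> char (distr M borel (X t)) u"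
    by (rule char_limit) (use lin in \<open>auto simp: linear_process_def sums_def\<close>)
  then show ?thesis by (simp add: char_lincomb nf.\<Phi>_def)
qed

lemma X_char: "char (distr M borel (X t)) u = ch u"
  unfolding ch_def using LIMSEQ_unique[OF Phi_tendsto Phi_tendsto] .

lemma X_distr: "distr M borel (X t) = distr M borel (X 0)"
  by (rule Levy_uniqueness) (auto simp: X_char fun_eq_iff)

lemma psi_tendsto:
  assumes ij: "i < n" "j < n"
  shows "(\<lambda>K. nf.\<psi> K n i j u) \<longlonglongrightarrow> \<Psi> (s - int i) (s - int j) u"
proof -
  have "(\<lambda>K. char (distr M borel (\<lambda>\<omega>. \<Sum>q<K+n. (nf.x K i q - nf.x K j q) * \<xi> (s - int q) \<omega>)) u)
      \<longlonglongrightarrow> char (distr M borel (\<lambda>\<omega>. X (s - int i) \<omega> - X (s - int j) \<omega>)) u"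
  proof (rule char_limit)
    show "AE \<omega> in M. (\<lambda>K. \<Sum>q<K+n. (nf.x K i q - nf.x K j q) * \<xi> (s - int q) \<omega>) \<longlonglongrightarrow> X (s - int i) \<omega> - X (s - int j) \<omega>"
      using partial_sum_tendsto[OF ij(1), of s] partial_sum_tendsto[OF ij(2), of s]
    proof eventually_elim
      case (elim \<omega>)
      show ?case using tendsto_diff[OF elim] by (simp only: left_diff_distrib sum_subtractf)
    qed
  qed measurable
  then show ?thesis unfolding char_lincomb nf.\<psi>_def \<Psi>_def by (simp only: right_diff_distrib)
qed

lemma Psi_decay_lag:
  assumes l: "l \<ge> 1"
  shows "\<exists>D>0. \<forall>s t u. \<bar>s - t\<bar> = int l \<longrightarrow> norm (\<Psi> s t u) \<le> D / (1 + \<bar>u\<bar>)\<^sup>2"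
proof -
  obtain D k1 where D: "D > 0" "\<forall>K>k1. \<forall>n i j u. i < n \<longrightarrow> j < n \<longrightarrow> lag i j = l \<longrightarrow> norm (nf.\<psi> K n i j u) \<le> D / (1 + \<bar>u\<bar>)\<^sup>2"
    using nf.psi_decay_lag[OF l] by (elim exE conjE)
  have gen: "norm (\<Psi> (S - int i) (S - int j) u) \<le> D / (1 + \<bar>u\<bar>)\<^sup>2" if ij: "i < n" "j < n" "lag i j = l" for S i j n u
  proof (rule LIMSEQ_le_const2[OF tendsto_norm[OF psi_tendsto[OF ij(1,2)]]])
    show "\<exists>N. \<forall>K\<ge>N. norm (nf.\<psi> K n i j u) \<le> D / (1 + \<bar>u\<bar>)\<^sup>2"
      by (intro exI[of _ "Suc k1"] allI impI D(2)[rule_format] ij) simp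
  qed
  have "norm (\<Psi> s t u) \<le> D / (1 + \<bar>u\<bar>)\<^sup>2" if st: "\<bar>s - t\<bar> = int l" for s t u
  proof (cases "s \<ge> t")
    case True
    then have "t = s - int l" using st by simp
    then show ?thesis using gen[of 0 "l+1" l s u] by (simp add: lag_def)
  next
    case False
    then have "s = t - int l" using st by simp
    then show ?thesis using gen[of l "l+1" 0 t u] by (simp add: lag_def)
  qed
  then show ?thesis using D(1) by blast
qed

lemma ch_decay: "\<exists>D>0. \<forall>u. norm (ch u) \<le> D / (1 + \<bar>u\<bar>) ^ 14"
proof -
  obtain k0 D where D: "D \<ge> 1" "\<forall>K>k0. \<forall>n i j u. i < n \<longrightarrow> j < n \<longrightarrow>
     norm (nf.\<Phi> K u) \<le> D / (1 + \<bar>u\<bar>) ^ 14 \<and> (\<forall>q. norm (nf.f K n i q u) \<le> D / (1 + \<bar>u\<bar>) ^ 14) \<and>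
     (lag i j > k0 \<longrightarrow> (\<forall>t\<in>closed_segment 0 1. \<forall>E\<subseteq>{..<K+n}. card ({..<K+n} - E) \<le> 2 \<longrightarrow>
        norm (\<Prod>q\<in>E. nf.B K i j q u + t * nf.e K i j q u) \<le> D / (1 + \<bar>u\<bar>) ^ 14))"
    using nf.uniform_decay by (elim exE conjE)
  have "norm (ch u) \<le> D / (1 + \<bar>u\<bar>) ^ 14" for u
    unfolding ch_def
  proof (rule LIMSEQ_le_const2[OF tendsto_norm[OF Phi_tendsto]])
    show "\<exists>N. \<forall>K\<ge>N. norm (nf.\<Phi> K u) \<le> D / (1 + \<bar>u\<bar>) ^ 14"
      by (intro exI[of _ "Suc k0"] allI impI D(2)[rule_format, THEN conjunct1, of _ 0 1 0]) auto
  qed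
  then show ?thesis using D(1) by (intro exI[of _ D]) auto
qed

text \<open>
  The constants of \<open>truncated_expansion\<close> do not depend on the truncation, so the estimate passes to the limit.
\<close>

theorem covariance_expansion:
  "\<exists>k0 C. C \<ge> 0 \<and> (\<forall>n u \<eta>. 0 < \<eta> \<longrightarrow> \<eta> \<le> 1 \<longrightarrow>
     norm ((\<Sum>i<n. \<Sum>j<n. if lag i j > k0 then \<Psi> (int n - int i) (int n - int j) u - ch u * cnj (ch u) else 0)
       - of_real (nf.s2\<^sup>2 / 2 * u ^ 4 * Wn b n) * (ch u * cnj (ch u)))
     \<le> C / (1 + \<bar>u\<bar>)\<^sup>2 * (real n / \<eta> + Tn b n + (\<Sum>i<n. \<Sum>j<n. \<eta> * (rho b (lag i j))\<^sup>2 + \<bar>rho b (lag i j)\<bar> ^ 3)))"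
proof -
  obtain k0 C where C: "C \<ge> 0" and main: "\<forall>K>k0. \<forall>n u \<eta>. 0 < \<eta> \<longrightarrow> \<eta> \<le> 1 \<longrightarrow>
     norm ((\<Sum>i<n. \<Sum>j<n. if lag i j > k0 then nf.\<psi> K n i j u - nf.\<Phi> K u * cnj (nf.\<Phi> K u) else 0)
       - of_real (nf.s2\<^sup>2 / 2 * u ^ 4 * (\<Sum>i<n. \<Sum>j<n. (nf.r K n i j)\<^sup>2)) * (nf.\<Phi> K u * cnj (nf.\<Phi> K u)))
     \<le> C / (1 + \<bar>u\<bar>)\<^sup>2 * (real n / \<eta> + (\<Sum>i<n. \<Sum>j<n. nf.r K n i j) + (\<Sum>i<n. \<Sum>j<n. \<eta> * (nf.r K n i j)\<^sup>2 + \<bar>nf.r K n i j\<bar> ^ 3))"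
    using nf.truncated_expansion by (elim exE conjE)
  show ?thesis
  proof (intro exI[of _ k0] exI[of _ C] conjI C allI impI)
    fix n u and \<eta> :: real assume \<eta>: "0 < \<eta>" "\<eta> \<le> 1"
    let ?L = "\<lambda>K. norm ((\<Sum>i<n. \<Sum>j<n. if lag i j > k0 then nf.\<psi> K n i j u - nf.\<Phi> K u * cnj (nf.\<Phi> K u) else 0)
       - of_real (nf.s2\<^sup>2 / 2 * u ^ 4 * (\<Sum>i<n. \<Sum>j<n. (nf.r K n i j)\<^sup>2)) * (nf.\<Phi> K u * cnj (nf.\<Phi> K u)))"
    let ?R = "\<lambda>K. C / (1 + \<bar>u\<bar>)\<^sup>2 * (real n / \<eta> + (\<Sum>i<n. \<Sum>j<n. nf.r K n i j) + (\<Sum>i<n. \<Sum>j<n. \<eta> * (nf.r K n i j)\<^sup>2 + \<bar>nf.r K n i j\<bar> ^ 3))"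
    have \<Phi>: "(\<lambda>K. nf.\<Phi> K u) \<longlonglongrightarrow> ch u" unfolding ch_def by (rule Phi_tendsto)
    have rt: "(\<lambda>K. nf.r K n i j) \<longlonglongrightarrow> rho b (lag i j)" if "i \<in> {..<n}" "j \<in> {..<n}" for i j
      using that by (intro nf.r_tendsto) auto
    have pt: "(\<lambda>K. if lag i j > k0 then nf.\<psi> K n i j u - nf.\<Phi> K u * cnj (nf.\<Phi> K u) else 0)
        \<longlonglongrightarrow> (if lag i j > k0 then \<Psi> (int n - int i) (int n - int j) u - ch u * cnj (ch u) else 0)"
      if "i \<in> {..<n}" "j \<in> {..<n}" for i j
    proof (cases "lag i j > k0")
      case True
      have "(\<lambda>K. nf.\<psi> K n i j u - nf.\<Phi> K u * cnj (nf.\<Phi> K u)) \<longlonglongrightarrow> \<Psi> (int n - int i) (int n - int j) u - ch u * cnj (ch u)"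
        using that by (intro tendsto_diff tendsto_mult tendsto_cnj \<Phi> psi_tendsto) auto
      then show ?thesis using True by simp
    qed simp
    have L: "?L \<longlonglongrightarrow> norm ((\<Sum>i<n. \<Sum>j<n. if lag i j > k0 then \<Psi> (int n - int i) (int n - int j) u - ch u * cnj (ch u) else 0)
       - of_real (nf.s2\<^sup>2 / 2 * u ^ 4 * Wn b n) * (ch u * cnj (ch u)))"
      unfolding Wn_def
      by (intro tendsto_norm tendsto_diff tendsto_mult tendsto_of_real tendsto_const tendsto_sum tendsto_power tendsto_cnj \<Phi> rt pt)
    have R: "?R \<longlonglongrightarrow> C / (1 + \<bar>u\<bar>)\<^sup>2 * (real n / \<eta> + Tn b n + (\<Sum>i<n. \<Sum>j<n. \<eta> * (rho b (lag i j))\<^sup>2 + \<bar>rho b (lag i j)\<bar> ^ 3))"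
      unfolding Tn_def
      by (intro tendsto_mult tendsto_const tendsto_add tendsto_sum tendsto_power tendsto_rabs rt)
    show "norm ((\<Sum>i<n. \<Sum>j<n. if lag i j > k0 then \<Psi> (int n - int i) (int n - int j) u - ch u * cnj (ch u) else 0)
       - of_real (nf.s2\<^sup>2 / 2 * u ^ 4 * Wn b n) * (ch u * cnj (ch u)))
     \<le> C / (1 + \<bar>u\<bar>)\<^sup>2 * (real n / \<eta> + Tn b n + (\<Sum>i<n. \<Sum>j<n. \<eta> * (rho b (lag i j))\<^sup>2 + \<bar>rho b (lag i j)\<bar> ^ 3))"
    proof (rule LIMSEQ_le[OF L R])
      show "\<exists>N. \<forall>K\<ge>N. ?L K \<le> ?R K"
        by (intro exI[of _ "Suc k0"] allI impI main[rule_format] \<eta>) simp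
    qed
  qed
qed

end

section \<open>Variance of the empirical second moment\<close>

lemma pow4_prod_le: "\<bar>x\<bar> ^ k * \<bar>y\<bar> ^ l \<le> 1 + x ^ 4 + (y::real) ^ 4" if "k + l \<le> 4"
proof -
  define z where "z = max 1 (max \<bar>x\<bar> \<bar>y\<bar>)"
  have z: "1 \<le> z" "\<bar>x\<bar> \<le> z" "\<bar>y\<bar> \<le> z" by (auto simp: z_def)
  have "\<bar>x\<bar> ^ k * \<bar>y\<bar> ^ l \<le> z ^ k * z ^ l" using z by (intro mult_mono power_mono) auto
  also have "\<dots> = z ^ (k + l)" by (simp add: power_add)
  also have "\<dots> \<le> z ^ 4" using z that by (intro power_increasing) auto
  also have "\<dots> \<le> 1 + x ^ 4 + y ^ 4" by (auto simp: z_def max_def)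
  finally show ?thesis .
qed

lemma pow4_sum_le: "(x + y) ^ 4 \<le> 8 * (x ^ 4 + (y::real) ^ 4)"
proof -
  have a: "(p + q)\<^sup>2 \<le> 2 * (p\<^sup>2 + q\<^sup>2)" for p q :: real using sum_squares_bound[of p q] by (simp add: power2_sum)
  have "((x + y)\<^sup>2)\<^sup>2 \<le> (2 * (x\<^sup>2 + y\<^sup>2))\<^sup>2" by (intro power_mono a) auto
  also have "\<dots> = 4 * (x\<^sup>2 + y\<^sup>2)\<^sup>2" by (simp only: power_mult_distrib) simp
  also have "\<dots> \<le> 4 * (2 * ((x\<^sup>2)\<^sup>2 + (y\<^sup>2)\<^sup>2))" by (intro mult_left_mono a) auto
  finally show ?thesis by simp
qed

text \<open>
  Continuity of \<open>P\<^sup>2 * Q\<^sup>2\<close> in terms of fourth powers only, as needed for limits in the fourth mean.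
\<close>

lemma product_square_perturbation:
  fixes P Q A B :: real
  assumes \<delta>: "0 < \<delta>" "\<delta> \<le> 1"
  shows "\<bar>(P + A)\<^sup>2 * (Q + B)\<^sup>2 - P\<^sup>2 * Q\<^sup>2\<bar> \<le> 15 * \<delta> * (P ^ 4 + Q ^ 4) + 17 / \<delta> ^ 4 * (A ^ 4 + B ^ 4)"
proof -
  define s a where "s = max \<bar>P\<bar> \<bar>Q\<bar>" and "a = max \<bar>A\<bar> \<bar>B\<bar>"
  have s: "0 \<le> s" "\<bar>P\<bar> \<le> s" "\<bar>Q\<bar> \<le> s" "s ^ 4 \<le> P ^ 4 + Q ^ 4" by (auto simp: s_def max_def)
  have a: "0 \<le> a" "\<bar>A\<bar> \<le> a" "\<bar>B\<bar> \<le> a" "a ^ 4 \<le> A ^ 4 + B ^ 4" by (auto simp: a_def max_def)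
  have pa: "\<bar>(P + A) * (Q + B)\<bar> \<le> (s + a) * (s + a)"
    unfolding abs_mult using s a by (intro mult_mono) auto
  show ?thesis
  proof (cases "a \<le> \<delta> * s")
    case True
    have as: "a \<le> s" using True \<delta> s mult_right_mono[of \<delta> 1 s] by linarith
    have "\<bar>(P + A) * (Q + B) - P * Q\<bar> = \<bar>A * Q + P * B + A * B\<bar>" by (simp add: algebra_simps)
    also have "\<dots> \<le> \<bar>A\<bar> * \<bar>Q\<bar> + \<bar>P\<bar> * \<bar>B\<bar> + \<bar>A\<bar> * \<bar>B\<bar>"
      by (simp only: abs_mult[symmetric])
    also have "\<dots> \<le> (\<delta> * s) * s + s * (\<delta> * s) + (\<delta> * s) * s"
      using s a True as \<delta> by (intro add_mono mult_mono) auto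
    finally have d: "\<bar>(P + A) * (Q + B) - P * Q\<bar> \<le> 3 * \<delta> * s\<^sup>2" by (simp add: power2_eq_square mult_ac)
    have "\<bar>(P + A) * (Q + B) + P * Q\<bar> \<le> (s + a) * (s + a) + s * s"
      using pa mult_mono[OF s(2,3) s(1)] abs_triangle_ineq[of "(P + A) * (Q + B)" "P * Q"] by (simp add: abs_mult)
    also have "\<dots> \<le> (s + s) * (s + s) + s * s" using as s a by (intro add_mono mult_mono) auto
    finally have p: "\<bar>(P + A) * (Q + B) + P * Q\<bar> \<le> 5 * s\<^sup>2" by (simp add: power2_eq_square)
    have "(P + A)\<^sup>2 * (Q + B)\<^sup>2 - P\<^sup>2 * Q\<^sup>2 = ((P + A) * (Q + B) - P * Q) * ((P + A) * (Q + B) + P * Q)"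
      by (simp add: power2_eq_square algebra_simps)
    then have "\<bar>(P + A)\<^sup>2 * (Q + B)\<^sup>2 - P\<^sup>2 * Q\<^sup>2\<bar> = \<bar>(P + A) * (Q + B) - P * Q\<bar> * \<bar>(P + A) * (Q + B) + P * Q\<bar>"
      by (simp only: abs_mult)
    also have "\<dots> \<le> (3 * \<delta> * s\<^sup>2) * (5 * s\<^sup>2)" using d p \<delta> by (intro mult_mono) auto
    also have "\<dots> = 15 * \<delta> * s ^ 4" by (simp add: power2_eq_square power4_eq_xxxx)
    also have "\<dots> \<le> 15 * \<delta> * (P ^ 4 + Q ^ 4)" using s \<delta> by (intro mult_left_mono) auto
    also have "\<dots> \<le> 15 * \<delta> * (P ^ 4 + Q ^ 4) + 17 / \<delta> ^ 4 * (A ^ 4 + B ^ 4)" using \<delta> by simp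
    finally show ?thesis .
  next
    case False
    then have sa: "s \<le> a / \<delta>" using \<delta> by (simp add: field_simps)
    have ad: "a \<le> a / \<delta>" using \<delta> a by (simp add: field_simps mult_left_le_one_le)
    have "\<bar>(P + A)\<^sup>2 * (Q + B)\<^sup>2 - P\<^sup>2 * Q\<^sup>2\<bar> \<le> \<bar>(P + A) * (Q + B)\<bar>\<^sup>2 + (\<bar>P\<bar> * \<bar>Q\<bar>)\<^sup>2"
    proof -
      have "(P + A)\<^sup>2 * (Q + B)\<^sup>2 = \<bar>(P + A) * (Q + B)\<bar>\<^sup>2" "P\<^sup>2 * Q\<^sup>2 = (\<bar>P\<bar> * \<bar>Q\<bar>)\<^sup>2" by (simp_all add: power_mult_distrib)
      moreover have "0 \<le> \<bar>(P + A) * (Q + B)\<bar>\<^sup>2" "0 \<le> (\<bar>P\<bar> * \<bar>Q\<bar>)\<^sup>2" by auto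
      ultimately show ?thesis by linarith
    qed
    also have "\<dots> \<le> ((2 * (a / \<delta>)) * (2 * (a / \<delta>)))\<^sup>2 + ((a / \<delta>) * (a / \<delta>))\<^sup>2"
    proof (intro add_mono power_mono)
      have "(s + a) * (s + a) \<le> (2 * (a / \<delta>)) * (2 * (a / \<delta>))" using sa ad s a by (intro mult_mono) auto
      then show "\<bar>(P + A) * (Q + B)\<bar> \<le> (2 * (a / \<delta>)) * (2 * (a / \<delta>))" using pa by linarith
      show "\<bar>P\<bar> * \<bar>Q\<bar> \<le> (a / \<delta>) * (a / \<delta>)" using sa s by (intro mult_mono) auto
    qed auto
    also have "\<dots> = 17 / \<delta> ^ 4 * a ^ 4" by (simp add: power2_eq_square power4_eq_xxxx)
    also have "\<dots> \<le> 17 / \<delta> ^ 4 * (A ^ 4 + B ^ 4)" using a \<delta> by (intro mult_left_mono) auto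
    also have "\<dots> \<le> 15 * \<delta> * (P ^ 4 + Q ^ 4) + 17 / \<delta> ^ 4 * (A ^ 4 + B ^ 4)" using \<delta> by simp
    finally show ?thesis .
  qed
qed

context prob_space
begin

lemma integrable_pow4_prod:
  fixes P Q :: "'a \<Rightarrow> real"
  assumes [measurable]: "P \<in> borel_measurable M" "Q \<in> borel_measurable M"
    and "integrable M (\<lambda>\<omega>. P \<omega> ^ 4)" "integrable M (\<lambda>\<omega>. Q \<omega> ^ 4)" "k + l \<le> 4"
  shows "integrable M (\<lambda>\<omega>. P \<omega> ^ k * Q \<omega> ^ l)"
proof (rule Bochner_Integration.integrable_bound[of _ "\<lambda>\<omega>. 1 + P \<omega> ^ 4 + Q \<omega> ^ 4"])
  show "AE \<omega> in M. norm (P \<omega> ^ k * Q \<omega> ^ l) \<le> norm (1 + P \<omega> ^ 4 + Q \<omega> ^ 4)"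
  proof (rule AE_I2)
    fix \<omega>
    have "norm (P \<omega> ^ k * Q \<omega> ^ l) \<le> 1 + P \<omega> ^ 4 + Q \<omega> ^ 4"
      using pow4_prod_le[OF assms(5), of "P \<omega>" "Q \<omega>"] by (simp add: abs_mult power_abs)
    then show "norm (P \<omega> ^ k * Q \<omega> ^ l) \<le> norm (1 + P \<omega> ^ 4 + Q \<omega> ^ 4)" by simp
  qed
qed (use assms in auto)

lemma integrable_pow4_add:
  fixes P Q :: "'a \<Rightarrow> real"
  assumes [measurable]: "P \<in> borel_measurable M" "Q \<in> borel_measurable M"
    and "integrable M (\<lambda>\<omega>. P \<omega> ^ 4)" "integrable M (\<lambda>\<omega>. Q \<omega> ^ 4)"
  shows "integrable M (\<lambda>\<omega>. (P \<omega> + Q \<omega>) ^ 4)"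
proof (rule Bochner_Integration.integrable_bound[of _ "\<lambda>\<omega>. 8 * (P \<omega> ^ 4 + Q \<omega> ^ 4)"])
  show "AE \<omega> in M. norm ((P \<omega> + Q \<omega>) ^ 4) \<le> norm (8 * (P \<omega> ^ 4 + Q \<omega> ^ 4))"
    using pow4_sum_le by (intro AE_I2) auto
qed (use assms in auto)

lemma expectation_sq_prod_tendsto:
  fixes P Q :: "nat \<Rightarrow> 'a \<Rightarrow> real" and X Y :: "'a \<Rightarrow> real"
  assumes [measurable]: "\<And>k. P k \<in> borel_measurable M" "\<And>k. Q k \<in> borel_measurable M" "X \<in> borel_measurable M" "Y \<in> borel_measurable M"
    and iP: "\<And>k. integrable M (\<lambda>\<omega>. P k \<omega> ^ 4)" and iQ: "\<And>k. integrable M (\<lambda>\<omega>. Q k \<omega> ^ 4)"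
    and iX: "integrable M (\<lambda>\<omega>. X \<omega> ^ 4)" and iY: "integrable M (\<lambda>\<omega>. Y \<omega> ^ 4)"
    and C: "\<And>k. expectation (\<lambda>\<omega>. P k \<omega> ^ 4) \<le> C" "\<And>k. expectation (\<lambda>\<omega>. Q k \<omega> ^ 4) \<le> C"
    and d: "(\<lambda>k. expectation (\<lambda>\<omega>. (X \<omega> - P k \<omega>) ^ 4)) \<longlonglongrightarrow> 0" "(\<lambda>k. expectation (\<lambda>\<omega>. (Y \<omega> - Q k \<omega>) ^ 4)) \<longlonglongrightarrow> 0"
  shows "(\<lambda>k. expectation (\<lambda>\<omega>. (P k \<omega>)\<^sup>2 * (Q k \<omega>)\<^sup>2)) \<longlonglongrightarrow> expectation (\<lambda>\<omega>. (X \<omega>)\<^sup>2 * (Y \<omega>)\<^sup>2)"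
proof -
  have C0: "0 \<le> C" by (rule order_trans[OF _ C(1)[of 0]]) (auto intro!: integral_nonneg_AE)
  have iA: "integrable M (\<lambda>\<omega>. (X \<omega> - P k \<omega>) ^ 4)" for k
    using integrable_pow4_add[of X "\<lambda>\<omega>. - P k \<omega>"] iX iP by simp
  have iB: "integrable M (\<lambda>\<omega>. (Y \<omega> - Q k \<omega>) ^ 4)" for k
    using integrable_pow4_add[of Y "\<lambda>\<omega>. - Q k \<omega>"] iY iQ by simp
  have i1: "integrable M (\<lambda>\<omega>. (P k \<omega>)\<^sup>2 * (Q k \<omega>)\<^sup>2)" for k
    by (rule integrable_pow4_prod) (use iP iQ in auto)
  have i2: "integrable M (\<lambda>\<omega>. (X \<omega>)\<^sup>2 * (Y \<omega>)\<^sup>2)"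
    by (rule integrable_pow4_prod) (use iX iY in auto)
  define E where "E k = expectation (\<lambda>\<omega>. (X \<omega> - P k \<omega>) ^ 4) + expectation (\<lambda>\<omega>. (Y \<omega> - Q k \<omega>) ^ 4)" for k
  have E: "E \<longlonglongrightarrow> 0" unfolding E_def using tendsto_add[OF d] by simp
  have bd: "\<bar>expectation (\<lambda>\<omega>. (X \<omega>)\<^sup>2 * (Y \<omega>)\<^sup>2) - expectation (\<lambda>\<omega>. (P k \<omega>)\<^sup>2 * (Q k \<omega>)\<^sup>2)\<bar> \<le> 30 * \<delta> * C + 17 / \<delta> ^ 4 * E k"
    if \<delta>: "0 < \<delta>" "\<delta> \<le> 1" for \<delta> k
  proof -
    have "expectation (\<lambda>\<omega>. (X \<omega>)\<^sup>2 * (Y \<omega>)\<^sup>2) - expectation (\<lambda>\<omega>. (P k \<omega>)\<^sup>2 * (Q k \<omega>)\<^sup>2)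
       = expectation (\<lambda>\<omega>. (X \<omega>)\<^sup>2 * (Y \<omega>)\<^sup>2 - (P k \<omega>)\<^sup>2 * (Q k \<omega>)\<^sup>2)"
      using i1 i2 by simp
    then have "\<bar>expectation (\<lambda>\<omega>. (X \<omega>)\<^sup>2 * (Y \<omega>)\<^sup>2) - expectation (\<lambda>\<omega>. (P k \<omega>)\<^sup>2 * (Q k \<omega>)\<^sup>2)\<bar>
       \<le> expectation (\<lambda>\<omega>. \<bar>(X \<omega>)\<^sup>2 * (Y \<omega>)\<^sup>2 - (P k \<omega>)\<^sup>2 * (Q k \<omega>)\<^sup>2\<bar>)"
      using integral_abs_bound by simp
    also have "\<dots> \<le> expectation (\<lambda>\<omega>. 15 * \<delta> * (P k \<omega> ^ 4 + Q k \<omega> ^ 4) + 17 / \<delta> ^ 4 * ((X \<omega> - P k \<omega>) ^ 4 + (Y \<omega> - Q k \<omega>) ^ 4))"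
    proof (rule integral_mono)
      fix \<omega>
      show "\<bar>(X \<omega>)\<^sup>2 * (Y \<omega>)\<^sup>2 - (P k \<omega>)\<^sup>2 * (Q k \<omega>)\<^sup>2\<bar> \<le> 15 * \<delta> * (P k \<omega> ^ 4 + Q k \<omega> ^ 4) + 17 / \<delta> ^ 4 * ((X \<omega> - P k \<omega>) ^ 4 + (Y \<omega> - Q k \<omega>) ^ 4)"
        using product_square_perturbation[OF \<delta>, of "P k \<omega>" "X \<omega> - P k \<omega>" "Q k \<omega>" "Y \<omega> - Q k \<omega>"] by simp
    qed (use i1 i2 iP iQ iA iB in auto)
    also have "\<dots> = 15 * \<delta> * (expectation (\<lambda>\<omega>. P k \<omega> ^ 4) + expectation (\<lambda>\<omega>. Q k \<omega> ^ 4)) + 17 / \<delta> ^ 4 * E k"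
      using iP iQ iA iB by (simp add: E_def)
    also have "\<dots> \<le> 15 * \<delta> * (C + C) + 17 / \<delta> ^ 4 * E k"
      using C \<delta> by (intro add_mono mult_left_mono) auto
    finally show ?thesis by simp
  qed
  show ?thesis
  proof (rule LIMSEQ_I)
    fix \<epsilon> :: real assume \<epsilon>: "0 < \<epsilon>"
    define \<delta> where "\<delta> = min 1 (\<epsilon> / (60 * (C + 1)))"
    have \<delta>: "0 < \<delta>" "\<delta> \<le> 1" using \<epsilon> C0 by (auto simp: \<delta>_def)
    have "\<delta> \<le> \<epsilon> / (60 * (C + 1))" by (simp add: \<delta>_def)
    then have "\<delta> * (60 * (C + 1)) \<le> \<epsilon>" using C0 by (simp add: pos_le_divide_eq)
    then have h: "30 * \<delta> * C < \<epsilon> / 2 + 0" using \<delta> by (simp add: algebra_simps)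
    have lim: "(\<lambda>k. 30 * \<delta> * C + 17 / \<delta> ^ 4 * E k) \<longlonglongrightarrow> 30 * \<delta> * C + 17 / \<delta> ^ 4 * 0"
      by (intro tendsto_intros E)
    have "30 * \<delta> * C + 17 / \<delta> ^ 4 * 0 < \<epsilon>" using h \<epsilon> by simp
    from order_tendstoD(2)[OF lim this]
    have "\<forall>\<^sub>F k in sequentially. 30 * \<delta> * C + 17 / \<delta> ^ 4 * E k < \<epsilon>" .
    then obtain k0 where k0: "\<And>k. k \<ge> k0 \<Longrightarrow> 30 * \<delta> * C + 17 / \<delta> ^ 4 * E k < \<epsilon>"
      by (auto simp: eventually_sequentially)
    show "\<exists>no. \<forall>k\<ge>no. norm (expectation (\<lambda>\<omega>. (P k \<omega>)\<^sup>2 * (Q k \<omega>)\<^sup>2) - expectation (\<lambda>\<omega>. (X \<omega>)\<^sup>2 * (Y \<omega>)\<^sup>2)) < \<epsilon>"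
    proof (intro exI[of _ k0] allI impI)
      fix k assume "k \<ge> k0"
      then show "norm (expectation (\<lambda>\<omega>. (P k \<omega>)\<^sup>2 * (Q k \<omega>)\<^sup>2) - expectation (\<lambda>\<omega>. (X \<omega>)\<^sup>2 * (Y \<omega>)\<^sup>2)) < \<epsilon>"
        using bd[OF \<delta>, of k] k0[of k] unfolding real_norm_def by linarith
    qed
  qed
qed

end

context noise_process
begin

definition LC :: "int \<Rightarrow> (nat \<Rightarrow> real) \<Rightarrow> nat \<Rightarrow> 'a \<Rightarrow> real" where
  "LC s d m \<omega> = (\<Sum>q<m. d q * \<xi> (s - int q) \<omega>)"

lemma LC_meas [measurable]: "LC s d m \<in> borel_measurable M"
  unfolding LC_def by measurable

lemma LC_Suc: "LC s d (Suc m) \<omega> = LC s d m \<omega> + d m * \<xi> (s - int m) \<omega>"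
  by (simp add: LC_def)

lemma xi_moments:
  shows "integrable M (\<lambda>\<omega>. \<xi> t \<omega> ^ 4)" "expectation (\<lambda>\<omega>. \<xi> t \<omega>) = 0" "expectation (\<lambda>\<omega>. (\<xi> t \<omega>)\<^sup>2) = nf.s2" "expectation (\<lambda>\<omega>. \<xi> t \<omega> ^ 4) = nf.m4"
proof -
  have "integrable (distr M borel (\<xi> t)) (\<lambda>x. x ^ 4)" unfolding xi_distr[of t] by (rule nf.int4)
  then show "integrable M (\<lambda>\<omega>. \<xi> t \<omega> ^ 4)" by (subst (asm) integrable_distr_eq) auto
  have e: "expectation (\<lambda>\<omega>. h (\<xi> t \<omega>)) = integral\<^sup>L (distr M borel (\<xi> 0)) h" if "h \<in> borel_measurable borel" for h :: "real \<Rightarrow> real"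
    unfolding xi_distr[of t, symmetric] using that by (subst integral_distr) auto
  show "expectation (\<lambda>\<omega>. \<xi> t \<omega>) = 0" using e[of "\<lambda>x. x"] nf.mean0 by simp
  show "expectation (\<lambda>\<omega>. (\<xi> t \<omega>)\<^sup>2) = nf.s2" using e[of "\<lambda>x. x\<^sup>2"] by (simp add: nf.s2_def)
  show "expectation (\<lambda>\<omega>. \<xi> t \<omega> ^ 4) = nf.m4" using e[of "\<lambda>x. x ^ 4"] by (simp add: nf.m4_def)
qed

lemma LC_int4: "integrable M (\<lambda>\<omega>. LC s d m \<omega> ^ 4)"
proof (induction m)
  case 0 then show ?case by (simp add: LC_def)
next
  case (Suc m)
  show ?case unfolding LC_Suc
    by (rule integrable_pow4_add[OF _ _ Suc]) (use xi_moments(1) in \<open>auto simp: power_mult_distrib\<close>)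
qed

lemma LC_int: "k + l \<le> 4 \<Longrightarrow> integrable M (\<lambda>\<omega>. LC s a m \<omega> ^ k * LC s c m \<omega> ^ l)"
  by (rule integrable_pow4_prod) (auto intro: LC_int4)

lemma LC_indep:
  assumes kl: "k + l \<le> 4" and p: "p \<le> 4"
  shows "integrable M (\<lambda>\<omega>. (LC s a m \<omega> ^ k * LC s c m \<omega> ^ l) * \<xi> (s - int m) \<omega> ^ p)" (is ?I)
    and "expectation (\<lambda>\<omega>. (LC s a m \<omega> ^ k * LC s c m \<omega> ^ l) * \<xi> (s - int m) \<omega> ^ p)
      = expectation (\<lambda>\<omega>. LC s a m \<omega> ^ k * LC s c m \<omega> ^ l) * expectation (\<lambda>\<omega>. \<xi> (s - int m) \<omega> ^ p)" (is ?E)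
proof -
  let ?\<eta> = "\<lambda>q. \<xi> (s - int q)"
  have ind: "indep_vars (\<lambda>_. borel) ?\<eta> (UNIV :: nat set)" by (rule noise_indep)
  have "indep_var
    borel ((\<lambda>f. (\<Sum>q<m. a q * f q) ^ k * (\<Sum>q<m. c q * f q) ^ l) \<circ> (\<lambda>\<omega>. restrict (\<lambda>i. ?\<eta> i \<omega>) {..<m}))
    borel ((\<lambda>f. f m ^ p) \<circ> (\<lambda>\<omega>. restrict (\<lambda>i. ?\<eta> i \<omega>) {m}))"
    by (intro indep_var_compose[OF indep_var_restrict[OF ind]]) auto
  also have "(\<lambda>f. (\<Sum>q<m. a q * f q) ^ k * (\<Sum>q<m. c q * f q) ^ l) \<circ> (\<lambda>\<omega>. restrict (\<lambda>i. ?\<eta> i \<omega>) {..<m})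
      = (\<lambda>\<omega>. LC s a m \<omega> ^ k * LC s c m \<omega> ^ l)"
    by (auto simp: LC_def fun_eq_iff)
  also have "(\<lambda>f. f m ^ p) \<circ> (\<lambda>\<omega>. restrict (\<lambda>i. ?\<eta> i \<omega>) {m}) = (\<lambda>\<omega>. \<xi> (s - int m) \<omega> ^ p)"
    by (auto simp: fun_eq_iff)
  finally have iv: "indep_var borel (\<lambda>\<omega>. LC s a m \<omega> ^ k * LC s c m \<omega> ^ l) borel (\<lambda>\<omega>. \<xi> (s - int m) \<omega> ^ p)" .
  have ip: "integrable M (\<lambda>\<omega>. \<xi> (s - int m) \<omega> ^ p)"
    using integrable_pow4_prod[of "\<xi> (s - int m)" "\<xi> (s - int m)" p 0] xi_moments(1) p by simp
  show ?I by (rule indep_var_integrable[OF iv LC_int[OF kl] ip])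
  show ?E by (rule indep_var_lebesgue_integral[OF iv LC_int[OF kl] ip])
qed

lemma LC_second: "expectation (\<lambda>\<omega>. LC s a m \<omega> * LC s c m \<omega>) = nf.s2 * (\<Sum>q<m. a q * c q)"
  and LC_first: "expectation (LC s a m) = 0"
proof -
  have 1: "expectation (LC s a m) = 0" for a
    unfolding LC_def using xi_moments(2) integrable_pow4_prod[of "\<xi> _" "\<xi> _" 1 0] xi_moments(1) by simp
  show "expectation (LC s a m) = 0" by (rule 1)
  show "expectation (\<lambda>\<omega>. LC s a m \<omega> * LC s c m \<omega>) = nf.s2 * (\<Sum>q<m. a q * c q)"
  proof (induction m)
    case 0 then show ?case by (simp add: LC_def)
  next
    case (Suc m)
    let ?\<eta> = "\<xi> (s - int m)"
    have eq: "LC s a (Suc m) \<omega> * LC s c (Suc m) \<omega> = LC s a m \<omega> ^ 1 * LC s c m \<omega> ^ 1 + c m * ((LC s a m \<omega> ^ 1 * LC s c m \<omega> ^ 0) * ?\<eta> \<omega> ^ 1)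
       + a m * ((LC s a m \<omega> ^ 0 * LC s c m \<omega> ^ 1) * ?\<eta> \<omega> ^ 1) + a m * c m * ((LC s a m \<omega> ^ 0 * LC s c m \<omega> ^ 0) * ?\<eta> \<omega> ^ 2)" for \<omega>
      by (simp add: LC_Suc algebra_simps power2_eq_square)
    have "expectation (\<lambda>\<omega>. LC s a (Suc m) \<omega> * LC s c (Suc m) \<omega>) =
       expectation (\<lambda>\<omega>. LC s a m \<omega> ^ 1 * LC s c m \<omega> ^ 1) + c m * expectation (\<lambda>\<omega>. (LC s a m \<omega> ^ 1 * LC s c m \<omega> ^ 0) * ?\<eta> \<omega> ^ 1)
       + a m * expectation (\<lambda>\<omega>. (LC s a m \<omega> ^ 0 * LC s c m \<omega> ^ 1) * ?\<eta> \<omega> ^ 1)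
       + a m * c m * expectation (\<lambda>\<omega>. (LC s a m \<omega> ^ 0 * LC s c m \<omega> ^ 0) * ?\<eta> \<omega> ^ 2)"
      unfolding eq using LC_int[of 1 1 s a m c] LC_indep(1)[of 1 0 1 s a m c] LC_indep(1)[of 0 1 1 s a m c] LC_indep(1)[of 0 0 2 s a m c]
      by (simp del: power_0 power_one_right)
    also have "\<dots> = nf.s2 * (\<Sum>q<m. a q * c q) + a m * c m * nf.s2"
      using Suc LC_indep(2)[of 1 0 1 s a m c] LC_indep(2)[of 0 1 1 s a m c] LC_indep(2)[of 0 0 2 s a m c]
      by (simp add: 1 xi_moments prob_space)
    finally show ?case by (simp add: algebra_simps)
  qed
qed

text \<open>
  The formula for Gaussian variables plus the contribution of the fourth cumulant of the noise. The innovations are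
  added one at a time, each being independent of the preceding partial sum.
\<close>

lemma LC_fourth: "expectation (\<lambda>\<omega>. (LC s a m \<omega>)\<^sup>2 * (LC s c m \<omega>)\<^sup>2) =
   nf.s2\<^sup>2 * (\<Sum>q<m. (a q)\<^sup>2) * (\<Sum>q<m. (c q)\<^sup>2) + 2 * nf.s2\<^sup>2 * (\<Sum>q<m. a q * c q)\<^sup>2 + (nf.m4 - 3 * nf.s2\<^sup>2) * (\<Sum>q<m. (a q)\<^sup>2 * (c q)\<^sup>2)"
proof (induction m)
  case 0 then show ?case by (simp add: LC_def)
next
  case (Suc m)
  let ?\<eta> = "\<xi> (s - int m)"
  define T where "T k l p \<omega> = (LC s a m \<omega> ^ k * LC s c m \<omega> ^ l) * ?\<eta> \<omega> ^ p" for k l p \<omega>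
  define A C where "A = a m" and "C = c m"
  have Ti: "integrable M (T k l p)" if "k + l \<le> 4" "p \<le> 4" for k l p
    unfolding T_def by (rule LC_indep(1)[OF that])
  have TE: "expectation (T k l p) = expectation (\<lambda>\<omega>. LC s a m \<omega> ^ k * LC s c m \<omega> ^ l) * expectation (\<lambda>\<omega>. ?\<eta> \<omega> ^ p)" if "k + l \<le> 4" "p \<le> 4" for k l p
    unfolding T_def by (rule LC_indep(2)[OF that])
  have eq: "(LC s a (Suc m) \<omega>)\<^sup>2 * (LC s c (Suc m) \<omega>)\<^sup>2 = T 2 2 0 \<omega> + 2 * C * T 2 1 1 \<omega> + C\<^sup>2 * T 2 0 2 \<omega>
     + 2 * A * T 1 2 1 \<omega> + 4 * A * C * T 1 1 2 \<omega> + 2 * A * C\<^sup>2 * T 1 0 3 \<omega>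
     + A\<^sup>2 * T 0 2 2 \<omega> + 2 * A\<^sup>2 * C * T 0 1 3 \<omega> + A\<^sup>2 * C\<^sup>2 * T 0 0 4 \<omega>" for \<omega>
    by (simp add: LC_Suc T_def A_def C_def algebra_simps power2_eq_square power3_eq_cube power4_eq_xxxx)
  have "expectation (\<lambda>\<omega>. (LC s a (Suc m) \<omega>)\<^sup>2 * (LC s c (Suc m) \<omega>)\<^sup>2) =
     expectation (T 2 2 0) + 2 * C * expectation (T 2 1 1) + C\<^sup>2 * expectation (T 2 0 2)
     + 2 * A * expectation (T 1 2 1) + 4 * A * C * expectation (T 1 1 2) + 2 * A * C\<^sup>2 * expectation (T 1 0 3)
     + A\<^sup>2 * expectation (T 0 2 2) + 2 * A\<^sup>2 * C * expectation (T 0 1 3) + A\<^sup>2 * C\<^sup>2 * expectation (T 0 0 4)"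
    unfolding eq using Ti by simp
  also have "\<dots> = expectation (\<lambda>\<omega>. (LC s a m \<omega>)\<^sup>2 * (LC s c m \<omega>)\<^sup>2) + C\<^sup>2 * (nf.s2 * (\<Sum>q<m. a q * a q) * nf.s2)
     + 4 * A * C * (nf.s2 * (\<Sum>q<m. a q * c q) * nf.s2) + A\<^sup>2 * (nf.s2 * (\<Sum>q<m. c q * c q) * nf.s2) + A\<^sup>2 * C\<^sup>2 * nf.m4"
  proof -
    have z: "expectation (T 2 1 1) = 0" "expectation (T 1 2 1) = 0" "expectation (T 1 0 3) = 0" "expectation (T 0 1 3) = 0"
      by (simp_all add: TE xi_moments LC_first)
    have n: "expectation (T 2 2 0) = expectation (\<lambda>\<omega>. (LC s a m \<omega>)\<^sup>2 * (LC s c m \<omega>)\<^sup>2)"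
      "expectation (T 2 0 2) = nf.s2 * (\<Sum>q<m. a q * a q) * nf.s2"
      "expectation (T 1 1 2) = nf.s2 * (\<Sum>q<m. a q * c q) * nf.s2"
      "expectation (T 0 2 2) = nf.s2 * (\<Sum>q<m. c q * c q) * nf.s2"
      "expectation (T 0 0 4) = nf.m4"
      using LC_second[of s a m a] LC_second[of s a m c] LC_second[of s c m c]
      by (simp_all add: TE xi_moments prob_space power2_eq_square[of "LC s _ m _"])
    show ?thesis unfolding z n by simp
  qed
  finally show ?case
    unfolding Suc by (simp add: A_def C_def algebra_simps power2_eq_square)
qed

definition "c4 = 6 * nf.s2\<^sup>2 + nf.m4"

lemma LC_fourth_le: "expectation (\<lambda>\<omega>. LC s a m \<omega> ^ 4) \<le> c4 * (\<Sum>q<m. (a q)\<^sup>2)\<^sup>2"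
proof -
  have s: "(\<Sum>q<m. (a q)\<^sup>2 * (a q)\<^sup>2) \<le> (\<Sum>q<m. (a q)\<^sup>2)\<^sup>2"
  proof -
    have "(\<Sum>q<m. (a q)\<^sup>2 * (a q)\<^sup>2) \<le> (\<Sum>q<m. (a q)\<^sup>2 * (\<Sum>q<m. (a q)\<^sup>2))"
      by (intro sum_mono mult_left_mono member_le_sum) auto
    then show ?thesis by (simp add: power2_eq_square sum_distrib_right)
  qed
  have s0: "0 \<le> (\<Sum>q<m. (a q)\<^sup>2 * (a q)\<^sup>2)" by (intro sum_nonneg) auto
  have "(nf.m4 - 3 * nf.s2\<^sup>2) * (\<Sum>q<m. (a q)\<^sup>2 * (a q)\<^sup>2) \<le> nf.m4 * (\<Sum>q<m. (a q)\<^sup>2 * (a q)\<^sup>2)"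
    using s0 by (intro mult_right_mono) auto
  also have "\<dots> \<le> nf.m4 * (\<Sum>q<m. (a q)\<^sup>2)\<^sup>2" using s nf.moments_nonneg by (intro mult_left_mono) auto
  finally have b: "(nf.m4 - 3 * nf.s2\<^sup>2) * (\<Sum>q<m. (a q)\<^sup>2 * (a q)\<^sup>2) \<le> nf.m4 * (\<Sum>q<m. (a q)\<^sup>2)\<^sup>2" .
  have "expectation (\<lambda>\<omega>. LC s a m \<omega> ^ 4) = expectation (\<lambda>\<omega>. (LC s a m \<omega>)\<^sup>2 * (LC s a m \<omega>)\<^sup>2)"
    by (simp add: power2_eq_square power4_eq_xxxx mult.assoc)
  also have "\<dots> = nf.s2\<^sup>2 * (\<Sum>q<m. (a q)\<^sup>2) * (\<Sum>q<m. (a q)\<^sup>2) + 2 * nf.s2\<^sup>2 * (\<Sum>q<m. a q * a q)\<^sup>2 + (nf.m4 - 3 * nf.s2\<^sup>2) * (\<Sum>q<m. (a q)\<^sup>2 * (a q)\<^sup>2)"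
    by (rule LC_fourth)
  also have "\<dots> \<le> nf.s2\<^sup>2 * (\<Sum>q<m. (a q)\<^sup>2)\<^sup>2 + 2 * nf.s2\<^sup>2 * (\<Sum>q<m. (a q)\<^sup>2)\<^sup>2 + nf.m4 * (\<Sum>q<m. (a q)\<^sup>2)\<^sup>2"
    using b by (simp add: power2_eq_square mult.assoc)
  also have "\<dots> \<le> c4 * (\<Sum>q<m. (a q)\<^sup>2)\<^sup>2" by (simp add: c4_def algebra_simps)
  finally show ?thesis .
qed

lemma c4_nonneg: "0 \<le> c4" unfolding c4_def using nf.moments_nonneg by auto

definition "tail K = (\<Sum>q. (b (q + K))\<^sup>2)"

lemma tail_tendsto: "tail \<longlonglongrightarrow> 0"
  unfolding tail_def[abs_def] by (rule suminf_exist_split2[OF nf.b_sq])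

text \<open>
  Fatou's lemma carries the bound for finite sums over to the almost sure limit.
\<close>

lemma tail_fourth:
  shows "integrable M (\<lambda>\<omega>. (X t \<omega> - LC t b K \<omega>) ^ 4)"
    and "expectation (\<lambda>\<omega>. (X t \<omega> - LC t b K \<omega>) ^ 4) \<le> c4 * (tail K)\<^sup>2"
proof -
  have b_sum: "(\<Sum>q<m. (b (q + K))\<^sup>2) \<le> tail K" for m
    unfolding tail_def using nf.b_sq by (intro sum_le_suminf) (auto simp: summable_iff_shift[of "\<lambda>q. (b q)\<^sup>2"])
  have "(\<integral>\<^sup>+ \<omega>. ennreal ((X t \<omega> - LC t b K \<omega>) ^ 4) \<partial>M) = (\<integral>\<^sup>+ \<omega>. liminf (\<lambda>L. ennreal ((LC t b (L + K) \<omega> - LC t b K \<omega>) ^ 4)) \<partial>M)"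
  proof (rule nn_integral_cong_AE)
    have "AE \<omega> in M. (\<lambda>L. LC t b L \<omega>) \<longlonglongrightarrow> X t \<omega>"
      using lin by (auto simp: linear_process_def sums_def LC_def)
    then show "AE \<omega> in M. ennreal ((X t \<omega> - LC t b K \<omega>) ^ 4) = liminf (\<lambda>L. ennreal ((LC t b (L + K) \<omega> - LC t b K \<omega>) ^ 4))"
    proof eventually_elim
      case (elim \<omega>)
      have "(\<lambda>L. LC t b (L + K) \<omega>) \<longlonglongrightarrow> X t \<omega>" using elim by (rule LIMSEQ_ignore_initial_segment)
      then have "(\<lambda>L. ennreal ((LC t b (L + K) \<omega> - LC t b K \<omega>) ^ 4)) \<longlonglongrightarrow> ennreal ((X t \<omega> - LC t b K \<omega>) ^ 4)"
        by (intro tendsto_ennrealI tendsto_intros)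
      from lim_imp_Liminf[OF trivial_limit_sequentially this] show ?case by (rule sym)
    qed
  qed
  also have "\<dots> \<le> liminf (\<lambda>L. \<integral>\<^sup>+ \<omega>. ennreal ((LC t b (L + K) \<omega> - LC t b K \<omega>) ^ 4) \<partial>M)"
    by (rule nn_integral_liminf) measurable
  also have "\<dots> \<le> ennreal (c4 * (tail K)\<^sup>2)"
  proof (rule Liminf_le)
    have "(\<integral>\<^sup>+ \<omega>. ennreal ((LC t b (L + K) \<omega> - LC t b K \<omega>) ^ 4) \<partial>M) \<le> ennreal (c4 * (tail K)\<^sup>2)" for L
    proof -
      define d where "d q = (if q < K then 0 else b q)" for q
      have e: "LC t b (L + K) \<omega> - LC t b K \<omega> = LC t d (L + K) \<omega>" for \<omega>
      proof -
        have "LC t b (L + K) \<omega> = LC t b K \<omega> + (\<Sum>q\<in>{K..<L+K}. b q * \<xi> (t - int q) \<omega>)"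
          unfolding LC_def by (simp add: lessThan_atLeast0 sum.atLeastLessThan_concat)
        moreover have "LC t d (L + K) \<omega> = (\<Sum>q\<in>{K..<L+K}. b q * \<xi> (t - int q) \<omega>)"
          unfolding LC_def by (intro sum.mono_neutral_cong_right) (auto simp: d_def)
        ultimately show ?thesis by simp
      qed
      have ds: "(\<Sum>q<L + K. (d q)\<^sup>2) = (\<Sum>q<L. (b (q + K))\<^sup>2)"
      proof -
        have "(\<Sum>q<L + K. (d q)\<^sup>2) = (\<Sum>q\<in>{K..<L + K}. (b q)\<^sup>2)"
          by (intro sum.mono_neutral_cong_right) (auto simp: d_def)
        then show ?thesis using sum.shift_bounds_nat_ivl[of "\<lambda>q. (b q)\<^sup>2" 0 K L] by (simp add: atLeast0LessThan)
      qed
      have "(\<integral>\<^sup>+ \<omega>. ennreal ((LC t b (L + K) \<omega> - LC t b K \<omega>) ^ 4) \<partial>M) = ennreal (expectation (\<lambda>\<omega>. LC t d (L + K) \<omega> ^ 4))"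
        unfolding e by (rule nn_integral_eq_integral[OF LC_int4]) simp
      also have "expectation (\<lambda>\<omega>. LC t d (L + K) \<omega> ^ 4) \<le> c4 * (\<Sum>q<L + K. (d q)\<^sup>2)\<^sup>2" by (rule LC_fourth_le)
      also have "\<dots> \<le> c4 * (tail K)\<^sup>2"
        unfolding ds using c4_nonneg by (intro mult_left_mono power_mono b_sum sum_nonneg) auto
      finally show ?thesis by (simp add: ennreal_leI)
    qed
    then show "\<forall>\<^sub>F L in sequentially. (\<integral>\<^sup>+ \<omega>. ennreal ((LC t b (L + K) \<omega> - LC t b K \<omega>) ^ 4) \<partial>M) \<le> ennreal (c4 * (tail K)\<^sup>2)"
      by (rule always_eventually[OF allI])
  qed auto
  finally have nn: "(\<integral>\<^sup>+ \<omega>. ennreal ((X t \<omega> - LC t b K \<omega>) ^ 4) \<partial>M) \<le> ennreal (c4 * (tail K)\<^sup>2)" .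
  show i: "integrable M (\<lambda>\<omega>. (X t \<omega> - LC t b K \<omega>) ^ 4)"
    by (rule integrableI_bounded) (use nn in \<open>auto intro: le_less_trans simp: power_abs\<close>)
  show "expectation (\<lambda>\<omega>. (X t \<omega> - LC t b K \<omega>) ^ 4) \<le> c4 * (tail K)\<^sup>2"
    using nn unfolding nn_integral_eq_integral[OF i, OF AE_I2, simplified]
    using c4_nonneg by (simp add: ennreal_le_iff)
qed

lemma X_int4: "integrable M (\<lambda>\<omega>. X t \<omega> ^ 4)"
  using tail_fourth(1)[of t 0] by (simp add: LC_def)

lemma X_LC_tendsto: "(\<lambda>K. expectation (\<lambda>\<omega>. (X t \<omega> - LC t b K \<omega>) ^ 4)) \<longlonglongrightarrow> 0"
proof (rule tendsto_sandwich[of "\<lambda>_. 0" _ _ "\<lambda>K. c4 * (tail K)\<^sup>2"])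
  have "(\<lambda>K. c4 * (tail K)\<^sup>2) \<longlonglongrightarrow> c4 * 0\<^sup>2" by (intro tendsto_intros tail_tendsto)
  then show "(\<lambda>K. c4 * (tail K)\<^sup>2) \<longlonglongrightarrow> 0" by simp
qed (auto intro!: always_eventually integral_nonneg_AE tail_fourth(2))

lemma LC_b_fourth: "expectation (\<lambda>\<omega>. LC t b K \<omega> ^ 4) \<le> c4 * nf.S\<^sup>2"
proof -
  have "(\<Sum>q<K. (b q)\<^sup>2) \<le> nf.S"
    using sum_le_suminf[OF nf.b_sq, of "{..<K}"] by (simp add: nf.S_def)
  then have "(\<Sum>q<K. (b q)\<^sup>2)\<^sup>2 \<le> nf.S\<^sup>2" by (intro power_mono sum_nonneg) auto
  then have "c4 * (\<Sum>q<K. (b q)\<^sup>2)\<^sup>2 \<le> c4 * nf.S\<^sup>2" using c4_nonneg by (intro mult_left_mono) auto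
  then show ?thesis using LC_fourth_le[of t b K] by linarith
qed

lemma X_sq: "expectation (\<lambda>\<omega>. (X t \<omega>)\<^sup>2) = nf.s2 * rho b 0"
proof -
  have "(\<lambda>K. expectation (\<lambda>\<omega>. (LC t b K \<omega>)\<^sup>2 * (1::real)\<^sup>2)) \<longlonglongrightarrow> expectation (\<lambda>\<omega>. (X t \<omega>)\<^sup>2 * 1\<^sup>2)"
    by (rule expectation_sq_prod_tendsto[where C = "c4 * nf.S\<^sup>2 + 1"])
       (auto simp: prob_space LC_int4 X_int4 X_LC_tendsto c4_nonneg intro: order_trans[OF LC_b_fourth])
  then have "(\<lambda>K. expectation (\<lambda>\<omega>. LC t b K \<omega> * LC t b K \<omega>)) \<longlonglongrightarrow> expectation (\<lambda>\<omega>. (X t \<omega>)\<^sup>2)"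
    by (simp add: power2_eq_square)
  then have "(\<lambda>K. nf.s2 * (\<Sum>q<K. b q * b q)) \<longlonglongrightarrow> expectation (\<lambda>\<omega>. (X t \<omega>)\<^sup>2)"
    unfolding LC_second .
  moreover have "(\<lambda>K. nf.s2 * (\<Sum>q<K. b q * b q)) \<longlonglongrightarrow> nf.s2 * rho b 0"
    unfolding rho_def using nf.b_sq by (intro tendsto_intros) (simp add: summable_LIMSEQ power2_eq_square)
  ultimately show ?thesis by (rule LIMSEQ_unique)
qed

lemma X_sq_int: "integrable M (\<lambda>\<omega>. (X t \<omega>)\<^sup>2)"
  using integrable_pow4_prod[of "X t" "X t" 2 0] X_int4 by simp

lemma X_sq_sq_int: "integrable M (\<lambda>\<omega>. (X s \<omega>)\<^sup>2 * (X t \<omega>)\<^sup>2)"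
  using integrable_pow4_prod[of "X s" "X t" 2 2] X_int4 by simp

definition "Cv s t = expectation (\<lambda>\<omega>. (X s \<omega>)\<^sup>2 * (X t \<omega>)\<^sup>2) - (nf.s2 * rho b 0)\<^sup>2"

lemma Cv_sum:
  "\<bar>(\<Sum>i<n. \<Sum>j<n. Cv (int n - int i) (int n - int j)) - 2 * nf.s2\<^sup>2 * Wn b n\<bar> \<le> \<bar>nf.m4 - 3 * nf.s2\<^sup>2\<bar> * (real n * nf.S\<^sup>2)"
proof -
  let ?s = "int n"
  define E where "E K i j = expectation (\<lambda>\<omega>. (LC ?s (nf.x K i) (K+n) \<omega>)\<^sup>2 * (LC ?s (nf.x K j) (K+n) \<omega>)\<^sup>2)" for K i j
  define V where "V K = (\<Sum>q<K. (b q)\<^sup>2)" for K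
  have xx: "(\<Sum>q<K+n. (nf.x K i q)\<^sup>2) = V K" if "i < n" for i K
  proof -
    have "(\<Sum>q<K+n. (nf.x K i q)\<^sup>2) = (\<Sum>q\<in>{i..<K+i}. (nf.x K i q)\<^sup>2)"
      using that by (intro sum.mono_neutral_right) (auto simp: sh_def nf.tr_def)
    also have "\<dots> = V K"
      using sum.shift_bounds_nat_ivl[of "\<lambda>q. (nf.x K i q)\<^sup>2" 0 i K] by (simp add: sh_def nf.tr_def atLeast0LessThan V_def)
    finally show ?thesis .
  qed
  have Elim: "(\<lambda>K. E K i j) \<longlonglongrightarrow> expectation (\<lambda>\<omega>. (X (?s - int i) \<omega>)\<^sup>2 * (X (?s - int j) \<omega>)\<^sup>2)" if ij: "i < n" "j < n" for i j
  proof -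
    have LCe: "LC ?s (nf.x K i) (K+n) = LC (?s - int i) b K" if "i < n" for i K
      unfolding LC_def[abs_def] partial_sum_eq[OF that] ..
    show ?thesis unfolding E_def LCe[OF ij(1)] LCe[OF ij(2)]
      by (rule expectation_sq_prod_tendsto[where C = "c4 * nf.S\<^sup>2"])
         (auto simp: LC_int4 X_int4 X_LC_tendsto LC_b_fourth)
  qed
  have Eeq: "E K i j - nf.s2\<^sup>2 * (V K)\<^sup>2 - 2 * nf.s2\<^sup>2 * (nf.r K n i j)\<^sup>2 = (nf.m4 - 3 * nf.s2\<^sup>2) * nf.k2 K n i j" if ij: "i < n" "j < n" for K i j
    unfolding E_def LC_fourth xx[OF ij(1)] xx[OF ij(2)] nf.r_def nf.k2_def by (simp add: power2_eq_square)
  have Vlim: "V \<longlonglongrightarrow> rho b 0"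
    unfolding V_def[abs_def] rho_def using summable_LIMSEQ[OF nf.b_sq] by (simp add: power2_eq_square)
  have L: "(\<lambda>K. \<bar>\<Sum>i<n. \<Sum>j<n. E K i j - nf.s2\<^sup>2 * (V K)\<^sup>2 - 2 * nf.s2\<^sup>2 * (nf.r K n i j)\<^sup>2\<bar>) \<longlonglongrightarrow>
     \<bar>\<Sum>i<n. \<Sum>j<n. expectation (\<lambda>\<omega>. (X (?s - int i) \<omega>)\<^sup>2 * (X (?s - int j) \<omega>)\<^sup>2) - nf.s2\<^sup>2 * (rho b 0)\<^sup>2 - 2 * nf.s2\<^sup>2 * (rho b (lag i j))\<^sup>2\<bar>"
    by (intro tendsto_rabs tendsto_sum tendsto_diff tendsto_mult tendsto_const tendsto_power Vlim Elim nf.r_tendsto) auto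
  have B: "\<bar>\<Sum>i<n. \<Sum>j<n. E K i j - nf.s2\<^sup>2 * (V K)\<^sup>2 - 2 * nf.s2\<^sup>2 * (nf.r K n i j)\<^sup>2\<bar> \<le> \<bar>nf.m4 - 3 * nf.s2\<^sup>2\<bar> * (real n * nf.S\<^sup>2)" for K
  proof -
    have "(\<Sum>i<n. \<Sum>j<n. E K i j - nf.s2\<^sup>2 * (V K)\<^sup>2 - 2 * nf.s2\<^sup>2 * (nf.r K n i j)\<^sup>2) = (nf.m4 - 3 * nf.s2\<^sup>2) * (\<Sum>i<n. \<Sum>j<n. nf.k2 K n i j)"
      by (simp add: Eeq sum_distrib_left)
    moreover have "\<bar>\<Sum>i<n. \<Sum>j<n. nf.k2 K n i j\<bar> \<le> real n * nf.S\<^sup>2"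
      using nf.k2_sum_le[where K = K and n = n] by (subst abs_of_nonneg) (auto intro!: sum_nonneg nf.k2_nonneg)
    ultimately show ?thesis by (simp add: abs_mult mult_left_mono)
  qed
  have "\<bar>\<Sum>i<n. \<Sum>j<n. expectation (\<lambda>\<omega>. (X (?s - int i) \<omega>)\<^sup>2 * (X (?s - int j) \<omega>)\<^sup>2) - nf.s2\<^sup>2 * (rho b 0)\<^sup>2 - 2 * nf.s2\<^sup>2 * (rho b (lag i j))\<^sup>2\<bar>
     \<le> \<bar>nf.m4 - 3 * nf.s2\<^sup>2\<bar> * (real n * nf.S\<^sup>2)"
    by (rule LIMSEQ_le_const2[OF L]) (use B in blast)
  then show ?thesis
    by (simp add: Cv_def Wn_def sum_subtractf sum_distrib_left power_mult_distrib)
qed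

text \<open>
  The covariance of \<open>(X s)\<^sup>2\<close> and \<open>(X t)\<^sup>2\<close> is \<open>2 * s2\<^sup>2 * \<rho>\<^sup>2\<close> plus a fourth cumulant, and the cumulants
  sum to \<open>O(n)\<close> by \<open>k2_sum_le\<close>.
\<close>

theorem variance_expansion:
  "\<exists>C\<ge>0. \<forall>n\<ge>1. \<bar>(real n)\<^sup>2 * variance (\<lambda>\<omega>. 1 / real n * (\<Sum>j=1..n. ((X (int j) \<omega>)\<^sup>2 - expectation (\<lambda>\<omega>'. (X 1 \<omega>')\<^sup>2))))
     - 2 * nf.s2\<^sup>2 * Wn b n\<bar> \<le> C * real n"
proof (intro exI[of _ "\<bar>nf.m4 - 3 * nf.s2\<^sup>2\<bar> * nf.S\<^sup>2"] conjI allI impI)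
  fix n :: nat assume n: "n \<ge> 1"
  define c where "c = nf.s2 * rho b 0"
  define Y where "Y \<omega> = (\<Sum>j=1..n. (X (int j) \<omega>)\<^sup>2 - c)" for \<omega>
  have int1: "integrable M (\<lambda>\<omega>. (X t \<omega>)\<^sup>2 - c)" for t using X_sq_int by simp
  have "expectation Y = (\<Sum>j=1..n. expectation (\<lambda>\<omega>. (X (int j) \<omega>)\<^sup>2 - c))"
    unfolding Y_def using int1 by (intro Bochner_Integration.integral_sum) auto
  also have "\<dots> = 0" using X_sq_int by (simp add: X_sq c_def prob_space)
  finally have EY: "expectation Y = 0" .
  have pr: "((X s \<omega>)\<^sup>2 - c) * ((X t \<omega>)\<^sup>2 - c) = (X s \<omega>)\<^sup>2 * (X t \<omega>)\<^sup>2 - c * (X s \<omega>)\<^sup>2 - c * (X t \<omega>)\<^sup>2 + c * c" for s t \<omega>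
    by (simp add: algebra_simps)
  have pint: "integrable M (\<lambda>\<omega>. ((X s \<omega>)\<^sup>2 - c) * ((X t \<omega>)\<^sup>2 - c))" for s t
    unfolding pr using X_sq_int X_sq_sq_int by simp
  have pexp: "expectation (\<lambda>\<omega>. ((X s \<omega>)\<^sup>2 - c) * ((X t \<omega>)\<^sup>2 - c)) = Cv s t" for s t
    unfolding pr using X_sq_int X_sq_sq_int by (simp add: X_sq Cv_def c_def prob_space) (simp add: power2_eq_square)
  have "expectation (\<lambda>\<omega>. (Y \<omega>)\<^sup>2) = (\<Sum>s=1..n. \<Sum>t=1..n. Cv (int s) (int t))"
  proof -
    have sq: "(Y \<omega>)\<^sup>2 = (\<Sum>s=1..n. \<Sum>t=1..n. ((X (int s) \<omega>)\<^sup>2 - c) * ((X (int t) \<omega>)\<^sup>2 - c))" for \<omega>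
      by (subst power2_eq_square) (simp only: Y_def sum_product)
    show ?thesis unfolding sq pexp[symmetric] using pint by simp
  qed
  also have "\<dots> = (\<Sum>i<n. \<Sum>j<n. Cv (int n - int i) (int n - int j))"
  proof -
    have re: "(\<Sum>s=1..n. h (int s)) = (\<Sum>i<n. h (int n - int i))" for h :: "int \<Rightarrow> real"
      by (rule sum.reindex_bij_witness[of _ "\<lambda>i. n - i" "\<lambda>s. n - s"]) (auto simp: of_nat_diff)
    show ?thesis
      by (rule trans[OF re[of "\<lambda>s. \<Sum>t=1..n. Cv s (int t)"]]) (intro sum.cong refl re)
  qed
  finally have EYY: "expectation (\<lambda>\<omega>. (Y \<omega>)\<^sup>2) = (\<Sum>i<n. \<Sum>j<n. Cv (int n - int i) (int n - int j))" .
  have "variance (\<lambda>\<omega>. 1 / real n * Y \<omega>) = (1 / real n)\<^sup>2 * expectation (\<lambda>\<omega>. (Y \<omega>)\<^sup>2)"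
    using EY by (simp add: power_mult_distrib power_divide)
  then have "(real n)\<^sup>2 * variance (\<lambda>\<omega>. 1 / real n * Y \<omega>) = (\<Sum>i<n. \<Sum>j<n. Cv (int n - int i) (int n - int j))"
    using n EYY by (simp add: power_divide)
  then show "\<bar>(real n)\<^sup>2 * variance (\<lambda>\<omega>. 1 / real n * (\<Sum>j=1..n. ((X (int j) \<omega>)\<^sup>2 - expectation (\<lambda>\<omega>'. (X 1 \<omega>')\<^sup>2))))
     - 2 * nf.s2\<^sup>2 * Wn b n\<bar> \<le> \<bar>nf.m4 - 3 * nf.s2\<^sup>2\<bar> * nf.S\<^sup>2 * real n"
    using Cv_sum[of n] unfolding Y_def X_sq c_def by (simp add: mult_ac)
qed auto

end

section \<open>Fourier inversion and the Plancherel identity\<close>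

lemma integrable_product_function:
  fixes a :: "'a \<Rightarrow> real" and c :: "'b \<Rightarrow> real"
  assumes "sigma_finite_measure M1" "sigma_finite_measure M2" and a: "integrable M1 a" and c: "integrable M2 c"
  shows "integrable (M1 \<Otimes>\<^sub>M M2) (\<lambda>(x, y). a x * c y)"
proof -
  interpret pair_sigma_finite M1 M2 using assms(1,2) by (simp add: pair_sigma_finite_def)
  have [measurable]: "a \<in> borel_measurable M1" "c \<in> borel_measurable M2" using a c by auto
  show ?thesis
  proof (rule Fubini_integrable)
    show "integrable M1 (\<lambda>x. \<integral>y. norm (case (x, y) of (x, y) \<Rightarrow> a x * c y) \<partial>M2)"
      using a by (simp add: abs_mult)
    show "AE x in M1. integrable M2 (\<lambda>y. case (x, y) of (x, y) \<Rightarrow> a x * c y)" using c by simp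
  qed measurable
qed

lemma fubini_dominated:
  fixes k :: "'a \<Rightarrow> 'b \<Rightarrow> 'c :: {banach, second_countable_topology}"
  assumes sf: "sigma_finite_measure M1" "sigma_finite_measure M2"
    and k: "(\<lambda>(x, y). k x y) \<in> borel_measurable (M1 \<Otimes>\<^sub>M M2)"
    and a: "integrable M1 a" and c: "integrable M2 c" and le: "\<And>x y. norm (k x y) \<le> a x * c y"
  shows "(\<integral>y. (\<integral>x. k x y \<partial>M1) \<partial>M2) = (\<integral>x. (\<integral>y. k x y \<partial>M2) \<partial>M1)"
    and "integrable M1 (\<lambda>x. \<integral>y. k x y \<partial>M2)"
    and "integrable M2 (\<lambda>y. \<integral>x. k x y \<partial>M1)"
proof -
  interpret pair_sigma_finite M1 M2 using sf by (simp add: pair_sigma_finite_def)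
  have i: "integrable (M1 \<Otimes>\<^sub>M M2) (case_prod k)"
  proof (rule Bochner_Integration.integrable_bound[OF integrable_product_function[OF sf a c]])
    show "AE x in M1 \<Otimes>\<^sub>M M2. norm (case x of (x, y) \<Rightarrow> k x y) \<le> norm (case x of (x, y) \<Rightarrow> a x * c y)"
      by (intro AE_I2) (auto intro!: order_trans[OF le abs_ge_self])
  qed (use k in simp)
  show "(\<integral>y. (\<integral>x. k x y \<partial>M1) \<partial>M2) = (\<integral>x. (\<integral>y. k x y \<partial>M2) \<partial>M1)" by (rule Fubini_integral[OF i])
  show "integrable M1 (\<lambda>x. \<integral>y. k x y \<partial>M2)" using integrable_fst[OF i] by simp
  show "integrable M2 (\<lambda>y. \<integral>x. k x y \<partial>M1)" using integrable_snd[OF i] by simp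
qed

text \<open>
  A Gaussian damping factor, which makes all integrals over frequencies absolutely convergent and tends to 1 as \<open>s\<close> tends to 0.
\<close>

definition gs :: "real \<Rightarrow> real \<Rightarrow> real" where "gs s u = exp (- (s * u)\<^sup>2 / 2)"

lemma gs_measurable [measurable]: "gs s \<in> borel_measurable borel"
  unfolding gs_def by measurable

lemma gs_eq: "gs s u = sqrt (2 * pi) * std_normal_density (0 + s * u)"
  by (simp add: gs_def std_normal_density_def)

lemma gs_bounds: "0 \<le> gs s u" "gs s u \<le> 1"
  by (auto simp: gs_def)

lemma gs_integrable: "s > 0 \<Longrightarrow> integrable lborel (gs s)"
  unfolding gs_eq[abs_def] by (intro integrable_mult_right lborel_integrable_real_affine integrable_normal_density) auto

lemma std_normal_fourier: "(LINT x|lborel. of_real (std_normal_density x) * iexp (t * x)) = of_real (exp (- (t\<^sup>2) / 2))"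
proof -
  have "of_real (exp (- (t\<^sup>2) / 2)) = char std_normal_distribution t" by (simp add: char_std_normal_distribution)
  also have "\<dots> = (LINT x|lborel. std_normal_density x *\<^sub>R iexp (t * x))"
    unfolding char_def by (rule integral_density) auto
  finally show ?thesis by (simp add: scaleR_conv_of_real)
qed

lemma gs_fourier:
  assumes s: "s > 0"
  shows "(LINT u|lborel. of_real (gs s u) * iexp (u * (z - v))) = of_real (2 * pi * (std_normal_density ((v - z) / s) / s))"
proof -
  have "(LINT u|lborel. of_real (gs s u) * iexp (u * (z - v)))
      = of_real (sqrt (2 * pi)) * (LINT u|lborel. of_real (std_normal_density (0 + s * u)) * iexp ((z - v) / s * (0 + s * u)))"
  proof -
    have "(z - v) / s * (0 + s * u) = u * (z - v)" for u using s by simp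
    then show ?thesis by (simp only: gs_eq of_real_mult[of "sqrt (2 * pi)"] mult.assoc integral_mult_right_zero)
  qed
  also have "(LINT u|lborel. of_real (std_normal_density (0 + s * u)) * iexp ((z - v) / s * (0 + s * u)))
      = of_real (exp (- (((z - v) / s)\<^sup>2) / 2)) / of_real s"
    using lborel_integral_real_affine[of s "\<lambda>x. of_real (std_normal_density x) * iexp ((z - v) / s * x)" 0] s
    unfolding std_normal_fourier by (simp add: scaleR_conv_of_real field_simps del: of_real_mult of_real_diff of_real_divide of_real_exp)
  also have "of_real (sqrt (2 * pi)) * (of_real (exp (- (((z - v) / s)\<^sup>2) / 2)) / of_real s)
     = (of_real (2 * pi * (std_normal_density ((v - z) / s) / s)) :: complex)"
  proof -
    have e: "((z - v) / s)\<^sup>2 = ((v - z) / s)\<^sup>2" by (simp add: power_divide power2_commute)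
    have "sqrt (2 * pi) * (exp (- (((z - v) / s)\<^sup>2) / 2) / s) = 2 * pi * (std_normal_density ((v - z) / s) / s)"
    proof -
      have "2 * pi * (1 / sqrt (2 * pi)) = sqrt (2 * pi)" by (simp add: real_div_sqrt)
      then have "2 * pi * (1 / sqrt (2 * pi) * exp (- (((v - z) / s)\<^sup>2) / 2) / s) = sqrt (2 * pi) * (exp (- (((v - z) / s)\<^sup>2) / 2) / s)"
        by (metis (no_types, opaque_lifting) mult.assoc times_divide_eq_right)
      then show ?thesis unfolding e std_normal_density_def by simp
    qed
    then show ?thesis by (simp only: of_real_mult[symmetric] of_real_divide[symmetric])
  qed
  finally show ?thesis .
qed

text \<open>
  Damping on the Fourier side is convolution with a narrow Gaussian, which for continuous bounded \<open>L\<close> is an approximate identity.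
\<close>

lemma gauss_smoothing:
  fixes L :: "real \<Rightarrow> complex"
  assumes s: "s > 0" and L: "integrable lborel L"
  defines "Lh \<equiv> \<lambda>u. LINT v|lborel. L v * iexp (- (u * v))"
  shows "(LINT y|lborel. of_real (std_normal_density y) * L (z + s * y)) = (LINT u|lborel. of_real (gs s u) * iexp (u * z) * Lh u) / of_real (2 * pi)"
proof -
  have [measurable]: "L \<in> borel_measurable borel" using L by auto
  have "(LINT y|lborel. of_real (std_normal_density y) * L (z + s * y)) = (LINT v|lborel. of_real (std_normal_density ((v - z) / s) / s) * L v)"
    using lborel_integral_real_affine[of s "\<lambda>v. of_real (std_normal_density ((v - z) / s) / s) * L v" z] s
    by (simp add: scaleR_conv_of_real)
  also have "\<dots> = (LINT v|lborel. L v * (LINT u|lborel. of_real (gs s u) * iexp (u * (z - v)))) / of_real (2 * pi)"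
  proof -
    have "L v * of_real (2 * pi * k) = of_real (2 * pi) * (of_real k * L v)" for v k
      by (simp add: mult_ac)
    then show ?thesis unfolding gs_fourier[OF s] by (simp only: integral_mult_right_zero) simp
  qed
  also have "(LINT v|lborel. L v * (LINT u|lborel. of_real (gs s u) * iexp (u * (z - v))))
     = (LINT v|lborel. (LINT u|lborel. L v * (of_real (gs s u) * iexp (u * (z - v)))))"
    by simp
  also have "\<dots> = (LINT u|lborel. (LINT v|lborel. L v * (of_real (gs s u) * iexp (u * (z - v)))))"
    by (rule fubini_dominated(1)[where c = "\<lambda>v. norm (L v)" and a = "gs s"])
       (use s L in \<open>auto simp: norm_mult gs_integrable gs_bounds intro!: sigma_finite_lborel\<close>)
  also have "\<dots> = (LINT u|lborel. of_real (gs s u) * iexp (u * z) * Lh u)"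
  proof (intro Bochner_Integration.integral_cong refl)
    fix u
    have "L v * (of_real (gs s u) * iexp (u * (z - v))) = of_real (gs s u) * iexp (u * z) * (L v * iexp (- (u * v)))" for v
      by (simp add: algebra_simps exp_diff exp_minus field_simps)
    then show "(LINT v|lborel. L v * (of_real (gs s u) * iexp (u * (z - v)))) = of_real (gs s u) * iexp (u * z) * Lh u"
      by (simp only: Lh_def integral_mult_right_zero)
  qed
  finally show ?thesis .
qed

lemma fourier_transform_bounds:
  fixes L :: "real \<Rightarrow> complex"
  assumes L: "integrable lborel L"
  shows "norm (LINT v|lborel. L v * iexp (- (u * v))) \<le> (LINT v|lborel. norm (L v))"
    and "(\<lambda>u. LINT v|lborel. L v * iexp (- (u * v))) \<in> borel_measurable borel"
proof -
  have [measurable]: "L \<in> borel_measurable borel" using L by auto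
  have "norm (LINT v|lborel. L v * iexp (- (u * v))) \<le> (LINT v|lborel. norm (L v * iexp (- (u * v))))" by simp
  then show "norm (LINT v|lborel. L v * iexp (- (u * v))) \<le> (LINT v|lborel. norm (L v))" by (simp add: norm_mult)
  show "(\<lambda>u. LINT v|lborel. L v * iexp (- (u * v))) \<in> borel_measurable borel" by measurable
qed

lemma gs_tendsto: "(\<lambda>n. gs (1 / real (Suc n)) u) \<longlonglongrightarrow> 1"
proof -
  have "(\<lambda>n. gs (1 / real (Suc n)) u) \<longlonglongrightarrow> exp (- (0 * u)\<^sup>2 / 2)"
    unfolding gs_def by (intro tendsto_intros LIMSEQ_Suc lim_1_over_n) auto
  then show ?thesis by simp
qed

lemma gauss_smoothing_tendsto:
  fixes L :: "real \<Rightarrow> complex"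
  assumes c: "continuous_on UNIV L" and B: "\<And>v. norm (L v) \<le> B"
  shows "(\<lambda>n. LINT y|lborel. of_real (std_normal_density y) * L (z + 1 / real (Suc n) * y)) \<longlonglongrightarrow> L z"
    and "norm (LINT y|lborel. of_real (std_normal_density y) * L (z + s * y)) \<le> B"
proof -
  have [measurable]: "L \<in> borel_measurable borel" using c by (rule borel_measurable_continuous_onI)
  have one: "(LINT y|lborel. std_normal_density y) = 1" by (rule integral_normal_density) simp
  have bd: "norm (of_real (std_normal_density y) * L w) \<le> B * std_normal_density y" for y w
    unfolding norm_mult using B[of w] by (simp add: mult_right_mono mult.commute)
  have iB: "integrable lborel (\<lambda>y. B * std_normal_density y)" by simp
  have "(\<lambda>n. LINT y|lborel. of_real (std_normal_density y) * L (z + 1 / real (Suc n) * y)) \<longlonglongrightarrow> (LINT y|lborel. of_real (std_normal_density y) * L z)"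
  proof (rule integral_dominated_convergence[where w = "\<lambda>y. B * std_normal_density y"])
    show "AE y in lborel. (\<lambda>n. of_real (std_normal_density y) * L (z + 1 / real (Suc n) * y)) \<longlonglongrightarrow> of_real (std_normal_density y) * L z"
    proof (rule AE_I2)
      fix y
      have "(\<lambda>n. z + 1 / real (Suc n) * y) \<longlonglongrightarrow> z + 0 * y" by (intro tendsto_intros LIMSEQ_Suc lim_1_over_n)
      then have "(\<lambda>n. z + 1 / real (Suc n) * y) \<longlonglongrightarrow> z" by simp
      moreover have "isCont L z" using c by (simp add: continuous_on_eq_continuous_at)
      ultimately have "(\<lambda>n. L (z + 1 / real (Suc n) * y)) \<longlonglongrightarrow> L z" by (rule isCont_tendsto_compose[rotated])
      then show "(\<lambda>n. of_real (std_normal_density y) * L (z + 1 / real (Suc n) * y)) \<longlonglongrightarrow> of_real (std_normal_density y) * L z"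
        by (rule tendsto_mult_left)
    qed
  qed (use iB bd in auto)
  also have "(LINT y|lborel. of_real (std_normal_density y) * L z) = L z"
    using one integral_complex_of_real[of lborel std_normal_density] by simp
  finally show "(\<lambda>n. LINT y|lborel. of_real (std_normal_density y) * L (z + 1 / real (Suc n) * y)) \<longlonglongrightarrow> L z" .
  have "norm (LINT y|lborel. of_real (std_normal_density y) * L (z + s * y)) \<le> (LINT y|lborel. norm (of_real (std_normal_density y) * L (z + s * y)))" by simp
  also have "\<dots> \<le> (LINT y|lborel. B * std_normal_density y)"
  proof (rule integral_mono)
    show "integrable lborel (\<lambda>y. norm (of_real (std_normal_density y) * L (z + s * y)))"
      by (rule integrable_norm, rule Bochner_Integration.integrable_bound[OF iB]) (auto intro!: AE_I2 order_trans[OF bd abs_ge_self])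
  qed (use iB bd in auto)
  finally show "norm (LINT y|lborel. of_real (std_normal_density y) * L (z + s * y)) \<le> B" using one by simp
qed

text \<open>
  Inversion in weak form: \<open>L\<close> is smoothed, Fubini is applied to the damped integrals, and the damping is removed.
\<close>

theorem (in real_distribution) parseval_char:
  fixes L :: "real \<Rightarrow> complex"
  assumes \<psi>: "integrable lborel (char M)" and L: "integrable lborel L" and c: "continuous_on UNIV L" and B: "\<And>v. norm (L v) \<le> B"
  shows "(LINT z|M. L z) = (LINT u|lborel. char M u * (LINT v|lborel. L v * iexp (- (u * v)))) / of_real (2 * pi)"
proof -
  define Lh where "Lh u = (LINT v|lborel. L v * iexp (- (u * v)))" for u
  have [measurable]: "L \<in> borel_measurable borel" using L by auto
  have [measurable]: "Lh \<in> borel_measurable borel" unfolding Lh_def[abs_def] by (rule fourier_transform_bounds(2)[OF L])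
  define C where "C = (LINT v|lborel. norm (L v))"
  have LhC: "norm (Lh u) \<le> C" for u unfolding Lh_def C_def by (rule fourier_transform_bounds(1)[OF L])
  let ?s = "\<lambda>n. 1 / real (Suc n)"
  define Am where "Am n = (LINT z|M. (LINT y|lborel. of_real (std_normal_density y) * L (z + ?s n * y)))" for n
  have lim1: "Am \<longlonglongrightarrow> (LINT z|M. L z)"
    unfolding Am_def
  proof (rule integral_dominated_convergence[where w = "\<lambda>_. B"])
    show "AE z in M. (\<lambda>n. LINT y|lborel. of_real (std_normal_density y) * L (z + ?s n * y)) \<longlonglongrightarrow> L z"
      by (intro AE_I2 gauss_smoothing_tendsto(1)[OF c B])
    show "AE z in M. norm (LINT y|lborel. of_real (std_normal_density y) * L (z + ?s n * y)) \<le> B" for n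
      by (intro AE_I2 gauss_smoothing_tendsto(2)[OF c B])
  qed auto
  have Am_eq: "Am n = (LINT u|lborel. of_real (gs (?s n) u) * (char M u * Lh u)) / of_real (2 * pi)" for n
  proof -
    have "Am n = (LINT z|M. (LINT u|lborel. of_real (gs (?s n) u) * iexp (u * z) * Lh u)) / of_real (2 * pi)"
      unfolding Am_def Lh_def by (subst gauss_smoothing[OF _ L]) auto
    also have "(LINT z|M. (LINT u|lborel. of_real (gs (?s n) u) * iexp (u * z) * Lh u)) = (LINT u|lborel. (LINT z|M. of_real (gs (?s n) u) * iexp (u * z) * Lh u))"
    proof (rule fubini_dominated(1)[where c = "\<lambda>_. C" and a = "gs (?s n)"])
      fix x y
      show "norm (of_real (gs (?s n) x) * iexp (x * y) * Lh x) \<le> gs (?s n) x * C"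
        using LhC[of x] gs_bounds by (simp add: norm_mult mult_left_mono)
      show "(\<lambda>(x, y). of_real (gs (?s n) x) * iexp (x * y) * Lh x) \<in> borel_measurable (lborel \<Otimes>\<^sub>M M)" by measurable
      show "sigma_finite_measure M" by unfold_locales
    qed (auto intro: gs_integrable sigma_finite_lborel)
    also have "\<dots> = (LINT u|lborel. of_real (gs (?s n) u) * (char M u * Lh u))"
      by (intro Bochner_Integration.integral_cong refl) (simp add: char_def mult_ac)
    finally show ?thesis .
  qed
  have lim2: "(\<lambda>n. (LINT u|lborel. of_real (gs (?s n) u) * (char M u * Lh u)) / of_real (2 * pi)) \<longlonglongrightarrow> (LINT u|lborel. char M u * Lh u) / of_real (2 * pi)"
  proof (intro tendsto_divide tendsto_const)
    show "(\<lambda>n. (LINT u|lborel. of_real (gs (?s n) u) * (char M u * Lh u))) \<longlonglongrightarrow> (LINT u|lborel. char M u * Lh u)"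
    proof (rule integral_dominated_convergence[where w = "\<lambda>u. norm (char M u) * C"])
      show "integrable lborel (\<lambda>u. norm (char M u) * C)" using \<psi> by simp
      show "AE u in lborel. (\<lambda>n. of_real (gs (?s n) u) * (char M u * Lh u)) \<longlonglongrightarrow> char M u * Lh u"
      proof (rule AE_I2)
        fix u
        have "(\<lambda>n. of_real (gs (?s n) u) * (char M u * Lh u)) \<longlonglongrightarrow> of_real 1 * (char M u * Lh u)"
          by (intro tendsto_mult tendsto_of_real gs_tendsto tendsto_const)
        then show "(\<lambda>n. of_real (gs (?s n) u) * (char M u * Lh u)) \<longlonglongrightarrow> char M u * Lh u" by simp
      qed
      show "AE u in lborel. norm (of_real (gs (?s n) u) * (char M u * Lh u)) \<le> norm (char M u) * C" for n
      proof (rule AE_I2)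
        fix u
        have "gs (?s n) u * (norm (char M u) * norm (Lh u)) \<le> 1 * (norm (char M u) * C)"
          using gs_bounds[of "?s n" u] LhC[of u] by (intro mult_mono) auto
        then show "norm (of_real (gs (?s n) u) * (char M u * Lh u)) \<le> norm (char M u) * C"
          using gs_bounds by (simp add: norm_mult)
      qed
    qed measurable
  qed auto
  have "Am \<longlonglongrightarrow> (LINT u|lborel. char M u * Lh u) / of_real (2 * pi)"
    unfolding Am_eq[abs_def] by (rule lim2)
  with lim1 have "(LINT z|M. L z) = (LINT u|lborel. char M u * Lh u) / of_real (2 * pi)" by (rule LIMSEQ_unique)
  then show ?thesis unfolding Lh_def .
qed

text \<open>
  The damped identity follows from Fubini. Fatou's lemma then shows that the squared transform is integrable, so that
  dominated convergence removes the damping.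
\<close>

theorem plancherel:
  fixes L :: "real \<Rightarrow> complex"
  assumes L: "integrable lborel L" and c: "continuous_on UNIV L" and B: "\<And>v. norm (L v) \<le> B"
  defines "Lh \<equiv> \<lambda>u. LINT v|lborel. L v * iexp (- (u * v))"
  shows "integrable lborel (\<lambda>u. (norm (Lh u))\<^sup>2)"
    and "(LINT u|lborel. (norm (Lh u))\<^sup>2) = 2 * pi * (LINT v|lborel. (norm (L v))\<^sup>2)"
proof -
  have [measurable]: "L \<in> borel_measurable borel" using L by auto
  have [measurable]: "Lh \<in> borel_measurable borel" unfolding Lh_def by (rule fourier_transform_bounds(2)[OF L])
  let ?s = "\<lambda>n. 1 / real (Suc n)"
  define C where "C = (LINT v|lborel. norm (L v))"
  have C0: "0 \<le> C" unfolding C_def by (intro integral_nonneg_AE) auto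
  have LhC: "norm (Lh u) \<le> C" for u unfolding Lh_def C_def by (rule fourier_transform_bounds(1)[OF L])
  define Q where "Q n = (LINT z|lborel. cnj (L z) * (LINT y|lborel. of_real (std_normal_density y) * L (z + ?s n * y)))" for n
  have [measurable]: "cnj \<in> borel_measurable borel"
    by (intro borel_measurable_continuous_onI continuous_intros)
  have cnjLh: "(LINT z|lborel. cnj (L z) * iexp (u * z)) = cnj (Lh u)" for u
  proof -
    have "cnj (Lh u) = (LINT v|lborel. cnj (L v * iexp (- (u * v))))"
      unfolding Lh_def by (rule Bochner_Integration.integral_cnj[symmetric])
    also have "\<dots> = (LINT z|lborel. cnj (L z) * iexp (u * z))"
      by (intro Bochner_Integration.integral_cong refl) (simp add: exp_cnj)
    finally show ?thesis by simp
  qed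
  have Q_eq: "Q n = of_real (LINT u|lborel. gs (?s n) u * (norm (Lh u))\<^sup>2) / of_real (2 * pi)" for n
  proof -
    have "Q n = (LINT z|lborel. (LINT u|lborel. cnj (L z) * (of_real (gs (?s n) u) * iexp (u * z) * Lh u))) / of_real (2 * pi)"
      unfolding Q_def Lh_def by (subst gauss_smoothing[OF _ L]) auto
    also have "(LINT z|lborel. (LINT u|lborel. cnj (L z) * (of_real (gs (?s n) u) * iexp (u * z) * Lh u)))
      = (LINT u|lborel. (LINT z|lborel. cnj (L z) * (of_real (gs (?s n) u) * iexp (u * z) * Lh u)))"
    proof (rule fubini_dominated(1)[where c = "\<lambda>z. norm (L z)" and a = "\<lambda>u. C * gs (?s n) u"])
      fix x y
      have "norm (Lh x) * gs (?s n) x \<le> C * gs (?s n) x" using LhC[of x] gs_bounds by (intro mult_right_mono)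
      then have "norm (Lh x) * gs (?s n) x * norm (L y) \<le> C * gs (?s n) x * norm (L y)" by (rule mult_right_mono) simp
      then show "norm (cnj (L y) * (of_real (gs (?s n) x) * iexp (x * y) * Lh x)) \<le> C * gs (?s n) x * norm (L y)"
        using gs_bounds by (simp add: norm_mult mult_ac)
      show "(\<lambda>(u, z). cnj (L z) * (of_real (gs (?s n) u) * iexp (u * z) * Lh u)) \<in> borel_measurable (lborel \<Otimes>\<^sub>M lborel)"
        by measurable
    qed (use L gs_integrable[of "?s n"] in \<open>auto intro: sigma_finite_lborel\<close>)
    also have "\<dots> = (LINT u|lborel. of_real (gs (?s n) u * (norm (Lh u))\<^sup>2))"
    proof (intro Bochner_Integration.integral_cong refl)
      fix u
      have "(LINT z|lborel. cnj (L z) * (of_real (gs (?s n) u) * iexp (u * z) * Lh u)) = (LINT z|lborel. (of_real (gs (?s n) u) * Lh u) * (cnj (L z) * iexp (u * z)))"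
        by (simp add: mult_ac)
      also have "\<dots> = of_real (gs (?s n) u) * Lh u * cnj (Lh u)" by (simp only: cnjLh integral_mult_right_zero)
      also have "\<dots> = of_real (gs (?s n) u * (norm (Lh u))\<^sup>2)"
        by (simp only: mult.assoc complex_norm_square[symmetric] of_real_mult)
      finally show "(LINT z|lborel. cnj (L z) * (of_real (gs (?s n) u) * iexp (u * z) * Lh u)) = of_real (gs (?s n) u * (norm (Lh u))\<^sup>2)" .
    qed
    finally show ?thesis by (simp only: integral_complex_of_real)
  qed
  have Qlim: "Q \<longlonglongrightarrow> of_real (LINT v|lborel. (norm (L v))\<^sup>2)"
  proof -
    have "Q \<longlonglongrightarrow> (LINT z|lborel. cnj (L z) * L z)"
      unfolding Q_def
    proof (rule integral_dominated_convergence[where w = "\<lambda>z. norm (L z) * B"])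
      show "AE z in lborel. (\<lambda>n. cnj (L z) * (LINT y|lborel. of_real (std_normal_density y) * L (z + ?s n * y))) \<longlonglongrightarrow> cnj (L z) * L z"
        by (intro AE_I2 tendsto_mult_left gauss_smoothing_tendsto(1)[OF c B])
      show "AE z in lborel. norm (cnj (L z) * (LINT y|lborel. of_real (std_normal_density y) * L (z + ?s n * y))) \<le> norm (L z) * B" for n
        unfolding norm_mult complex_mod_cnj by (intro AE_I2 mult_left_mono gauss_smoothing_tendsto(2)[OF c B] norm_ge_zero)
    qed (use L in auto)
    also have "(LINT z|lborel. cnj (L z) * L z) = (LINT z|lborel. of_real ((norm (L z))\<^sup>2))"
      by (simp only: complex_norm_square mult.commute[of "L _"])
    finally show ?thesis by (simp only: integral_complex_of_real)
  qed
  define q where "q n = (LINT u|lborel. gs (?s n) u * (norm (Lh u))\<^sup>2)" for n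
  have qlim: "q \<longlonglongrightarrow> 2 * pi * (LINT v|lborel. (norm (L v))\<^sup>2)"
  proof -
    have "(\<lambda>n. Re (Q n) * (2 * pi)) \<longlonglongrightarrow> Re (of_real (LINT v|lborel. (norm (L v))\<^sup>2)) * (2 * pi)"
      by (intro tendsto_intros Qlim)
    moreover have "Re (Q n) * (2 * pi) = q n" for n
      unfolding Q_eq q_def of_real_divide[symmetric] Re_complex_of_real by simp
    ultimately show ?thesis by (simp only: Re_complex_of_real mult.commute[of _ "2 * pi"])
  qed
  have qi: "integrable lborel (\<lambda>u. gs (?s n) u * (norm (Lh u))\<^sup>2)" for n
  proof (rule Bochner_Integration.integrable_bound[of _ "\<lambda>u. C\<^sup>2 * gs (?s n) u"])
    show "AE u in lborel. norm (gs (?s n) u * (norm (Lh u))\<^sup>2) \<le> norm (C\<^sup>2 * gs (?s n) u)"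
      using LhC gs_bounds by (intro AE_I2) (auto simp: abs_mult mult.commute[of "gs _ _"] intro!: mult_right_mono power_mono)
  qed (use gs_integrable[of "?s n"] in auto)
  have "(\<integral>\<^sup>+ u. ennreal ((norm (Lh u))\<^sup>2) \<partial>lborel) = (\<integral>\<^sup>+ u. liminf (\<lambda>n. ennreal (gs (?s n) u * (norm (Lh u))\<^sup>2)) \<partial>lborel)"
  proof (intro nn_integral_cong)
    fix u
    have "(\<lambda>n. ennreal (gs (?s n) u * (norm (Lh u))\<^sup>2)) \<longlonglongrightarrow> ennreal (1 * (norm (Lh u))\<^sup>2)"
      by (intro tendsto_ennrealI tendsto_mult gs_tendsto tendsto_const)
    from lim_imp_Liminf[OF trivial_limit_sequentially this]
    show "ennreal ((norm (Lh u))\<^sup>2) = liminf (\<lambda>n. ennreal (gs (?s n) u * (norm (Lh u))\<^sup>2))" by simp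
  qed
  also have "\<dots> \<le> liminf (\<lambda>n. \<integral>\<^sup>+ u. ennreal (gs (?s n) u * (norm (Lh u))\<^sup>2) \<partial>lborel)"
    by (rule nn_integral_liminf) measurable
  also have "\<dots> = liminf (\<lambda>n. ennreal (q n))"
    unfolding q_def using qi gs_bounds by (subst nn_integral_eq_integral) auto
  also have "\<dots> = ennreal (2 * pi * (LINT v|lborel. (norm (L v))\<^sup>2))"
    by (rule lim_imp_Liminf[OF trivial_limit_sequentially tendsto_ennrealI[OF qlim]])
  finally have fin: "(\<integral>\<^sup>+ u. ennreal ((norm (Lh u))\<^sup>2) \<partial>lborel) < \<infinity>" by (auto intro: le_less_trans)
  show i: "integrable lborel (\<lambda>u. (norm (Lh u))\<^sup>2)"
    by (rule integrableI_bounded) (use fin in auto)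
  have "q \<longlonglongrightarrow> (LINT u|lborel. (norm (Lh u))\<^sup>2)"
    unfolding q_def
  proof (rule integral_dominated_convergence[OF _ _ i])
    show "AE u in lborel. (\<lambda>n. gs (?s n) u * (norm (Lh u))\<^sup>2) \<longlonglongrightarrow> (norm (Lh u))\<^sup>2"
    proof (rule AE_I2)
      fix u
      have "(\<lambda>n. gs (?s n) u * (norm (Lh u))\<^sup>2) \<longlonglongrightarrow> 1 * (norm (Lh u))\<^sup>2"
        by (intro tendsto_mult gs_tendsto tendsto_const)
      then show "(\<lambda>n. gs (?s n) u * (norm (Lh u))\<^sup>2) \<longlonglongrightarrow> (norm (Lh u))\<^sup>2" by simp
    qed
    show "AE u in lborel. norm (gs (?s n) u * (norm (Lh u))\<^sup>2) \<le> (norm (Lh u))\<^sup>2" for n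
      using gs_bounds by (intro AE_I2) (auto simp: abs_mult intro!: mult_left_le_one_le)
  qed auto
  then show "(LINT u|lborel. (norm (Lh u))\<^sup>2) = 2 * pi * (LINT v|lborel. (norm (L v))\<^sup>2)"
    using qlim LIMSEQ_unique by blast
qed

lemma has_vector_derivative_iff_quotient:
  fixes f :: "real \<Rightarrow> 'a :: real_normed_vector"
  shows "(f has_vector_derivative D) (at x) \<longleftrightarrow> ((\<lambda>y. (1 / (y - x)) *\<^sub>R (f y - f x)) \<longlongrightarrow> D) (at x)"
proof -
  have "(f has_vector_derivative D) (at x) \<longleftrightarrow> ((\<lambda>y. norm ((f y - f x) - (y - x) *\<^sub>R D) / norm (y - x)) \<longlongrightarrow> 0) (at x)"
    unfolding has_vector_derivative_def has_derivative_iff_norm by (simp add: bounded_linear_scaleR_left)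
  also have "\<dots> \<longleftrightarrow> ((\<lambda>y. norm ((1 / (y - x)) *\<^sub>R (f y - f x) - D)) \<longlongrightarrow> 0) (at x)"
  proof (rule tendsto_cong, unfold eventually_at_topological, intro exI[of _ UNIV] conjI ballI impI)
    fix y assume "y \<noteq> x"
    then have "(1 / (y - x)) *\<^sub>R (f y - f x) - D = (1 / (y - x)) *\<^sub>R ((f y - f x) - (y - x) *\<^sub>R D)"
      by (simp add: scaleR_diff_right)
    then show "norm ((f y - f x) - (y - x) *\<^sub>R D) / norm (y - x) = norm ((1 / (y - x)) *\<^sub>R (f y - f x) - D)"
      by simp
  qed auto
  also have "\<dots> \<longleftrightarrow> ((\<lambda>y. (1 / (y - x)) *\<^sub>R (f y - f x)) \<longlongrightarrow> D) (at x)"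
    by (simp only: tendsto_norm_zero_iff LIM_zero_iff)
  finally show ?thesis .
qed

lemma fourier_integral_derivative:
  fixes w :: "real \<Rightarrow> complex"
  assumes w: "integrable lborel w" and w1: "integrable lborel (\<lambda>u. \<bar>u\<bar> * norm (w u))"
  shows "((\<lambda>x. LINT u|lborel. w u * iexp (- (x * u))) has_vector_derivative (LINT u|lborel. (- \<i> * of_real u * w u) * iexp (- (x * u)))) (at x)"
proof -
  have [measurable]: "w \<in> borel_measurable borel" using w by auto
  let ?F = "\<lambda>x. LINT u|lborel. w u * iexp (- (x * u))"
  let ?D = "LINT u|lborel. (- \<i> * of_real u * w u) * iexp (- (x * u))"
  have wi: "integrable lborel (\<lambda>u. w u * iexp (- (y * u)))" for y
    by (rule Bochner_Integration.integrable_bound[OF w]) (auto simp: norm_mult)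
  have "((\<lambda>y. (1 / (y - x)) *\<^sub>R (?F y - ?F x)) \<longlongrightarrow> ?D) (at x)"
    unfolding tendsto_at_iff_sequentially o_def
  proof (intro allI impI)
    fix Y :: "nat \<Rightarrow> real" assume Y: "\<forall>i. Y i \<in> UNIV - {x}" "Y \<longlonglongrightarrow> x"
    have e: "(1 / (Y n - x)) *\<^sub>R (?F (Y n) - ?F x) = (LINT u|lborel. (1 / (Y n - x)) *\<^sub>R (w u * iexp (- (Y n * u)) - w u * iexp (- (x * u))))" for n
      using wi by simp
    show "(\<lambda>n. (1 / (Y n - x)) *\<^sub>R (?F (Y n) - ?F x)) \<longlonglongrightarrow> ?D"
      unfolding e
    proof (rule integral_dominated_convergence[where w = "\<lambda>u. \<bar>u\<bar> * norm (w u)"])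
      show "AE u in lborel. (\<lambda>n. (1 / (Y n - x)) *\<^sub>R (w u * iexp (- (Y n * u)) - w u * iexp (- (x * u)))) \<longlonglongrightarrow> (- \<i> * of_real u * w u) * iexp (- (x * u))"
      proof (rule AE_I2)
        fix u
        have "((\<lambda>z. w u * exp (- \<i> * of_real u * z)) has_field_derivative (- \<i> * of_real u * w u) * exp (- \<i> * of_real u * of_real x)) (at (of_real x))"
          by (auto intro!: derivative_eq_intros)
        from has_vector_derivative_real_field[OF this, where s = UNIV]
        have "((\<lambda>y. w u * iexp (- (y * u))) has_vector_derivative (- \<i> * of_real u * w u) * iexp (- (x * u))) (at x)"
          by (simp add: mult_ac)
        then have "((\<lambda>y. (1 / (y - x)) *\<^sub>R (w u * iexp (- (y * u)) - w u * iexp (- (x * u)))) \<longlongrightarrow> (- \<i> * of_real u * w u) * iexp (- (x * u))) (at x)"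
          by (simp only: has_vector_derivative_iff_quotient)
        then show "(\<lambda>n. (1 / (Y n - x)) *\<^sub>R (w u * iexp (- (Y n * u)) - w u * iexp (- (x * u)))) \<longlonglongrightarrow> (- \<i> * of_real u * w u) * iexp (- (x * u))"
          using Y unfolding tendsto_at_iff_sequentially o_def by blast
      qed
      show "AE u in lborel. norm ((1 / (Y n - x)) *\<^sub>R (w u * iexp (- (Y n * u)) - w u * iexp (- (x * u)))) \<le> \<bar>u\<bar> * norm (w u)" for n
      proof (rule AE_I2)
        fix u
        have ne: "Y n - x \<noteq> 0" using Y(1) by auto
        have "w u * iexp (- (Y n * u)) - w u * iexp (- (x * u)) = w u * iexp (- (x * u)) * (iexp ((x - Y n) * u) - 1)"
          by (simp add: algebra_simps exp_diff exp_minus field_simps)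
        then have "norm (w u * iexp (- (Y n * u)) - w u * iexp (- (x * u))) = norm (w u) * norm (iexp ((x - Y n) * u) - 1)"
          by (simp add: norm_mult)
        also have "\<dots> \<le> norm (w u) * \<bar>(x - Y n) * u\<bar>"
          using iexp_approx1[of "(x - Y n) * u" 0] by (intro mult_left_mono) auto
        also have "\<dots> = \<bar>Y n - x\<bar> * (\<bar>u\<bar> * norm (w u))" by (simp add: abs_mult abs_minus_commute)
        finally show "norm ((1 / (Y n - x)) *\<^sub>R (w u * iexp (- (Y n * u)) - w u * iexp (- (x * u)))) \<le> \<bar>u\<bar> * norm (w u)"
          unfolding norm_scaleR using ne by (simp add: field_simps)
      qed
    qed (use w1 in auto)
  qed
  then show ?thesis
    by (simp only: has_vector_derivative_iff_quotient)
qed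

section \<open>Kernel density estimators in the Fourier domain\<close>

lemma integral_double_sum:
  fixes F :: "'i \<Rightarrow> 'j \<Rightarrow> 'a \<Rightarrow> 'b :: {banach, second_countable_topology}"
  assumes "\<And>i j. i \<in> I \<Longrightarrow> j \<in> J \<Longrightarrow> integrable M (F i j)"
  shows "(LINT x|M. (\<Sum>i\<in>I. \<Sum>j\<in>J. F i j x)) = (\<Sum>i\<in>I. \<Sum>j\<in>J. LINT x|M. F i j x)"
proof -
  have "(LINT x|M. (\<Sum>i\<in>I. \<Sum>j\<in>J. F i j x)) = (\<Sum>i\<in>I. LINT x|M. (\<Sum>j\<in>J. F i j x))"
    using assms by (intro Bochner_Integration.integral_sum Bochner_Integration.integrable_sum) auto
  also have "\<dots> = (\<Sum>i\<in>I. \<Sum>j\<in>J. LINT x|M. F i j x)"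
    using assms by (intro sum.cong refl Bochner_Integration.integral_sum) auto
  finally show ?thesis .
qed


locale kernel =
  fixes K :: "real \<Rightarrow> real" and R B :: real
  assumes K_cont: "continuous_on UNIV K" and K_nonneg: "0 \<le> K w" and K_le: "K w \<le> B"
    and K_supp: "\<bar>w\<bar> > R \<Longrightarrow> K w = 0" and K_int: "integrable lborel K" and K_one: "(LINT w|lborel. K w) = 1"
begin

lemma K_meas [measurable]: "K \<in> borel_measurable borel"
  using K_cont by (rule borel_measurable_continuous_onI)

lemma B_nonneg: "0 \<le> B" using K_nonneg[of 0] K_le[of 0] by simp

definition "Kd = density lborel (\<lambda>w. ennreal (K w))"

lemma Kd_real_distribution: "real_distribution Kd"
proof -
  have "emeasure Kd (space Kd) = (\<integral>\<^sup>+ w. ennreal (K w) \<partial>lborel)"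
    unfolding Kd_def by (subst emeasure_density) auto
  also have "\<dots> = 1" using nn_integral_eq_integral[OF K_int] K_nonneg K_one by simp
  finally have "prob_space Kd" by (rule prob_spaceI)
  then show ?thesis by (simp add: real_distribution_def real_distribution_axioms_def Kd_def)
qed

definition "kh t = (LINT w|lborel. of_real (K w) * iexp (t * w))"

lemma kh_char: "kh t = char Kd t"
proof -
  have "char Kd t = (LINT w|lborel. K w *\<^sub>R iexp (t * w))"
    unfolding char_def Kd_def using K_nonneg by (intro integral_density) auto
  then show ?thesis by (simp add: kh_def scaleR_conv_of_real)
qed

lemma kh_le: "norm (kh t) \<le> 1"
  unfolding kh_char by (rule real_distribution.cmod_char_le_1[OF Kd_real_distribution])

lemma kh_isCont: "isCont kh t"
  unfolding kh_char[abs_def] by (rule real_distribution.isCont_char[OF Kd_real_distribution])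

lemma kh_0: "kh 0 = 1"
  unfolding kh_char by (rule real_distribution.char_zero[OF Kd_real_distribution])

lemma kh_meas [measurable]: "kh \<in> borel_measurable borel"
  unfolding kh_char[abs_def] by (rule real_distribution.char_measurable[OF Kd_real_distribution])

lemma kh_cnj: "kh (- t) = cnj (kh t)"
proof -
  have "cnj (kh t) = (LINT w|lborel. cnj (of_real (K w) * iexp (t * w)))"
    unfolding kh_def by (rule Bochner_Integration.integral_cnj[symmetric])
  also have "\<dots> = (LINT w|lborel. of_real (K w) * iexp (- t * w))"
    by (intro Bochner_Integration.integral_cong refl) (simp add: exp_cnj)
  finally show ?thesis by (simp add: kh_def)
qed

text \<open>
  The autocorrelation of the kernel arises when the product of two shifted kernels is integrated over the line. Its Fourier
  transform is the square of the modulus of \<open>kh\<close>.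
\<close>

definition "KK v = (LINT w|lborel. K w * K (w + v))"

lemma int_KK_inner: "integrable lborel (\<lambda>w. K w * K (w + v))"
proof (rule Bochner_Integration.integrable_bound[of _ "\<lambda>w. B * K w"])
  show "AE w in lborel. norm (K w * K (w + v)) \<le> norm (B * K w)"
    using K_nonneg K_le B_nonneg by (intro AE_I2) (auto simp: abs_mult mult.commute[of B] intro!: mult_left_mono)
qed (use K_int in auto)

lemma KK_nonneg: "0 \<le> KK v"
  unfolding KK_def using K_nonneg by (intro integral_nonneg_AE) auto

lemma KK_le: "KK v \<le> B"
proof -
  have "KK v \<le> (LINT w|lborel. K w * B)"
    unfolding KK_def using K_int K_nonneg K_le int_KK_inner by (intro integral_mono mult_left_mono) auto
  then show ?thesis using K_one by simp
qed

lemma KK_cont: "continuous_on UNIV KK"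
  unfolding continuous_on_sequentially
proof (intro allI ballI impI)
  fix X :: "nat \<Rightarrow> real" and a assume X: "(\<forall>n. X n \<in> UNIV) \<and> X \<longlonglongrightarrow> a"
  show "(KK \<circ> X) \<longlonglongrightarrow> KK a"
    unfolding KK_def o_def
  proof (rule integral_dominated_convergence[where w = "\<lambda>w. K w * B"])
    show "AE w in lborel. (\<lambda>n. K w * K (w + X n)) \<longlonglongrightarrow> K w * K (w + a)"
    proof (rule AE_I2)
      fix w
      have "isCont K (w + a)" using K_cont by (simp add: continuous_on_eq_continuous_at)
      then have "(\<lambda>n. K (w + X n)) \<longlonglongrightarrow> K (w + a)"
        by (rule isCont_tendsto_compose) (use X in \<open>auto intro: tendsto_intros\<close>)
      then show "(\<lambda>n. K w * K (w + X n)) \<longlonglongrightarrow> K w * K (w + a)" by (rule tendsto_mult_left)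
    qed
    show "AE w in lborel. norm (K w * K (w + X n)) \<le> K w * B" for n
      using K_nonneg K_le by (intro AE_I2) (auto simp: abs_mult intro!: mult_left_mono)
  qed (use K_int in auto)
qed

lemma KK_meas [measurable]: "KK \<in> borel_measurable borel"
  using KK_cont by (rule borel_measurable_continuous_onI)

lemma K_shift_int: "integrable lborel (\<lambda>v. K (w + v))"
  using lborel_integrable_real_affine[OF K_int, of 1 w] by simp

lemma K_shift_one: "(LINT v|lborel. K (w + v)) = 1"
  using lborel_integral_real_affine[of 1 K w] K_one by simp

lemma KK_int: "integrable lborel KK" and KK_fourier: "(LINT v|lborel. of_real (KK v) * iexp (- (t * v))) = of_real ((norm (kh t))\<^sup>2)"
proof -
  have i0: "integrable (lborel \<Otimes>\<^sub>M lborel) (\<lambda>(w, v). K w * K (w + v))"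
  proof (rule lborel_pair.Fubini_integrable)
    show "integrable lborel (\<lambda>w. LINT v|lborel. norm (case (w, v) of (w, v) \<Rightarrow> K w * K (w + v)))"
      using K_int by (simp add: abs_mult K_nonneg K_shift_one)
    show "AE w in lborel. integrable lborel (\<lambda>v. case (w, v) of (w, v) \<Rightarrow> K w * K (w + v))"
      using K_shift_int by simp
  qed measurable
  show "integrable lborel KK" unfolding KK_def[abs_def] using lborel_pair.integrable_snd[OF i0] by simp
  have i1: "integrable (lborel \<Otimes>\<^sub>M lborel) (\<lambda>(w, v). of_real (K w * K (w + v)) * iexp (- (t * v)))"
    by (rule Bochner_Integration.integrable_bound[OF i0]) (auto simp: norm_mult K_nonneg)
  have "(LINT v|lborel. of_real (KK v) * iexp (- (t * v))) = (LINT v|lborel. (LINT w|lborel. of_real (K w * K (w + v)) * iexp (- (t * v))))"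
    unfolding KK_def integral_complex_of_real[symmetric] by simp
  also have "\<dots> = (LINT w|lborel. (LINT v|lborel. of_real (K w * K (w + v)) * iexp (- (t * v))))"
    by (rule lborel_pair.Fubini_integral[OF i1])
  also have "\<dots> = (LINT w|lborel. (of_real (K w) * iexp (t * w)) * cnj (kh t))"
  proof (intro Bochner_Integration.integral_cong refl)
    fix w
    have "of_real (K w * K (w + v)) * iexp (- (t * v)) = (of_real (K w) * iexp (t * w)) * (of_real (K (w + v)) * iexp (- t * (w + v)))" for v
      by (simp add: algebra_simps exp_diff exp_minus exp_add field_simps)
    then have "(LINT v|lborel. of_real (K w * K (w + v)) * iexp (- (t * v))) = (of_real (K w) * iexp (t * w)) * (LINT v|lborel. of_real (K (w + v)) * iexp (- t * (w + v)))"
      by (simp only: integral_mult_right_zero)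
    also have "(LINT v|lborel. of_real (K (w + v)) * iexp (- t * (w + v))) = kh (- t)"
      using lborel_integral_real_affine[of 1 "\<lambda>y. of_real (K y) * iexp (- t * y)" w] by (simp add: kh_def)
    finally show "(LINT v|lborel. of_real (K w * K (w + v)) * iexp (- (t * v))) = (of_real (K w) * iexp (t * w)) * cnj (kh t)"
      unfolding kh_cnj .
  qed
  also have "\<dots> = kh t * cnj (kh t)" by (simp only: kh_def integral_mult_left_zero)
  finally show "(LINT v|lborel. of_real (KK v) * iexp (- (t * v))) = of_real ((norm (kh t))\<^sup>2)"
    by (simp only: complex_norm_square)
qed

lemma expectation_KK:
  assumes rd: "real_distribution M" and \<psi>: "integrable lborel (char M)" and h: "h > 0"
  shows "of_real (LINT z|M. KK (z / h)) = (LINT u|lborel. char M u * of_real (h * (norm (kh (u * h)))\<^sup>2)) / of_real (2 * pi)"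
proof -
  interpret real_distribution M by (rule rd)
  have ft: "(LINT v|lborel. of_real (KK (v / h)) * iexp (- (u * v))) = of_real (h * (norm (kh (u * h)))\<^sup>2)" for u
  proof -
    have "(LINT v|lborel. of_real (KK (v / h)) * iexp (- (u * v))) = h *\<^sub>R (LINT v|lborel. of_real (KK v) * iexp (- ((u * h) * v)))"
      using lborel_integral_real_affine[of h "\<lambda>v. of_real (KK (v / h)) * iexp (- (u * v))" 0] h by (simp add: mult_ac)
    then show ?thesis unfolding KK_fourier by (simp only: scaleR_conv_of_real of_real_mult)
  qed
  have Li: "integrable lborel (\<lambda>v. complex_of_real (KK (v / h)))"
    using lborel_integrable_real_affine[OF KK_int, of "1/h" 0] h by simp
  have "(LINT z|M. complex_of_real (KK (z / h))) = (LINT u|lborel. char M u * (LINT v|lborel. of_real (KK (v / h)) * iexp (- (u * v)))) / of_real (2 * pi)"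
  proof (rule parseval_char[OF \<psi> Li])
    show "continuous_on UNIV (\<lambda>v. complex_of_real (KK (v / h)))"
      by (intro continuous_intros continuous_on_compose2[OF KK_cont]) (use h in auto)
    show "norm (complex_of_real (KK (v / h))) \<le> B" for v using KK_nonneg KK_le by simp
  qed
  then show ?thesis unfolding ft by simp
qed

lemma kernel_product_integral:
  assumes h: "h > 0"
  shows "integrable lborel (\<lambda>x. K ((x - a) / h) * K ((x - c) / h))"
    and "(LINT x|lborel. K ((x - a) / h) * K ((x - c) / h)) = h * KK ((a - c) / h)"
proof -
  have e: "K ((a + h * w - a) / h) * K ((a + h * w - c) / h) = K w * K (w + (a - c) / h)" for w
    using h by (simp add: field_simps)
  have "integrable lborel (\<lambda>w. K ((a + h * w - a) / h) * K ((a + h * w - c) / h))"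
    unfolding e by (rule int_KK_inner)
  then show "integrable lborel (\<lambda>x. K ((x - a) / h) * K ((x - c) / h))"
    using lborel_integrable_real_affine_iff[of h "\<lambda>x. K ((x - a) / h) * K ((x - c) / h)" a] h by simp
  show "(LINT x|lborel. K ((x - a) / h) * K ((x - c) / h)) = h * KK ((a - c) / h)"
    using lborel_integral_real_affine[of h "\<lambda>x. K ((x - a) / h) * K ((x - c) / h)" a] h unfolding e KK_def by simp
qed

text \<open>
  The kernel estimate of \<open>f x\<close>, averaged over the law and with bandwidth tending to 0, is computed in two ways: directly, by
  continuity of \<open>f\<close>, and on the Fourier side, where the transform of the kernel tends to 1.
\<close>

lemma density_inversion:
  assumes rd: "real_distribution M" and \<psi>: "integrable lborel (char M)"
    and M: "M = density lborel (\<lambda>x. ennreal (f x))" and f0: "\<And>x. 0 \<le> f x" and fc: "continuous_on UNIV f"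
  shows "of_real (f x) = (LINT u|lborel. char M u * iexp (- (x * u))) / of_real (2 * pi)"
proof -
  interpret real_distribution M by (rule rd)
  have [measurable]: "f \<in> borel_measurable borel" using fc by (rule borel_measurable_continuous_onI)
  let ?h = "\<lambda>n. 1 / real (Suc n)"
  define E where "E n = (LINT z|M. complex_of_real (K ((x - z) / ?h n) / ?h n))" for n
  have h0: "0 < ?h n" "?h n \<le> 1" for n by auto
  have E1: "E n = of_real (LINT w|lborel. K w * f (x - ?h n * w))" for n
  proof -
    have "E n = of_real (LINT z|M. K ((x - z) / ?h n) / ?h n)" unfolding E_def by (rule integral_complex_of_real)
    also have "(LINT z|M. K ((x - z) / ?h n) / ?h n) = (LINT z|lborel. f z *\<^sub>R (K ((x - z) / ?h n) / ?h n))"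
      unfolding M using f0 by (intro integral_density) auto
    also have "\<dots> = \<bar>- ?h n\<bar> *\<^sub>R (LINT w|lborel. f (x + - ?h n * w) *\<^sub>R (K ((x - (x + - ?h n * w)) / ?h n) / ?h n))"
      by (rule lborel_integral_real_affine) (simp del: of_nat_Suc)
    also have "(\<lambda>w. f (x + - ?h n * w) *\<^sub>R (K ((x - (x + - ?h n * w)) / ?h n) / ?h n)) = (\<lambda>w. (1 / ?h n) * (K w * f (x - ?h n * w)))"
      by (simp add: fun_eq_iff mult_ac del: of_nat_Suc)
    also have "\<bar>- ?h n\<bar> *\<^sub>R (LINT w|lborel. (1 / ?h n) * (K w * f (x - ?h n * w))) = (LINT w|lborel. K w * f (x - ?h n * w))"
      unfolding integral_mult_right_zero using h0[of n] by (simp del: of_nat_Suc)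
    finally show ?thesis .
  qed
  have lim1: "E \<longlonglongrightarrow> of_real (f x)"
  proof -
    have "compact (f ` {x - \<bar>R\<bar>..x + \<bar>R\<bar>})"
      by (intro compact_continuous_image continuous_on_subset[OF fc]) auto
    then obtain C where C: "\<And>y. y \<in> {x - \<bar>R\<bar>..x + \<bar>R\<bar>} \<Longrightarrow> \<bar>f y\<bar> \<le> C"
      by (force dest!: compact_imp_bounded simp: bounded_iff)
    have "(\<lambda>n. LINT w|lborel. K w * f (x - ?h n * w)) \<longlonglongrightarrow> (LINT w|lborel. K w * f x)"
    proof (rule integral_dominated_convergence[where w = "\<lambda>w. K w * C"])
      show "AE w in lborel. (\<lambda>n. K w * f (x - ?h n * w)) \<longlonglongrightarrow> K w * f x"
      proof (rule AE_I2)
        fix w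
        have "(\<lambda>n. x - ?h n * w) \<longlonglongrightarrow> x - 0 * w" by (intro tendsto_intros LIMSEQ_Suc lim_1_over_n)
        moreover have "isCont f x" using fc by (simp add: continuous_on_eq_continuous_at)
        ultimately have "(\<lambda>n. f (x - ?h n * w)) \<longlonglongrightarrow> f x" by (intro isCont_tendsto_compose[of x f]) auto
        then show "(\<lambda>n. K w * f (x - ?h n * w)) \<longlonglongrightarrow> K w * f x" by (rule tendsto_mult_left)
      qed
      show "AE w in lborel. norm (K w * f (x - ?h n * w)) \<le> K w * C" for n
      proof (rule AE_I2)
        fix w
        show "norm (K w * f (x - ?h n * w)) \<le> K w * C"
        proof (cases "\<bar>w\<bar> > R")
          case False
          have "\<bar>?h n * w\<bar> \<le> 1 * \<bar>w\<bar>" unfolding abs_mult using h0[of n] by (intro mult_right_mono) auto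
          then have le: "\<bar>?h n * w\<bar> \<le> \<bar>R\<bar>" using False by linarith
          have "x - y \<in> {x - \<bar>R\<bar>..x + \<bar>R\<bar>}" if "\<bar>y\<bar> \<le> \<bar>R\<bar>" for y using that by auto
          from this[OF le] have "x - ?h n * w \<in> {x - \<bar>R\<bar>..x + \<bar>R\<bar>}" .
          then have "\<bar>f (x - ?h n * w)\<bar> \<le> C" by (rule C)
          then show ?thesis unfolding real_norm_def abs_mult abs_of_nonneg[OF K_nonneg] by (rule mult_left_mono[OF _ K_nonneg])
        qed (simp add: K_supp)
      qed
    qed (use K_int in auto)
    also have "(LINT w|lborel. K w * f x) = f x" using K_one by simp
    finally show ?thesis unfolding E1[abs_def] by (rule tendsto_of_real)
  qed
  have E2: "E n = (LINT u|lborel. char M u * (iexp (- (x * u)) * kh (?h n * u))) / of_real (2 * pi)" for n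
  proof -
    have ft: "(LINT v|lborel. complex_of_real (K ((x - v) / ?h n) / ?h n) * iexp (- (u * v))) = iexp (- (x * u)) * kh (?h n * u)" for u
    proof -
      have e: "complex_of_real (K ((x - (x + - ?h n * w)) / ?h n) / ?h n) * iexp (- (u * (x + - ?h n * w))) = iexp (- (x * u)) / of_real (?h n) * (of_real (K w) * iexp (?h n * u * w))" for w
      proof -
        have "iexp (- (u * (x + - ?h n * w))) = iexp (- (x * u)) * iexp (?h n * u * w)"
          by (simp add: exp_add[symmetric] algebra_simps del: of_nat_Suc)
        moreover have "(x - (x + - ?h n * w)) / ?h n = w" by (simp del: of_nat_Suc)
        ultimately show ?thesis by (simp add: mult_ac del: of_nat_Suc)
      qed
      have "(LINT v|lborel. complex_of_real (K ((x - v) / ?h n) / ?h n) * iexp (- (u * v)))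
        = \<bar>- ?h n\<bar> *\<^sub>R (LINT w|lborel. complex_of_real (K ((x - (x + - ?h n * w)) / ?h n) / ?h n) * iexp (- (u * (x + - ?h n * w))))"
        by (rule lborel_integral_real_affine) (simp del: of_nat_Suc)
      also have "\<dots> = of_real (?h n) * (iexp (- (x * u)) / of_real (?h n) * kh (?h n * u))"
        unfolding e integral_mult_right_zero kh_def[symmetric] using h0[of n] by (simp add: scaleR_conv_of_real del: of_nat_Suc)
      also have "\<dots> = iexp (- (x * u)) * kh (?h n * u)" using h0[of n] by (simp del: of_nat_Suc)
      finally show ?thesis .
    qed
    have Li: "integrable lborel (\<lambda>v. complex_of_real (K ((x - v) / ?h n) / ?h n))"
    proof -
      have "integrable lborel (\<lambda>v. K (x / ?h n + (- 1 / ?h n) * v))"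
        by (rule lborel_integrable_real_affine[OF K_int]) (simp del: of_nat_Suc)
      moreover have "x / ?h n + (- 1 / ?h n) * v = (x - v) / ?h n" for v by (simp add: diff_divide_distrib algebra_simps del: of_nat_Suc)
      ultimately show ?thesis by (simp only:) (simp del: of_nat_Suc)
    qed
    have "E n = (LINT u|lborel. char M u * (LINT v|lborel. complex_of_real (K ((x - v) / ?h n) / ?h n) * iexp (- (u * v)))) / of_real (2 * pi)"
      unfolding E_def
    proof (rule parseval_char[OF \<psi> Li])
      show "continuous_on UNIV (\<lambda>v. complex_of_real (K ((x - v) / ?h n) / ?h n))"
        by (intro continuous_intros continuous_on_compose2[OF K_cont]) auto
      show "norm (complex_of_real (K ((x - v) / ?h n) / ?h n)) \<le> B / ?h n" for v
      proof -
        have "norm (complex_of_real (K ((x - v) / ?h n) / ?h n)) = K ((x - v) / ?h n) / ?h n"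
          unfolding norm_of_real using K_nonneg h0[of n] by (intro abs_of_nonneg divide_nonneg_pos) auto
        also have "\<dots> \<le> B / ?h n" by (rule divide_right_mono[OF K_le]) simp
        finally show ?thesis .
      qed
    qed
    then show ?thesis unfolding ft .
  qed
  have lim2: "E \<longlonglongrightarrow> (LINT u|lborel. char M u * iexp (- (x * u))) / of_real (2 * pi)"
    unfolding E2[abs_def]
  proof (intro tendsto_divide tendsto_const)
    show "(\<lambda>n. LINT u|lborel. char M u * (iexp (- (x * u)) * kh (?h n * u))) \<longlonglongrightarrow> (LINT u|lborel. char M u * iexp (- (x * u)))"
    proof (rule integral_dominated_convergence[where w = "\<lambda>u. norm (char M u)"])
      show "AE u in lborel. (\<lambda>n. char M u * (iexp (- (x * u)) * kh (?h n * u))) \<longlonglongrightarrow> char M u * iexp (- (x * u))"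
      proof (rule AE_I2)
        fix u
        have "(\<lambda>n. ?h n * u) \<longlonglongrightarrow> 0 * u" by (intro tendsto_intros LIMSEQ_Suc lim_1_over_n)
        then have "(\<lambda>n. kh (?h n * u)) \<longlonglongrightarrow> kh 0" by (intro isCont_tendsto_compose[OF kh_isCont]) simp
        then have "(\<lambda>n. char M u * (iexp (- (x * u)) * kh (?h n * u))) \<longlonglongrightarrow> char M u * (iexp (- (x * u)) * kh 0)"
          by (intro tendsto_mult tendsto_const)
        then show "(\<lambda>n. char M u * (iexp (- (x * u)) * kh (?h n * u))) \<longlonglongrightarrow> char M u * iexp (- (x * u))" by (simp add: kh_0)
      qed
      show "AE u in lborel. norm (char M u * (iexp (- (x * u)) * kh (?h n * u))) \<le> norm (char M u)" for n
        using kh_le by (intro AE_I2) (simp add: norm_mult mult_left_le del: of_nat_Suc)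
    qed (use \<psi> in auto)
  qed auto
  show ?thesis by (rule LIMSEQ_unique[OF lim1 lim2])
qed

text \<open>
  Expanding the square, the mixed and the squared bias terms depend on the marginal law only; just the pair terms involve the joint
  law of the sample. This is stated for an arbitrary probability space so that it applies to both samples.
\<close>

lemma MISE_general:
  fixes Z :: "nat \<Rightarrow> 'b \<Rightarrow> real" and f :: "real \<Rightarrow> real"
  assumes P: "prob_space P" and Z: "\<And>j. j \<in> {1..n} \<Longrightarrow> Z j \<in> borel_measurable P"
    and dist: "\<And>j. j \<in> {1..n} \<Longrightarrow> distr P borel (Z j) = density lborel (\<lambda>x. ennreal (f x))"
    and f: "\<And>x. 0 \<le> f x" "\<And>x. f x \<le> C" "f \<in> borel_measurable borel" "integrable lborel f"
    and h: "h > 0" and n: "n \<ge> 1"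
  shows "(LINT x|lborel. LINT \<omega>|P. (kde K h n (\<lambda>j. Z j \<omega>) x - f x)\<^sup>2)
     = 1 / ((real n)\<^sup>2 * h) * (\<Sum>i=1..n. \<Sum>j=1..n. LINT \<omega>|P. KK ((Z i \<omega> - Z j \<omega>) / h))
       - (LINT x|lborel. 2 * f x * (1 / h * (LINT y|lborel. f y * K ((x - y) / h))) - (f x)\<^sup>2)"
proof -
  interpret prob_space P by (rule P)
  interpret pair_sigma_finite P "lborel :: real measure" ..
  note [measurable] = f(3)
  define q where "q x = 1 / h * (LINT y|lborel. f y * K ((x - y) / h))" for x
  have C0: "0 \<le> C" using f(1,2)[of 0] by simp
  have fK: "(\<lambda>y. f y * K ((x - y) / h)) \<in> borel_measurable lborel" for x by measurable
  have q_meas [measurable]: "q \<in> borel_measurable borel" unfolding q_def by measurable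
  have EK: "(LINT \<omega>|P. K ((x - Z j \<omega>) / h)) = h * q x" if j: "j \<in> {1..n}" for x j
  proof -
    note [measurable] = Z[OF j]
    have "(LINT \<omega>|P. K ((x - Z j \<omega>) / h)) = (LINT y|distr P borel (Z j). K ((x - y) / h))"
      by (subst integral_distr) auto
    also have "\<dots> = (LINT y|lborel. f y *\<^sub>R K ((x - y) / h))"
      unfolding dist[OF j] using f(1) by (intro integral_density) auto
    finally show ?thesis using h by (simp add: q_def)
  qed
  have Kint: "integrable P (\<lambda>\<omega>. K ((x - Z j \<omega>) / h))" if j: "j \<in> {1..n}" for x j
  proof (rule integrable_const_bound[of _ B])
    note [measurable] = Z[OF j]
    show "(\<lambda>\<omega>. K ((x - Z j \<omega>) / h)) \<in> borel_measurable P" by measurable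
  qed (use K_nonneg K_le in auto)
  have q_bound: "0 \<le> q x \<and> q x \<le> B / h" for x
  proof -
    have j: "1 \<in> {1..n}" using n by simp
    note [measurable] = Z[OF j]
    have "0 \<le> (LINT \<omega>|P. K ((x - Z 1 \<omega>) / h))" using K_nonneg by (intro integral_nonneg_AE) auto
    moreover have "(LINT \<omega>|P. K ((x - Z 1 \<omega>) / h)) \<le> B"
    proof (rule integral_le_const)
      show "integrable P (\<lambda>\<omega>. K ((x - Z 1 \<omega>) / h))" by (rule Kint[OF j])
    qed (use K_le in auto)
    ultimately show ?thesis unfolding EK[OF j] using h by (simp add: field_simps zero_le_mult_iff)
  qed
  have KKint: "integrable P (\<lambda>\<omega>. K ((x - Z i \<omega>) / h) * K ((x - Z j \<omega>) / h))" if ij: "i \<in> {1..n}" "j \<in> {1..n}" for x i j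
  proof (rule integrable_const_bound[of _ "B * B"])
    show "AE \<omega> in P. norm (K ((x - Z i \<omega>) / h) * K ((x - Z j \<omega>) / h)) \<le> B * B"
      using K_nonneg K_le B_nonneg by (intro AE_I2) (auto simp: abs_mult intro!: mult_mono)
    note [measurable] = Z[OF ij(1)] Z[OF ij(2)]
    show "(\<lambda>\<omega>. K ((x - Z i \<omega>) / h) * K ((x - Z j \<omega>) / h)) \<in> borel_measurable P" by measurable
  qed
  define p where "p i j x = (LINT \<omega>|P. K ((x - Z i \<omega>) / h) * K ((x - Z j \<omega>) / h))" for i j x
  have p: "integrable lborel (p i j)" "(LINT x|lborel. p i j x) = h * (LINT \<omega>|P. KK ((Z i \<omega> - Z j \<omega>) / h))"
    if ij: "i \<in> {1..n}" "j \<in> {1..n}" for i j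
  proof -
    note [measurable] = Z[OF ij(1)] Z[OF ij(2)]
    have i: "integrable (P \<Otimes>\<^sub>M lborel) (\<lambda>(\<omega>, x). K ((x - Z i \<omega>) / h) * K ((x - Z j \<omega>) / h))"
    proof (rule Fubini_integrable)
      show "integrable P (\<lambda>\<omega>. LINT x|lborel. norm (case (\<omega>, x) of (\<omega>, x) \<Rightarrow> K ((x - Z i \<omega>) / h) * K ((x - Z j \<omega>) / h)))"
        by (rule integrable_const_bound[of _ "h * B"])
           (use h KK_nonneg KK_le in \<open>auto simp: abs_mult K_nonneg kernel_product_integral(2)[OF h] intro!: mult_left_mono\<close>)
      show "AE \<omega> in P. integrable lborel (\<lambda>x. case (\<omega>, x) of (\<omega>, x) \<Rightarrow> K ((x - Z i \<omega>) / h) * K ((x - Z j \<omega>) / h))"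
        using kernel_product_integral(1)[OF h] by simp
    qed measurable
    show "integrable lborel (p i j)" unfolding p_def using integrable_snd[OF i] by simp
    have "(LINT x|lborel. p i j x) = (LINT \<omega>|P. LINT x|lborel. K ((x - Z i \<omega>) / h) * K ((x - Z j \<omega>) / h))"
      unfolding p_def by (rule Fubini_integral[OF i])
    also have "\<dots> = h * (LINT \<omega>|P. KK ((Z i \<omega> - Z j \<omega>) / h))"
      unfolding kernel_product_integral(2)[OF h] by simp
    finally show "(LINT x|lborel. p i j x) = h * (LINT \<omega>|P. KK ((Z i \<omega> - Z j \<omega>) / h))" .
  qed
  have pointwise: "(LINT \<omega>|P. (kde K h n (\<lambda>j. Z j \<omega>) x - f x)\<^sup>2)
     = 1 / (real n * h)\<^sup>2 * (\<Sum>i=1..n. \<Sum>j=1..n. p i j x) - (2 * f x * q x - (f x)\<^sup>2)" for x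
  proof -
    let ?c = "1 / (real n * h)"
    have e: "(kde K h n (\<lambda>j. Z j \<omega>) x - f x)\<^sup>2 = ?c\<^sup>2 * (\<Sum>i=1..n. \<Sum>j=1..n. K ((x - Z i \<omega>) / h) * K ((x - Z j \<omega>) / h))
       - 2 * f x * ?c * (\<Sum>j=1..n. K ((x - Z j \<omega>) / h)) + (f x)\<^sup>2" for \<omega>
    proof -
      have "(\<Sum>i=1..n. \<Sum>j=1..n. K ((x - Z i \<omega>) / h) * K ((x - Z j \<omega>) / h)) = (\<Sum>j=1..n. K ((x - Z j \<omega>) / h))\<^sup>2"
        by (simp add: power2_eq_square sum_product)
      then show ?thesis unfolding kde_def by (simp add: power2_diff power_mult_distrib power_divide mult_ac)
    qed
    have i1: "integrable P (\<lambda>\<omega>. \<Sum>i=1..n. \<Sum>j=1..n. K ((x - Z i \<omega>) / h) * K ((x - Z j \<omega>) / h))"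
      using KKint by (intro Bochner_Integration.integrable_sum) auto
    have i2: "integrable P (\<lambda>\<omega>. \<Sum>j=1..n. K ((x - Z j \<omega>) / h))"
      using Kint by (intro Bochner_Integration.integrable_sum) auto
    have s1: "(LINT \<omega>|P. (\<Sum>i=1..n. \<Sum>j=1..n. K ((x - Z i \<omega>) / h) * K ((x - Z j \<omega>) / h))) = (\<Sum>i=1..n. \<Sum>j=1..n. p i j x)"
      unfolding p_def by (rule integral_double_sum) (use KKint in auto)
    have s2: "(LINT \<omega>|P. (\<Sum>j=1..n. K ((x - Z j \<omega>) / h))) = real n * (h * q x)"
    proof -
      have "(LINT \<omega>|P. (\<Sum>j=1..n. K ((x - Z j \<omega>) / h))) = (\<Sum>j=1..n. LINT \<omega>|P. K ((x - Z j \<omega>) / h))"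
        using Kint by (intro Bochner_Integration.integral_sum) auto
      also have "\<dots> = (\<Sum>j=1..n. h * q x)" using EK by (intro sum.cong) auto
      finally show ?thesis by simp
    qed
    have "(LINT \<omega>|P. (kde K h n (\<lambda>j. Z j \<omega>) x - f x)\<^sup>2) = ?c\<^sup>2 * (\<Sum>i=1..n. \<Sum>j=1..n. p i j x) - 2 * f x * ?c * (real n * (h * q x)) + (f x)\<^sup>2"
    proof -
      note i1' = integrable_mult_right[OF i1, of "?c\<^sup>2"]
      note i2' = integrable_mult_right[OF i2, of "2 * f x * ?c"]
      show ?thesis unfolding e
        by (subst Bochner_Integration.integral_add[OF Bochner_Integration.integrable_diff[OF i1' i2']], simp,
            subst Bochner_Integration.integral_diff[OF i1' i2'])
           (simp only: integral_mult_right_zero s1 s2 Bochner_Integration.lebesgue_integral_const prob_space scaleR_one)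
    qed
    then show ?thesis using h n by (simp add: power_divide)
  qed
  have fq: "integrable lborel (\<lambda>x. 2 * f x * q x - (f x)\<^sup>2)"
  proof (rule Bochner_Integration.integrable_bound[of _ "\<lambda>x. (2 * (B / h) + C) * f x"])
    show "AE x in lborel. norm (2 * f x * q x - (f x)\<^sup>2) \<le> norm ((2 * (B / h) + C) * f x)"
    proof (rule AE_I2)
      fix x
      have "\<bar>2 * f x * q x - (f x)\<^sup>2\<bar> \<le> 2 * f x * q x + (f x)\<^sup>2" using f(1)[of x] q_bound[of x] by (simp add: abs_le_iff)
      also have "\<dots> \<le> 2 * f x * (B / h) + f x * C"
        unfolding power2_eq_square using f(1,2)[of x] q_bound[of x] by (intro add_mono mult_left_mono) auto
      finally show "norm (2 * f x * q x - (f x)\<^sup>2) \<le> norm ((2 * (B / h) + C) * f x)"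
        using f(1)[of x] C0 B_nonneg h by (simp add: abs_mult algebra_simps)
    qed
  qed (use f(4) in auto)
  have "(LINT x|lborel. LINT \<omega>|P. (kde K h n (\<lambda>j. Z j \<omega>) x - f x)\<^sup>2)
     = 1 / (real n * h)\<^sup>2 * (\<Sum>i=1..n. \<Sum>j=1..n. LINT x|lborel. p i j x) - (LINT x|lborel. 2 * f x * q x - (f x)\<^sup>2)"
  proof -
    have i: "integrable lborel (\<lambda>x. \<Sum>i=1..n. \<Sum>j=1..n. p i j x)"
      using p(1) by (intro Bochner_Integration.integrable_sum) auto
    have s: "(LINT x|lborel. (\<Sum>i=1..n. \<Sum>j=1..n. p i j x)) = (\<Sum>i=1..n. \<Sum>j=1..n. LINT x|lborel. p i j x)"
      by (rule integral_double_sum) (use p(1) in auto)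
    show ?thesis unfolding pointwise s[symmetric]
      by (subst Bochner_Integration.integral_diff[OF integrable_mult_right[OF i] fq]) (simp only: integral_mult_right_zero)
  qed
  also have "(\<Sum>i=1..n. \<Sum>j=1..n. LINT x|lborel. p i j x) = h * (\<Sum>i=1..n. \<Sum>j=1..n. LINT \<omega>|P. KK ((Z i \<omega> - Z j \<omega>) / h))"
    using p(2) by (simp add: sum_distrib_left)
  also have "1 / (real n * h)\<^sup>2 * (h * (\<Sum>i=1..n. \<Sum>j=1..n. LINT \<omega>|P. KK ((Z i \<omega> - Z j \<omega>) / h)))
     = 1 / ((real n)\<^sup>2 * h) * (\<Sum>i=1..n. \<Sum>j=1..n. LINT \<omega>|P. KK ((Z i \<omega> - Z j \<omega>) / h))"
    using h by (simp add: power2_eq_square)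
  finally show ?thesis unfolding q_def .
qed

end

section \<open>Smoothness and curvature of the marginal density\<close>

lemma integrable_inverse_square_growth: "integrable lborel (\<lambda>u::real. 1 / (1 + \<bar>u\<bar>)\<^sup>2)"
proof (rule Bochner_Integration.integrable_bound)
  show "integrable lborel (\<lambda>x::real. inverse (1 + x\<^sup>2))"
    using integrable_inverse_1_plus_square by (simp add: set_integrable_def einterval_def)
  show "AE u in lborel. norm (1 / (1 + \<bar>u\<bar>)\<^sup>2) \<le> norm (inverse (1 + (u::real)\<^sup>2))"
  proof (rule AE_I2)
    fix u :: real
    have "1 + u\<^sup>2 \<le> (1 + \<bar>u\<bar>)\<^sup>2" by (simp add: power2_eq_square algebra_simps)
    moreover have "0 < 1 + u\<^sup>2" by (simp add: add_pos_nonneg)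
    ultimately show "norm (1 / (1 + \<bar>u\<bar>)\<^sup>2) \<le> norm (inverse (1 + u\<^sup>2))"
      by (simp add: divide_inverse le_imp_inverse_le)
  qed
qed measurable

lemma integrable_of_square_growth:
  fixes h :: "real \<Rightarrow> 'a :: {banach, second_countable_topology}"
  assumes "h \<in> borel_measurable borel" and "\<And>u. norm (h u) \<le> C / (1 + \<bar>u\<bar>)\<^sup>2"
  shows "integrable lborel h"
proof (rule Bochner_Integration.integrable_bound[OF integrable_mult_right[OF integrable_inverse_square_growth, of C]])
  show "AE u in lborel. norm (h u) \<le> norm (C * (1 / (1 + \<bar>u\<bar>)\<^sup>2))"
  proof (rule AE_I2)
    fix u
    have "C / (1 + \<bar>u\<bar>)\<^sup>2 \<le> \<bar>C\<bar> / (1 + \<bar>u\<bar>)\<^sup>2" by (intro divide_right_mono) auto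
    then show "norm (h u) \<le> norm (C * (1 / (1 + \<bar>u\<bar>)\<^sup>2))" using order_trans[OF assms(2)] by simp
  qed
qed (use assms(1) in simp)

lemma power_div_growth_le:
  assumes "k \<le> 12" shows "\<bar>u\<bar> ^ k * (D / (1 + \<bar>u\<bar>) ^ 14) \<le> \<bar>D\<bar> / (1 + \<bar>u::real\<bar>)\<^sup>2"
proof -
  have p: "0 < 1 + \<bar>u\<bar>" by simp
  have "\<bar>u\<bar> ^ k \<le> (1 + \<bar>u\<bar>) ^ k" by (rule power_mono) auto
  also have "\<dots> \<le> (1 + \<bar>u\<bar>) ^ 12" using assms by (intro power_increasing) auto
  finally have 1: "\<bar>u\<bar> ^ k \<le> (1 + \<bar>u\<bar>) ^ 12" .
  have "D / (1 + \<bar>u\<bar>) ^ 14 \<le> \<bar>D\<bar> / (1 + \<bar>u\<bar>) ^ 14" using p by (intro divide_right_mono) auto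
  then have "\<bar>u\<bar> ^ k * (D / (1 + \<bar>u\<bar>) ^ 14) \<le> (1 + \<bar>u\<bar>) ^ 12 * (\<bar>D\<bar> / (1 + \<bar>u\<bar>) ^ 14)"
    using 1 by (intro order_trans[OF mult_left_mono mult_right_mono]) auto
  also have "\<dots> = \<bar>D\<bar> / (1 + \<bar>u\<bar>)\<^sup>2"
  proof -
    have "(1 + \<bar>u\<bar>) ^ 14 = (1 + \<bar>u\<bar>) ^ 12 * (1 + \<bar>u\<bar>)\<^sup>2" by (simp only: power_add[symmetric]) simp
    moreover have "(1 + \<bar>u\<bar>) ^ 12 \<noteq> 0" using p by simp
    ultimately show ?thesis by (metis times_divide_eq_right nonzero_mult_divide_mult_cancel_left)
  qed
  finally show ?thesis .
qed

context noise_process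
begin

lemma real_distribution_X: "real_distribution (distr M borel (X t))"
  by (rule real_distribution_distr) simp

lemma ch_isCont: "isCont ch u"
  unfolding ch_def[abs_def] by (rule real_distribution.isCont_char[OF real_distribution_X])

lemma ch_meas [measurable]: "ch \<in> borel_measurable borel"
  by (intro borel_measurable_continuous_onI) (simp add: continuous_on_eq_continuous_at ch_isCont)

lemma cnj_ch_meas [measurable]: "(\<lambda>u. cnj (ch u)) \<in> borel_measurable borel"
  by (intro borel_measurable_continuous_onI continuous_on_cnj) (simp add: continuous_on_eq_continuous_at ch_isCont)

lemma ch_le: "norm (ch u) \<le> 1"
  unfolding ch_def by (rule real_distribution.cmod_char_le_1[OF real_distribution_X])

lemma ch_0: "ch 0 = 1"
  unfolding ch_def by (rule real_distribution.char_zero[OF real_distribution_X])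

lemma ch_minus: "ch (- u) = cnj (ch u)"
proof -
  interpret D: real_distribution "distr M borel (X 0)" by (rule real_distribution_X)
  have "integrable (distr M borel (X 0)) (\<lambda>x. iexp (u * x))" by (rule D.integrable_const_bound[of _ 1]) auto
  then have "(LINT x|distr M borel (X 0). cnj (iexp (u * x))) = cnj (ch u)"
    unfolding ch_def char_def by (rule integral_bounded_linear[OF bounded_linear_cnj])
  then show ?thesis by (simp add: ch_def char_def exp_cnj)
qed

lemma ch_moment: "k \<le> 12 \<Longrightarrow> \<exists>D. \<forall>u. \<bar>u\<bar> ^ k * norm (ch u) \<le> D / (1 + \<bar>u\<bar>)\<^sup>2"
proof -
  assume k: "k \<le> 12"
  obtain D where D: "\<forall>u. norm (ch u) \<le> D / (1 + \<bar>u\<bar>) ^ 14" using ch_decay by blast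
  have "\<bar>u\<bar> ^ k * norm (ch u) \<le> \<bar>D\<bar> / (1 + \<bar>u\<bar>)\<^sup>2" for u
    by (rule order_trans[OF mult_left_mono[OF D[rule_format]] power_div_growth_le[OF k]]) simp
  then show ?thesis by blast
qed

lemma ch_moment_int: "k \<le> 12 \<Longrightarrow> integrable lborel (\<lambda>u. \<bar>u\<bar> ^ k * norm (ch u))"
proof -
  assume k: "k \<le> 12"
  obtain D where D: "\<forall>u. \<bar>u\<bar> ^ k * norm (ch u) \<le> D / (1 + \<bar>u\<bar>)\<^sup>2" using ch_moment[OF k] by blast
  show ?thesis by (rule integrable_of_square_growth[of _ D]) (use D in simp_all)
qed

lemma ch_int: "integrable lborel ch"
  using ch_moment_int[of 0] by (simp add: integrable_norm_iff)

text \<open>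
  Up to the factor \<open>2 * pi\<close>, this is the integral of the squared second derivative of the density.
\<close>

definition "curv = (LINT u|lborel. u ^ 4 * (norm (ch u))\<^sup>2)"

lemma curv_int: "integrable lborel (\<lambda>u. u ^ 4 * (norm (ch u))\<^sup>2)"
proof (rule Bochner_Integration.integrable_bound[OF ch_moment_int[of 4]])
  show "AE u in lborel. norm (u ^ 4 * (norm (ch u))\<^sup>2) \<le> norm (\<bar>u\<bar> ^ 4 * norm (ch u))"
  proof (rule AE_I2)
    fix u
    have "norm (ch u) * norm (ch u) \<le> norm (ch u) * 1" using ch_le by (intro mult_left_mono) auto
    then show "norm (u ^ 4 * (norm (ch u))\<^sup>2) \<le> norm (\<bar>u\<bar> ^ 4 * norm (ch u))"
      by (simp add: abs_mult power2_eq_square mult_left_mono)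
  qed
qed simp_all

lemma curv_pos: "curv > 0"
proof -
  have nn: "0 \<le> u ^ 4 * (norm (ch u))\<^sup>2" for u by simp
  have "curv \<noteq> 0"
  proof
    assume "curv = 0"
    then have ae: "AE u in lborel. u ^ 4 * (norm (ch u))\<^sup>2 = 0"
      unfolding curv_def using integral_nonneg_eq_0_iff_AE[OF curv_int] by simp
    have "((\<lambda>u. norm (ch u)) \<longlongrightarrow> norm (ch 0)) (at 0)"
      using ch_isCont[of 0] unfolding isCont_def by (rule tendsto_norm)
    then have "eventually (\<lambda>u. norm (ch u) > 0) (at 0)"
      by (rule order_tendstoD) (simp add: ch_0)
    then obtain d where d: "d > 0" "\<forall>u. u \<noteq> 0 \<and> dist u 0 < d \<longrightarrow> norm (ch u) > 0" unfolding eventually_at by auto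
    have "AE u in lborel. u \<notin> {0<..<d}"
      using ae by eventually_elim (use d in \<open>auto simp: dist_real_def\<close>)
    then have "{0<..<d} \<in> null_sets lborel" using AE_iff_null_sets[of "{0<..<d}" lborel] by simp
    then have "emeasure lborel {0<..<d} = 0" by blast
    then show False using d(1) by simp
  qed
  moreover have "curv \<ge> 0" unfolding curv_def by (rule Bochner_Integration.integral_nonneg) auto
  ultimately show ?thesis by simp
qed

text \<open>
  Degenerate noise has a constant characteristic function, which does not decay.
\<close>

lemma s2_pos: "nf.s2 > 0"
proof (rule ccontr)
  assume "\<not> nf.s2 > 0"
  then have s0: "nf.s2 = 0" using nf.moments_nonneg(1) by simp
  have one: "char (distr M borel (\<xi> 0)) u = 1" for u
  proof -
    have "norm (LINT x|distr M borel (\<xi> 0). nf.Q u x) \<le> (LINT x|distr M borel (\<xi> 0). u\<^sup>2 * x\<^sup>2)"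
      by (rule norm_integral_le_bound(2)[OF nf.Q_meas integrable_mult_right[OF nf.int2] nf.Q_le])
    then have "norm (char (distr M borel (\<xi> 0)) u - 1) \<le> u\<^sup>2 * nf.s2"
      unfolding nf.E_Q nf.s2_def by simp
    then show ?thesis using s0 by simp
  qed
  obtain \<delta> C where \<delta>: "\<delta> > 0" and C: "\<forall>u. norm (char (distr M borel (\<xi> 0)) u) \<le> C * (1 + \<bar>u\<bar>) powr (- \<delta>)"
    using nf.decay by blast
  have C1: "1 \<le> C * (1 + \<bar>u\<bar>) powr (- \<delta>)" for u using C[rule_format, of u] one[of u] by simp
  have "((\<lambda>u. (1 + \<bar>u\<bar>) powr (- \<delta>)) \<longlongrightarrow> 0) (at_top :: real filter)"
  proof (rule tendsto_neg_powr)
    show "filterlim (\<lambda>u. 1 + \<bar>u\<bar>) at_top (at_top :: real filter)"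
      by (rule filterlim_at_top_mono[OF filterlim_ident]) (auto intro!: always_eventually)
  qed (use \<delta> in simp)
  then have "((\<lambda>u. C * (1 + \<bar>u\<bar>) powr (- \<delta>)) \<longlongrightarrow> C * 0) (at_top :: real filter)"
    by (rule tendsto_mult_left)
  then have "1 \<le> C * 0" by (rule tendsto_lowerbound) (use C1 in \<open>auto intro!: always_eventually\<close>)
  then show False by simp
qed

end

locale density_process = noise_process M \<xi> b X
  for M :: "'a measure" and \<xi> b X +
  fixes f :: "real \<Rightarrow> real"
  assumes f_nonneg: "0 \<le> f x" and f_cont: "continuous_on UNIV f"
    and f_density: "distributed M lborel (X 0) (\<lambda>x. ennreal (f x))"
begin

lemma f_meas [measurable]: "f \<in> borel_measurable borel"
  using f_cont by (rule borel_measurable_continuous_onI)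

lemma X_law: "distr M borel (X t) = density lborel (\<lambda>x. ennreal (f x))"
  using f_density unfolding distributed_def X_distr[of t] by (simp cong: distr_cong)

lemma prob_density: "prob_space (density lborel (\<lambda>x. ennreal (f x)))"
  unfolding X_law[of 0, symmetric] by (rule prob_space_distr) simp

lemma f_int: "integrable lborel f"
proof (rule integrableI_nonneg)
  have "emeasure (density lborel (\<lambda>x. ennreal (f x))) UNIV = 1"
    using prob_space.emeasure_space_1[OF prob_density] by simp
  then show "(\<integral>\<^sup>+ x. ennreal (f x) \<partial>lborel) < \<infinity>" by (subst (asm) emeasure_density) auto
qed (use f_nonneg in auto)

text \<open>
  \<open>2 * pi\<close> times the \<open>k\<close>-th derivative of the density, as a Fourier integral.
\<close>

definition "I k x = (LINT u|lborel. (- \<i> * of_real u) ^ k * ch u * iexp (- (x * u)))"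

lemma I_derivative:
  assumes "k \<le> 10" shows "(I k has_vector_derivative I (Suc k) x) (at x)"
proof -
  let ?w = "\<lambda>u. (- \<i> * of_real u) ^ k * ch u"
  have nw: "norm (?w u) = \<bar>u\<bar> ^ k * norm (ch u)" for u by (simp add: norm_mult norm_power)
  have w: "integrable lborel ?w"
    using ch_moment_int[of k] assms
    by (subst integrable_norm_iff[symmetric]) (auto simp: norm_mult norm_power)
  have w1: "integrable lborel (\<lambda>u. \<bar>u\<bar> * norm (?w u))"
    unfolding nw using ch_moment_int[of "Suc k"] assms by (simp add: mult.assoc)
  have e: "I (Suc k) x = (LINT u|lborel. (- \<i> * of_real u * ?w u) * iexp (- (x * u)))"
    unfolding I_def by (simp add: mult.assoc)
  show ?thesis unfolding e using fourier_integral_derivative[OF w w1, of x] unfolding I_def[abs_def] .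
qed

end

locale smoothed_process = density_process M \<xi> b X f + kernel K R B
  for M :: "'a measure" and \<xi> b X f K R B
begin

lemma inversion: "of_real (f x) = I 0 x / of_real (2 * pi)"
proof -
  have c: "char (distr M borel (X 0)) = ch" by (rule ext) (simp add: ch_def)
  show ?thesis
    using density_inversion[OF real_distribution_X[of 0] _ X_law[of 0] f_nonneg f_cont, of x] ch_int
    unfolding c I_def by simp
qed

lemma f_bounded: "\<exists>C. \<forall>x. f x \<le> C"
proof (intro exI allI)
  fix x
  have "norm (I 0 x) \<le> (LINT u|lborel. norm (ch u))"
    unfolding I_def by (rule norm_integral_le_bound(2)) (use ch_int in \<open>auto simp: norm_mult\<close>)
  moreover have "norm (complex_of_real (f x)) = norm (I 0 x) / (2 * pi)" unfolding inversion by (simp add: norm_divide)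
  ultimately show "f x \<le> (LINT u|lborel. norm (ch u)) / (2 * pi)"
    using f_nonneg[of x] by (simp add: divide_right_mono)
qed

lemma I_real_derivative:
  assumes k: "k \<le> 10"
  shows "((\<lambda>x. Re (I k x)) has_real_derivative Re (I (Suc k) x)) (at x)"
    and "(\<And>x. Im (I k x) = 0) \<Longrightarrow> Im (I (Suc k) x) = 0"
proof -
  show "((\<lambda>x. Re (I k x)) has_real_derivative Re (I (Suc k) x)) (at x)"
    unfolding has_real_derivative_iff_has_vector_derivative
    by (rule bounded_linear.has_vector_derivative[OF bounded_linear_Re I_derivative[OF k]])
  have i: "((\<lambda>x. Im (I k x)) has_real_derivative Im (I (Suc k) x)) (at x)"
    unfolding has_real_derivative_iff_has_vector_derivative
    by (rule bounded_linear.has_vector_derivative[OF bounded_linear_Im I_derivative[OF k]])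
  assume z: "\<And>x. Im (I k x) = 0"
  show "Im (I (Suc k) x) = 0" using DERIV_unique[OF i] unfolding z by (metis DERIV_const)
qed

lemma second_derivative: "of_real ((deriv ^^ 2) f x) = I 2 x / of_real (2 * pi)"
proof -
  have f: "f x = Re (I 0 x) / (2 * pi)" for x
    using arg_cong[OF inversion[of x], of Re] by simp
  have z0: "Im (I 0 x) = 0" for x
    using arg_cong[OF inversion[of x], of Im] by simp
  have z1: "Im (I 1 x) = 0" for x using I_real_derivative(2)[of 0 x] z0 by simp
  have z2: "Im (I 2 x) = 0" for x using I_real_derivative(2)[of 1 x] z1 by (simp add: numeral_2_eq_2)
  have "(f has_real_derivative Re (I 1 x) / (2 * pi)) (at x)" for x
    unfolding f[abs_def] using DERIV_cdivide[OF I_real_derivative(1)[of 0 x]] by simp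
  then have d1: "deriv f = (\<lambda>x. Re (I 1 x) / (2 * pi))" by (intro ext DERIV_imp_deriv)
  have "deriv (deriv f) x = Re (I 2 x) / (2 * pi)"
    unfolding d1 using DERIV_cdivide[OF I_real_derivative(1)[of 1 x]]
    by (intro DERIV_imp_deriv) (simp add: numeral_2_eq_2)
  then show ?thesis using z2[of x] by (simp add: numeral_2_eq_2 complex_eq_iff)
qed

lemma curvature_integral: "(LINT x|lborel. ((deriv ^^ 2) f x)\<^sup>2) = curv / (2 * pi)"
proof -
  let ?L = "\<lambda>u. (- \<i> * of_real u)\<^sup>2 * ch u"
  have nL: "norm (?L u) = \<bar>u\<bar>\<^sup>2 * norm (ch u)" for u by (simp add: norm_mult norm_power)
  have L: "integrable lborel ?L"
    using ch_moment_int[of 2] by (subst integrable_norm_iff[symmetric]) (auto simp: norm_mult norm_power)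
  have c: "continuous_on UNIV ?L"
    by (intro continuous_intros) (simp add: continuous_on_eq_continuous_at ch_isCont)
  obtain D where D: "\<forall>u. \<bar>u\<bar>\<^sup>2 * norm (ch u) \<le> D / (1 + \<bar>u\<bar>)\<^sup>2" using ch_moment[of 2] by auto
  have D0: "0 \<le> D" using order_trans[OF _ D[rule_format, of 0]] by simp
  have B: "norm (?L u) \<le> D" for u
  proof -
    have "1 \<le> (1 + \<bar>u\<bar>)\<^sup>2" by (rule one_le_power) simp
    then have "D / (1 + \<bar>u\<bar>)\<^sup>2 \<le> D / 1" using D0 by (intro divide_left_mono) auto
    then show ?thesis unfolding nL using D[rule_format, of u] by simp
  qed
  have "(LINT x|lborel. (norm (LINT v|lborel. ?L v * iexp (- (x * v))))\<^sup>2) = 2 * pi * (LINT v|lborel. (norm (?L v))\<^sup>2)"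
    by (rule plancherel(2)[OF L c B])
  also have "(LINT v|lborel. (norm (?L v))\<^sup>2) = curv"
    unfolding curv_def nL by (simp add: power_mult_distrib power_mult[symmetric])
  finally have 1: "(LINT x|lborel. (norm (I 2 x))\<^sup>2) = 2 * pi * curv" unfolding I_def .
  have sq: "((deriv ^^ 2) f x)\<^sup>2 = 1 / (2 * pi)\<^sup>2 * (norm (I 2 x))\<^sup>2" for x
  proof -
    have "((deriv ^^ 2) f x)\<^sup>2 = (norm (complex_of_real ((deriv ^^ 2) f x)))\<^sup>2" unfolding norm_of_real power2_abs ..
    also have "\<dots> = 1 / (2 * pi)\<^sup>2 * (norm (I 2 x))\<^sup>2" unfolding second_derivative by (simp add: norm_divide power_divide)
    finally show ?thesis .
  qed
  show ?thesis unfolding sq integral_mult_right_zero 1 by (simp add: power2_eq_square)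
qed

end

section \<open>The difference of the two mean integrated squared errors\<close>

context smoothed_process
begin

text \<open>
  The accumulated dependence of the pairs of distinct times, in reversed time.
\<close>

definition "gap n u = (\<Sum>i<n. \<Sum>j<n. if lag i j > 0 then \<Psi> (int n - int i) (int n - int j) u - ch u * cnj (ch u) else 0)"

lemma lag_process: "\<bar>(int n - int i) - (int n - int j)\<bar> = int (lag i j)"
  by (simp add: lag_def)

lemma real_distribution_diff: "real_distribution (distr M borel (\<lambda>\<omega>. X s \<omega> - X t \<omega>))"
  by (rule real_distribution_distr) simp

lemma Psi_meas [measurable]: "\<Psi> s t \<in> borel_measurable borel"
proof -
  have "isCont (\<Psi> s t) u" for u
    unfolding \<Psi>_def[abs_def] by (rule real_distribution.isCont_char[OF real_distribution_diff])
  then show ?thesis by (intro borel_measurable_continuous_onI) (simp add: continuous_on_eq_continuous_at)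
qed

lemma Psi_int: "s \<noteq> t \<Longrightarrow> integrable lborel (\<Psi> s t)"
proof -
  assume "s \<noteq> t"
  then have l: "nat \<bar>s - t\<bar> \<ge> 1" by simp
  obtain D where D: "\<forall>s' t' u. \<bar>s' - t'\<bar> = int (nat \<bar>s - t\<bar>) \<longrightarrow> norm (\<Psi> s' t' u) \<le> D / (1 + \<bar>u\<bar>)\<^sup>2"
    using Psi_decay_lag[OF l] by (elim exE conjE)
  show ?thesis by (rule integrable_of_square_growth[of _ D]) (use D in simp_all)
qed

lemma ch_sq_int: "integrable lborel (\<lambda>u. ch u * cnj (ch u))"
proof (rule Bochner_Integration.integrable_bound[OF ch_int])
  show "AE u in lborel. norm (ch u * cnj (ch u)) \<le> norm (ch u)"
    using ch_le by (intro AE_I2) (simp add: norm_mult mult_left_le)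
qed measurable

lemma weight_int:
  fixes H :: "real \<Rightarrow> complex"
  assumes H: "integrable lborel H"
  shows "integrable lborel (\<lambda>u. H u * of_real ((norm (kh (u * h)))\<^sup>2))"
proof (rule Bochner_Integration.integrable_bound[OF H])
  show "AE u in lborel. norm (H u * of_real ((norm (kh (u * h)))\<^sup>2)) \<le> norm (H u)"
    using kh_le by (intro AE_I2) (simp add: norm_mult norm_power mult_left_le power_le_one)
  show "(\<lambda>u. H u * of_real ((norm (kh (u * h)))\<^sup>2)) \<in> borel_measurable lborel"
    using borel_measurable_integrable[OF H] by measurable
qed

text \<open>
  The expected overlap of the kernels at two observations, as a Fourier integral; \<open>overlap_independent\<close> is the
  counterpart for two coordinates of the independent sample.
\<close>

lemma overlap_dependent:
  assumes st: "s \<noteq> t" and h: "h > 0"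
  shows "of_real (2 * pi * (LINT \<omega>|M. KK ((X s \<omega> - X t \<omega>) / h))) =
    of_real h * (LINT u|lborel. \<Psi> s t u * of_real ((norm (kh (u * h)))\<^sup>2))"
proof -
  have c: "char (distr M borel (\<lambda>\<omega>. X s \<omega> - X t \<omega>)) = \<Psi> s t" by (rule ext) (simp add: \<Psi>_def)
  have "of_real (LINT \<omega>|M. KK ((X s \<omega> - X t \<omega>) / h)) =
      (LINT u|lborel. \<Psi> s t u * of_real (h * (norm (kh (u * h)))\<^sup>2)) / of_real (2 * pi)"
    using expectation_KK[OF real_distribution_diff[of s t] _ h] Psi_int[OF st]
    unfolding c by (subst (asm) integral_distr) auto
  also have "(LINT u|lborel. \<Psi> s t u * of_real (h * (norm (kh (u * h)))\<^sup>2)) = of_real h * (LINT u|lborel. \<Psi> s t u * of_real ((norm (kh (u * h)))\<^sup>2))"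
    by (subst integral_mult_right_zero[symmetric]) (simp add: mult_ac)
  finally show ?thesis by simp
qed

definition "F = density lborel (\<lambda>x. ennreal (f x))"

lemma F_prob: "prob_space F" unfolding F_def by (rule prob_density)

lemma F_sets [measurable_cong, simp]: "sets F = sets borel" unfolding F_def by simp

lemma F_space [simp]: "space F = UNIV" unfolding F_def by simp

lemma F_char: "char F u = ch u"
  unfolding F_def ch_def X_law[of 0] ..

abbreviation "sample n \<equiv> (\<Pi>\<^sub>M j\<in>{1..n}. F)"

lemma sample_prob: "prob_space (sample n)"
  by (rule prob_space_PiM) (rule F_prob)

lemma sample_marginal: "j \<in> {1..n} \<Longrightarrow> distr (sample n) borel (\<lambda>y. y j) = F"
proof -
  assume j: "j \<in> {1..n}"
  have "distr (sample n) borel (\<lambda>y. y j) = distr (sample n) F (\<lambda>y. y j)"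
    by (rule distr_cong) auto
  also have "\<dots> = F" by (rule distr_PiM_component[of "{1..n}" "\<lambda>_. F" j]) (use j F_prob in auto)
  finally show ?thesis .
qed

lemma sample_coord_meas: "j \<in> {1..n} \<Longrightarrow> (\<lambda>y. y j) \<in> borel_measurable (sample n)"
  using measurable_component_singleton[of j "{1..n}" "\<lambda>_. F"] by simp

lemma sample_diff_char:
  fixes i j n :: nat
  assumes ij: "i \<in> {1..n}" "j \<in> {1..n}" "i \<noteq> j"
  shows "char (distr (sample n) borel (\<lambda>y. y i - y j)) u = ch u * cnj (ch u)"
proof -
  interpret P: prob_space "sample n" by (rule sample_prob)
  interpret ps: product_prob_space "\<lambda>_. F" "{1..n}"
    by (simp add: product_prob_space_def product_prob_space_axioms_def product_sigma_finite_def F_prob prob_space_imp_sigma_finite)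
  define w where "w k x = (if k = i then iexp (u * x) else if k = j then iexp (- (u * x)) else 1)" for k :: nat and x :: real
  have wi: "integrable F (w k)" for k
  proof -
    have meas: "w k \<in> borel_measurable F" unfolding w_def[abs_def] by (cases "k = i"; cases "k = j") simp_all
    show ?thesis by (rule finite_measure.integrable_const_bound[OF prob_space.finite_measure[OF F_prob], of _ 1]) (auto simp: w_def meas)
  qed
  note [measurable] = sample_coord_meas[OF ij(1)] sample_coord_meas[OF ij(2)]
  have wv: "(LINT x|F. w k x) = (if k = i then ch u else if k = j then cnj (ch u) else 1)" for k
  proof -
    have 1: "(LINT x|F. iexp (u * x)) = ch u" unfolding F_char[symmetric] char_def ..
    have 2: "(LINT x|F. iexp (- (u * x))) = cnj (ch u)"
      using ch_minus[of u] F_char[of "- u", unfolded char_def] by simp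
    show ?thesis using 1 2 ij(3) prob_space.prob_space[OF F_prob] by (simp add: w_def[abs_def])
  qed
  have prodij: "(\<Prod>k\<in>{1..n}. if k = i then a else if k = j then c else 1) = a * c" for a c :: complex
  proof -
    have "(\<Prod>k\<in>{1..n}. if k = i then a else if k = j then c else 1) = (\<Prod>k\<in>{i, j}. if k = i then a else if k = j then c else 1)"
      by (rule prod.mono_neutral_right) (use ij in auto)
    then show ?thesis using ij(3) by simp
  qed
  have "char (distr (sample n) borel (\<lambda>y. y i - y j)) u = (LINT y|sample n. iexp (u * (y i - y j)))"
    unfolding char_def by (rule integral_distr) measurable
  also have "\<dots> = (LINT y|sample n. (\<Prod>k\<in>{1..n}. w k (y k)))"
  proof (rule Bochner_Integration.integral_cong[OF refl])
    fix y :: "nat \<Rightarrow> real"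
    have "(\<Prod>k\<in>{1..n}. w k (y k)) = (\<Prod>k\<in>{1..n}. if k = i then iexp (u * y i) else if k = j then iexp (- (u * y j)) else 1)"
      by (rule prod.cong) (auto simp: w_def)
    also have "\<dots> = iexp (u * (y i - y j))" unfolding prodij by (simp add: exp_add[symmetric] algebra_simps)
    finally show "iexp (u * (y i - y j)) = (\<Prod>k\<in>{1..n}. w k (y k))" ..
  qed
  also have "\<dots> = (\<Prod>k\<in>{1..n}. LINT x|F. w k x)"
    by (rule ps.product_integral_prod) (use wi in auto)
  also have "\<dots> = ch u * cnj (ch u)" unfolding wv prodij ..
  finally show ?thesis .
qed

lemma overlap_independent:
  fixes i j n :: nat
  assumes ij: "i \<in> {1..n}" "j \<in> {1..n}" "i \<noteq> j" and h: "h > 0"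
  shows "of_real (2 * pi * (LINT y|sample n. KK ((y i - y j) / h))) =
    of_real h * (LINT u|lborel. (ch u * cnj (ch u)) * of_real ((norm (kh (u * h)))\<^sup>2))"
proof -
  interpret P: prob_space "sample n" by (rule sample_prob)
  note [measurable] = sample_coord_meas[OF ij(1)] sample_coord_meas[OF ij(2)]
  have c: "char (distr (sample n) borel (\<lambda>y. y i - y j)) = (\<lambda>u. ch u * cnj (ch u))"
    by (rule ext) (rule sample_diff_char[OF ij])
  have rd: "real_distribution (distr (sample n) borel (\<lambda>y. y i - y j))"
    by (rule P.real_distribution_distr) measurable
  have tr: "(LINT z|distr (sample n) borel (\<lambda>y. y i - y j). KK (z / h)) = (LINT y|sample n. KK ((y i - y j) / h))"
    by (rule integral_distr) measurable
  have "of_real (LINT y|sample n. KK ((y i - y j) / h)) =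
      (LINT u|lborel. (ch u * cnj (ch u)) * of_real (h * (norm (kh (u * h)))\<^sup>2)) / of_real (2 * pi)"
    using expectation_KK[OF rd _ h] ch_sq_int unfolding c tr by blast
  also have "(LINT u|lborel. (ch u * cnj (ch u)) * of_real (h * (norm (kh (u * h)))\<^sup>2)) = of_real h * (LINT u|lborel. (ch u * cnj (ch u)) * of_real ((norm (kh (u * h)))\<^sup>2))"
    by (subst integral_mult_right_zero[symmetric]) (simp add: mult_ac)
  finally show ?thesis by simp
qed

text \<open>
  The bias terms agree for both samples, and so do the diagonal pair terms, which all equal \<open>KK 0\<close>. For a pair of distinct times the
  two overlaps differ by the Fourier integral of the difference of the characteristic functions.
\<close>

theorem MISE_difference:
  assumes h: "h > 0" and n: "n \<ge> 1"
  shows "of_real (2 * pi * (real n)\<^sup>2 * (MISE M X f K h n - MISE_iid f K h n))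
    = (LINT u|lborel. gap n u * of_real ((norm (kh (u * h)))\<^sup>2))"
proof -
  obtain C where C: "\<forall>x. f x \<le> C" using f_bounded by blast
  define d where "d i j = (LINT \<omega>|M. KK ((X (int i) \<omega> - X (int j) \<omega>) / h)) - (LINT y|sample n. KK ((y i - y j) / h))" for i j
  define k where "k u = (norm (kh (u * h)))\<^sup>2" for u
  interpret P: prob_space "sample n" by (rule sample_prob)
  let ?rest = "LINT x|lborel. 2 * f x * (1 / h * (LINT y|lborel. f y * K ((x - y) / h))) - (f x)\<^sup>2"
  have 1: "MISE M X f K h n = 1 / ((real n)\<^sup>2 * h) * (\<Sum>i=1..n. \<Sum>j=1..n. LINT \<omega>|M. KK ((X (int i) \<omega> - X (int j) \<omega>) / h)) - ?rest"
    unfolding MISE_def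
    by (rule MISE_general[of M n "\<lambda>j. X (int j)" f C h]) (use C f_nonneg f_int h n X_law prob_space_axioms in auto)
  have 2: "MISE_iid f K h n = 1 / ((real n)\<^sup>2 * h) * (\<Sum>i=1..n. \<Sum>j=1..n. LINT y|sample n. KK ((y i - y j) / h)) - ?rest"
    unfolding MISE_iid_def F_def[symmetric]
    by (rule MISE_general[of "sample n" n "\<lambda>j y. y j" f C h])
       (use C f_nonneg f_int h n sample_marginal[of _ n] sample_prob sample_coord_meas[of _ n] in \<open>simp_all add: F_def[symmetric] del: One_nat_def\<close>)
  have "MISE M X f K h n - MISE_iid f K h n = 1 / ((real n)\<^sup>2 * h) * (\<Sum>i=1..n. \<Sum>j=1..n. d i j)"
    unfolding 1 2 d_def sum_subtractf by (simp only: right_diff_distrib)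
  then have diff: "2 * pi * (real n)\<^sup>2 * (MISE M X f K h n - MISE_iid f K h n) = 1 / h * (\<Sum>i=1..n. \<Sum>j=1..n. 2 * pi * d i j)"
    using n by (simp add: sum_distrib_left[symmetric] del: of_nat_Suc)
  define g where "g i j u = (if i \<noteq> j then \<Psi> (int i) (int j) u - ch u * cnj (ch u) else 0)" for i j u
  have gi: "integrable lborel (\<lambda>u. g i j u * of_real (k u))" for i j
    unfolding k_def by (rule weight_int) (cases "i = j", use Psi_int ch_sq_int in \<open>auto simp: g_def[abs_def]\<close>)
  have dg: "of_real (2 * pi * d i j) = of_real h * (LINT u|lborel. g i j u * of_real (k u))" if ij: "i \<in> {1..n}" "j \<in> {1..n}" for i j
  proof (cases "i = j")
    case True
    have "d i j = 0" unfolding d_def True using P.prob_space prob_space by simp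
    then show ?thesis using True by (simp add: g_def)
  next
    case False
    have "of_real (2 * pi * d i j) = of_real h * ((LINT u|lborel. \<Psi> (int i) (int j) u * of_real (k u)) - (LINT u|lborel. (ch u * cnj (ch u)) * of_real (k u)))"
      unfolding d_def k_def right_diff_distrib of_real_diff
      using overlap_dependent[of "int i" "int j" h] overlap_independent[OF ij False h] False h by simp
    also have "(LINT u|lborel. \<Psi> (int i) (int j) u * of_real (k u)) - (LINT u|lborel. (ch u * cnj (ch u)) * of_real (k u)) = (LINT u|lborel. \<Psi> (int i) (int j) u * of_real (k u) - (ch u * cnj (ch u)) * of_real (k u))"
      unfolding k_def by (rule Bochner_Integration.integral_diff[symmetric]) (use False weight_int[OF Psi_int, of "int i" "int j" h] weight_int[OF ch_sq_int, of h] in simp_all)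
    also have "\<dots> = (LINT u|lborel. g i j u * of_real (k u))" using False by (simp add: g_def left_diff_distrib)
    finally show ?thesis .
  qed
  have re: "(\<Sum>i=1..n. H i) = (\<Sum>i<n. H (n - i))" for H :: "nat \<Rightarrow> complex"
    by (rule sum.reindex_bij_witness[of _ "\<lambda>i. n - i" "\<lambda>i. n - i"]) auto
  have gap: "(\<Sum>i=1..n. \<Sum>j=1..n. g i j u) = gap n u" for u
    unfolding re gap_def
  proof (intro sum.cong refl)
    fix i j assume "i \<in> {..<n}" "j \<in> {..<n}"
    then have ij: "i < n" "j < n" by auto
    have "n - i \<noteq> n - j \<longleftrightarrow> lag i j > 0" using ij by (auto simp: lag_def)
    then show "g (n - i) (n - j) u = (if lag i j > 0 then \<Psi> (int n - int i) (int n - int j) u - ch u * cnj (ch u) else 0)"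
      unfolding g_def using ij by (simp add: of_nat_diff)
  qed
  have "complex_of_real (2 * pi * (real n)\<^sup>2 * (MISE M X f K h n - MISE_iid f K h n)) = of_real (1 / h) * (\<Sum>i=1..n. \<Sum>j=1..n. of_real (2 * pi * d i j))"
    unfolding diff of_real_mult of_real_sum ..
  also have "\<dots> = of_real (1 / h) * (\<Sum>i=1..n. \<Sum>j=1..n. of_real h * (LINT u|lborel. g i j u * of_real (k u)))"
    using dg by (intro arg_cong2[of _ _ _ _ "(*)"] sum.cong refl) auto
  also have "\<dots> = (\<Sum>i=1..n. \<Sum>j=1..n. (LINT u|lborel. g i j u * of_real (k u)))"
    unfolding sum_distrib_left[symmetric] using h by (simp add: mult.assoc[symmetric] of_real_mult[symmetric] del: of_real_mult of_real_divide)
  also have "\<dots> = (LINT u|lborel. (\<Sum>i=1..n. \<Sum>j=1..n. g i j u * of_real (k u)))"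
    by (rule integral_double_sum[symmetric]) (rule gi)
  also have "\<dots> = (LINT u|lborel. gap n u * of_real (k u))"
    unfolding sum_distrib_right[symmetric] gap ..
  finally show ?thesis unfolding k_def .
qed

lemma MISE_iid_nonneg: "0 \<le> MISE_iid f K h n"
  unfolding MISE_iid_def by (intro Bochner_Integration.integral_nonneg) auto

end

section \<open>Negligible terms\<close>

text \<open>
  \<open>p\<close> may be of any order relative to \<open>v\<close>: the error \<open>x - p - v\<close> is small against \<open>v\<close>, and adding \<open>p \<ge> 0\<close> to the
  denominator only diminishes the relative error.
\<close>

lemma ratio_tendsto_1:
  fixes x p v w :: "nat \<Rightarrow> real"
  assumes w: "eventually (\<lambda>n. w n > 0) sequentially" and p: "\<And>n. p n \<ge> 0"
    and xp: "(\<lambda>n. (x n - p n) * w n) \<longlonglongrightarrow> c" and v: "(\<lambda>n. v n * w n) \<longlonglongrightarrow> c" and c: "c > 0"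
  shows "(\<lambda>n. x n / (p n + v n)) \<longlonglongrightarrow> 1"
proof -
  have d: "(\<lambda>n. (x n - p n) * w n - v n * w n) \<longlonglongrightarrow> 0" using tendsto_diff[OF xp v] by simp
  have q: "(\<lambda>n. \<bar>(x n - p n) * w n - v n * w n\<bar> / (v n * w n)) \<longlonglongrightarrow> 0"
    using tendsto_divide[OF tendsto_rabs[OF d] v] c by simp
  have vw: "eventually (\<lambda>n. v n * w n > 0) sequentially" using order_tendstoD(1)[OF v c] .
  have "(\<lambda>n. x n / (p n + v n) - 1) \<longlonglongrightarrow> 0"
  proof (rule Lim_null_comparison[OF _ q])
    show "eventually (\<lambda>n. norm (x n / (p n + v n) - 1) \<le> \<bar>(x n - p n) * w n - v n * w n\<bar> / (v n * w n)) sequentially"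
      using w vw
    proof eventually_elim
      fix n assume w: "w n > 0" and vw: "v n * w n > 0"
      have v: "v n > 0" using w vw by (simp add: zero_less_mult_iff)
      have s: "p n + v n > 0" using v p[of n] by simp
      have "x n / (p n + v n) - 1 = ((x n - p n) * w n - v n * w n) / ((p n + v n) * w n)"
      proof -
        have "(x n - p n) * w n - v n * w n = (x n - (p n + v n)) * w n" by (simp add: algebra_simps)
        then show ?thesis using s w by (simp add: diff_divide_distrib)
      qed
      then have "norm (x n / (p n + v n) - 1) = \<bar>(x n - p n) * w n - v n * w n\<bar> / ((p n + v n) * w n)"
        using s w by (simp add: abs_mult)
      also have "\<dots> \<le> \<bar>(x n - p n) * w n - v n * w n\<bar> / (v n * w n)"
        using vw w p[of n] s by (intro divide_left_mono mult_right_mono) auto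
      finally show "norm (x n / (p n + v n) - 1) \<le> \<bar>(x n - p n) * w n - v n * w n\<bar> / (v n * w n)" .
    qed
  qed
  then have "(\<lambda>n. (x n / (p n + v n) - 1) + 1) \<longlonglongrightarrow> 0 + 1" by (intro tendsto_add tendsto_const)
  then show ?thesis by simp
qed

context noise_process
begin

lemma tail_bounds: "0 \<le> tail l" "tail l \<le> nf.S"
proof -
  have s: "summable (\<lambda>q. (b (q + l))\<^sup>2)" using nf.b_sq by (simp add: summable_iff_shift[of "\<lambda>q. (b q)\<^sup>2"])
  show "0 \<le> tail l" unfolding tail_def by (rule suminf_nonneg[OF s]) simp
  have "tail l = (\<Sum>q. (b q)\<^sup>2) - (\<Sum>q<l. (b q)\<^sup>2)"
    unfolding tail_def using suminf_minus_initial_segment[OF nf.b_sq] by simp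
  then show "tail l \<le> nf.S" unfolding nf.S_def using sum_nonneg[of "{..<l}" "\<lambda>q. (b q)\<^sup>2"] by simp
qed

text \<open>
  Arithmetic-geometric mean inequality with a weight that balances the total mass of \<open>b\<^sup>2\<close> against its tail.
\<close>

lemma rho_le: assumes c: "c > 0" shows "\<bar>rho b l\<bar> \<le> c * nf.S + tail l / c"
proof -
  have s: "summable (\<lambda>q. (b (q + l))\<^sup>2)" using nf.b_sq by (simp add: summable_iff_shift[of "\<lambda>q. (b q)\<^sup>2"])
  note ab = summable_prod_l2[OF nf.b_sq s]
  have "\<bar>rho b l\<bar> \<le> (\<Sum>q. \<bar>b q * b (q + l)\<bar>)" unfolding rho_def by (rule summable_rabs[OF ab(1)])
  also have "\<dots> \<le> (\<Sum>q. c * (b q)\<^sup>2 + (b (q + l))\<^sup>2 / c)"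
  proof (rule suminf_le[OF _ ab(1)])
    fix q
    have "2 * \<bar>b q * b (q + l)\<bar> = 2 * (\<bar>sqrt c * b q\<bar> * \<bar>b (q + l) / sqrt c\<bar>)" using c by (simp add: abs_mult)
    also have "\<dots> \<le> \<bar>sqrt c * b q\<bar>\<^sup>2 + \<bar>b (q + l) / sqrt c\<bar>\<^sup>2"
      using sum_squares_bound[of "\<bar>sqrt c * b q\<bar>" "\<bar>b (q + l) / sqrt c\<bar>"] by simp
    also have "\<dots> = c * (b q)\<^sup>2 + (b (q + l))\<^sup>2 / c" using c by (simp add: power_mult_distrib power_divide)
    finally show "\<bar>b q * b (q + l)\<bar> \<le> c * (b q)\<^sup>2 + (b (q + l))\<^sup>2 / c" by simp
  next
    show "summable (\<lambda>q. c * (b q)\<^sup>2 + (b (q + l))\<^sup>2 / c)" by (intro summable_add summable_mult summable_divide nf.b_sq s)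
  qed
  also have "\<dots> = c * (\<Sum>q. (b q)\<^sup>2) + tail l / c"
    unfolding tail_def
    by (subst suminf_add[symmetric]) (simp_all add: suminf_mult suminf_divide summable_mult summable_divide nf.b_sq s)
  also have "\<dots> \<le> c * nf.S + tail l / c" unfolding nf.S_def using c by simp
  finally show ?thesis .
qed

lemma rho_small: assumes e: "e > 0" shows "\<exists>l0. \<forall>l>l0. \<bar>rho b l\<bar> \<le> e"
proof -
  define c where "c = e / (2 * nf.S)"
  have S: "nf.S > 0" using nf.S_ge1 by simp
  have c: "c > 0" unfolding c_def using e S by simp
  have "eventually (\<lambda>l. tail l < c * (e / 2)) sequentially"
    using order_tendstoD(2)[OF tail_tendsto, of "c * (e / 2)"] c e by simp
  then obtain l0 where l0: "\<forall>l\<ge>l0. tail l < c * (e / 2)" unfolding eventually_sequentially by blast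
  have "\<bar>rho b l\<bar> \<le> e" if "l > l0" for l
  proof -
    have "tail l / c \<le> e / 2" using l0 that c by (simp add: divide_le_eq mult.commute less_imp_le)
    moreover have "c * nf.S = e / 2" unfolding c_def using S by simp
    ultimately show ?thesis using rho_le[OF c, of l] by linarith
  qed
  then show ?thesis by blast
qed

lemma rho_bounded: "\<bar>rho b l\<bar> \<le> 2 * nf.S"
  using rho_le[of 1 l] tail_bounds[of l] by simp

definition "remainder \<eta> n = real n / \<eta> + Tn b n + (\<Sum>i<n. \<Sum>j<n. \<eta> * (rho b (lag i j))\<^sup>2 + \<bar>rho b (lag i j)\<bar> ^ 3)"

text \<open>
  The quadratic part is small by the choice of \<open>\<eta>\<close>. The cubic part is small at large lags because \<open>\<rho>\<close> tends to 0, while the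
  small lags contribute \<open>O(n)\<close>; only then is \<open>n\<close> sent to infinity with \<open>\<eta>\<close> fixed.
\<close>

lemma remainder_negligible:
  assumes n: "(\<lambda>n. real n / Wn b n) \<longlonglongrightarrow> 0" and T: "(\<lambda>n. Tn b n / Wn b n) \<longlonglongrightarrow> 0"
    and W: "eventually (\<lambda>n. Wn b n > 0) sequentially" and e: "e > 0"
  shows "\<exists>\<eta>. 0 < \<eta> \<and> \<eta> \<le> 1 \<and> eventually (\<lambda>n. remainder \<eta> n \<le> e * Wn b n) sequentially"
proof -
  define \<eta> where "\<eta> = min 1 (e / 4)"
  have \<eta>: "0 < \<eta>" "\<eta> \<le> 1" "\<eta> \<le> e / 4" unfolding \<eta>_def using e by auto
  have e4: "e / 4 > 0" using e by simp
  obtain l0 where l0: "\<forall>l>l0. \<bar>rho b l\<bar> \<le> e / 4" using rho_small[OF e4] by blast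
  define H where "H = (2 * nf.S) ^ 3"
  have H: "0 \<le> H" unfolding H_def using nf.S_ge1 by simp
  define L where "L = 1 / \<eta> + (2 * real l0 + 1) * H"
  have pt: "\<eta> * (rho b l)\<^sup>2 + \<bar>rho b l\<bar> ^ 3 \<le> e / 2 * (rho b l)\<^sup>2 + (if l > l0 then 0 else H)" for l
  proof -
    have 1: "\<eta> * (rho b l)\<^sup>2 \<le> e / 4 * (rho b l)\<^sup>2" using \<eta> by (intro mult_right_mono) auto
    have 2: "\<bar>rho b l\<bar> ^ 3 \<le> e / 4 * (rho b l)\<^sup>2 + (if l > l0 then 0 else H)"
    proof (cases "l > l0")
      case True
      have "\<bar>rho b l\<bar> * \<bar>rho b l\<bar>\<^sup>2 \<le> e / 4 * \<bar>rho b l\<bar>\<^sup>2" using l0 True by (intro mult_right_mono) auto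
      then show ?thesis using True by (simp add: power3_eq_cube power2_eq_square)
    next
      case False
      have "\<bar>rho b l\<bar> ^ 3 \<le> H" unfolding H_def using rho_bounded by (intro power_mono) auto
      moreover have "0 \<le> e / 4 * (rho b l)\<^sup>2" using e by simp
      ultimately show ?thesis using False by simp
    qed
    show ?thesis using 1 2 by (simp add: field_simps)
  qed
  have bound: "remainder \<eta> n \<le> e / 2 * Wn b n + L * real n + Tn b n" for n
  proof -
    have "(\<Sum>i<n. \<Sum>j<n. \<eta> * (rho b (lag i j))\<^sup>2 + \<bar>rho b (lag i j)\<bar> ^ 3) \<le> (\<Sum>i<n. \<Sum>j<n. e / 2 * (rho b (lag i j))\<^sup>2 + (if lag i j > l0 then 0 else H))"
      by (intro sum_mono pt)
    also have "\<dots> = e / 2 * Wn b n + (\<Sum>i<n. \<Sum>j<n. if lag i j > l0 then 0 else H)"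
      unfolding Wn_def by (simp only: sum.distrib sum_distrib_left)
    also have "\<dots> \<le> e / 2 * Wn b n + real n * (2 * real l0 + 1) * H" using small_lag_sum_real[OF H] by simp
    finally show ?thesis unfolding remainder_def L_def by (simp add: algebra_simps)
  qed
  have "(\<lambda>n. L * (real n / Wn b n) + Tn b n / Wn b n) \<longlonglongrightarrow> L * 0 + 0" by (intro tendsto_intros n T)
  then have "eventually (\<lambda>n. L * (real n / Wn b n) + Tn b n / Wn b n < e / 2) sequentially"
    by (rule order_tendstoD(2)) (use e in simp)
  then have "eventually (\<lambda>n. remainder \<eta> n \<le> e * Wn b n) sequentially"
    using W
  proof eventually_elim
    fix n assume a: "L * (real n / Wn b n) + Tn b n / Wn b n < e / 2" and W: "Wn b n > 0"
    have "L * (real n / Wn b n) + Tn b n / Wn b n = (L * real n + Tn b n) / Wn b n" by (simp add: add_divide_distrib)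
    then have "L * real n + Tn b n \<le> e / 2 * Wn b n" using a W by (simp add: pos_divide_less_eq)
    then show "remainder \<eta> n \<le> e * Wn b n" using bound[of n] by (simp add: field_simps)
  qed
  then show ?thesis using \<eta> by blast
qed

end

context smoothed_process
begin

text \<open>
  \<open>covariance_expansion\<close> leaves out the lags from 1 to \<open>k0\<close>. Each row has at most \<open>2 * k0 + 1\<close> of them and their
  characteristic functions are integrable uniformly, so they contribute \<open>O(n)\<close>, which is part of the remainder.
\<close>

lemma gap_expansion:
  "\<exists>C\<ge>0. \<forall>n u \<eta>. 0 < \<eta> \<longrightarrow> \<eta> \<le> 1 \<longrightarrow>
     norm (gap n u - of_real (nf.s2\<^sup>2 / 2 * u ^ 4 * Wn b n) * (ch u * cnj (ch u))) \<le> C / (1 + \<bar>u\<bar>)\<^sup>2 * remainder \<eta> n"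
proof -
  obtain k0 C where C: "C \<ge> 0" and main: "\<forall>n u \<eta>. 0 < \<eta> \<longrightarrow> \<eta> \<le> 1 \<longrightarrow>
     norm ((\<Sum>i<n. \<Sum>j<n. if lag i j > k0 then \<Psi> (int n - int i) (int n - int j) u - ch u * cnj (ch u) else 0)
       - of_real (nf.s2\<^sup>2 / 2 * u ^ 4 * Wn b n) * (ch u * cnj (ch u)))
     \<le> C / (1 + \<bar>u\<bar>)\<^sup>2 * remainder \<eta> n"
    unfolding remainder_def using covariance_expansion by (elim exE conjE)
  have "\<forall>l. \<exists>D. l \<ge> 1 \<longrightarrow> D > 0 \<and> (\<forall>s t u. \<bar>s - t\<bar> = int l \<longrightarrow> norm (\<Psi> s t u) \<le> D / (1 + \<bar>u\<bar>)\<^sup>2)"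
    using Psi_decay_lag by blast
  then obtain D where D: "\<forall>l. l \<ge> 1 \<longrightarrow> D l > 0 \<and> (\<forall>s t u. \<bar>s - t\<bar> = int l \<longrightarrow> norm (\<Psi> s t u) \<le> D l / (1 + \<bar>u\<bar>)\<^sup>2)"
    unfolding choice_iff by (elim exE)
  obtain E where E: "\<forall>u. \<bar>u\<bar> ^ 0 * norm (ch u) \<le> E / (1 + \<bar>u\<bar>)\<^sup>2" using ch_moment[of 0] by auto
  have E0: "0 \<le> E" using order_trans[OF _ E[rule_format, of 0]] by simp
  define D1 where "D1 = (\<Sum>l\<in>{1..k0}. D l) + E"
  have D10: "0 \<le> D1" unfolding D1_def using D E0 by (intro add_nonneg_nonneg sum_nonneg) (auto intro: less_imp_le)
  have small: "norm (\<Psi> (int n - int i) (int n - int j) u - ch u * cnj (ch u)) \<le> D1 / (1 + \<bar>u\<bar>)\<^sup>2"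
    if l: "lag i j > 0" "\<not> lag i j > k0" for n i j u
  proof -
    have U: "0 < (1 + \<bar>u\<bar>)\<^sup>2" by (rule zero_less_power) simp
    have "norm (\<Psi> (int n - int i) (int n - int j) u) \<le> D (lag i j) / (1 + \<bar>u\<bar>)\<^sup>2"
      using D[rule_format, of "lag i j"] l(1) lag_process[of n i j] by simp
    moreover have "D (lag i j) \<le> (\<Sum>l\<in>{1..k0}. D l)"
      by (rule member_le_sum) (use l D in \<open>auto intro: less_imp_le\<close>)
    moreover have "norm (ch u * cnj (ch u)) \<le> E / (1 + \<bar>u\<bar>)\<^sup>2"
      using mult_mono[OF ch_le[of u] E[rule_format, of u]] by (simp add: norm_mult)
    ultimately have "norm (\<Psi> (int n - int i) (int n - int j) u) + norm (ch u * cnj (ch u)) \<le> (\<Sum>l\<in>{1..k0}. D l) / (1 + \<bar>u\<bar>)\<^sup>2 + E / (1 + \<bar>u\<bar>)\<^sup>2"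
      using divide_right_mono[of "D (lag i j)" "\<Sum>l\<in>{1..k0}. D l" "(1 + \<bar>u\<bar>)\<^sup>2"] by fastforce
    then show ?thesis unfolding D1_def add_divide_distrib using norm_triangle_ineq4 order_trans by blast
  qed
  define C' where "C' = C + (2 * real k0 + 1) * D1"
  show ?thesis
  proof (intro exI[of _ C'] conjI allI impI)
    show "0 \<le> C'" unfolding C'_def using C D10 by simp
    fix n u and \<eta> :: real assume \<eta>: "0 < \<eta>" "\<eta> \<le> 1"
    define Z where "Z i j = \<Psi> (int n - int i) (int n - int j) u - ch u * cnj (ch u)" for i j
    define far where "far = (\<Sum>i<n. \<Sum>j<n. if lag i j > k0 then Z i j else 0)"
    define near where "near = (\<Sum>i<n. \<Sum>j<n. if lag i j > k0 then 0 else if lag i j > 0 then Z i j else 0)"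
    define lead where "lead = of_real (nf.s2\<^sup>2 / 2 * u ^ 4 * Wn b n) * (ch u * cnj (ch u))"
    have U: "0 < (1 + \<bar>u\<bar>)\<^sup>2" by (rule zero_less_power) simp
    have g: "gap n u = far + near"
      unfolding gap_def far_def near_def Z_def[symmetric] sum.distrib[symmetric] by (intro sum.cong refl) auto
    have "norm near \<le> real n * (2 * real k0 + 1) * (D1 / (1 + \<bar>u\<bar>)\<^sup>2)"
    proof -
      have "norm near \<le> (\<Sum>i<n. \<Sum>j<n. if lag i j > k0 then 0 else D1 / (1 + \<bar>u\<bar>)\<^sup>2)"
        unfolding near_def Z_def using small D10 U by (intro order_trans[OF norm_sum] sum_mono) auto
      also have "\<dots> \<le> real n * (2 * real k0 + 1) * (D1 / (1 + \<bar>u\<bar>)\<^sup>2)"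
        by (rule small_lag_sum_real) (use D10 U in simp)
      finally show ?thesis .
    qed
    also have "\<dots> = (2 * real k0 + 1) * D1 / (1 + \<bar>u\<bar>)\<^sup>2 * real n" by simp
    also have "\<dots> \<le> (2 * real k0 + 1) * D1 / (1 + \<bar>u\<bar>)\<^sup>2 * remainder \<eta> n"
    proof (rule mult_left_mono)
      have "real n * 1 \<le> real n * (1 / \<eta>)" using \<eta> by (intro mult_left_mono) auto
      moreover have "0 \<le> Tn b n" by (rule sums_le[OF _ sums_zero Tn_sums[OF nf.b_sq]]) simp
      moreover have "0 \<le> (\<Sum>i<n. \<Sum>j<n. \<eta> * (rho b (lag i j))\<^sup>2 + \<bar>rho b (lag i j)\<bar> ^ 3)"
        using \<eta> by (intro sum_nonneg add_nonneg_nonneg mult_nonneg_nonneg) auto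
      ultimately show "real n \<le> remainder \<eta> n" unfolding remainder_def by simp
    qed (use D10 U in simp)
    finally have near: "norm near \<le> (2 * real k0 + 1) * D1 / (1 + \<bar>u\<bar>)\<^sup>2 * remainder \<eta> n" .
    have far: "norm (far - lead) \<le> C / (1 + \<bar>u\<bar>)\<^sup>2 * remainder \<eta> n"
      unfolding far_def Z_def lead_def by (rule main[rule_format, OF \<eta>])
    have e: "gap n u - lead = (far - lead) + near" unfolding g by simp
    have "norm (gap n u - lead) \<le> C / (1 + \<bar>u\<bar>)\<^sup>2 * remainder \<eta> n + (2 * real k0 + 1) * D1 / (1 + \<bar>u\<bar>)\<^sup>2 * remainder \<eta> n"
      unfolding e by (rule order_trans[OF norm_triangle_ineq add_mono[OF far near]])
    also have "\<dots> = C' / (1 + \<bar>u\<bar>)\<^sup>2 * remainder \<eta> n" unfolding C'_def add_divide_distrib distrib_right ..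
    finally show "norm (gap n u - of_real (nf.s2\<^sup>2 / 2 * u ^ 4 * Wn b n) * (ch u * cnj (ch u))) \<le> C' / (1 + \<bar>u\<bar>)\<^sup>2 * remainder \<eta> n"
      unfolding lead_def .
  qed
qed

definition "smoothed_curv h = (LINT u|lborel. u ^ 4 * (norm (ch u))\<^sup>2 * (norm (kh (u * h)))\<^sup>2)"

lemma smoothed_curv_tendsto:
  assumes "bw \<longlonglongrightarrow> 0" shows "(\<lambda>n. smoothed_curv (bw n)) \<longlonglongrightarrow> curv"
  unfolding smoothed_curv_def curv_def
proof (rule integral_dominated_convergence[where w = "\<lambda>u. u ^ 4 * (norm (ch u))\<^sup>2"])
  show "integrable lborel (\<lambda>u. u ^ 4 * (norm (ch u))\<^sup>2)" by (rule curv_int)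
  show "AE u in lborel. (\<lambda>n. u ^ 4 * (norm (ch u))\<^sup>2 * (norm (kh (u * bw n)))\<^sup>2) \<longlonglongrightarrow> u ^ 4 * (norm (ch u))\<^sup>2"
  proof (rule AE_I2)
    fix u
    have "(\<lambda>n. u * bw n) \<longlonglongrightarrow> u * 0" using assms by (rule tendsto_mult_left)
    then have "(\<lambda>n. kh (u * bw n)) \<longlonglongrightarrow> kh 0" using isCont_tendsto_compose[OF kh_isCont[of 0]] by simp
    then have "(\<lambda>n. u ^ 4 * (norm (ch u))\<^sup>2 * (norm (kh (u * bw n)))\<^sup>2) \<longlonglongrightarrow> u ^ 4 * (norm (ch u))\<^sup>2 * (norm (kh 0))\<^sup>2"
      by (intro tendsto_intros)
    then show "(\<lambda>n. u ^ 4 * (norm (ch u))\<^sup>2 * (norm (kh (u * bw n)))\<^sup>2) \<longlonglongrightarrow> u ^ 4 * (norm (ch u))\<^sup>2" by (simp add: kh_0)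
  qed
  show "AE u in lborel. norm (u ^ 4 * (norm (ch u))\<^sup>2 * (norm (kh (u * bw n)))\<^sup>2) \<le> u ^ 4 * (norm (ch u))\<^sup>2" for n
  proof (rule AE_I2)
    fix u
    have "(u ^ 4 * (norm (ch u))\<^sup>2) * (norm (kh (u * bw n)))\<^sup>2 \<le> (u ^ 4 * (norm (ch u))\<^sup>2) * 1"
      using kh_le by (intro mult_left_mono power_le_one) auto
    then show "norm (u ^ 4 * (norm (ch u))\<^sup>2 * (norm (kh (u * bw n)))\<^sup>2) \<le> u ^ 4 * (norm (ch u))\<^sup>2" by simp
  qed
qed measurable

lemma gap_integral_expansion:
  "\<exists>C\<ge>0. \<forall>n \<eta> h. 0 < \<eta> \<longrightarrow> \<eta> \<le> 1 \<longrightarrow>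
     norm ((LINT u|lborel. gap n u * of_real ((norm (kh (u * h)))\<^sup>2)) - of_real (nf.s2\<^sup>2 / 2 * Wn b n * smoothed_curv h)) \<le> C * remainder \<eta> n"
proof -
  obtain C where C: "C \<ge> 0" and main: "\<forall>n u \<eta>. 0 < \<eta> \<longrightarrow> \<eta> \<le> 1 \<longrightarrow>
     norm (gap n u - of_real (nf.s2\<^sup>2 / 2 * u ^ 4 * Wn b n) * (ch u * cnj (ch u))) \<le> C / (1 + \<bar>u\<bar>)\<^sup>2 * remainder \<eta> n"
    using gap_expansion by (elim exE conjE)
  define J where "J = (LINT u|lborel. 1 / (1 + \<bar>u::real\<bar>)\<^sup>2)"
  have J: "0 \<le> J" unfolding J_def by (rule Bochner_Integration.integral_nonneg) simp
  show ?thesis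
  proof (intro exI[of _ "C * J"] conjI allI impI)
    show "0 \<le> C * J" using C J by simp
    fix n h and \<eta> :: real assume \<eta>: "0 < \<eta>" "\<eta> \<le> 1"
    define k where "k u = (norm (kh (u * h)))\<^sup>2" for u
    have k: "0 \<le> k u" "k u \<le> 1" for u unfolding k_def using kh_le by (auto intro: power_le_one)
    define lead where "lead u = complex_of_real (nf.s2\<^sup>2 / 2 * u ^ 4 * Wn b n) * (ch u * cnj (ch u))" for u
    have lr: "lead u * of_real (k u) = complex_of_real (nf.s2\<^sup>2 / 2 * Wn b n * (u ^ 4 * (norm (ch u))\<^sup>2 * (norm (kh (u * h)))\<^sup>2))" for u
      unfolding lead_def k_def complex_norm_square[symmetric] of_real_mult[symmetric] by (simp add: mult_ac)
    have cint: "integrable lborel (\<lambda>u. u ^ 4 * (norm (ch u))\<^sup>2 * (norm (kh (u * h)))\<^sup>2)"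
    proof (rule Bochner_Integration.integrable_bound[OF curv_int])
      show "AE u in lborel. norm (u ^ 4 * (norm (ch u))\<^sup>2 * (norm (kh (u * h)))\<^sup>2) \<le> norm (u ^ 4 * (norm (ch u))\<^sup>2)"
      proof (rule AE_I2)
        fix u
        have "(u ^ 4 * (norm (ch u))\<^sup>2) * k u \<le> (u ^ 4 * (norm (ch u))\<^sup>2) * 1" using k by (intro mult_left_mono) auto
        then show "norm (u ^ 4 * (norm (ch u))\<^sup>2 * (norm (kh (u * h)))\<^sup>2) \<le> norm (u ^ 4 * (norm (ch u))\<^sup>2)" by (simp add: k_def)
      qed
    qed measurable
    have li: "integrable lborel (\<lambda>u. lead u * of_real (k u))"
      unfolding lr by (intro integrable_of_real integrable_mult_right cint)
    have lv: "(LINT u|lborel. lead u * of_real (k u)) = of_real (nf.s2\<^sup>2 / 2 * Wn b n * smoothed_curv h)"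
      unfolding lr smoothed_curv_def by (simp only: integral_complex_of_real integral_mult_right_zero)
    have gm: "gap n \<in> borel_measurable borel"
      unfolding gap_def[abs_def]
    proof (intro borel_measurable_sum)
      fix i j
      show "(\<lambda>u. if lag i j > 0 then \<Psi> (int n - int i) (int n - int j) u - ch u * cnj (ch u) else 0) \<in> borel_measurable borel"
        by (cases "lag i j > 0") simp_all
    qed
    have le: "norm ((gap n u - lead u) * of_real (k u)) \<le> C * remainder \<eta> n * (1 / (1 + \<bar>u\<bar>)\<^sup>2)" for u
    proof -
      have "norm ((gap n u - lead u) * of_real (k u)) = norm (gap n u - lead u) * k u" using k(1) by (simp add: norm_mult)
      also have "\<dots> \<le> norm (gap n u - lead u) * 1" using k(2) by (intro mult_left_mono) auto
      also have "\<dots> \<le> C / (1 + \<bar>u\<bar>)\<^sup>2 * remainder \<eta> n" unfolding lead_def using main[rule_format, OF \<eta>] by simp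
      finally show ?thesis by simp
    qed
    have km: "k \<in> borel_measurable borel" unfolding k_def[abs_def] by measurable
    have lm: "lead \<in> borel_measurable borel" unfolding lead_def[abs_def] by measurable
    have m: "(\<lambda>u. (gap n u - lead u) * of_real (k u)) \<in> borel_measurable lborel" using gm km lm by simp
    note d = norm_integral_le_bound[OF m integrable_mult_right[OF integrable_inverse_square_growth] le]
    have "(LINT u|lborel. gap n u * of_real (k u)) = (LINT u|lborel. (gap n u - lead u) * of_real (k u) + lead u * of_real (k u))"
      by (simp add: algebra_simps)
    also have "\<dots> = (LINT u|lborel. (gap n u - lead u) * of_real (k u)) + (LINT u|lborel. lead u * of_real (k u))"
      by (rule Bochner_Integration.integral_add[OF d(1) li])
    finally have e: "(LINT u|lborel. gap n u * of_real (k u)) - of_real (nf.s2\<^sup>2 / 2 * Wn b n * smoothed_curv h) = (LINT u|lborel. (gap n u - lead u) * of_real (k u))"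
      unfolding lv by simp
    have "norm (LINT u|lborel. (gap n u - lead u) * of_real (k u)) \<le> C * remainder \<eta> n * J"
      using d(2) unfolding J_def integral_mult_right_zero .
    then show "norm ((LINT u|lborel. gap n u * of_real ((norm (kh (u * h)))\<^sup>2)) - of_real (nf.s2\<^sup>2 / 2 * Wn b n * smoothed_curv h)) \<le> C * J * remainder \<eta> n"
      unfolding k_def[symmetric] e by (simp add: mult_ac)
  qed
qed

end

section \<open>Asymptotic equivalence\<close>

lemma Wn_linear_if_finite_support:
  assumes fin: "finite {q. b q \<noteq> 0}"
  shows "\<exists>C\<ge>0. \<forall>n. Wn b n \<le> C * real n"
proof -
  obtain L where L: "\<forall>q\<in>{q. b q \<noteq> 0}. q \<le> L" using fin unfolding finite_nat_set_iff_bounded_le by blast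
  have z: "rho b l = 0" if "l > L" for l
  proof -
    have "b (q + l) = 0" for q
    proof (rule ccontr)
      assume "b (q + l) \<noteq> 0"
      then have "q + l \<le> L" using L by blast
      then show False using that by simp
    qed
    then show ?thesis unfolding rho_def by simp
  qed
  define H where "H = (\<Sum>l\<le>L. (rho b l)\<^sup>2)"
  have H: "0 \<le> H" unfolding H_def by (intro sum_nonneg) simp
  have le: "(rho b l)\<^sup>2 \<le> (if l > L then 0 else H)" for l
  proof (cases "l > L")
    case False
    have "(rho b l)\<^sup>2 \<le> H" unfolding H_def by (rule member_le_sum) (use False in auto)
    then show ?thesis using False by simp
  qed (simp add: z)
  have "Wn b n \<le> (2 * real L + 1) * H * real n" for n
  proof -
    have "Wn b n \<le> (\<Sum>i<n. \<Sum>j<n. if lag i j > L then 0 else H)" unfolding Wn_def by (intro sum_mono le)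
    also have "\<dots> \<le> real n * (2 * real L + 1) * H" by (rule small_lag_sum_real[OF H])
    finally show ?thesis by (simp add: mult_ac)
  qed
  then show ?thesis using H by (intro exI[of _ "(2 * real L + 1) * H"]) auto
qed

text \<open>
  A moving average of finite order has only finitely many nonzero autocovariances, and \<open>Wn\<close> grows linearly. Thus the growth of \<open>Wn\<close>
  itself guarantees the infinitely many coefficients from which the decay of the characteristic functions is drawn.
\<close>

lemma infinite_support_if_Wn_superlinear:
  assumes n: "(\<lambda>n. real n / Wn b n) \<longlonglongrightarrow> 0" and W: "eventually (\<lambda>n. Wn b n > 0) sequentially"
  shows "infinite {q. b q \<noteq> 0}"
proof
  assume "finite {q. b q \<noteq> 0}"
  then obtain C where C: "C \<ge> 0" "\<forall>n. Wn b n \<le> C * real n" using Wn_linear_if_finite_support by blast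
  have "eventually (\<lambda>n. real n / Wn b n < 1 / (C + 1)) sequentially"
    by (rule order_tendstoD(2)[OF n]) (use C in simp)
  then have "eventually (\<lambda>n. False) sequentially"
    using W eventually_gt_at_top[of 0]
  proof eventually_elim
    fix n :: nat assume 1: "real n / Wn b n < 1 / (C + 1)" and W: "Wn b n > 0" and n0: "0 < n"
    have "real n * (C + 1) < Wn b n" using 1 W C(1) by (simp add: field_simps)
    also have "\<dots> \<le> C * real n" using C(2) by blast
    finally show False using n0 by (simp add: algebra_simps)
  qed
  then show False by simp
qed

context smoothed_process
begin

text \<open>
  The remainder is at most an arbitrarily small multiple of \<open>Wn\<close>, and the smoothed integral converges to the unsmoothed one as
  the bandwidth tends to 0.
\<close>

lemma MISE_increment_tendsto:
  assumes n: "(\<lambda>n. real n / Wn b n) \<longlonglongrightarrow> 0" and T: "(\<lambda>n. Tn b n / Wn b n) \<longlonglongrightarrow> 0"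
    and W: "eventually (\<lambda>n. Wn b n > 0) sequentially"
    and bw: "bw \<longlonglongrightarrow> 0" "eventually (\<lambda>n. bw n > 0) sequentially"
  shows "(\<lambda>n. (MISE M X f K (bw n) n - MISE_iid f K (bw n) n) * ((real n)\<^sup>2 / Wn b n)) \<longlonglongrightarrow> nf.s2\<^sup>2 * curv / (4 * pi)"
proof -
  obtain C where C: "C \<ge> 0" and main: "\<forall>n \<eta> h. 0 < \<eta> \<longrightarrow> \<eta> \<le> 1 \<longrightarrow>
     norm ((LINT u|lborel. gap n u * of_real ((norm (kh (u * h)))\<^sup>2)) - of_real (nf.s2\<^sup>2 / 2 * Wn b n * smoothed_curv h)) \<le> C * remainder \<eta> n"
    using gap_integral_expansion by (elim exE conjE)
  define d where "d n = 2 * pi * (real n)\<^sup>2 * (MISE M X f K (bw n) n - MISE_iid f K (bw n) n)" for n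
  define s where "s n = nf.s2\<^sup>2 / 2 * smoothed_curv (bw n)" for n
  have z: "(\<lambda>n. d n / Wn b n - s n) \<longlonglongrightarrow> 0"
  proof (rule tendstoI)
    fix e :: real assume e: "e > 0"
    have e': "e / (C + 1) > 0" using e C by simp
    obtain \<eta> where \<eta>: "0 < \<eta>" "\<eta> \<le> 1" and ev: "eventually (\<lambda>n. remainder \<eta> n \<le> e / (C + 1) * Wn b n) sequentially"
      using remainder_negligible[OF n T W e'] by blast
    show "eventually (\<lambda>n. dist (d n / Wn b n - s n) 0 < e) sequentially"
      using ev W bw(2) eventually_ge_at_top[of 1]
    proof eventually_elim
      fix n :: nat assume r: "remainder \<eta> n \<le> e / (C + 1) * Wn b n" and W: "Wn b n > 0" and h: "bw n > 0" and n1: "1 \<le> n"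
      have "\<bar>d n - s n * Wn b n\<bar> = norm (complex_of_real (d n) - of_real (nf.s2\<^sup>2 / 2 * Wn b n * smoothed_curv (bw n)))"
        unfolding s_def of_real_diff[symmetric] norm_of_real by (simp add: mult_ac)
      also have "\<dots> \<le> C * remainder \<eta> n"
        unfolding d_def MISE_difference[OF h n1] by (rule main[rule_format, OF \<eta>])
      also have "\<dots> \<le> C * (e / (C + 1) * Wn b n)" using r C by (rule mult_left_mono)
      finally have 1: "\<bar>d n - s n * Wn b n\<bar> \<le> (C * e / (C + 1)) * Wn b n" by simp
      have "\<bar>d n / Wn b n - s n\<bar> = \<bar>(d n - s n * Wn b n) / Wn b n\<bar>" using W by (simp add: diff_divide_distrib)
      also have "\<dots> = \<bar>d n - s n * Wn b n\<bar> / Wn b n" using W by simp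
      also have "\<dots> \<le> C * e / (C + 1)" using 1 W by (simp add: pos_divide_le_eq)
      also have "\<dots> < e" using C e by (simp add: field_simps)
      finally show "dist (d n / Wn b n - s n) 0 < e" by (simp add: dist_real_def)
    qed
  qed
  have "s \<longlonglongrightarrow> nf.s2\<^sup>2 / 2 * curv" unfolding s_def[abs_def] by (intro tendsto_intros smoothed_curv_tendsto bw(1))
  then have "(\<lambda>n. ((d n / Wn b n - s n) + s n) / (2 * pi)) \<longlonglongrightarrow> (0 + nf.s2\<^sup>2 / 2 * curv) / (2 * pi)"
    by (intro tendsto_divide tendsto_add z tendsto_const) auto
  moreover have "((d n / Wn b n - s n) + s n) / (2 * pi) = (MISE M X f K (bw n) n - MISE_iid f K (bw n) n) * ((real n)\<^sup>2 / Wn b n)" for n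
    unfolding d_def by simp
  ultimately show ?thesis by (simp add: field_simps)
qed

lemma variance_tendsto:
  assumes n: "(\<lambda>n. real n / Wn b n) \<longlonglongrightarrow> 0" and W: "eventually (\<lambda>n. Wn b n > 0) sequentially"
  shows "(\<lambda>n. variance (\<lambda>\<omega>. 1 / real n * (\<Sum>j=1..n. ((X (int j) \<omega>)\<^sup>2 - expectation (\<lambda>\<omega>'. (X 1 \<omega>')\<^sup>2)))) * ((real n)\<^sup>2 / Wn b n))
    \<longlonglongrightarrow> 2 * nf.s2\<^sup>2"
proof -
  define V where "V n = variance (\<lambda>\<omega>. 1 / real n * (\<Sum>j=1..n. ((X (int j) \<omega>)\<^sup>2 - expectation (\<lambda>\<omega>'. (X 1 \<omega>')\<^sup>2))))" for n
  obtain C where C: "C \<ge> 0" "\<forall>n\<ge>1. \<bar>(real n)\<^sup>2 * V n - 2 * nf.s2\<^sup>2 * Wn b n\<bar> \<le> C * real n"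
    using variance_expansion unfolding V_def by blast
  have "(\<lambda>n. V n * ((real n)\<^sup>2 / Wn b n) - 2 * nf.s2\<^sup>2) \<longlonglongrightarrow> 0"
  proof (rule Lim_null_comparison)
    have "(\<lambda>n. C * (real n / Wn b n)) \<longlonglongrightarrow> C * 0" by (intro tendsto_intros n)
    then show "(\<lambda>n. C * (real n / Wn b n)) \<longlonglongrightarrow> 0" by simp
    show "eventually (\<lambda>n. norm (V n * ((real n)\<^sup>2 / Wn b n) - 2 * nf.s2\<^sup>2) \<le> C * (real n / Wn b n)) sequentially"
      using W eventually_ge_at_top[of 1]
    proof eventually_elim
      fix n :: nat assume W: "Wn b n > 0" and n1: "1 \<le> n"
      have "V n * ((real n)\<^sup>2 / Wn b n) - 2 * nf.s2\<^sup>2 = ((real n)\<^sup>2 * V n - 2 * nf.s2\<^sup>2 * Wn b n) / Wn b n"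
        using W by (simp add: diff_divide_distrib mult.commute)
      then have "norm (V n * ((real n)\<^sup>2 / Wn b n) - 2 * nf.s2\<^sup>2) = \<bar>(real n)\<^sup>2 * V n - 2 * nf.s2\<^sup>2 * Wn b n\<bar> / Wn b n"
        using W by simp
      also have "\<dots> \<le> C * real n / Wn b n" using C(2) n1 W by (intro divide_right_mono) auto
      finally show "norm (V n * ((real n)\<^sup>2 / Wn b n) - 2 * nf.s2\<^sup>2) \<le> C * (real n / Wn b n)" by simp
    qed
  qed
  then show ?thesis unfolding V_def by (rule LIM_zero_cancel)
qed

theorem MISE_ratio_tendsto:
  assumes n: "(\<lambda>n. real n / Wn b n) \<longlonglongrightarrow> 0" and T: "(\<lambda>n. Tn b n / Wn b n) \<longlonglongrightarrow> 0"
    and W: "eventually (\<lambda>n. Wn b n > 0) sequentially"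
    and bw: "bw \<longlonglongrightarrow> 0" "eventually (\<lambda>n. bw n > 0) sequentially"
  shows "(\<lambda>n. MISE M X f K (bw n) n /
      (MISE_iid f K (bw n) n
       + 1 / 4 * variance (\<lambda>\<omega>. 1 / real n * (\<Sum>j=1..n. ((X (int j) \<omega>)\<^sup>2 - expectation (\<lambda>\<omega>'. (X 1 \<omega>')\<^sup>2))))
         * (LINT x|lborel. ((deriv ^^ 2) f x)\<^sup>2))) \<longlonglongrightarrow> 1"
proof (rule ratio_tendsto_1[where w = "\<lambda>n. (real n)\<^sup>2 / Wn b n" and c = "nf.s2\<^sup>2 * curv / (4 * pi)"])
  show "eventually (\<lambda>n. 0 < (real n)\<^sup>2 / Wn b n) sequentially"
    using W eventually_gt_at_top[of 0] by eventually_elim simp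
  show "0 \<le> MISE_iid f K (bw n) n" for n by (rule MISE_iid_nonneg)
  show "(\<lambda>n. (MISE M X f K (bw n) n - MISE_iid f K (bw n) n) * ((real n)\<^sup>2 / Wn b n)) \<longlonglongrightarrow> nf.s2\<^sup>2 * curv / (4 * pi)"
    by (rule MISE_increment_tendsto[OF assms])
  have e: "2 * nf.s2\<^sup>2 * (1 / 4 * (curv / (2 * pi))) = nf.s2\<^sup>2 * curv / (4 * pi)" by (simp add: field_simps)
  show "(\<lambda>n. 1 / 4 * variance (\<lambda>\<omega>. 1 / real n * (\<Sum>j=1..n. ((X (int j) \<omega>)\<^sup>2 - expectation (\<lambda>\<omega>'. (X 1 \<omega>')\<^sup>2))))
         * (LINT x|lborel. ((deriv ^^ 2) f x)\<^sup>2) * ((real n)\<^sup>2 / Wn b n)) \<longlonglongrightarrow> nf.s2\<^sup>2 * curv / (4 * pi)"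
    using tendsto_mult_right[OF variance_tendsto[OF n W], of "1 / 4 * (curv / (2 * pi))"]
    unfolding curvature_integral e by (simp add: mult_ac)
  show "0 < nf.s2\<^sup>2 * curv / (4 * pi)" using s2_pos curv_pos by simp
qed

end

theorem theorem3p1:
  fixes M :: "'a measure"
    and \<xi> X :: "int \<Rightarrow> 'a \<Rightarrow> real"
    and g :: "complex \<Rightarrow> complex"
    and m :: nat
    and \<alpha> lam :: "int \<Rightarrow> real"
    and b :: "nat \<Rightarrow> real"
    and f K :: "real \<Rightarrow> real"
    and bw :: "nat \<Rightarrow> real"
    and \<alpha>_min :: real
  assumes "prob_space M"
    and "iid M \<xi>"
    and "integrable M (\<xi> 0)" and "prob_space.expectation M (\<xi> 0) = 0"
    and "integrable M (\<lambda>\<omega>. (\<xi> 0 \<omega>)\<^sup>2)"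
    and "m \<ge> 1"
    and "g analytic_on ball 0 1" and "continuous_on (cball 0 1) g"
    and "\<forall>z. norm z = 1 \<longrightarrow> g z \<noteq> 0"
    and "\<forall>k. (deriv ^^ k) g 0 / fact k \<in> \<real>"
    and "\<forall>j\<in>{0..int m}. 0 < \<alpha> j \<and> \<alpha> j \<le> 1 \<and> \<alpha> (- j) = \<alpha> j \<and> lam (- j) = - lam j"
    and "lam 0 = 0" and "strict_mono_on {0..int m} lam" and "lam (int m) < pi"
    and "\<forall>z. norm z < 1 \<longrightarrow> (\<lambda>k. complex_of_real (b k) * z ^ k) sums transfer_fun g m \<alpha> lam z"
    and "linear_process M \<xi> b X"
    and "\<alpha>_min = Min (\<alpha> ` {0..int m})"
    and "\<forall>x. 0 \<le> f x" and "continuous_on UNIV f"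
    and "distributed M lborel (X 0) (\<lambda>x. ennreal (f x))"
    and "integrable M (\<lambda>\<omega>. (\<xi> 0 \<omega>) ^ 4)"
    and "\<exists>\<delta> C. \<delta> > 0 \<and> (\<forall>u. norm (char (distr M borel (\<xi> 0)) u) \<le> C * (1 + \<bar>u\<bar>) powr (- \<delta>))"
    and "\<alpha>_min < min (1 / 3) (\<alpha> 0 / 2)"
    and "bounded (range K)" and "\<forall>x. K (- x) = K x"
    and "\<forall>x. 0 \<le> K x" and "(K has_integral 1) UNIV"
    and "continuous_on UNIV K" and "compact (closure {x. K x \<noteq> 0})"
    and "bw \<longlonglongrightarrow> 0" and "filterlim (\<lambda>n. real n * bw n) at_top sequentially"
  shows "(\<lambda>n. MISE M X f K (bw n) n /
            (MISE_iid f K (bw n) n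
             + 1 / 4 * prob_space.variance M
                 (\<lambda>\<omega>. 1 / real n * (\<Sum>j=1..n. ((X (int j) \<omega>)\<^sup>2 - prob_space.expectation M (\<lambda>\<omega>'. (X 1 \<omega>')\<^sup>2))))
               * (LINT x|lborel. ((deriv ^^ 2) f x)\<^sup>2)))
         \<longlonglongrightarrow> 1"
proof -
  note as = assms
  interpret M: prob_space M by (rule as(1))
  interpret ff: fractional_filter g m \<alpha> lam b
    using as(8,9,11-15) by unfold_locales auto
  have "Min (\<alpha> ` {0..int m}) \<in> \<alpha> ` {0..int m}" by (rule Min_in) auto
  then obtain k where k: "k \<in> {0..int m}" "\<alpha> k = \<alpha>_min" unfolding as(17) by force
  have kJ: "k \<in> {- int m..int m}" using k(1) by simp
  have k2: "2 * \<alpha> k < \<alpha> 0" using as(23) unfolding k(2) by simp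
  note dom = ff.Wn_dominates[OF kJ k2]
  have xi0: "\<xi> 0 \<in> borel_measurable M" using as(3) by (rule borel_measurable_integrable)
  have noise: "noise_filter (distr M borel (\<xi> 0)) b"
  proof -
    interpret D: real_distribution "distr M borel (\<xi> 0)" by (rule M.real_distribution_distr[OF xi0])
    show ?thesis
    proof unfold_locales
      show "integrable (distr M borel (\<xi> 0)) (\<lambda>x. x ^ 4)"
        using as(21) by (subst integrable_distr_eq[OF xi0]) simp_all
      show "(LINT x|distr M borel (\<xi> 0). x) = 0"
        using as(4) by (subst integral_distr[OF xi0]) simp_all
      show "summable (\<lambda>q. (b q)\<^sup>2)" by (rule ff.summable_b_sq)
      show "infinite {q. b q \<noteq> 0}" by (rule infinite_support_if_Wn_superlinear[OF dom(1,3)])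
      show "\<exists>\<delta> C. \<delta> > 0 \<and> (\<forall>u. norm (char (distr M borel (\<xi> 0)) u) \<le> C * (1 + \<bar>u\<bar>) powr (- \<delta>))" by (rule as(22))
    qed
  qed
  obtain B where B: "\<forall>w. norm (K w) \<le> B" using as(24) unfolding bounded_iff by auto
  obtain R where R: "\<forall>w\<in>closure {x. K x \<noteq> 0}. norm w \<le> R"
    using compact_imp_bounded[OF as(29)] unfolding bounded_iff by blast
  have Kmeas: "K \<in> borel_measurable borel" using as(28) by (rule borel_measurable_continuous_onI)
  have nnK: "(\<integral>\<^sup>+ w. ennreal (K w) \<partial>lborel) = ennreal 1"
    by (rule nn_integral_has_integral_lborel[OF Kmeas _ as(27)]) (use as(26) in auto)
  have Kint: "integrable lborel K"
    by (rule integrableI_nonneg) (use Kmeas as(26) nnK in auto)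
  have Kone: "(LINT w|lborel. K w) = 1"
    by (subst integral_eq_nn_integral) (use Kmeas as(26) nnK in auto)
  have K_le: "K w \<le> B" for w
    using abs_ge_self[of "K w"] B[rule_format, of w] unfolding real_norm_def by linarith
  have K_supp: "K w = 0" if w: "\<bar>w\<bar> > R" for w
  proof (rule ccontr)
    assume "K w \<noteq> 0"
    then have "w \<in> {x. K x \<noteq> 0}" by (rule CollectI)
    then have "w \<in> closure {x. K x \<noteq> 0}" by (rule subsetD[OF closure_subset])
    with R have "norm w \<le> R" by (rule bspec)
    then have "\<bar>w\<bar> \<le> R" unfolding real_norm_def .
    with w show False by (rule leD[THEN notE, rotated])
  qed
  have kernel: "kernel K R B"
    using as(28) as(26)[rule_format] K_le K_supp Kint Kone by (rule kernel.intro)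
  interpret smoothed_process M \<xi> b X f K R B
    unfolding smoothed_process_def density_process_def noise_process_def noise_process_axioms_def density_process_axioms_def
    using as(1,2,16,18-20) noise kernel by blast
  have "eventually (\<lambda>n. real n * bw n > 0) sequentially"
    using as(31) by (simp add: filterlim_at_top_dense)
  then have bw: "eventually (\<lambda>n. bw n > 0) sequentially"
    by eventually_elim (simp add: zero_less_mult_iff)
  show ?thesis by (rule MISE_ratio_tendsto[OF dom as(30) bw])
qed

end
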